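(* Let $1<p<q<\infty$. Then for each integer $k>0$ the pair $(\lambda_k^D(q),\infty)$ is a bifurcation point of problem (P); that is, there is a sequence $(\mu_n,u_n)$ with $\mu_n\in\mathbb{R}$ and $u_n\in W^{1,q}_0(\Omega)$, $u_n\not\equiv 0$, such that $u_n$ is a weak solution of problem (P) with $\lambda=\mu_n$ for every $n$, $\mu_n\to\lambda_k^D(q)$ and $\|u_n\|_{1,q}\to\infty$ as $n\to\infty$.
   Context: $\Omega\subset\mathbb{R}^N$ ($N\ge2$) is a bounded open domain with smooth boundary; $\|u\|_{1,s}=(\int_\Omega|\nabla u|^s\,dx)^{1/s}$ and $\Delta_s u=\mathrm{div}(|\nabla u|^{s-2}\nabla u)$ for $s\in(1,\infty)$. Problem (P) is: $-\Delta_p u-\Delta_q u=\lambda|u|^{q-2}u$ in $\Omega$, $u=0$ on $\partial\Omega$. For $p<q$, a weak solution is $u\in W^{1,q}_0(\Omega)$ with $$\int_\Omega|\nabla u|^{p-2}\nabla u\cdot\nabla v\,dx+\int_\Omega|\nabla u|^{q-2}\nabla u\cdot\nabla v\,dx=\lambda\int_\Omega|u|^{q-2}uv\,dx\quad\text{for all } v\in W^{1,q}_0(\Omega).$$ The variational eigenvalues $\lambda_k^D(q)$ of $-\Delta_q u=\lambda|u|^{q-2}u$ in $\Omega$, $u=0$ on $\partial\Omega$, are $\lambda_k^D(q)=\inf_{A\in\Sigma_k}\sup_{u\in A}\int_\Omega|\nabla u|^q\,dx$, where $\Sigma_k$ is the family of sets $A\subset D_1(q)=\{u\in W^{1,q}_0(\Omega):\int_\Omega|u|^q\,dx=1\}$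 that are closed in $W^{1,q}_0(\Omega)$, satisfy $A=-A$ and $\gamma(A)\ge k$. Here $\gamma(A)=\inf\{m\in\mathbb{N}:\exists\varphi\in C(A,\mathbb{R}^m\setminus\{0\}),\ \varphi(-x)=-\varphi(x)\}$ is the Krasnoselskii genus ($+\infty$ if no such $m$ exists). *)

theory Defs
  imports "HOL-Analysis.Analysis"
begin

section \<open>Smooth functions and domains with smooth boundary\<close>

primrec C_k :: "nat \<Rightarrow> ('a::real_normed_vector \<Rightarrow> 'b::real_normed_vector) \<Rightarrow> bool" where
  "C_k 0 f \<longleftrightarrow> continuous_on UNIV f"
| "C_k (Suc n) f \<longleftrightarrow>
     (\<forall>x. f differentiable (at x)) \<and> (\<forall>v. C_k n (\<lambda>x. frechet_derivative f (at x) v))"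

definition C_infinity :: "('a::real_normed_vector \<Rightarrow> 'b::real_normed_vector) \<Rightarrow> bool" where
  "C_infinity f \<longleftrightarrow> (\<forall>n. C_k n f)"

text \<open>Near each boundary point, \<open>\<Omega>\<close> is, in suitably rotated coordinates, the set above the graph
  of a smooth function of \<open>N - 1\<close> variables. The vertical direction is the unit vector \<open>e\<close>, and
  \<open>g\<close> is a function on the whole space that does not depend on the coordinate along \<open>e\<close>.\<close>

definition smooth_boundary :: "'a::euclidean_space set \<Rightarrow> bool" where
  "smooth_boundary \<Omega> \<longleftrightarrow>
     (\<forall>x\<in>frontier \<Omega>. \<exists>r>0. \<exists>e. \<exists>g :: 'a \<Rightarrow> real.
        norm e = 1 \<and> C_infinity g \<and> (\<forall>y t. g (y + t *\<^sub>R e) = g y) \<and>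
        \<Omega> \<inter> ball x r = {y \<in> ball x r. g y < y \<bullet> e})"

definition test_function :: "'a::euclidean_space set \<Rightarrow> ('a \<Rightarrow> real) \<Rightarrow> bool" where
  "test_function \<Omega> \<phi> \<longleftrightarrow>
     C_infinity \<phi> \<and> compact (closure {x. \<phi> x \<noteq> 0}) \<and> closure {x. \<phi> x \<noteq> 0} \<subseteq> \<Omega>"


section \<open>Sobolev spaces\<close>

text \<open>Elements of Lebesgue and Sobolev spaces are represented by functions on the whole space, of
  which only the restriction to \<open>\<Omega>\<close>, up to null sets, matters; accordingly, the zero element is
  described by an almost-everywhere condition.\<close>

definition L_space ::
    "real \<Rightarrow> 'a::euclidean_space set \<Rightarrow> ('a \<Rightarrow> 'b::euclidean_space) set" where
  "L_space s \<Omega> = {f \<in> borel_measurable (lebesgue_on \<Omega>).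
                     integrable (lebesgue_on \<Omega>) (\<lambda>x. norm (f x) powr s)}"

definition locally_integrable ::
    "'a::euclidean_space set \<Rightarrow> ('a \<Rightarrow> 'b::euclidean_space) \<Rightarrow> bool" where
  "locally_integrable \<Omega> f \<longleftrightarrow> (\<forall>K. compact K \<and> K \<subseteq> \<Omega> \<longrightarrow> set_integrable lebesgue K f)"

definition has_weak_gradient ::
    "'a::euclidean_space set \<Rightarrow> ('a \<Rightarrow> real) \<Rightarrow> ('a \<Rightarrow> 'a) \<Rightarrow> bool" where
  "has_weak_gradient \<Omega> u G \<longleftrightarrow>
     locally_integrable \<Omega> u \<and> locally_integrable \<Omega> G \<and>
     (\<forall>\<phi>. test_function \<Omega> \<phi> \<longrightarrow> (\<forall>b\<in>Basis.
        (LINT x|lebesgue_on \<Omega>. u x * frechet_derivative \<phi> (at x) b)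
          = - (LINT x|lebesgue_on \<Omega>. (G x \<bullet> b) * \<phi> x)))"

text \<open>On an open set the weak gradient is unique up to null sets, so the choice made here does not
  influence any of the integrals below.\<close>

definition weak_gradient :: "'a::euclidean_space set \<Rightarrow> ('a \<Rightarrow> real) \<Rightarrow> 'a \<Rightarrow> 'a" where
  "weak_gradient \<Omega> u = (SOME G. has_weak_gradient \<Omega> u G)"

definition W1_space :: "real \<Rightarrow> 'a::euclidean_space set \<Rightarrow> ('a \<Rightarrow> real) set" where
  "W1_space s \<Omega> =
     {u \<in> L_space s \<Omega>. \<exists>G. has_weak_gradient \<Omega> u G \<and> G \<in> L_space s \<Omega>}"

definition W1_norm :: "real \<Rightarrow> 'a::euclidean_space set \<Rightarrow> ('a \<Rightarrow> real) \<Rightarrow> real" where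
  "W1_norm s \<Omega> u =
     ((LINT x|lebesgue_on \<Omega>. \<bar>u x\<bar> powr s)
       + (LINT x|lebesgue_on \<Omega>. norm (weak_gradient \<Omega> u x) powr s)) powr (1 / s)"

text \<open>The closure of the test functions in \<open>W\<^sup>1\<^sup>,\<^sup>s(\<Omega>)\<close>.\<close>

definition W10_space :: "real \<Rightarrow> 'a::euclidean_space set \<Rightarrow> ('a \<Rightarrow> real) set" where
  "W10_space s \<Omega> =
     {u \<in> W1_space s \<Omega>. \<forall>\<epsilon>>0. \<exists>\<phi>. test_function \<Omega> \<phi> \<and> W1_norm s \<Omega> (u - \<phi>) < \<epsilon>}"

definition W10_norm :: "real \<Rightarrow> 'a::euclidean_space set \<Rightarrow> ('a \<Rightarrow> real) \<Rightarrow> real" where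
  "W10_norm s \<Omega> u = (LINT x|lebesgue_on \<Omega>. norm (weak_gradient \<Omega> u x) powr s) powr (1 / s)"

text \<open>The norm topology of \<open>W\<^sub>0\<^sup>1\<^sup>,\<^sup>s(\<Omega>)\<close>. On representatives the distance
  \<open>W10_norm s \<Omega> (u - v)\<close> is only a pseudometric. Open and closed sets are therefore invariant under
  changes on null sets, and continuous maps into Hausdorff spaces factor through the
  equivalence classes.\<close>

definition W10_topology ::
    "real \<Rightarrow> 'a::euclidean_space set \<Rightarrow> ('a \<Rightarrow> real) topology" where
  "W10_topology s \<Omega> = topology (\<lambda>U. U \<subseteq> W10_space s \<Omega> \<and>
     (\<forall>u\<in>U. \<exists>r>0. \<forall>v\<in>W10_space s \<Omega>. W10_norm s \<Omega> (u - v) < r \<longrightarrow> v \<in> U))"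

lemma openin_W10_topology:
  "openin (W10_topology s \<Omega>) U \<longleftrightarrow> U \<subseteq> W10_space s \<Omega> \<and>
     (\<forall>u\<in>U. \<exists>r>0. \<forall>v\<in>W10_space s \<Omega>. W10_norm s \<Omega> (u - v) < r \<longrightarrow> v \<in> U)"
proof -
  define P where "P = (\<lambda>U. U \<subseteq> W10_space s \<Omega> \<and>
     (\<forall>u\<in>U. \<exists>r>0. \<forall>v\<in>W10_space s \<Omega>. W10_norm s \<Omega> (u - v) < r \<longrightarrow> v \<in> U))"
  have "istopology P"
    unfolding istopology_def
  proof (intro conjI allI impI)
    fix S T assume S: "P S" and T: "P T"
    show "P (S \<inter> T)"
      unfolding P_def
    proof (intro conjI ballI)
      show "S \<inter> T \<subseteq> W10_space s \<Omega>" using S unfolding P_def by blast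
      fix u assume u: "u \<in> S \<inter> T"
      obtain r1 where "r1 > 0" "\<forall>v\<in>W10_space s \<Omega>. W10_norm s \<Omega> (u - v) < r1 \<longrightarrow> v \<in> S"
        using S u unfolding P_def by blast
      moreover obtain r2 where "r2 > 0" "\<forall>v\<in>W10_space s \<Omega>. W10_norm s \<Omega> (u - v) < r2 \<longrightarrow> v \<in> T"
        using T u unfolding P_def by blast
      ultimately show "\<exists>r>0. \<forall>v\<in>W10_space s \<Omega>. W10_norm s \<Omega> (u - v) < r \<longrightarrow> v \<in> S \<inter> T"
        by (intro exI[of _ "min r1 r2"]) auto
    qed
  next
    fix \<K> assume K: "\<forall>K\<in>\<K>. P K"
    show "P (\<Union>\<K>)"
      unfolding P_def
    proof (intro conjI ballI)
      show "\<Union>\<K> \<subseteq> W10_space s \<Omega>" using K unfolding P_def by blast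
      fix u assume "u \<in> \<Union>\<K>"
      then obtain S where S: "S \<in> \<K>" "u \<in> S" by blast
      then obtain r where "r > 0" "\<forall>v\<in>W10_space s \<Omega>. W10_norm s \<Omega> (u - v) < r \<longrightarrow> v \<in> S"
        using K unfolding P_def by blast
      then show "\<exists>r>0. \<forall>v\<in>W10_space s \<Omega>. W10_norm s \<Omega> (u - v) < r \<longrightarrow> v \<in> \<Union>\<K>"
        using S(1) by blast
    qed
  qed
  then have "openin (topology P) = P" by (rule topology_inverse')
  moreover have "W10_topology s \<Omega> = topology P" unfolding W10_topology_def P_def ..
  ultimately have "openin (W10_topology s \<Omega>) U = P U" by simp
  then show ?thesis unfolding P_def .
qed

lemma topspace_W10_topology [simp]: "topspace (W10_topology s \<Omega>) = W10_space s \<Omega>"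
proof (rule subset_antisym)
  show "topspace (W10_topology s \<Omega>) \<subseteq> W10_space s \<Omega>"
    using openin_topspace[of "W10_topology s \<Omega>"] unfolding openin_W10_topology by (rule conjunct1)
  have "openin (W10_topology s \<Omega>) (W10_space s \<Omega>)"
    unfolding openin_W10_topology by (intro conjI ballI exI[of _ 1]) simp_all
  then show "W10_space s \<Omega> \<subseteq> topspace (W10_topology s \<Omega>)"
    by (rule openin_subset)
qed


section \<open>Krasnoselskii genus and variational eigenvalues\<close>

text \<open>Here \<open>m = 0\<close> is admitted, so that the empty set (and only the empty set) has genus \<open>0\<close>;
  in \<^typ>\<open>enat\<close> the infimum of the empty set is \<open>\<infinity>\<close>.\<close>

definition genus :: "('a \<Rightarrow> real) topology \<Rightarrow> ('a \<Rightarrow> real) set \<Rightarrow> enat" where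
  "genus T A = Inf {enat m | m. \<exists>\<phi>.
     continuous_map (subtopology T A) (subtopology (Euclidean_space m) (- {\<lambda>i. 0})) \<phi> \<and>
     (\<forall>u\<in>A. \<phi> (- u) = - \<phi> u)}"

definition D1 :: "real \<Rightarrow> 'a::euclidean_space set \<Rightarrow> ('a \<Rightarrow> real) set" where
  "D1 q \<Omega> = {u \<in> W10_space q \<Omega>. (LINT x|lebesgue_on \<Omega>. \<bar>u x\<bar> powr q) = 1}"

definition Sigma_family ::
    "real \<Rightarrow> 'a::euclidean_space set \<Rightarrow> nat \<Rightarrow> ('a \<Rightarrow> real) set set" where
  "Sigma_family q \<Omega> k = {A. A \<subseteq> D1 q \<Omega> \<and> closedin (W10_topology q \<Omega>) A \<and>
     uminus ` A = A \<and> enat k \<le> genus (W10_topology q \<Omega>) A}"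

text \<open>The supremum over an unbounded set \<open>A\<close> is \<open>\<infinity>\<close>, hence the extended reals.\<close>

definition dirichlet_eigenvalue :: "real \<Rightarrow> 'a::euclidean_space set \<Rightarrow> nat \<Rightarrow> ereal" where
  "dirichlet_eigenvalue q \<Omega> k =
     (INF A\<in>Sigma_family q \<Omega> k. SUP u\<in>A.
        ereal (LINT x|lebesgue_on \<Omega>. norm (weak_gradient \<Omega> u x) powr q))"


section \<open>Weak solutions and bifurcation from infinity\<close>

text \<open>Weak solutions for \<open>p < q\<close>. Where the gradient (or \<open>u\<close>) vanishes,
  \<open>|\<nabla>u|\<^sup>s\<^sup>-\<^sup>2\<nabla>u\<close> is read as \<open>0\<close> also for \<open>s < 2\<close>.\<close>

definition weak_solution ::
    "real \<Rightarrow> real \<Rightarrow> 'a::euclidean_space set \<Rightarrow> real \<Rightarrow> ('a \<Rightarrow> real) \<Rightarrow> bool" where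
  "weak_solution p q \<Omega> lam u \<longleftrightarrow> u \<in> W10_space q \<Omega> \<and>
     (\<forall>v\<in>W10_space q \<Omega>.
        (LINT x|lebesgue_on \<Omega>. (norm (weak_gradient \<Omega> u x) powr (p - 2) *\<^sub>R weak_gradient \<Omega> u x)
            \<bullet> weak_gradient \<Omega> v x)
        + (LINT x|lebesgue_on \<Omega>. (norm (weak_gradient \<Omega> u x) powr (q - 2) *\<^sub>R weak_gradient \<Omega> u x)
            \<bullet> weak_gradient \<Omega> v x)
        = lam * (LINT x|lebesgue_on \<Omega>. \<bar>u x\<bar> powr (q - 2) * u x * v x))"

definition bifurcation_point_at_infinity ::
    "real \<Rightarrow> real \<Rightarrow> 'a::euclidean_space set \<Rightarrow> real \<Rightarrow> bool" where
  "bifurcation_point_at_infinity p q \<Omega> l \<longleftrightarrow>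
     (\<exists>(\<mu> :: nat \<Rightarrow> real) (u :: nat \<Rightarrow> 'a \<Rightarrow> real).
        (\<forall>n. u n \<in> W10_space q \<Omega> \<and> \<not> (AE x in lebesgue_on \<Omega>. u n x = 0) \<and>
             weak_solution p q \<Omega> (\<mu> n) (u n)) \<and>
        \<mu> \<longlonglongrightarrow> l \<and>
        filterlim (\<lambda>n. W10_norm q \<Omega> (u n)) at_top sequentially)"

end

theory Submission
  imports Defs "HOL-Library.Diagonal_Subsequence" "HOL-Homology.Invariance_of_Domain"
begin

text \<open>
  Put \<open>u = t w\<close> with \<open>t > 0\<close>. The two principal parts have the homogeneities \<open>p - 1\<close> and \<open>q - 1\<close>, and
  the right-hand side has \<open>q - 1\<close>, so that \<open>u\<close> solves the problem exactly if
  \<open>-e\<Delta>\<^sub>pw - \<Delta>\<^sub>qw = \<lambda>|w|\<^sup>q\<^sup>-\<^sup>2w\<close> with \<open>e = t\<^sup>p\<^sup>-\<^sup>q\<close>. Since \<open>p < q\<close>, large solutions correspond to small \<open>e\<close>,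
  and bifurcation from infinity at the eigenvalue becomes a perturbation problem: find normalised
  solutions \<open>w\<close> for small \<open>e\<close> whose multipliers tend to the eigenvalue as \<open>e \<rightarrow> 0\<close>.

  Such \<open>w\<close> are critical points of the energy \<open>e (q/p) \<integral>|\<nabla>w|\<^sup>p + \<integral>|\<nabla>w|\<^sup>q\<close> on the unit sphere of \<open>L\<^sup>q\<close>, at
  the \<open>k\<close>-th minimax level: the infimum of the levels whose sublevel sets have genus at least \<open>k\<close>.
  For \<open>e = 0\<close> this level is the variational eigenvalue (\<open>dirichlet_eigenvalue_eq_minimax\<close>). On a
  bounded domain \<open>\<integral>|\<nabla>w|\<^sup>p \<le> |\<Omega>| + \<integral>|\<nabla>w|\<^sup>q\<close>, so that levels and multipliers change by \<open>O(e)\<close>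
  (\<open>perturbed_eigenfunctions\<close>).

  That minimax levels are critical is shown without gradient flows. Let \<open>w\<close> be normalised and suppose that
  some \<open>y\<close> with \<open>\<integral>|w|\<^sup>q\<^sup>-\<^sup>2wy = 1\<close> has energy well below the level. By Young's inequality such a \<open>y\<close> has
  \<open>L\<^sup>q\<close> norm at least \<open>1\<close>, so that normalising it does not increase the energy. If every \<open>w\<close> of a
  sublevel set slightly above the level admits such a \<open>y\<close>, a partition of unity over a finite net for
  the \<open>L\<^sup>q\<close> distance, which exists by compactness of the embedding, combines the \<open>y\<close> into a continuous
  odd map to a lower sublevel set (\<open>genus_sublevel_descent\<close>). This contradicts the definition of the
  level. Hence there are \<open>w\<close> that almost minimise the energy on the hyperplanes
  \<open>\<integral>|w|\<^sup>q\<^sup>-\<^sup>2wy = 1\<close>. A subsequence converges in \<open>L\<^sup>q\<close>. The midpoint of two members is then nearly on the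
  hyperplane of one of them and cannot have much smaller energy, so that uniform convexity makes the
  gradients converge (\<open>minimax_sequence_converges\<close>). The limit minimises the energy on its own
  hyperplane, and this is the Euler--Lagrange equation (\<open>Euler_Lagrange\<close>).

  The levels are finite because spheres spanned by bump functions of disjoint boxes have large
  genus, by the Borsuk--Ulam theorem. It follows from the fact that odd self-maps of spheres have odd
  degree, which is proved by induction: in general position, such a map can be deformed through odd
  maps to one that preserves the equator (\<open>odd_map_odd_degree\<close>).

  Sobolev spaces are treated only as far as necessary. The \<open>s\<close>-th powers of norms (\<open>modular\<close>) are
  integrals of convex functions, and compactness of the unit sphere yields uniform convexity and
  continuity of the duality map in a form that can be integrated (\<open>homogeneous_absorption\<close>). The
  estimate of translations by gradients (\<open>translation_estimate\<close>) gives both the Poincare inequality and,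
  through averages over the cells of a grid, the compactness of the embedding into \<open>L\<^sup>q\<close>
  (\<open>cell_approximation\<close>).
\<close>



section \<open>Powers of norms\<close>

text \<open>The tangent at \<open>1\<close>. Rescaling an arbitrary base point to \<open>1\<close>, all convexity properties of powers
  and Young's inequality below reduce to this estimate.\<close>

lemma powr_tangent_strict:
  fixes s t :: real
  assumes "1 < s" "0 \<le> t" "t \<noteq> 1"
  shows "1 + s * (t - 1) < t powr s"
proof (cases "t = 0")
  case True
  then show ?thesis using assms by simp
next
  case False
  then have t: "0 < t" using assms by simp
  have D: "((\<lambda>x. x powr s) has_real_derivative s * x powr (s - 1)) (at x)" if "0 < x" for x
    using that by (auto intro!: derivative_eq_intros simp: field_simps powr_diff)
  show ?thesis
  proof (cases "t < 1")
    case True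
    obtain z where z: "t < z" "z < 1" "1 powr s - t powr s = (1 - t) * (s * z powr (s - 1))"
      using MVT2[of t 1 "\<lambda>x. x powr s" "\<lambda>x. s * x powr (s - 1)"] D t True by auto
    have "z powr (s - 1) < 1" using z t assms powr_less_mono2[of "s - 1" z 1] by simp
    then have "(1 - t) * (s * z powr (s - 1)) < (1 - t) * s"
      using True assms by (intro mult_strict_left_mono) auto
    then show ?thesis using z(3) by (simp add: algebra_simps)
  next
    case False
    then have t1: "1 < t" using assms by simp
    obtain z where z: "1 < z" "z < t" "t powr s - 1 powr s = (t - 1) * (s * z powr (s - 1))"
      using MVT2[of 1 t "\<lambda>x. x powr s" "\<lambda>x. s * x powr (s - 1)"] D t1 by auto
    have "1 < z powr (s - 1)" using z assms by (simp add: gr_one_powr)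
    then have "(t - 1) * s < (t - 1) * (s * z powr (s - 1))"
      using t1 assms by (intro mult_strict_left_mono) auto
    then show ?thesis using z(3) by (simp add: algebra_simps)
  qed
qed

lemma powr_tangent:
  fixes s t :: real
  assumes "1 \<le> s" "0 \<le> t"
  shows "1 + s * (t - 1) \<le> t powr s"
proof (cases "s = 1 \<or> t = 1")
  case False
  then show ?thesis using powr_tangent_strict[of s t] assms by auto
qed (use assms in auto)

lemma convex_on_powr:
  fixes s :: real
  assumes "1 \<le> s"
  shows "convex_on {0..} (\<lambda>t::real. t powr s)"
proof (rule convex_onI)
  fix t x y :: real
  assume t: "0 < t" "t < 1" and x: "x \<in> {0..}" and y: "y \<in> {0..}"
  define m where "m = (1 - t) * x + t * y"
  have m0: "0 \<le> m" using t x y by (simp add: m_def)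
  show "((1 - t) *\<^sub>R x + t *\<^sub>R y) powr s \<le> (1 - t) * x powr s + t * y powr s"
  proof (cases "m = 0")
    case True
    then show ?thesis using t x y by (simp add: m_def)
  next
    case False
    then have mp: "0 < m" using m0 by simp
    have *: "m powr s * (1 + s * (x / m - 1)) \<le> x powr s" if "0 \<le> x" for x
    proof -
      have "m powr s * (1 + s * (x / m - 1)) \<le> m powr s * (x / m) powr s"
        using powr_tangent[of s "x / m"] assms mp that by (intro mult_left_mono) auto
      also have "\<dots> = x powr s" using mp that by (simp add: powr_divide)
      finally show ?thesis .
    qed
    have "m powr s = (1 - t) * (m powr s * (1 + s * (x / m - 1))) + t * (m powr s * (1 + s * (y / m - 1)))"
    proof -
      have "(1 - t) * (1 + s * (x / m - 1)) + t * (1 + s * (y / m - 1)) = 1 + s * (m / m - 1)"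
        by (simp add: m_def field_simps add_divide_distrib[symmetric])
      also have "\<dots> = 1" using mp by simp
      finally have e: "(1 - t) * (1 + s * (x / m - 1)) + t * (1 + s * (y / m - 1)) = 1" .
      have "(1 - t) * (m powr s * (1 + s * (x / m - 1))) + t * (m powr s * (1 + s * (y / m - 1)))
        = m powr s * ((1 - t) * (1 + s * (x / m - 1)) + t * (1 + s * (y / m - 1)))"
        by (simp only: distrib_left mult.left_commute)
      then show ?thesis unfolding e by simp
    qed
    also have "\<dots> \<le> (1 - t) * x powr s + t * y powr s"
      using * x y t by (intro add_mono mult_left_mono) auto
    finally show ?thesis by (simp add: m_def)
  qed
qed simp

lemma convex_on_norm_powr:
  fixes s :: real
  assumes "1 \<le> s"
  shows "convex_on UNIV (\<lambda>x::'a::real_normed_vector. norm x powr s)"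
proof (rule convex_onI)
  fix t :: real and x y :: 'a
  assume t: "0 < t" "t < 1"
  have "norm ((1 - t) *\<^sub>R x + t *\<^sub>R y) \<le> (1 - t) * norm x + t * norm y"
    using norm_triangle_ineq[of "(1 - t) *\<^sub>R x" "t *\<^sub>R y"] t by simp
  then have "norm ((1 - t) *\<^sub>R x + t *\<^sub>R y) powr s \<le> ((1 - t) * norm x + t * norm y) powr s"
    using assms by (intro powr_mono2) auto
  also have "\<dots> \<le> (1 - t) * norm x powr s + t * norm y powr s"
    using convex_onD[OF convex_on_powr[OF assms], of t "norm x" "norm y"] t by simp
  finally show "norm ((1 - t) *\<^sub>R x + t *\<^sub>R y) powr s \<le> (1 - t) * norm x powr s + t * norm y powr s" .
qed simp

lemma norm_add_powr_le:
  fixes a b :: "'a::real_normed_vector"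
  assumes "0 \<le> s"
  shows "norm (a + b) powr s \<le> 2 powr s * (norm a powr s + norm b powr s)"
proof -
  have "norm (a + b) powr s \<le> (2 * max (norm a) (norm b)) powr s"
    using norm_triangle_ineq[of a b] assms by (intro powr_mono2) auto
  also have "\<dots> = 2 powr s * (max (norm a) (norm b)) powr s"
    by (simp add: powr_mult)
  also have "\<dots> \<le> 2 powr s * (norm a powr s + norm b powr s)"
    by (intro mult_left_mono) (auto simp: max_def)
  finally show ?thesis .
qed

text \<open>If the norms differ, strictness comes from the strict convexity of \<open>t\<^sup>s\<close>; if they agree, it comes
  from the equality case of the triangle inequality.\<close>

lemma norm_powr_midpoint_strict:
  fixes a b :: "'a::real_inner"
  assumes s: "1 < s" and ab: "a \<noteq> b"
  shows "norm ((1/2) *\<^sub>R (a + b)) powr s < (norm a powr s + norm b powr s) / 2"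
proof -
  have le: "norm ((1/2) *\<^sub>R (a + b)) \<le> (norm a + norm b) / 2"
    using norm_triangle_ineq[of a b] by simp
  show ?thesis
  proof (cases "norm a = norm b")
    case True
    have "norm (a + b) \<noteq> norm a + norm b"
    proof
      assume "norm (a + b) = norm a + norm b"
      then have "norm a *\<^sub>R b = norm b *\<^sub>R a" by (simp add: norm_triangle_eq)
      then show False using True ab by auto
    qed
    then have "norm ((1/2) *\<^sub>R (a + b)) < norm a" using le True norm_triangle_ineq[of a b] by auto
    then have "norm ((1/2) *\<^sub>R (a + b)) powr s < norm a powr s" using s by (intro powr_less_mono2) auto
    then show ?thesis using True by simp
  next
    case False
    define m where "m = (norm a + norm b) / 2"
    \<comment> \<open>Tangents at the mean \<open>m\<close> of the two norms: the linear terms cancel.\<close>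
    have mp: "0 < m" using False by (auto simp: m_def) (smt (verit) norm_ge_zero)
    have *: "m powr s * (1 + s * (x / m - 1)) < x powr s" if "0 \<le> x" "x \<noteq> m" for x
    proof -
      have "m powr s * (1 + s * (x / m - 1)) < m powr s * (x / m) powr s"
        using powr_tangent_strict[of s "x / m"] s mp that by (intro mult_strict_left_mono) auto
      also have "\<dots> = x powr s" using mp that by (simp add: powr_divide)
      finally show ?thesis .
    qed
    have ne: "norm a \<noteq> m" "norm b \<noteq> m" using False by (auto simp: m_def)
    have "norm ((1/2) *\<^sub>R (a + b)) powr s \<le> m powr s"
      using le s by (intro powr_mono2) (auto simp: m_def)
    also have "m powr s = (m powr s * (1 + s * (norm a / m - 1)) + m powr s * (1 + s * (norm b / m - 1))) / 2"
    proof -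
      have "norm a / m + norm b / m = (norm a + norm b) / m" by (simp add: add_divide_distrib)
      also have "norm a + norm b = 2 * m" by (simp add: m_def)
      also have "2 * m / m = 2" using mp by simp
      finally have "norm a / m + norm b / m = 2" .
      moreover have "(1 + s * (u - 1)) + (1 + s * (v - 1)) = 2 + s * ((u + v) - 2)" for u v :: real
        by (simp add: algebra_simps)
      ultimately have "(1 + s * (norm a / m - 1)) + (1 + s * (norm b / m - 1)) = 2" by simp
      then show ?thesis by (simp only: distrib_left[symmetric])
    qed
    also have "\<dots> < (norm a powr s + norm b powr s) / 2"
      using ne by (intro divide_strict_right_mono add_strict_mono *) auto
    finally show ?thesis .
  qed
qed

text \<open>A comparison of homogeneous functions that replaces quantitative inequalities (Clarkson,
  continuity estimates for \<open>|a|\<^sup>s\<^sup>-\<^sup>2a\<close>) by compactness of the unit sphere: if \<open>g\<close> is not positive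
  where \<open>h\<close> vanishes, then on the sphere \<open>h\<close> is bounded below wherever \<open>g\<close> is at least \<open>\<theta>\<close>, and
  homogeneity extends the resulting estimate to the whole space.\<close>

lemma homogeneous_absorption:
  fixes g h :: "'a::euclidean_space \<Rightarrow> real"
  assumes cg: "continuous_on UNIV g" and ch: "continuous_on UNIV h"
    and hg: "\<And>r z. 0 < r \<Longrightarrow> g (r *\<^sub>R z) = r powr s * g z"
    and hh: "\<And>r z. 0 < r \<Longrightarrow> h (r *\<^sub>R z) = r powr s * h z"
    and z0: "g 0 = 0" "h 0 = 0"
    and pos: "\<And>z. 0 \<le> h z" and zero: "\<And>z. h z = 0 \<Longrightarrow> g z \<le> 0"
    and th: "0 < \<theta>"
  obtains C where "0 \<le> C" "\<And>z. g z \<le> \<theta> * norm z powr s + C * h z"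
proof -
  define K where "K = sphere 0 1 \<inter> {z. \<theta> \<le> g z}"
  have "closed {z. \<theta> \<le> g z}"
    using cg by (intro closed_Collect_le continuous_intros) auto
  then have cK: "compact K" unfolding K_def by (intro compact_Int_closed) auto
  obtain C where C: "0 \<le> C" "\<And>z. z \<in> K \<Longrightarrow> g z \<le> C * h z"
  proof (cases "K = {}")
    case True
    then show ?thesis using that[of 0] by simp
  next
    case False
    obtain a where a: "a \<in> K" "\<And>y. y \<in> K \<Longrightarrow> h a \<le> h y"
      using continuous_attains_inf[OF cK False, of h] ch continuous_on_subset by blast
    obtain b where b: "b \<in> K" "\<And>y. y \<in> K \<Longrightarrow> g y \<le> g b"
      using continuous_attains_sup[OF cK False, of g] cg continuous_on_subset by blast
    have ha: "0 < h a"
      using pos[of a] zero[of a] a(1) th unfolding K_def by force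
    have gb: "0 < g b" using b(1) th unfolding K_def by auto
    show ?thesis
    proof (rule that[of "g b / h a"])
      show "0 \<le> g b / h a" using ha gb by simp
      fix z assume z: "z \<in> K"
      have "g z \<le> g b / h a * h a" using b(2)[OF z] ha by simp
      also have "\<dots> \<le> g b / h a * h z" using a(2)[OF z] ha gb by (intro mult_left_mono) auto
      finally show "g z \<le> g b / h a * h z" .
    qed
  qed
  show ?thesis
  proof (rule that[OF C(1)])
    fix z :: 'a
    show "g z \<le> \<theta> * norm z powr s + C * h z"
    proof (cases "z = 0")
      case False
      define u where "u = (1 / norm z) *\<^sub>R z"
      have nu: "norm u = 1" and zu: "z = norm z *\<^sub>R u" using False by (auto simp: u_def)
      have "g u \<le> \<theta> + C * h u"
        using C(2)[of u] nu th C(1) pos[of u] by (cases "\<theta> \<le> g u") (auto simp: K_def intro: add_increasing2)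
      then have "norm z powr s * g u \<le> norm z powr s * (\<theta> + C * h u)"
        by (intro mult_left_mono) auto
      moreover have "g z = norm z powr s * g u" "h z = norm z powr s * h u"
        using False hg[of "norm z" u] hh[of "norm z" u] zu by auto
      ultimately show ?thesis by (simp add: algebra_simps)
    qed (use z0 in simp)
  qed
qed

lemma norm_Pair_powr_le:
  assumes "0 \<le> s"
  shows "norm (a, b) powr s \<le> 2 powr s * (norm a powr s + norm b powr s)"
proof -
  have "norm (a, b) \<le> norm a + norm b" by (rule norm_Pair_le)
  then have "norm (a, b) powr s \<le> norm (norm a + norm b) powr s"
    using assms by (intro powr_mono2) auto
  also have "\<dots> \<le> 2 powr s * (norm (norm a) powr s + norm (norm b) powr s)"
    by (rule norm_add_powr_le[OF assms])
  finally show ?thesis by simp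
qed

text \<open>Uniform convexity of \<open>|\<cdot>|\<^sup>s\<close>, in a form that can be integrated directly.\<close>

lemma uniform_convexity_pointwise:
  fixes s \<theta> :: real
  assumes s: "1 < s" and th: "0 < \<theta>"
  obtains C where "0 \<le> C"
    "\<And>a b :: 'a::euclidean_space. norm (a - b) powr s \<le> \<theta> * (norm a powr s + norm b powr s)
       + C * ((norm a powr s + norm b powr s) / 2 - norm ((1/2) *\<^sub>R (a + b)) powr s)"
proof -
  define g where "g = (\<lambda>z::'a \<times> 'a. norm (fst z - snd z) powr s)"
  define h where "h = (\<lambda>z::'a \<times> 'a. (norm (fst z) powr s + norm (snd z) powr s) / 2
      - norm ((1/2) *\<^sub>R (fst z + snd z)) powr s)"
  have hpos: "0 < h z" if "fst z \<noteq> snd z" for z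
    using norm_powr_midpoint_strict[OF s that] by (simp add: h_def)
  have h0: "h z = 0" if "fst z = snd z" for z
    using that by (simp add: h_def flip: scaleR_2)
  have th': "0 < \<theta> / 2 powr s" using th by simp
  obtain C where C: "0 \<le> C" "\<And>z. g z \<le> \<theta> / 2 powr s * norm z powr s + C * h z"
  proof (rule homogeneous_absorption[of g h s "\<theta> / 2 powr s"])
    show "continuous_on UNIV g" "continuous_on UNIV h"
      unfolding g_def h_def using s by (auto intro!: continuous_intros continuous_on_powr')
    show "g (r *\<^sub>R z) = r powr s * g z" if "0 < r" for r z
      using that by (simp add: g_def powr_mult flip: scaleR_diff_right)
    show "h (r *\<^sub>R z) = r powr s * h z" if "0 < r" for r z
    proof -
      have "norm ((1/2) *\<^sub>R (fst (r *\<^sub>R z) + snd (r *\<^sub>R z))) = r * norm ((1/2) *\<^sub>R (fst z + snd z))"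
        using that by (simp flip: scaleR_add_right)
      then show ?thesis using that by (simp add: h_def powr_mult algebra_simps del: norm_scaleR) (simp add: powr_mult)
    qed
    show "0 \<le> h z" for z using hpos[of z] h0[of z] by (cases "fst z = snd z") auto
    show "g z \<le> 0" if "h z = 0" for z using hpos[of z] that by (cases "fst z = snd z") (auto simp: g_def)
  qed (use th' s in \<open>auto simp: g_def h_def\<close>)
  show ?thesis
  proof (rule that[OF C(1)])
    fix a b :: 'a
    have "\<theta> / 2 powr s * norm (a, b) powr s \<le> \<theta> / 2 powr s * (2 powr s * (norm a powr s + norm b powr s))"
      using norm_Pair_powr_le[of s a b] s th by (intro mult_left_mono) auto
    then show "norm (a - b) powr s \<le> \<theta> * (norm a powr s + norm b powr s)
       + C * ((norm a powr s + norm b powr s) / 2 - norm ((1/2) *\<^sub>R (a + b)) powr s)"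
      using C(2)[of "(a, b)"] by (simp add: g_def h_def)
  qed
qed

text \<open>The right-hand side makes the continuity at \<open>0\<close> visible also for \<open>s < 2\<close>, where the factor
  \<open>|a|\<^sup>s\<^sup>-\<^sup>2\<close> is unbounded.\<close>

lemma signed_powr_eq:
  fixes a s :: real
  assumes "1 < s"
  shows "\<bar>a\<bar> powr (s - 2) * a = max a 0 powr (s - 1) - max (- a) 0 powr (s - 1)"
proof -
  have *: "x powr (s - 2) * x = x powr (s - 1)" if "0 < x" for x :: real
    using powr_mult_base[of x "s - 2"] that by (simp add: mult.commute)
  consider "a = 0" | "0 < a" | "a < 0" by linarith
  then show ?thesis
  proof cases
    case 2
    then show ?thesis using *[of a] assms by simp
  next
    case 3
    then show ?thesis using *[of "- a"] assms by simp
  qed simp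
qed

text \<open>Uniform continuity of the duality map \<open>a \<mapsto> |a|\<^sup>s\<^sup>-\<^sup>2a\<close>, again in an integrable form.\<close>

lemma duality_map_pointwise:
  fixes s \<theta> :: real
  assumes s: "1 < s" and th: "0 < \<theta>"
  obtains C where "0 \<le> C"
    "\<And>a b y :: real. \<bar>\<bar>a\<bar> powr (s - 2) * a * y - \<bar>b\<bar> powr (s - 2) * b * y\<bar>
        \<le> \<theta> * (\<bar>a\<bar> powr s + \<bar>b\<bar> powr s + \<bar>y\<bar> powr s) + C * \<bar>a - b\<bar> powr s"
proof -
  define J where "J = (\<lambda>a::real. max a 0 powr (s - 1) - max (- a) 0 powr (s - 1))"
  have J: "\<bar>a\<bar> powr (s - 2) * a = J a" for a using signed_powr_eq[OF s, of a] by (simp add: J_def)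
  have cJ: "continuous_on UNIV J" unfolding J_def
    using s by (auto intro!: continuous_intros continuous_on_powr')
  have Jh: "J (r * a) = r powr (s - 1) * J a" if "0 < r" for r a
    using that unfolding J[symmetric] using powr_mult_base[of r "s - 2"]
    by (simp add: abs_mult powr_mult mult_ac)
  define g where "g = (\<lambda>z::real \<times> real \<times> real. \<bar>(J (fst z) - J (fst (snd z))) * snd (snd z)\<bar>)"
  define h where "h = (\<lambda>z::real \<times> real \<times> real. \<bar>fst z - fst (snd z)\<bar> powr s)"
  \<comment> \<open>The norm of a triple costs two applications of the estimate for pairs.\<close>
  define T where "T = 2 powr s * (1 + 2 powr s)"
  have Tp: "0 < T" by (simp add: T_def add_pos_nonneg)
  obtain C where C: "0 \<le> C" "\<And>z. g z \<le> \<theta> / T * norm z powr s + C * h z"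
  proof (rule homogeneous_absorption[of g h s "\<theta> / T"])
    show "continuous_on UNIV g" unfolding g_def
      by (intro continuous_intros continuous_on_compose2[OF cJ]) auto
    show "continuous_on UNIV h" unfolding h_def
      using s by (auto intro!: continuous_intros continuous_on_powr')
    show "g (r *\<^sub>R z) = r powr s * g z" if "0 < r" for r z
    proof -
      have "r powr s = r powr (s - 1) * r" using that powr_mult_base[of r "s - 1"] by (simp add: mult.commute)
      then show ?thesis using that by (simp add: g_def Jh abs_mult flip: right_diff_distrib)
    qed
    show "h (r *\<^sub>R z) = r powr s * h z" if "0 < r" for r z
      using that by (simp add: h_def powr_mult abs_mult flip: right_diff_distrib)
    show "g z \<le> 0" if "h z = 0" for z using that by (simp add: g_def h_def)
  qed (use th Tp in \<open>auto simp: g_def h_def\<close>)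
  show ?thesis
  proof (rule that[OF C(1)])
    fix a b y :: real
    have "norm (a, b, y) powr s \<le> 2 powr s * (norm a powr s + norm (b, y) powr s)"
      using norm_Pair_powr_le[of s a "(b, y)"] s by simp
    also have "\<dots> \<le> 2 powr s * (norm a powr s + 2 powr s * (norm b powr s + norm y powr s))"
      using norm_Pair_powr_le[of s b y] s by (intro mult_left_mono add_mono) auto
    also have "\<dots> \<le> T * (\<bar>a\<bar> powr s + \<bar>b\<bar> powr s + \<bar>y\<bar> powr s)"
      by (simp add: T_def algebra_simps)
    finally have "\<theta> / T * norm (a, b, y) powr s \<le> \<theta> * (\<bar>a\<bar> powr s + \<bar>b\<bar> powr s + \<bar>y\<bar> powr s)"
      using mult_left_mono[of _ _ "\<theta> / T"] Tp th by fastforce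
    then show "\<bar>\<bar>a\<bar> powr (s - 2) * a * y - \<bar>b\<bar> powr (s - 2) * b * y\<bar>
        \<le> \<theta> * (\<bar>a\<bar> powr s + \<bar>b\<bar> powr s + \<bar>y\<bar> powr s) + C * \<bar>a - b\<bar> powr s"
      using C(2)[of "(a, b, y)"] unfolding J by (simp add: g_def h_def left_diff_distrib)
  qed
qed

text \<open>Young's inequality for the exponents \<open>s\<close> and \<open>s / (s - 1)\<close>, from the tangent of \<open>t\<^sup>s\<close> at
  \<open>t = |b| / |a|\<close> compared with the base point \<open>1\<close>.\<close>

lemma duality_young:
  fixes a b :: "'a::real_inner"
  assumes s: "1 < s"
  shows "s * \<bar>norm a powr (s - 2) * (a \<bullet> b)\<bar> \<le> (s - 1) * norm a powr s + norm b powr s"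
proof (cases "a = 0")
  case False
  then have na: "0 < norm a" by simp
  have "\<bar>norm a powr (s - 2) * (a \<bullet> b)\<bar> \<le> norm a powr (s - 2) * (norm a * norm b)"
    unfolding abs_mult by (intro mult_mono Cauchy_Schwarz_ineq2) auto
  also have "\<dots> = norm a powr s * (norm b / norm a)"
    using na by (simp add: powr_diff field_simps power2_eq_square)
  finally have 1: "s * \<bar>norm a powr (s - 2) * (a \<bullet> b)\<bar> \<le> s * (norm a powr s * (norm b / norm a))"
    using s by (intro mult_left_mono) auto
  have "norm a powr s * (1 + s * (norm b / norm a - 1)) \<le> norm a powr s * (norm b / norm a) powr s"
    using s na by (intro mult_left_mono powr_tangent) auto
  also have "\<dots> = norm b powr s" using na by (simp add: powr_divide)
  finally show ?thesis using 1 by (simp add: algebra_simps)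
qed simp

text \<open>At \<open>a = 0\<close> the derivative vanishes because \<open>s > 1\<close>; the right-hand side is then \<open>0\<close> as well,
  whatever value the power with exponent \<open>s - 2\<close> is given at \<open>0\<close>.\<close>

lemma norm_powr_has_derivative_line:
  fixes a b :: "'a::real_inner"
  assumes s: "1 < s"
  shows "((\<lambda>t. norm (a + t *\<^sub>R b) powr s) has_real_derivative s * (norm a powr (s - 2) * (a \<bullet> b))) (at 0)"
proof (cases "a = 0")
  case False
  have eq: "norm a powr s * (s * ((a \<bullet> b) * 2) / (2 * (norm a)\<^sup>2)) = s * (norm a powr (s - 2) * (a \<bullet> b))"
    using False by (simp add: powr_diff field_simps power2_eq_square)
  have e2: "norm x powr s = (x \<bullet> x) powr (s / 2)" for x :: 'a
    by (simp add: norm_eq_sqrt_inner powr_half_sqrt[symmetric] powr_powr)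
  have "((\<lambda>t. ((a + t *\<^sub>R b) \<bullet> (a + t *\<^sub>R b)) powr (s / 2)) has_real_derivative
      (s / 2) * ((a \<bullet> a) powr (s / 2 - 1)) * (2 * (a \<bullet> b))) (at 0)"
  proof -
    have 1: "((\<lambda>t. (a + t *\<^sub>R b) \<bullet> (a + t *\<^sub>R b)) has_real_derivative 2 * (a \<bullet> b)) (at 0)"
    proof -
      have "(\<lambda>t. (a + t *\<^sub>R b) \<bullet> (a + t *\<^sub>R b)) = (\<lambda>t. a \<bullet> a + 2 * t * (a \<bullet> b) + t^2 * (b \<bullet> b))"
        by (auto simp: inner_simps inner_commute[of b a] power2_eq_square algebra_simps)
      then show ?thesis by (auto intro!: derivative_eq_intros)
    qed
    show ?thesis
      using DERIV_chain'[OF 1, of "\<lambda>y. y powr (s / 2)" "(s / 2) * ((a \<bullet> a) powr (s / 2 - 1))"]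
        False has_real_derivative_powr[of "a \<bullet> a" "s / 2"] by (simp add: mult_ac)
  qed
  moreover have "(a \<bullet> a) powr (s / 2 - 1) = norm a powr (s - 2)"
    by (simp add: norm_eq_sqrt_inner powr_half_sqrt[symmetric] powr_powr right_diff_distrib)
  ultimately show ?thesis by (simp add: e2 mult_ac)
next
  case True
  have "((\<lambda>t::real. \<bar>t\<bar> powr s * norm b powr s) has_real_derivative 0) (at 0)"
  proof -
    have c: "((\<lambda>t::real. \<bar>t\<bar> powr (s - 1)) \<longlongrightarrow> 0) (at 0)"
    proof -
      have "continuous_on UNIV (\<lambda>t::real. \<bar>t\<bar> powr (s - 1))"
        using s by (auto intro!: continuous_intros continuous_on_powr')
      then have "isCont (\<lambda>t::real. \<bar>t\<bar> powr (s - 1)) 0" by (simp add: continuous_on_eq_continuous_at)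
      then show ?thesis unfolding isCont_def using s by simp
    qed
    have "((\<lambda>t::real. \<bar>t\<bar> powr s / t) \<longlongrightarrow> 0) (at 0)"
    proof (rule Lim_null_comparison[OF _ c])
      show "\<forall>\<^sub>F t::real in at 0. norm (\<bar>t\<bar> powr s / t) \<le> \<bar>t\<bar> powr (s - 1)"
        by (rule always_eventually) (auto simp: powr_diff)
    qed
    then have "((\<lambda>t::real. \<bar>t\<bar> powr s / t * norm b powr s) \<longlongrightarrow> 0 * norm b powr s) (at 0)"
      by (rule tendsto_mult_right)
    then show ?thesis using s by (simp add: has_field_derivative_iff)
  qed
  then show ?thesis using True s by (simp add: powr_mult)
qed



section \<open>Spaces of \<open>s\<close>-integrable functions\<close>

definition Lp :: "real \<Rightarrow> 'x measure \<Rightarrow> ('x \<Rightarrow> 'b::euclidean_space) set" where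
  "Lp s M = {f \<in> borel_measurable M. integrable M (\<lambda>x. norm (f x) powr s)}"

text \<open>The \<open>s\<close>-th power of the \<open>L\<^sup>s\<close> norm. Unlike the norm it is the integral of a pointwise expression,
  so that convexity and uniform convexity can be integrated without Hoelder's inequality.\<close>

definition modular :: "real \<Rightarrow> 'x measure \<Rightarrow> ('x \<Rightarrow> 'b::euclidean_space) \<Rightarrow> real" where
  "modular s M f = (LINT x|M. norm (f x) powr s)"

text \<open>The functional \<open>g \<mapsto> \<integral>|f|\<^sup>s\<^sup>-\<^sup>2f\<cdot>g\<close>, which is the derivative of \<open>modular s M / s\<close> at \<open>f\<close>.\<close>

definition duality :: "real \<Rightarrow> 'x measure \<Rightarrow> ('x \<Rightarrow> 'b::euclidean_space) \<Rightarrow> ('x \<Rightarrow> 'b) \<Rightarrow> real" where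
  "duality s M f g = (LINT x|M. norm (f x) powr (s - 2) * (f x \<bullet> g x))"

lemma LpD: "f \<in> Lp s M \<Longrightarrow> f \<in> borel_measurable M" "f \<in> Lp s M \<Longrightarrow> integrable M (\<lambda>x. norm (f x) powr s)"
  by (auto simp: Lp_def)

lemma Lp_bound:
  assumes "f \<in> borel_measurable M" "integrable M w" "AE x in M. norm (f x) powr s \<le> w x"
  shows "f \<in> Lp s M"
  unfolding Lp_def
proof (intro CollectI conjI)
  show "integrable M (\<lambda>x. norm (f x) powr s)"
    by (rule Bochner_Integration.integrable_bound[OF assms(2)]) (use assms in \<open>auto elim!: eventually_mono\<close>)
qed (fact assms(1))

lemma Lp_zero: "(\<lambda>x. 0) \<in> Lp s M"
  by (simp add: Lp_def)

lemma Lp_add: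
  assumes "0 \<le> s" "f \<in> Lp s M" "g \<in> Lp s M"
  shows "(\<lambda>x. f x + g x) \<in> Lp s M"
  by (rule Lp_bound[where w = "\<lambda>x. 2 powr s * (norm (f x) powr s + norm (g x) powr s)"])
    (use LpD[OF assms(2)] LpD[OF assms(3)] norm_add_powr_le[OF assms(1)] in auto)

lemma Lp_scaleR:
  assumes "f \<in> Lp s M"
  shows "(\<lambda>x. c *\<^sub>R f x) \<in> Lp s M"
  by (rule Lp_bound[where w = "\<lambda>x. \<bar>c\<bar> powr s * (norm (f x) powr s)"])
    (use LpD[OF assms] in \<open>auto simp: powr_mult\<close>)

lemma Lp_mult:
  fixes f :: "'x \<Rightarrow> real"
  assumes "f \<in> Lp s M"
  shows "(\<lambda>x. c * f x) \<in> Lp s M"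
  using Lp_scaleR[OF assms, of c] by simp

lemma Lp_diff:
  assumes "0 \<le> s" "f \<in> Lp s M" "g \<in> Lp s M"
  shows "(\<lambda>x. f x - g x) \<in> Lp s M"
  using Lp_add[OF assms(1,2) Lp_scaleR[OF assms(3), of "-1"]] by simp

lemma Lp_sum:
  assumes "0 \<le> s" "finite I" "\<And>i. i \<in> I \<Longrightarrow> f i \<in> Lp s M"
  shows "(\<lambda>x. \<Sum>i\<in>I. c i *\<^sub>R f i x) \<in> Lp s M"
  using assms(2,3) by (induction I) (auto intro!: Lp_zero Lp_add[OF assms(1)] Lp_scaleR)

lemma modular_cong_AE:
  assumes "f \<in> borel_measurable M" "g \<in> borel_measurable M" "AE x in M. f x = g x"
  shows "modular s M f = modular s M g"
  unfolding modular_def by (intro integral_cong_AE) (use assms in \<open>auto elim!: eventually_mono\<close>)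

lemma modular_nonneg [simp]: "0 \<le> modular s M f"
  unfolding modular_def by (rule Bochner_Integration.integral_nonneg) auto

lemma modular_scaleR: "modular s M (\<lambda>x. c *\<^sub>R f x) = \<bar>c\<bar> powr s * modular s M f"
  by (simp add: modular_def powr_mult)

lemma modular_mult: "modular s M (\<lambda>x. c * f x) = \<bar>c\<bar> powr s * modular s M f" for f :: "'x \<Rightarrow> real"
  using modular_scaleR[of s M c f] by simp

lemma modular_minus_commute: "modular s M (\<lambda>x. f x - g x) = modular s M (\<lambda>x. g x - f x)"
  by (simp add: modular_def norm_minus_commute)

lemma modular_mono:
  assumes "f \<in> borel_measurable M" "g \<in> Lp s M" "0 \<le> s" "AE x in M. norm (f x) \<le> norm (g x)"
  shows "modular s M f \<le> modular s M g"
proof -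
  have ae: "AE x in M. norm (f x) powr s \<le> norm (g x) powr s"
    using assms(4) by eventually_elim (use assms(3) in \<open>auto intro: powr_mono2\<close>)
  have "f \<in> Lp s M" by (rule Lp_bound[OF assms(1) LpD(2)[OF assms(2)] ae])
  then show ?thesis unfolding modular_def
    by (intro integral_mono_AE LpD assms ae)
qed

lemma modular_add_le:
  assumes "0 \<le> s" "f \<in> Lp s M" "g \<in> Lp s M"
  shows "modular s M (\<lambda>x. f x + g x) \<le> 2 powr s * (modular s M f + modular s M g)"
proof -
  have "modular s M (\<lambda>x. f x + g x) \<le> (LINT x|M. 2 powr s * (norm (f x) powr s + norm (g x) powr s))"
    unfolding modular_def
    by (intro integral_mono LpD[OF Lp_add] integrable_mult_right Bochner_Integration.integrable_add LpD assms
        norm_add_powr_le)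
  also have "\<dots> = 2 powr s * (modular s M f + modular s M g)"
    using LpD(2)[OF assms(2)] LpD(2)[OF assms(3)] by (simp add: modular_def)
  finally show ?thesis .
qed

lemma modular_eq_0_iff:
  assumes "f \<in> Lp s M"
  shows "modular s M f = 0 \<longleftrightarrow> (AE x in M. f x = 0)"
  using integral_nonneg_eq_0_iff_AE[OF LpD(2)[OF assms]] by (auto simp: modular_def)

text \<open>Coefficients of either sign are admitted because \<open>|\<cdot>|\<^sup>s\<close> is even, and their absolute values may
  sum to less than \<open>1\<close> because it vanishes at \<open>0\<close>.\<close>

lemma modular_convex_combination:
  assumes s: "1 \<le> s" and I: "finite I" and f: "\<And>i. i \<in> I \<Longrightarrow> f i \<in> Lp s M"
    and c: "(\<Sum>i\<in>I. \<bar>c i\<bar>) \<le> 1"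
  shows "modular s M (\<lambda>x. \<Sum>i\<in>I. c i *\<^sub>R f i x) \<le> (\<Sum>i\<in>I. \<bar>c i\<bar> * modular s M (f i))"
proof -
  have pt: "norm (\<Sum>i\<in>I. c i *\<^sub>R v i) powr s \<le> (\<Sum>i\<in>I. \<bar>c i\<bar> * norm (v i) powr s)" for v :: "'a \<Rightarrow> 'c"
  proof -
    define T where "T = (\<Sum>i\<in>I. \<bar>c i\<bar>)"
    show ?thesis
    proof (cases "T = 0")
      case True
      then have "\<forall>i\<in>I. c i = 0" using I by (simp add: T_def sum_nonneg_eq_0_iff)
      then show ?thesis by simp
    next
      case False
      then have T: "0 < T" "T \<le> 1" using c by (auto simp: T_def sum_nonneg order_less_le)
      have "norm (\<Sum>i\<in>I. c i *\<^sub>R v i) \<le> (\<Sum>i\<in>I. \<bar>c i\<bar> * norm (v i))"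
        by (rule order_trans[OF norm_sum]) simp
      also have "\<dots> = T * (\<Sum>i\<in>I. (\<bar>c i\<bar> / T) *\<^sub>R norm (v i))"
        using T by (simp add: sum_distrib_left)
      finally have "norm (\<Sum>i\<in>I. c i *\<^sub>R v i) powr s \<le> (T * (\<Sum>i\<in>I. (\<bar>c i\<bar> / T) *\<^sub>R norm (v i))) powr s"
        using s by (intro powr_mono2) auto
      also have "\<dots> = T powr s * (\<Sum>i\<in>I. (\<bar>c i\<bar> / T) *\<^sub>R norm (v i)) powr s"
        using T by (simp add: powr_mult)
      also have "\<dots> \<le> T * (\<Sum>i\<in>I. (\<bar>c i\<bar> / T) *\<^sub>R norm (v i)) powr s"
      proof (intro mult_right_mono)
        have "T powr s \<le> T powr 1" using T s by (intro powr_mono') auto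
        then show "T powr s \<le> T" using T by simp
      qed auto
      also have "(\<Sum>i\<in>I. (\<bar>c i\<bar> / T) *\<^sub>R norm (v i)) powr s \<le> (\<Sum>i\<in>I. (\<bar>c i\<bar> / T) * norm (v i) powr s)"
      proof (rule convex_on_sum[OF I _ convex_on_powr[OF s]])
        show "I \<noteq> {}" using False by (auto simp: T_def)
        have "(\<Sum>i\<in>I. \<bar>c i\<bar> / T) = T / T"
          unfolding sum_divide_distrib[symmetric] T_def by (rule refl)
        then show "(\<Sum>i\<in>I. \<bar>c i\<bar> / T) = 1" using T by simp
      qed (use T in auto)
      also have "T * (\<Sum>i\<in>I. (\<bar>c i\<bar> / T) * norm (v i) powr s) = (\<Sum>i\<in>I. \<bar>c i\<bar> * norm (v i) powr s)"
        using T by (simp add: sum_distrib_left)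
      finally show ?thesis using T by simp
    qed
  qed
  have "modular s M (\<lambda>x. \<Sum>i\<in>I. c i *\<^sub>R f i x) \<le> (LINT x|M. (\<Sum>i\<in>I. \<bar>c i\<bar> * norm (f i x) powr s))"
    unfolding modular_def
    using s by (intro integral_mono LpD[OF Lp_sum] pt I f Bochner_Integration.integrable_sum
        integrable_mult_right LpD) auto
  also have "\<dots> = (\<Sum>i\<in>I. \<bar>c i\<bar> * modular s M (f i))"
    unfolding modular_def
    by (subst Bochner_Integration.integral_sum) (auto intro!: integrable_mult_right LpD f)
  finally show ?thesis .
qed

text \<open>Minkowski's inequality by convexity alone: \<open>f + g\<close> is \<open>a + b\<close> times a convex combination of
  \<open>f / a\<close> and \<open>g / b\<close>. Here \<open>a\<close> and \<open>b\<close> slightly exceed the norms, because these may vanish.\<close>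

lemma modular_triangle:
  assumes s: "1 \<le> s" and f: "f \<in> Lp s M" and g: "g \<in> Lp s M"
  shows "modular s M (\<lambda>x. f x + g x) powr (1 / s) \<le> modular s M f powr (1 / s) + modular s M g powr (1 / s)"
proof -
  have main: "modular s M (\<lambda>x. f x + g x) powr (1 / s) \<le> a + b"
    if a: "0 < a" "modular s M f \<le> a powr s" and b: "0 < b" "modular s M g \<le> b powr s" for a b
  proof -
    define c where "c = (\<lambda>i::bool. if i then a / (a + b) else b / (a + b))"
    define h where "h = (\<lambda>i::bool. if i then (\<lambda>x. (1 / a) *\<^sub>R f x) else (\<lambda>x. (1 / b) *\<^sub>R g x))"
    have h1: "modular s M (h i) \<le> 1" for i
      using a b by (cases i) (auto simp: h_def modular_scaleR powr_divide)
    have "(\<lambda>x. \<Sum>i\<in>UNIV. c i *\<^sub>R h i x) = (\<lambda>x. (1 / (a + b)) *\<^sub>R (f x + g x))"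
      using a b by (auto simp: c_def h_def UNIV_bool scaleR_add_right)
    moreover have "modular s M (\<lambda>x. \<Sum>i\<in>UNIV. c i *\<^sub>R h i x) \<le> (\<Sum>i\<in>UNIV. \<bar>c i\<bar> * modular s M (h i))"
    proof (rule modular_convex_combination[OF s])
      show "h i \<in> Lp s M" for i unfolding h_def using Lp_scaleR f g by auto
      show "(\<Sum>i\<in>UNIV. \<bar>c i\<bar>) \<le> 1" using a b by (simp add: c_def UNIV_bool add_divide_distrib[symmetric])
    qed simp
    moreover have "(\<Sum>i\<in>UNIV. \<bar>c i\<bar> * modular s M (h i)) \<le> (\<Sum>i\<in>UNIV. \<bar>c i\<bar> * 1)"
      by (intro sum_mono mult_left_mono h1) auto
    moreover have "(\<Sum>i\<in>UNIV. \<bar>c i\<bar>) \<le> 1" using a b by (simp add: c_def UNIV_bool add_divide_distrib[symmetric])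
    ultimately have "modular s M (\<lambda>x. (1 / (a + b)) *\<^sub>R (f x + g x)) \<le> 1" by simp
    moreover have "modular s M (\<lambda>x. (1 / (a + b)) *\<^sub>R (f x + g x)) = modular s M (\<lambda>x. f x + g x) / (a + b) powr s"
      using a b unfolding modular_scaleR by (simp add: powr_divide)
    ultimately have "modular s M (\<lambda>x. f x + g x) \<le> (a + b) powr s"
      using a b by (simp add: divide_le_eq)
    then have "modular s M (\<lambda>x. f x + g x) powr (1 / s) \<le> ((a + b) powr s) powr (1 / s)"
      using s by (intro powr_mono2) auto
    then show ?thesis using a b s by (simp add: powr_powr)
  qed
  show ?thesis
  proof (rule field_le_epsilon)
    fix e :: real assume e: "0 < e"
    define a where "a = modular s M f powr (1 / s) + e / 2"
    define b where "b = modular s M g powr (1 / s) + e / 2"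
    have ab: "0 < a" "0 < b" using e by (auto simp: a_def b_def add_nonneg_pos)
    have *: "m \<le> (m powr (1 / s) + e / 2) powr s" if "0 \<le> m" for m
    proof -
      have "m = (m powr (1 / s)) powr s" using that s by (simp add: powr_powr)
      also have "\<dots> \<le> (m powr (1 / s) + e / 2) powr s" using s e by (intro powr_mono2) auto
      finally show ?thesis .
    qed
    show "modular s M (\<lambda>x. f x + g x) powr (1 / s) \<le> modular s M f powr (1 / s) + modular s M g powr (1 / s) + e"
      using main[OF ab(1) _ ab(2)] *[of "modular s M f"] *[of "modular s M g"] by (simp add: a_def b_def)
  qed
qed

lemma modular_uniform_convexity:
  fixes M :: "'x measure"
  assumes s: "1 < s" and th: "0 < \<theta>"
  obtains C where "0 \<le> C"
    "\<And>f g :: 'x \<Rightarrow> 'b::euclidean_space. f \<in> Lp s M \<Longrightarrow> g \<in> Lp s M \<Longrightarrow>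
      modular s M (\<lambda>x. f x - g x) \<le> \<theta> * (modular s M f + modular s M g)
       + C * ((modular s M f + modular s M g) / 2 - modular s M (\<lambda>x. (1/2) *\<^sub>R (f x + g x)))"
proof -
  obtain C where C: "0 \<le> C"
    "\<And>a b :: 'b. norm (a - b) powr s \<le> \<theta> * (norm a powr s + norm b powr s)
       + C * ((norm a powr s + norm b powr s) / 2 - norm ((1/2) *\<^sub>R (a + b)) powr s)"
    using uniform_convexity_pointwise[OF s th] by blast
  show ?thesis
  proof (rule that[OF C(1)])
    fix f g :: "'x \<Rightarrow> 'b" assume f: "f \<in> Lp s M" and g: "g \<in> Lp s M"
    have i: "integrable M (\<lambda>x. norm (f x) powr s)" "integrable M (\<lambda>x. norm (g x) powr s)"
      "integrable M (\<lambda>x. norm ((1/2) *\<^sub>R (f x + g x)) powr s)" "integrable M (\<lambda>x. norm (f x - g x) powr s)"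
      using s by (auto intro!: LpD(2) f g Lp_diff LpD(2)[OF Lp_scaleR] Lp_add simp del: norm_scaleR)
    have "modular s M (\<lambda>x. f x - g x) \<le> (LINT x|M. \<theta> * (norm (f x) powr s + norm (g x) powr s)
       + C * ((norm (f x) powr s + norm (g x) powr s) / 2 - norm ((1/2) *\<^sub>R (f x + g x)) powr s))"
      unfolding modular_def using i by (intro integral_mono C(2)) (auto simp del: norm_scaleR)
    also have "\<dots> = \<theta> * (modular s M f + modular s M g)
       + C * ((modular s M f + modular s M g) / 2 - modular s M (\<lambda>x. (1/2) *\<^sub>R (f x + g x)))"
      using i unfolding modular_def by (simp del: norm_scaleR)
    finally show "modular s M (\<lambda>x. f x - g x) \<le> \<theta> * (modular s M f + modular s M g)
       + C * ((modular s M f + modular s M g) / 2 - modular s M (\<lambda>x. (1/2) *\<^sub>R (f x + g x)))" .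
  qed
qed

lemma duality_integrable:
  assumes s: "1 < s" and f: "f \<in> Lp s M" and g: "g \<in> Lp s M"
  shows "integrable M (\<lambda>x. norm (f x) powr (s - 2) * (f x \<bullet> g x))"
proof (rule Bochner_Integration.integrable_bound)
  show "integrable M (\<lambda>x. ((s - 1) * norm (f x) powr s + norm (g x) powr s) / s)"
    using LpD(2)[OF f] LpD(2)[OF g] by simp
  show "(\<lambda>x. norm (f x) powr (s - 2) * (f x \<bullet> g x)) \<in> borel_measurable M"
    using LpD(1)[OF f] LpD(1)[OF g] by measurable
  show "AE x in M. norm (norm (f x) powr (s - 2) * (f x \<bullet> g x)) \<le> norm (((s - 1) * norm (f x) powr s + norm (g x) powr s) / s)"
  proof (rule AE_I2)
    fix x
    have "\<bar>norm (f x) powr (s - 2) * (f x \<bullet> g x)\<bar> \<le> ((s - 1) * norm (f x) powr s + norm (g x) powr s) / s"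
      using duality_young[OF s, of "f x" "g x"] s by (simp add: field_simps)
    then show "norm (norm (f x) powr (s - 2) * (f x \<bullet> g x)) \<le> norm (((s - 1) * norm (f x) powr s + norm (g x) powr s) / s)"
      unfolding real_norm_def by linarith
  qed
qed

lemma duality_le_modular:
  assumes s: "1 < s" and f: "f \<in> Lp s M" and g: "g \<in> Lp s M"
  shows "s * duality s M f g \<le> (s - 1) * modular s M f + modular s M g"
proof -
  have "s * duality s M f g = (LINT x|M. s * (norm (f x) powr (s - 2) * (f x \<bullet> g x)))"
    by (simp add: duality_def)
  also have "\<dots> \<le> (LINT x|M. (s - 1) * norm (f x) powr s + norm (g x) powr s)"
  proof (intro integral_mono integrable_mult_right duality_integrable assms)
    show "integrable M (\<lambda>x. (s - 1) * norm (f x) powr s + norm (g x) powr s)"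
      using LpD(2)[OF f] LpD(2)[OF g] by simp
    show "s * (norm (f x) powr (s - 2) * (f x \<bullet> g x)) \<le> (s - 1) * norm (f x) powr s + norm (g x) powr s" for x
    proof -
      have "s * (norm (f x) powr (s - 2) * (f x \<bullet> g x)) \<le> s * \<bar>norm (f x) powr (s - 2) * (f x \<bullet> g x)\<bar>"
        using s by (intro mult_left_mono) auto
      then show ?thesis using duality_young[OF s, of "f x" "g x"] by linarith
    qed
  qed
  also have "\<dots> = (s - 1) * modular s M f + modular s M g"
    using LpD(2)[OF f] LpD(2)[OF g] by (simp add: modular_def)
  finally show ?thesis .
qed

lemma duality_self: "1 < s \<Longrightarrow> duality s M f f = modular s M f"
proof -
  have "norm a powr (s - 2) * (a \<bullet> a) = norm a powr s" for a :: 'b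
    by (cases "a = 0") (simp_all add: powr_diff dot_square_norm power2_eq_square)
  then show ?thesis by (simp add: duality_def modular_def)
qed

lemma duality_scaleR: "duality s M f (\<lambda>x. c *\<^sub>R g x) = c * duality s M f g"
  by (simp add: duality_def mult.left_commute)

lemma duality_scaleR_left:
  assumes "0 < c"
  shows "duality s M (\<lambda>x. c *\<^sub>R f x) g = c powr (s - 1) * duality s M f g"
proof -
  have "c powr (s - 1) = c powr (s - 2) * c"
    using assms powr_mult_base[of c "s - 2"] by (simp add: mult.commute)
  then show ?thesis
    using assms by (simp add: duality_def powr_mult mult_ac flip: integral_mult_right_zero)
qed

lemma duality_uminus_left: "duality s M (\<lambda>x. - f x) g = - duality s M f g"
  by (simp add: duality_def)

lemma duality_add:
  assumes "1 < s" "f \<in> Lp s M" "g \<in> Lp s M" "h \<in> Lp s M"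
  shows "duality s M f (\<lambda>x. g x + h x) = duality s M f g + duality s M f h"
  unfolding duality_def inner_add_right distrib_left
  by (intro Bochner_Integration.integral_add duality_integrable assms)

lemma duality_sum:
  assumes "1 < s" "f \<in> Lp s M" "finite I" "\<And>i. i \<in> I \<Longrightarrow> g i \<in> Lp s M"
  shows "duality s M f (\<lambda>x. \<Sum>i\<in>I. c i *\<^sub>R g i x) = (\<Sum>i\<in>I. c i * duality s M f (g i))"
  using assms(3,4)
proof (induction I)
  case empty
  then show ?case by (simp add: duality_def)
next
  case (insert j J)
  have "duality s M f (\<lambda>x. c j *\<^sub>R g j x + (\<Sum>i\<in>J. c i *\<^sub>R g i x))
    = duality s M f (\<lambda>x. c j *\<^sub>R g j x) + duality s M f (\<lambda>x. \<Sum>i\<in>J. c i *\<^sub>R g i x)"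
    using assms insert by (intro duality_add Lp_scaleR Lp_sum) auto
  then show ?case using insert by (simp add: duality_scaleR)
qed

lemma duality_uniform_continuity:
  fixes M :: "'x measure"
  assumes s: "1 < s" and th: "0 < \<theta>"
  obtains C where "0 \<le> C"
    "\<And>f g y :: 'x \<Rightarrow> real. f \<in> Lp s M \<Longrightarrow> g \<in> Lp s M \<Longrightarrow> y \<in> Lp s M \<Longrightarrow>
      \<bar>duality s M f y - duality s M g y\<bar>
        \<le> \<theta> * (modular s M f + modular s M g + modular s M y) + C * modular s M (\<lambda>x. f x - g x)"
proof -
  obtain C where C: "0 \<le> C"
    "\<And>a b y :: real. \<bar>\<bar>a\<bar> powr (s - 2) * a * y - \<bar>b\<bar> powr (s - 2) * b * y\<bar>
        \<le> \<theta> * (\<bar>a\<bar> powr s + \<bar>b\<bar> powr s + \<bar>y\<bar> powr s) + C * \<bar>a - b\<bar> powr s"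
    using duality_map_pointwise[OF s th] by blast
  show ?thesis
  proof (rule that[OF C(1)])
    fix f g y :: "'x \<Rightarrow> real" assume L: "f \<in> Lp s M" "g \<in> Lp s M" "y \<in> Lp s M"
    have i: "integrable M (\<lambda>x. \<bar>f x\<bar> powr s)" "integrable M (\<lambda>x. \<bar>g x\<bar> powr s)"
      "integrable M (\<lambda>x. \<bar>y x\<bar> powr s)" "integrable M (\<lambda>x. \<bar>f x - g x\<bar> powr s)"
      using LpD(2)[OF L(1)] LpD(2)[OF L(2)] LpD(2)[OF L(3)] LpD(2)[OF Lp_diff[OF _ L(1,2)]] s by auto
    have d: "integrable M (\<lambda>x. \<bar>f x\<bar> powr (s - 2) * f x * y x)" "integrable M (\<lambda>x. \<bar>g x\<bar> powr (s - 2) * g x * y x)"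
      using duality_integrable[OF s L(1,3)] duality_integrable[OF s L(2,3)] by (auto simp: mult.assoc)
    have "\<bar>duality s M f y - duality s M g y\<bar> = \<bar>LINT x|M. \<bar>f x\<bar> powr (s - 2) * f x * y x - \<bar>g x\<bar> powr (s - 2) * g x * y x\<bar>"
      using d by (simp add: duality_def mult.assoc)
    also have "\<dots> \<le> (LINT x|M. \<bar>\<bar>f x\<bar> powr (s - 2) * f x * y x - \<bar>g x\<bar> powr (s - 2) * g x * y x\<bar>)"
      by (rule integral_abs_bound)
    also have "\<dots> \<le> (LINT x|M. \<theta> * (\<bar>f x\<bar> powr s + \<bar>g x\<bar> powr s + \<bar>y x\<bar> powr s) + C * \<bar>f x - g x\<bar> powr s)"
      using d i by (intro integral_mono C(2)) auto
    also have "\<dots> = \<theta> * (modular s M f + modular s M g + modular s M y) + C * modular s M (\<lambda>x. f x - g x)"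
      using i by (simp add: modular_def)
    finally show "\<bar>duality s M f y - duality s M g y\<bar>
        \<le> \<theta> * (modular s M f + modular s M g + modular s M y) + C * modular s M (\<lambda>x. f x - g x)" .
  qed
qed

text \<open>The difference quotients of the convex function \<open>t \<mapsto> |a + t b|\<^sup>s\<close> on \<open>[-1, 1]\<close> lie between its
  increments over \<open>[-1, 0]\<close> and \<open>[0, 1]\<close>, which provides the dominating function.\<close>

lemma modular_has_derivative_line:
  assumes s: "1 < s" and f: "f \<in> Lp s M" and g: "g \<in> Lp s M"
  shows "((\<lambda>t. modular s M (\<lambda>x. f x + t *\<^sub>R g x)) has_real_derivative s * duality s M f g) (at 0)"
proof -
  define P where "P = (\<lambda>t x. norm (f x + t *\<^sub>R g x) powr s)"
  have P: "integrable M (P t)" for t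
    unfolding P_def using s by (intro LpD(2) Lp_add f Lp_scaleR g) auto
  have conv: "P ((1 - t) * a + t * b) x \<le> (1 - t) * P a x + t * P b x" if "0 \<le> t" "t \<le> 1" for t a b x
  proof -
    have "f x + ((1 - t) * a + t * b) *\<^sub>R g x = (1 - t) *\<^sub>R (f x + a *\<^sub>R g x) + t *\<^sub>R (f x + b *\<^sub>R g x)"
      by (simp add: algebra_simps)
    then show ?thesis unfolding P_def
      using convex_onD[OF convex_on_norm_powr[of s], of t "f x + a *\<^sub>R g x" "f x + b *\<^sub>R g x"] s that by simp
  qed
  define w where "w = (\<lambda>x. \<bar>P 1 x - P 0 x\<bar> + \<bar>P (-1) x - P 0 x\<bar>)"
  have w: "integrable M w" unfolding w_def using P by auto
  have half: "\<bar>(P t x - P 0 x) / t\<bar> \<le> \<bar>P 1 x - P 0 x\<bar> + \<bar>P (-1) x - P 0 x\<bar>" if t: "0 < t" "t \<le> 1" for t x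
  proof -
    have 1: "(P t x - P 0 x) / t \<le> P 1 x - P 0 x"
      using conv[of t 0 1 x] t by (simp add: field_simps)
    have "P 0 x \<le> (1 - t / (1 + t)) * P t x + t / (1 + t) * P (-1) x"
      using conv[of "t / (1 + t)" t "-1" x] t by (simp add: field_simps)
    also have "1 - t / (1 + t) = 1 / (1 + t)" using t by (simp add: field_simps)
    also have "1 / (1 + t) * P t x + t / (1 + t) * P (-1) x = (P t x + t * P (-1) x) / (1 + t)"
      by (simp add: add_divide_distrib)
    finally have "P 0 x * (1 + t) \<le> P t x + t * P (-1) x" using t by (simp add: pos_le_divide_eq)
    then have 2: "P 0 x - P (-1) x \<le> (P t x - P 0 x) / t" using t by (simp add: field_simps)
    show ?thesis using 1 2 by linarith
  qed
  have neg: "\<bar>(P (-t) x - P 0 x) / t\<bar> \<le> w x" if t: "0 < t" "t \<le> 1" for t x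
  proof -
    have 1: "(P (-t) x - P 0 x) / t \<le> P (-1) x - P 0 x"
      using conv[of t 0 "-1" x] t by (simp add: field_simps)
    have "P 0 x \<le> (1 - t / (1 + t)) * P (-t) x + t / (1 + t) * P 1 x"
      using conv[of "t / (1 + t)" "-t" "1" x] t by (simp add: field_simps)
    also have "1 - t / (1 + t) = 1 / (1 + t)" using t by (simp add: field_simps)
    also have "1 / (1 + t) * P (-t) x + t / (1 + t) * P 1 x = (P (-t) x + t * P 1 x) / (1 + t)"
      by (simp add: add_divide_distrib)
    finally have "P 0 x * (1 + t) \<le> P (-t) x + t * P 1 x" using t by (simp add: pos_le_divide_eq)
    then have 2: "P 0 x - P 1 x \<le> (P (-t) x - P 0 x) / t" using t by (simp add: field_simps)
    show ?thesis using 1 2 unfolding w_def by linarith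
  qed
  have dom: "\<bar>(P t x - P 0 x) / t\<bar> \<le> w x" if "t \<noteq> 0" "\<bar>t\<bar> \<le> 1" for t x
    using half[of t x] neg[of "- t" x] that by (cases "0 < t") (auto simp: w_def)
  have "((\<lambda>t. (LINT x|M. (P t x - P 0 x) / t)) \<longlongrightarrow> (LINT x|M. s * (norm (f x) powr (s - 2) * (f x \<bullet> g x)))) (at 0)"
    unfolding tendsto_at_iff_sequentially comp_def
  proof (intro allI impI)
    fix X :: "nat \<Rightarrow> real" assume X0: "\<forall>i. X i \<in> UNIV - {0}" and X: "X \<longlonglongrightarrow> 0"
    have pt: "(\<lambda>i. (P (X i) x - P 0 x) / X i) \<longlonglongrightarrow> s * (norm (f x) powr (s - 2) * (f x \<bullet> g x))" for x
    proof -
      have "((\<lambda>t. (P t x - P 0 x) / t) \<longlongrightarrow> s * (norm (f x) powr (s - 2) * (f x \<bullet> g x))) (at 0)"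
        using norm_powr_has_derivative_line[OF s, of "f x" "g x"] by (simp add: has_field_derivative_iff P_def)
      then show ?thesis using X X0 unfolding tendsto_at_iff_sequentially comp_def by blast
    qed
    obtain n0 where n0: "\<And>i. n0 \<le> i \<Longrightarrow> \<bar>X i\<bar> \<le> 1"
      using LIMSEQ_D[OF X, of 1] by (auto intro: less_imp_le)
    have "(\<lambda>i. LINT x|M. (P (X (i + n0)) x - P 0 x) / X (i + n0)) \<longlonglongrightarrow> (LINT x|M. s * (norm (f x) powr (s - 2) * (f x \<bullet> g x)))"
    proof (rule integral_dominated_convergence[where w = w])
      show "(\<lambda>x. s * (norm (f x) powr (s - 2) * (f x \<bullet> g x))) \<in> borel_measurable M"
        using LpD(1)[OF f] LpD(1)[OF g] by measurable
      show "(\<lambda>x. (P (X (i + n0)) x - P 0 x) / X (i + n0)) \<in> borel_measurable M" for i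
        using P by (intro borel_measurable_integrable) auto
      show "AE x in M. (\<lambda>i. (P (X (i + n0)) x - P 0 x) / X (i + n0)) \<longlonglongrightarrow> s * (norm (f x) powr (s - 2) * (f x \<bullet> g x))"
        using LIMSEQ_ignore_initial_segment[OF pt] by auto
      show "AE x in M. norm ((P (X (i + n0)) x - P 0 x) / X (i + n0)) \<le> w x" for i
        using dom n0[of "i + n0"] X0 by auto
    qed (fact w)
    then show "(\<lambda>i. LINT x|M. (P (X i) x - P 0 x) / X i) \<longlonglongrightarrow> (LINT x|M. s * (norm (f x) powr (s - 2) * (f x \<bullet> g x)))"
      by (rule LIMSEQ_offset)
  qed
  moreover have "(LINT x|M. (P t x - P 0 x) / t) = (modular s M (\<lambda>x. f x + t *\<^sub>R g x) - modular s M f) / t" for t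
    using P[of t] P[of 0] by (simp add: modular_def P_def)
  ultimately have "((\<lambda>t. (modular s M (\<lambda>x. f x + t *\<^sub>R g x) - modular s M f) / t) \<longlongrightarrow> s * duality s M f g) (at 0)"
    by (simp only: duality_def integral_mult_right_zero)
  then show ?thesis by (simp add: has_field_derivative_iff)
qed

lemma (in finite_measure) Lp_subset:
  assumes "0 \<le> r" "r \<le> s" "f \<in> Lp s M"
  shows "f \<in> Lp r M" "modular r M f \<le> measure M (space M) + modular s M f"
proof -
  have b: "norm a powr r \<le> 1 + norm a powr s" for a :: 'b
  proof (cases "norm a \<le> 1")
    case True
    have "norm a powr r \<le> 1 powr r" using True assms by (intro powr_mono2) auto
    also have "\<dots> \<le> 1 + norm a powr s" by simp
    finally show ?thesis .
  next
    case False
    then have "norm a powr r \<le> norm a powr s" using assms by (intro powr_mono) auto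
    then show ?thesis by simp
  qed
  have i: "integrable M (\<lambda>x. 1 + norm (f x) powr s)" using LpD(2)[OF assms(3)] by auto
  show "f \<in> Lp r M" using Lp_bound[OF LpD(1)[OF assms(3)] i] b by auto
  then have "modular r M f \<le> (LINT x|M. 1 + norm (f x) powr s)"
    unfolding modular_def by (intro integral_mono LpD(2) b i)
  also have "\<dots> = measure M (space M) + modular s M f"
    using LpD(2)[OF assms(3)] by (simp add: modular_def)
  finally show "modular r M f \<le> measure M (space M) + modular s M f" .
qed

lemma (in finite_measure) Lp_integrable:
  assumes "1 \<le> s" "f \<in> Lp s M"
  shows "integrable M f"
proof -
  have "f \<in> Lp 1 M" using Lp_subset(1)[of 1 s f] assms by auto
  then show ?thesis using LpD[of f 1 M] by (simp add: integrable_norm_iff)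
qed

text \<open>Splitting the values at the height \<open>\<theta>\<close>; above it, \<open>|f| \<le> \<theta>\<^sup>1\<^sup>-\<^sup>s|f|\<^sup>s\<close>.\<close>

lemma (in finite_measure) integral_norm_le_modular:
  assumes s: "1 \<le> s" and f: "f \<in> Lp s M" and th: "0 < \<theta>"
  shows "(LINT x|M. norm (f x)) \<le> \<theta> * measure M (space M) + \<theta> powr (1 - s) * modular s M f"
proof -
  have "(LINT x|M. norm (f x)) \<le> (LINT x|M. \<theta> + \<theta> powr (1 - s) * norm (f x) powr s)"
  proof (intro integral_mono)
    fix x
    show "norm (f x) \<le> \<theta> + \<theta> powr (1 - s) * norm (f x) powr s"
    proof (cases "norm (f x) \<le> \<theta>")
      case False
      then have "norm (f x) = norm (f x) powr (1 - s) * norm (f x) powr s"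
        using th by (simp flip: powr_add)
      also have "\<dots> \<le> \<theta> powr (1 - s) * norm (f x) powr s"
        using False th s by (intro mult_right_mono powr_mono2') auto
      finally show ?thesis using th by simp
    qed (simp add: add_increasing2)
  qed (use Lp_integrable[OF s f] LpD(2)[OF f] in auto)
  also have "\<dots> = \<theta> * measure M (space M) + \<theta> powr (1 - s) * modular s M f"
    using LpD(2)[OF f] by (simp add: modular_def)
  finally show ?thesis .
qed

lemma (in finite_measure) integral_norm_small:
  assumes s: "1 \<le> s" and e: "0 < e"
  obtains d where "0 < d" "\<And>f :: 'a \<Rightarrow> 'b::euclidean_space. f \<in> Lp s M \<Longrightarrow> modular s M f < d \<Longrightarrow> (LINT x|M. norm (f x)) < e"
proof -
  define \<theta> where "\<theta> = e / (2 * (measure M (space M) + 1))"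
  have th: "0 < \<theta>" using e by (simp add: \<theta>_def add_nonneg_pos)
  have t2: "\<theta> * measure M (space M) < e / 2"
  proof -
    have "\<theta> * measure M (space M) < \<theta> * (measure M (space M) + 1)" using th by simp
    also have "\<dots> = e / 2"
      using add_nonneg_pos[of "measure M (space M)" 1] by (simp add: \<theta>_def field_simps)
    finally show ?thesis .
  qed
  show ?thesis
  proof (rule that[of "e / 2 / \<theta> powr (1 - s)"])
    show "0 < e / 2 / \<theta> powr (1 - s)" using e th by simp
    fix f :: "'a \<Rightarrow> 'b" assume f: "f \<in> Lp s M" and m: "modular s M f < e / 2 / \<theta> powr (1 - s)"
    have "\<theta> powr (1 - s) * modular s M f < e / 2"
      using m th by (simp add: field_simps)
    then show "(LINT x|M. norm (f x)) < e"
      using integral_norm_le_modular[OF s f th] t2 by linarith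
  qed
qed

text \<open>Riesz--Fischer. On a finite measure space a Cauchy sequence for the modular is Cauchy in \<open>L\<^sup>1\<close>,
  so a subsequence converges almost everywhere; Fatou's lemma transfers the Cauchy estimate.\<close>

lemma (in finite_measure) modular_complete:
  fixes f :: "nat \<Rightarrow> 'a \<Rightarrow> 'b::euclidean_space"
  assumes s: "1 \<le> s" and f: "\<And>n. f n \<in> Lp s M"
    and cau: "\<And>e. 0 < e \<Longrightarrow> \<exists>N. \<forall>i\<ge>N. \<forall>j\<ge>N. modular s M (\<lambda>x. f i x - f j x) < e"
  obtains g where "g \<in> Lp s M" "(\<lambda>n. modular s M (\<lambda>x. f n x - g x)) \<longlonglongrightarrow> 0"
proof -
  have s0: "0 \<le> s" using s by simp
  have [measurable]: "f n \<in> borel_measurable M" for n using LpD(1)[OF f] .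
  have dL: "(\<lambda>x. f i x - f j x) \<in> Lp s M" for i j by (intro Lp_diff f s0)
  have "\<exists>N. \<forall>i\<ge>N. \<forall>j\<ge>N. LINT x|M. norm (f i x - f j x) < e" if "0 < e" for e
  proof -
    obtain d where "0 < d" "\<And>h::'a \<Rightarrow> 'b. h \<in> Lp s M \<Longrightarrow> modular s M h < d \<Longrightarrow> (LINT x|M. norm (h x)) < e"
      using integral_norm_small[OF s \<open>0 < e\<close>] by blast
    then show ?thesis using cau[of d] dL by meson
  qed
  then obtain r where r: "strict_mono r" and ae: "AE x in M. Cauchy (\<lambda>i. f (r i) x)"
    using cauchy_L1_AE_cauchy_subseq[of M f] Lp_integrable[OF s f] by blast
  define g where "g = (\<lambda>x. lim (\<lambda>i. f (r i) x))"
  have gm [measurable]: "g \<in> borel_measurable M" unfolding g_def by measurable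
  have lim: "AE x in M. (\<lambda>i. f (r i) x) \<longlonglongrightarrow> g x"
    using ae by eventually_elim (simp add: g_def Cauchy_convergent_iff convergent_LIMSEQ_iff)
  have est: "(\<lambda>x. f i x - g x) \<in> Lp s M \<and> modular s M (\<lambda>x. f i x - g x) \<le> e"
    if e: "0 < e" and N: "\<forall>j\<ge>N. modular s M (\<lambda>x. f i x - f j x) < e" for i N e
  proof -
    have ptl: "AE x in M. (\<lambda>j. norm (f i x - f (r j) x) powr s) \<longlonglongrightarrow> norm (f i x - g x) powr s"
      using lim
    proof eventually_elim
      case (elim x)
      show ?case
        using s by (intro tendsto_powr' tendsto_norm tendsto_diff tendsto_const elim) auto
    qed
    have "AE x in M. ennreal (norm (f i x - g x) powr s) = liminf (\<lambda>j. ennreal (norm (f i x - f (r j) x) powr s))"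
      using ptl
    proof eventually_elim
      case (elim x)
      show ?case
        by (rule lim_imp_Liminf[symmetric, OF trivial_limit_sequentially tendsto_ennrealI[OF elim]])
    qed
    then have "(\<integral>\<^sup>+x. ennreal (norm (f i x - g x) powr s) \<partial>M)
        = (\<integral>\<^sup>+x. liminf (\<lambda>j. ennreal (norm (f i x - f (r j) x) powr s)) \<partial>M)"
      by (rule nn_integral_cong_AE)
    also have "\<dots> \<le> liminf (\<lambda>j. \<integral>\<^sup>+x. ennreal (norm (f i x - f (r j) x) powr s) \<partial>M)"
      by (rule nn_integral_liminf) auto
    also have "\<dots> \<le> liminf (\<lambda>j::nat. ennreal e)"
    proof (rule Liminf_mono)
      show "\<forall>\<^sub>F j in sequentially. (\<integral>\<^sup>+x. ennreal (norm (f i x - f (r j) x) powr s) \<partial>M) \<le> ennreal e"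
        using eventually_ge_at_top[of N]
      proof eventually_elim
        case (elim j)
        have "(\<integral>\<^sup>+x. ennreal (norm (f i x - f (r j) x) powr s) \<partial>M) = ennreal (modular s M (\<lambda>x. f i x - f (r j) x))"
          unfolding modular_def by (intro nn_integral_eq_integral LpD(2) dL) auto
        also have "\<dots> \<le> ennreal e" using N elim seq_suble[OF r, of j] by (intro ennreal_leI) (auto intro: less_imp_le)
        finally show ?case .
      qed
    qed
    also have "\<dots> = ennreal e" by (simp add: Liminf_const)
    finally have fin: "(\<integral>\<^sup>+x. ennreal (norm (f i x - g x) powr s) \<partial>M) \<le> ennreal e" .
    then have int: "integrable M (\<lambda>x. norm (f i x - g x) powr s)"
      by (intro integrableI_nonneg) (auto intro: le_less_trans)
    then have "ennreal (modular s M (\<lambda>x. f i x - g x)) \<le> ennreal e"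
      using fin unfolding modular_def by (subst (asm) nn_integral_eq_integral) auto
    then have "modular s M (\<lambda>x. f i x - g x) \<le> e" using e by (simp add: ennreal_le_iff)
    then show ?thesis using int by (simp add: Lp_def)
  qed
  obtain N1 where "\<forall>i\<ge>N1. \<forall>j\<ge>N1. modular s M (\<lambda>x. f i x - f j x) < 1" using cau[of 1] by auto
  then have "(\<lambda>x. f N1 x - g x) \<in> Lp s M" using est[of 1 N1 N1] by auto
  from Lp_diff[OF s0 f[of N1] this] have gL: "g \<in> Lp s M" by simp
  moreover have "(\<lambda>n. modular s M (\<lambda>x. f n x - g x)) \<longlonglongrightarrow> 0"
  proof (rule LIMSEQ_I)
    fix e :: real assume e: "0 < e"
    then obtain N where "\<forall>i\<ge>N. \<forall>j\<ge>N. modular s M (\<lambda>x. f i x - f j x) < e / 2" using cau[of "e / 2"] by auto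
    then have "\<forall>i\<ge>N. modular s M (\<lambda>x. f i x - g x) \<le> e / 2" using est[of "e / 2" N] e by auto
    then show "\<exists>no. \<forall>n\<ge>no. norm (modular s M (\<lambda>x. f n x - g x) - 0) < e"
      using e by (intro exI[of _ N]) auto
  qed
  ultimately show ?thesis by (rule that)
qed

lemma modular_tendsto:
  assumes s: "1 \<le> s" and f: "\<And>n. f n \<in> Lp s M" and g: "g \<in> Lp s M"
    and lim: "(\<lambda>n. modular s M (\<lambda>x. f n x - g x)) \<longlonglongrightarrow> 0"
  shows "(\<lambda>n. modular s M (f n)) \<longlonglongrightarrow> modular s M g"
proof -
  have s0: "0 \<le> s" "0 < s" using s by auto
  define N where "N = (\<lambda>f :: 'a \<Rightarrow> 'b. modular s M f powr (1 / s))"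
  have N: "N h powr s = modular s M h" "0 \<le> N h" for h using s0 by (auto simp: N_def powr_powr)
  have 1: "N h \<le> N (\<lambda>x. h x - k x) + N k" if "h \<in> Lp s M" "k \<in> Lp s M" for h k
    using modular_triangle[OF s Lp_diff[OF s0(1) that] that(2)] by (simp add: N_def)
  have 2: "N (\<lambda>x. g x - f n x) = N (\<lambda>x. f n x - g x)" for n by (simp add: N_def modular_minus_commute[of s M g])
  have "(\<lambda>n. N (\<lambda>x. f n x - g x)) \<longlonglongrightarrow> 0 powr (1 / s)"
    unfolding N_def using s0 by (intro tendsto_powr' lim tendsto_const) auto
  then have z: "(\<lambda>n. N (\<lambda>x. f n x - g x)) \<longlonglongrightarrow> 0" using s0 by simp
  have "\<bar>N (f n) - N g\<bar> \<le> N (\<lambda>x. f n x - g x)" for n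
    using 1[OF f[of n] g] 1[OF g f[of n]] unfolding 2 by linarith
  then have "(\<lambda>n. N (f n) - N g) \<longlonglongrightarrow> 0" by (intro Lim_null_comparison[OF _ z]) auto
  then have "(\<lambda>n. N (f n)) \<longlonglongrightarrow> N g" by (rule LIM_zero_cancel)
  then have "(\<lambda>n. N (f n) powr s) \<longlonglongrightarrow> N g powr s"
    by (rule tendsto_powr'[OF _ tendsto_const]) (simp add: s0 N(2))
  then show ?thesis by (simp only: N(1))
qed

text \<open>The crude comparison \<open>\<integral>|g|\<^sup>r \<le> |M| + \<integral>|g|\<^sup>s\<close> for \<open>g = f / t\<close> contributes the constant only with
  the small factor \<open>t\<^sup>r\<close>.\<close>

lemma (in finite_measure) modular_tendsto_0_lower_exponent:
  fixes f :: "nat \<Rightarrow> 'a \<Rightarrow> 'b::euclidean_space"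
  assumes r: "0 < r" "r \<le> s" and f: "\<And>n. f n \<in> Lp s M" and lim: "(\<lambda>n. modular s M (f n)) \<longlonglongrightarrow> 0"
  shows "(\<lambda>n. modular r M (f n)) \<longlonglongrightarrow> 0"
proof (rule order_tendstoI)
  fix a :: real assume "a < 0"
  then show "\<forall>\<^sub>F n in sequentially. a < modular r M (f n)"
    by (intro always_eventually allI) (rule less_le_trans[OF _ modular_nonneg])
next
  fix \<epsilon> :: real assume \<epsilon>: "0 < \<epsilon>"
  define K where "K = measure M (space M) + 1"
  have K: "0 < K" "measure M (space M) \<le> K" by (auto simp: K_def add_nonneg_pos)
  define t where "t = (\<epsilon> / (2 * K)) powr (1 / r)"
  have t: "0 < t" "t powr r = \<epsilon> / (2 * K)" using \<epsilon> K r by (auto simp: t_def powr_powr)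
  have key: "modular r M (f n) \<le> t powr r * (measure M (space M) + (1 / t) powr s * modular s M (f n))" for n
  proof -
    have "modular r M (\<lambda>x. (1 / t) *\<^sub>R f n x) \<le> measure M (space M) + modular s M (\<lambda>x. (1 / t) *\<^sub>R f n x)"
      using r by (intro Lp_subset(2) Lp_scaleR f) auto
    then have "(1 / t) powr r * modular r M (f n) \<le> measure M (space M) + (1 / t) powr s * modular s M (f n)"
      unfolding modular_scaleR using t(1) by simp
    then have "t powr r * ((1 / t) powr r * modular r M (f n)) \<le> t powr r * (measure M (space M) + (1 / t) powr s * modular s M (f n))"
      by (intro mult_left_mono) auto
    moreover have "t powr r * ((1 / t) powr r * modular r M (f n)) = modular r M (f n)"
      using t(1) by (simp add: powr_divide)
    ultimately show ?thesis by simp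
  qed
  have "(\<lambda>n. t powr r * (measure M (space M) + (1 / t) powr s * modular s M (f n))) \<longlonglongrightarrow>
    t powr r * (measure M (space M) + (1 / t) powr s * 0)"
    by (intro tendsto_intros lim)
  moreover have "t powr r * (measure M (space M) + (1 / t) powr s * 0) < \<epsilon>"
  proof -
    have "t powr r * measure M (space M) \<le> \<epsilon> / (2 * K) * K" unfolding t(2) using K \<epsilon> by (intro mult_left_mono) auto
    also have "\<dots> < \<epsilon>" using K \<epsilon> by simp
    finally show ?thesis by simp
  qed
  ultimately have "\<forall>\<^sub>F n in sequentially. t powr r * (measure M (space M) + (1 / t) powr s * modular s M (f n)) < \<epsilon>"
    by (rule order_tendstoD(2))
  then show "\<forall>\<^sub>F n in sequentially. modular r M (f n) < \<epsilon>"
    by (rule eventually_mono) (rule le_less_trans[OF key])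
qed



section \<open>Test functions\<close>

lemma frechet_derivative_eqI: "(f has_derivative f') (at x) \<Longrightarrow> frechet_derivative f (at x) = f'"
  using frechet_derivative_at by metis

lemma C_k_SucI:
  assumes "\<And>x. (f has_derivative f' x) (at x)" "\<And>v. C_k n (\<lambda>x. f' x v)"
  shows "C_k (Suc n) f"
proof -
  have "frechet_derivative f (at x) = f' x" for x by (rule frechet_derivative_eqI[OF assms(1)])
  then show ?thesis using assms by (auto simp: differentiable_def)
qed

lemma C_k_SucD:
  assumes "C_k (Suc n) f"
  shows "(f has_derivative frechet_derivative f (at x)) (at x)" "C_k n (\<lambda>x. frechet_derivative f (at x) v)"
  using assms by (auto simp flip: frechet_derivative_works)

lemma C_k_mono: "C_k (Suc n) f \<Longrightarrow> C_k n f"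
proof (induction n arbitrary: f)
  case 0
  then show ?case
    by (auto intro!: differentiable_imp_continuous_on simp: differentiable_on_def intro: differentiable_at_withinI)
next
  case (Suc n)
  show ?case
    using C_k_SucD[OF Suc.prems] Suc.IH by (intro C_k_SucI) blast+
qed

lemma C_k_const [simp]: "C_k n (\<lambda>x. c)"
proof (induction n arbitrary: c)
  case (Suc n)
  then show ?case by (intro C_k_SucI[where f' = "\<lambda>x v. 0"]) auto
qed simp

lemma C_k_add: "C_k n f \<Longrightarrow> C_k n g \<Longrightarrow> C_k n (\<lambda>x. f x + g x)"
proof (induction n arbitrary: f g)
  case 0
  then show ?case by (auto intro: continuous_intros)
next
  case (Suc n)
  show ?case
    by (rule C_k_SucI[where f' = "\<lambda>x v. frechet_derivative f (at x) v + frechet_derivative g (at x) v"])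
      (use C_k_SucD[OF Suc.prems(1)] C_k_SucD[OF Suc.prems(2)] Suc.IH in \<open>auto intro: has_derivative_add\<close>)
qed

lemma C_k_mult:
  fixes f g :: "'a::real_normed_vector \<Rightarrow> real"
  shows "C_k n f \<Longrightarrow> C_k n g \<Longrightarrow> C_k n (\<lambda>x. f x * g x)"
proof (induction n arbitrary: f g)
  case 0
  then show ?case by (auto intro: continuous_intros)
next
  case (Suc n)
  show ?case
    by (rule C_k_SucI[where f' = "\<lambda>x v. f x * frechet_derivative g (at x) v + frechet_derivative f (at x) v * g x"])
      (use C_k_SucD[OF Suc.prems(1)] C_k_SucD[OF Suc.prems(2)] C_k_mono[OF Suc.prems(1)] C_k_mono[OF Suc.prems(2)] Suc.IH
        in \<open>auto intro!: has_derivative_mult C_k_add\<close>)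
qed

lemma C_k_prod:
  fixes f :: "'i \<Rightarrow> 'a::real_normed_vector \<Rightarrow> real"
  assumes "finite I" "\<And>i. i \<in> I \<Longrightarrow> C_k n (f i)"
  shows "C_k n (\<lambda>x. \<Prod>i\<in>I. f i x)"
  using assms by (induction I) (auto intro: C_k_mult)

text \<open>The family \<open>e\<^sup>-\<^sup>1\<^sup>/\<^sup>t t\<^sup>-\<^sup>j\<close> is closed under differentiation up to linear combinations, which gives
  smoothness by a single induction over all \<open>j\<close>.\<close>

definition exp_inverse :: "nat \<Rightarrow> real \<Rightarrow> real" where
  "exp_inverse j t = (if t \<le> 0 then 0 else exp (- inverse t) * inverse t ^ j)"

lemma exp_inverse_deriv:
  "(exp_inverse j has_real_derivative exp_inverse (j + 2) t - j * exp_inverse (Suc j) t) (at t)"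
proof -
  consider "t < 0" | "0 < t" | "t = 0" by linarith
  then show ?thesis
  proof cases
    case 1
    have "((\<lambda>t. 0) has_real_derivative 0) (at t)" by simp
    then have "(exp_inverse j has_real_derivative 0) (at t)"
      by (rule DERIV_cong_ev[THEN iffD1, rotated 3])
        (use 1 eventually_nhds_in_open[of "{..<0}" t] in \<open>auto simp: exp_inverse_def elim: eventually_mono\<close>)
    then show ?thesis using 1 by (simp add: exp_inverse_def)
  next
    case 2
    have "((\<lambda>t. exp (- inverse t) * inverse t ^ j) has_real_derivative
       (exp (- inverse t) * (inverse t * inverse t)) * inverse t ^ j
        + exp (- inverse t) * (j * (inverse t ^ (j - 1) * (- (inverse t * inverse t))))) (at t)"
      using 2 by (auto intro!: derivative_eq_intros simp: algebra_simps)
    also have "(exp (- inverse t) * (inverse t * inverse t)) * inverse t ^ j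
        + exp (- inverse t) * (j * (inverse t ^ (j - 1) * (- (inverse t * inverse t))))
       = exp_inverse (j + 2) t - j * exp_inverse (Suc j) t"
      using 2 by (cases j) (auto simp: exp_inverse_def algebra_simps)
    finally have "((\<lambda>t. exp (- inverse t) * inverse t ^ j) has_real_derivative
      exp_inverse (j + 2) t - j * exp_inverse (Suc j) t) (at t)" .
    then show ?thesis
      by (rule DERIV_cong_ev[THEN iffD1, rotated 3])
        (use 2 eventually_nhds_in_open[of "{0<..}" t] in \<open>auto simp: exp_inverse_def elim: eventually_mono\<close>)
  next
    case 3
    have "((\<lambda>y::real. y ^ Suc j / exp y) \<longlongrightarrow> 0) at_top" by (rule tendsto_power_div_exp_0)
    then have r: "((\<lambda>h::real. inverse h ^ Suc j / exp (inverse h)) \<longlongrightarrow> 0) (at_right 0)"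
      by (rule filterlim_compose[OF _ filterlim_inverse_at_top_right])
    have "((\<lambda>h. exp_inverse j h / h) \<longlongrightarrow> 0) (at_right 0)"
      by (rule Lim_transform_eventually[OF r])
        (auto simp: eventually_at_right_less exp_inverse_def exp_minus field_simps eventually_at_filter)
    moreover have "((\<lambda>h. exp_inverse j h / h) \<longlongrightarrow> 0) (at_left 0)"
      by (rule Lim_transform_eventually[OF tendsto_const])
        (auto simp: exp_inverse_def eventually_at_filter)
    ultimately have "((\<lambda>h. exp_inverse j h / h) \<longlongrightarrow> 0) (at 0)"
      by (simp add: filterlim_split_at)
    then show ?thesis using 3 by (simp add: has_field_derivative_iff exp_inverse_def)
  qed
qed

lemma continuous_on_exp_inverse: "continuous_on S (exp_inverse j)"
  using exp_inverse_deriv by (intro continuous_at_imp_continuous_on ballI DERIV_isCont)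

lemma C_k_exp_inverse: "C_k n (\<lambda>x::'a::euclidean_space. exp_inverse j (a \<bullet> x + c))"
proof (induction n arbitrary: j)
  case 0
  then show ?case
    by (auto intro!: continuous_intros continuous_on_compose2[OF continuous_on_exp_inverse[of UNIV]])
next
  case (Suc n)
  show ?case
  proof (rule C_k_SucI)
    fix x :: 'a
    have "((\<lambda>x. a \<bullet> x + c) has_derivative (\<lambda>v. a \<bullet> v)) (at x)"
      by (auto intro!: derivative_eq_intros)
    then show "((\<lambda>x. exp_inverse j (a \<bullet> x + c)) has_derivative
      (\<lambda>v. (a \<bullet> v) * (exp_inverse (j + 2) (a \<bullet> x + c) - j * exp_inverse (Suc j) (a \<bullet> x + c)))) (at x)"
      by (rule DERIV_compose_FDERIV[OF exp_inverse_deriv])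
  next
    fix v :: 'a
    have "C_k n (\<lambda>x. (a \<bullet> v) * (exp_inverse (j + 2) (a \<bullet> x + c) + (- real j) * exp_inverse (Suc j) (a \<bullet> x + c)))"
      by (intro C_k_mult C_k_add C_k_const Suc.IH)
    then show "C_k n (\<lambda>x. (a \<bullet> v) * (exp_inverse (j + 2) (a \<bullet> x + c) - j * exp_inverse (Suc j) (a \<bullet> x + c)))"
      by simp
  qed
qed

text \<open>The parameter \<open>m\<close> steepens the flanks: for \<open>m \<rightarrow> \<infinity>\<close> the functions tend to the indicator of the
  open box.\<close>

definition bump :: "real \<Rightarrow> 'a::euclidean_space \<Rightarrow> 'a \<Rightarrow> 'a \<Rightarrow> real" where
  "bump m a b x = (\<Prod>i\<in>Basis. exp_inverse 0 (m * ((x - a) \<bullet> i)) * exp_inverse 0 (m * ((b - x) \<bullet> i)))"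

lemma C_infinity_bump: "C_infinity (bump m a b)"
  unfolding C_infinity_def
proof
  fix n
  have 1: "m * ((x - a) \<bullet> i) = (m *\<^sub>R i) \<bullet> x + - (m * (a \<bullet> i))"
    "m * ((b - x) \<bullet> i) = ((- m) *\<^sub>R i) \<bullet> x + m * (b \<bullet> i)" for x i :: 'a
    by (auto simp: inner_diff_left algebra_simps inner_commute)
  show "C_k n (bump m a b)"
    unfolding bump_def[abs_def] 1 by (intro C_k_prod C_k_mult C_k_exp_inverse) auto
qed

lemma exp_inverse_0: "0 \<le> exp_inverse 0 t" "exp_inverse 0 t \<le> 1" "0 < exp_inverse 0 t \<longleftrightarrow> 0 < t"
  by (auto simp: exp_inverse_def)

lemma bump_bounds: "0 \<le> bump m a b x" "bump m a b x \<le> 1"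
  unfolding bump_def by (auto intro!: prod_nonneg prod_le_1 mult_nonneg_nonneg mult_le_one simp: exp_inverse_0)

lemma bump_nonzero_iff:
  assumes "0 < m"
  shows "bump m a b x \<noteq> 0 \<longleftrightarrow> x \<in> box a b"
proof -
  have *: "exp_inverse 0 t \<noteq> 0 \<longleftrightarrow> 0 < t" for t using exp_inverse_0[of t] by force
  show ?thesis using assms by (auto simp: bump_def prod_zero_iff * mem_box inner_diff_left zero_less_mult_iff)
qed

lemma bump_tendsto: "(\<lambda>n. bump (real (Suc n)) a b x) \<longlonglongrightarrow> indicator (box a b) x"
proof (cases "x \<in> box a b")
  case True
  have 1: "(\<lambda>n. exp_inverse 0 (real (Suc n) * t)) \<longlonglongrightarrow> 1" if "0 < t" for t
  proof -
    have "filterlim (\<lambda>n. real (Suc n) * t) at_top sequentially"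
      using that by (intro filterlim_at_top_mult_tendsto_pos[OF tendsto_const])
        (auto intro!: filterlim_compose[OF filterlim_real_sequentially filterlim_Suc] simp del: of_nat_Suc)
    then have "(\<lambda>n. exp (- inverse (real (Suc n) * t))) \<longlonglongrightarrow> exp (- 0)"
      by (intro tendsto_exp tendsto_minus tendsto_inverse_0_at_top)
    then show ?thesis using that by (simp add: exp_inverse_def mult_le_0_iff not_le del: of_nat_Suc)
  qed
  have "(\<lambda>n. bump (real (Suc n)) a b x) \<longlonglongrightarrow> (\<Prod>i\<in>(Basis::'a set). 1 * 1)"
    unfolding bump_def
    by (intro tendsto_prod tendsto_mult 1) (use True in \<open>auto simp: mem_box inner_diff_left\<close>)
  then show ?thesis using True by simp
next
  case False
  then have "bump (real (Suc n)) a b x = 0" for n using bump_nonzero_iff[of "real (Suc n)" a b x] by auto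
  then show ?thesis using False by simp
qed

lemma test_functionI:
  assumes "C_infinity \<phi>" "compact K" "K \<subseteq> \<Omega>" "\<And>x. x \<notin> K \<Longrightarrow> \<phi> x = 0"
  shows "test_function \<Omega> \<phi>"
proof -
  have "closure {x. \<phi> x \<noteq> 0} \<subseteq> K"
    by (rule closure_minimal) (use assms compact_imp_closed in auto)
  moreover from this have "K \<inter> closure {x. \<phi> x \<noteq> 0} = closure {x. \<phi> x \<noteq> 0}" by blast
  moreover have "compact (K \<inter> closure {x. \<phi> x \<noteq> 0})" by (rule compact_Int_closed[OF assms(2) closed_closure])
  ultimately show ?thesis using assms(1,3) unfolding test_function_def by auto
qed

lemma test_function_bump:
  assumes "0 < m" "cbox a b \<subseteq> \<Omega>"
  shows "test_function \<Omega> (bump m a b)"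
proof (rule test_functionI[OF C_infinity_bump compact_cbox assms(2)])
  show "bump m a b x = 0" if "x \<notin> cbox a b" for x
    using bump_nonzero_iff[OF assms(1), of a b x] that box_subset_cbox[of a b] by auto
qed

lemma outside_support: "x \<notin> closure {x. f x \<noteq> 0} \<Longrightarrow> f x = 0"
  using closure_subset[of "{x. f x \<noteq> 0}"] by blast

lemma test_function_lincomb:
  assumes "test_function \<Omega> \<phi>" "test_function \<Omega> \<psi>"
  shows "test_function \<Omega> (\<lambda>x. c * \<phi> x + d * \<psi> x)"
proof (rule test_functionI)
  show "C_infinity (\<lambda>x. c * \<phi> x + d * \<psi> x)"
    using assms unfolding test_function_def C_infinity_def by (auto intro!: C_k_add C_k_mult)
  show "compact (closure {x. \<phi> x \<noteq> 0} \<union> closure {x. \<psi> x \<noteq> 0})"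
    "closure {x. \<phi> x \<noteq> 0} \<union> closure {x. \<psi> x \<noteq> 0} \<subseteq> \<Omega>"
    using assms unfolding test_function_def by auto
  show "c * \<phi> x + d * \<psi> x = 0" if "x \<notin> closure {x. \<phi> x \<noteq> 0} \<union> closure {x. \<psi> x \<noteq> 0}" for x
    using that outside_support[of x \<phi>] outside_support[of x \<psi>] by simp
qed

lemma test_function_mult:
  assumes "test_function \<Omega> \<phi>" "test_function \<Omega> \<psi>"
  shows "test_function \<Omega> (\<lambda>x. \<phi> x * \<psi> x)"
proof (rule test_functionI)
  show "C_infinity (\<lambda>x. \<phi> x * \<psi> x)"
    using assms unfolding test_function_def C_infinity_def by (auto intro!: C_k_mult)
  show "compact (closure {x. \<phi> x \<noteq> 0})" "closure {x. \<phi> x \<noteq> 0} \<subseteq> \<Omega>"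
    using assms unfolding test_function_def by auto
  show "\<phi> x * \<psi> x = 0" if "x \<notin> closure {x. \<phi> x \<noteq> 0}" for x
    using that outside_support[of x \<phi>] by simp
qed

definition classical_gradient :: "('a::euclidean_space \<Rightarrow> real) \<Rightarrow> 'a \<Rightarrow> 'a" where
  "classical_gradient \<phi> x = (\<Sum>b\<in>Basis. frechet_derivative \<phi> (at x) b *\<^sub>R b)"

lemma test_function_has_derivative:
  assumes "test_function \<Omega> \<phi>"
  shows "(\<phi> has_derivative (\<lambda>v. classical_gradient \<phi> x \<bullet> v)) (at x)"
    and "frechet_derivative \<phi> (at x) v = classical_gradient \<phi> x \<bullet> v"
proof -
  have "C_k (Suc 0) \<phi>" using assms unfolding test_function_def C_infinity_def by blast
  then have d: "(\<phi> has_derivative frechet_derivative \<phi> (at x)) (at x)" by (rule C_k_SucD)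
  have l: "linear (frechet_derivative \<phi> (at x))" using d by (rule has_derivative_linear)
  have e: "frechet_derivative \<phi> (at x) v = classical_gradient \<phi> x \<bullet> v" for v
  proof -
    have "frechet_derivative \<phi> (at x) v = frechet_derivative \<phi> (at x) (\<Sum>b\<in>Basis. (v \<bullet> b) *\<^sub>R b)"
      by (simp add: euclidean_representation)
    also have "\<dots> = (\<Sum>b\<in>Basis. (v \<bullet> b) * frechet_derivative \<phi> (at x) b)"
      by (simp add: linear_sum[OF l] linear_scale[OF l])
    finally show ?thesis
      by (simp only: classical_gradient_def inner_sum_left inner_scaleR_left) (simp add: inner_commute[of v] mult.commute)
  qed
  show "frechet_derivative \<phi> (at x) v = classical_gradient \<phi> x \<bullet> v" by (rule e)
  have "frechet_derivative \<phi> (at x) = (\<lambda>v. classical_gradient \<phi> x \<bullet> v)" using e by (rule ext)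
  then show "(\<phi> has_derivative (\<lambda>v. classical_gradient \<phi> x \<bullet> v)) (at x)" using d by simp
qed

lemma test_function_continuous:
  assumes "test_function \<Omega> \<phi>"
  shows "continuous_on UNIV \<phi>" "continuous_on UNIV (classical_gradient \<phi>)"
proof -
  have "C_k (Suc 0) \<phi>" using assms unfolding test_function_def C_infinity_def by blast
  then show "continuous_on UNIV \<phi>" "continuous_on UNIV (classical_gradient \<phi>)"
    using C_k_mono[of 0 \<phi>] unfolding classical_gradient_def[abs_def] by (auto intro!: continuous_intros)
qed

lemma test_function_zero:
  assumes "test_function \<Omega> \<phi>" "x \<notin> closure {x. \<phi> x \<noteq> 0}"
  shows "\<phi> x = 0" "classical_gradient \<phi> x = 0"
proof -
  let ?K = "closure {x. \<phi> x \<noteq> 0}"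
  have z: "\<phi> y = 0" if "y \<notin> ?K" for y using that by (rule outside_support)
  show "\<phi> x = 0" by (rule z[OF assms(2)])
  have "(\<phi> has_derivative (\<lambda>v. 0)) (at x)"
  proof (rule has_derivative_transform_within_open)
    show "((\<lambda>x. 0) has_derivative (\<lambda>v. 0)) (at x)" by simp
    show "open (- ?K)" by (intro open_Compl closed_closure)
    show "x \<in> - ?K" using assms(2) by blast
    show "0 = \<phi> y" if "y \<in> - ?K" for y by (rule z[symmetric]) (use that in blast)
  qed
  from fun_cong[OF has_derivative_unique[OF test_function_has_derivative(1)[OF assms(1)] this], of "classical_gradient \<phi> x"]
  show "classical_gradient \<phi> x = 0" by simp
qed

lemma test_function_support:
  assumes "test_function \<Omega> \<phi>"
  obtains K where "compact K" "K \<subseteq> \<Omega>" "\<And>x. x \<notin> K \<Longrightarrow> \<phi> x = 0" "\<And>x. x \<notin> K \<Longrightarrow> classical_gradient \<phi> x = 0"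
proof (rule that)
  show "compact (closure {x. \<phi> x \<noteq> 0})" "closure {x. \<phi> x \<noteq> 0} \<subseteq> \<Omega>"
    using assms by (auto simp: test_function_def)
qed (rule test_function_zero[OF assms], assumption)+

lemma bounded_continuous_compact_support:
  fixes f :: "'a::euclidean_space \<Rightarrow> 'b::real_normed_vector"
  assumes "continuous_on UNIV f" "compact K" "\<And>x. x \<notin> K \<Longrightarrow> f x = 0"
  obtains B where "0 \<le> B" "\<And>x. norm (f x) \<le> B"
proof -
  have "compact (f ` K)" using assms(2) continuous_on_subset[OF assms(1)] by (intro compact_continuous_image) auto
  then have "bounded (f ` K)" by (rule compact_imp_bounded)
  then obtain B where B: "0 < B" "\<forall>y\<in>f ` K. norm y \<le> B" unfolding bounded_pos by (elim exE conjE)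
  show ?thesis
  proof (rule that)
    show "0 \<le> B" using B(1) by simp
    show "norm (f x) \<le> B" for x
    proof (cases "x \<in> K")
      case True
      then show ?thesis using B(2) by simp
    next
      case False
      then show ?thesis using assms(3)[OF False] B(1) by simp
    qed
  qed
qed

lemma Lp_continuous_compact_support:
  fixes f :: "'a::euclidean_space \<Rightarrow> 'b::euclidean_space"
  assumes "continuous_on UNIV f" "compact K" "\<And>x. x \<notin> K \<Longrightarrow> f x = 0" "0 \<le> s"
  shows "f \<in> Lp s lborel"
proof -
  obtain B where B: "\<And>x. norm (f x) \<le> B" using bounded_continuous_compact_support[OF assms(1-3)] by blast
  have m: "f \<in> borel_measurable lborel" using assms(1) by (simp add: borel_measurable_continuous_onI)
  have "integrable lborel (\<lambda>x. norm (f x) powr s)"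
  proof (rule integrableI_bounded_set[of K])
    show "AE x in lborel. x \<in> K \<longrightarrow> norm (norm (f x) powr s) \<le> B powr s"
      using B assms(4) by (auto intro!: powr_mono2)
    show "K \<in> sets lborel" using compact_imp_closed[OF assms(2)] by (simp add: borel_closed)
    show "emeasure lborel K < \<infinity>" by (rule emeasure_compact_finite[OF assms(2)])
    show "(\<lambda>x. norm (f x) powr s) \<in> borel_measurable lborel" using m by measurable
  qed (use assms(3) in auto)
  then show ?thesis using m by (simp add: Lp_def)
qed

section \<open>Translations of test functions\<close>

text \<open>Along the difference quotients of step \<open>h / n\<close>, the dominated convergence theorem applies,
  because the supports stay in a ball and the mean value theorem bounds the quotients.\<close>

lemma test_function_difference_quotient:
  fixes \<phi> :: "'a::euclidean_space \<Rightarrow> real"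
  assumes \<phi>: "test_function \<Omega> \<phi>"
  obtains B R where "\<And>n x. \<bar>real (Suc n) * (\<phi> (x + (1 / real (Suc n)) *\<^sub>R h) - \<phi> x)\<bar> \<le> B * indicator (cball 0 R) x"
    "\<And>x. (\<lambda>n. real (Suc n) * (\<phi> (x + (1 / real (Suc n)) *\<^sub>R h) - \<phi> x)) \<longlonglongrightarrow> classical_gradient \<phi> x \<bullet> h"
    "0 \<le> B"
proof -
  obtain K where K: "compact K" "K \<subseteq> \<Omega>" "\<And>x. x \<notin> K \<Longrightarrow> \<phi> x = 0" "\<And>x. x \<notin> K \<Longrightarrow> classical_gradient \<phi> x = 0"
    using test_function_support[OF \<phi>] by blast
  have c: "continuous_on UNIV (\<lambda>x. classical_gradient \<phi> x \<bullet> h)"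
    by (intro continuous_intros test_function_continuous(2)[OF \<phi>])
  have z: "classical_gradient \<phi> x \<bullet> h = 0" if "x \<notin> K" for x using K(4)[OF that] by simp
  obtain B where B: "0 \<le> B" "\<And>x. norm (classical_gradient \<phi> x \<bullet> h) \<le> B"
    using bounded_continuous_compact_support[OF c K(1) z] by blast
  obtain r where r: "\<And>x. x \<in> K \<Longrightarrow> norm x \<le> r" using compact_imp_bounded[OF K(1)] unfolding bounded_iff by blast
  have D: "((\<lambda>t. \<phi> (x + t *\<^sub>R h)) has_real_derivative classical_gradient \<phi> (x + t *\<^sub>R h) \<bullet> h) (at t)" for x t
  proof -
    have "((\<lambda>t. x + t *\<^sub>R h) has_derivative (\<lambda>t. t *\<^sub>R h)) (at t)" by (auto intro!: derivative_eq_intros)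
    then have "((\<lambda>t. \<phi> (x + t *\<^sub>R h)) has_derivative (\<lambda>s. classical_gradient \<phi> (x + t *\<^sub>R h) \<bullet> (s *\<^sub>R h))) (at t)"
      by (rule has_derivative_compose) (rule test_function_has_derivative(1)[OF \<phi>])
    moreover have "(\<lambda>s. classical_gradient \<phi> (x + t *\<^sub>R h) \<bullet> (s *\<^sub>R h)) = (*) (classical_gradient \<phi> (x + t *\<^sub>R h) \<bullet> h)"
      by (rule ext) (simp only: inner_scaleR_right mult.commute)
    ultimately show ?thesis unfolding has_field_derivative_def by simp
  qed
  show ?thesis
  proof (rule that[OF _ _ B(1), of "r + norm h"])
    fix n :: nat and x :: 'a
    let ?t = "1 / real (Suc n)"
    have t: "0 < ?t" "?t \<le> 1" by auto
    show "\<bar>real (Suc n) * (\<phi> (x + ?t *\<^sub>R h) - \<phi> x)\<bar> \<le> B * indicator (cball 0 (r + norm h)) x"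
    proof (cases "x \<in> cball 0 (r + norm h)")
      case True
      obtain z where "\<phi> (x + ?t *\<^sub>R h) - \<phi> (x + 0 *\<^sub>R h) = (?t - 0) * (classical_gradient \<phi> (x + z *\<^sub>R h) \<bullet> h)"
        using MVT2[of 0 ?t "\<lambda>t. \<phi> (x + t *\<^sub>R h)" "\<lambda>t. classical_gradient \<phi> (x + t *\<^sub>R h) \<bullet> h"] D t by blast
      then have "real (Suc n) * (\<phi> (x + ?t *\<^sub>R h) - \<phi> x) = classical_gradient \<phi> (x + z *\<^sub>R h) \<bullet> h"
        by (simp add: field_simps)
      then show ?thesis using B(2) True by simp
    next
      case False
      then have nx: "r + norm h < norm x" by simp
      have "norm (?t *\<^sub>R h) = ?t * norm h" by simp
      also have "\<dots> \<le> 1 * norm h" using t by (intro mult_right_mono) auto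
      finally have "norm (?t *\<^sub>R h) \<le> norm h" by simp
      then have "r < norm (x + ?t *\<^sub>R h)"
        using nx norm_triangle_ineq2[of x "- (?t *\<^sub>R h)"] by (simp del: norm_scaleR)
      then have "x + ?t *\<^sub>R h \<notin> K" using r by fastforce
      moreover have "x \<notin> K" using r nx norm_ge_zero[of h] by fastforce
      ultimately show ?thesis using K(3) False by simp
    qed
  next
    fix x :: 'a
    have "((\<lambda>t. (\<phi> (x + t *\<^sub>R h) - \<phi> x) / t) \<longlongrightarrow> classical_gradient \<phi> x \<bullet> h) (at 0)"
      using D[of x 0] by (simp add: has_field_derivative_iff)
    moreover have "filterlim (\<lambda>n. 1 / real (Suc n)) (at 0) sequentially"
      using LIMSEQ_inverse_real_of_nat by (auto simp: filterlim_at inverse_eq_divide)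
    ultimately have "(\<lambda>n. (\<phi> (x + (1 / real (Suc n)) *\<^sub>R h) - \<phi> x) / (1 / real (Suc n))) \<longlonglongrightarrow> classical_gradient \<phi> x \<bullet> h"
      by (rule filterlim_compose)
    then show "(\<lambda>n. real (Suc n) * (\<phi> (x + (1 / real (Suc n)) *\<^sub>R h) - \<phi> x)) \<longlonglongrightarrow> classical_gradient \<phi> x \<bullet> h"
      by (simp add: mult.commute)
  qed
qed

lemma integral_lborel_translation:
  fixes f :: "'a::euclidean_space \<Rightarrow> 'b::{banach, second_countable_topology}"
  assumes "f \<in> borel_measurable borel"
  shows "(LINT x|lborel. f (x + h)) = (LINT x|lborel. f x)"
proof -
  have "(LINT x|lborel. f x) = (LINT x|distr lborel borel ((+) h). f x)" by (simp add: lborel_distr_plus)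
  also have "\<dots> = (LINT x|lborel. f (h + x))" using assms by (intro integral_distr) auto
  finally show ?thesis by (simp add: add.commute)
qed

lemma test_function_integrable:
  assumes "test_function \<Omega> \<phi>"
  shows "integrable lborel \<phi>" "\<phi> \<in> borel_measurable borel"
    "integrable lborel (classical_gradient \<phi>)" "classical_gradient \<phi> \<in> borel_measurable borel"
proof -
  obtain K where K: "compact K" "K \<subseteq> \<Omega>" "\<And>x. x \<notin> K \<Longrightarrow> \<phi> x = 0" "\<And>x. x \<notin> K \<Longrightarrow> classical_gradient \<phi> x = 0"
    using test_function_support[OF assms] by blast
  show m: "\<phi> \<in> borel_measurable borel" "classical_gradient \<phi> \<in> borel_measurable borel"
    using test_function_continuous[OF assms] by (auto intro: borel_measurable_continuous_onI)
  have "\<phi> \<in> Lp 1 lborel" "classical_gradient \<phi> \<in> Lp 1 lborel"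
    using Lp_continuous_compact_support[of _ K 1] test_function_continuous[OF assms] K by auto
  then show "integrable lborel \<phi>" "integrable lborel (classical_gradient \<phi>)"
    using m by (auto simp: Lp_def integrable_norm_iff integrable_abs_iff)
qed

text \<open>By translation invariance, all difference quotients have integral \<open>0\<close>.\<close>

lemma integral_directional_derivative_test_function:
  assumes "test_function \<Omega> \<phi>"
  shows "(LINT x|lborel. classical_gradient \<phi> x \<bullet> h) = 0"
proof -
  obtain B R where Q: "\<And>n x. \<bar>real (Suc n) * (\<phi> (x + (1 / real (Suc n)) *\<^sub>R h) - \<phi> x)\<bar> \<le> B * indicator (cball 0 R) x"
    "\<And>x. (\<lambda>n. real (Suc n) * (\<phi> (x + (1 / real (Suc n)) *\<^sub>R h) - \<phi> x)) \<longlonglongrightarrow> classical_gradient \<phi> x \<bullet> h" "0 \<le> B"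
    using test_function_difference_quotient[OF assms, of h] by blast
  note i = test_function_integrable[OF assms]
  have it: "integrable lborel (\<lambda>x. \<phi> (x + c))" for c
  proof -
    have "integrable (distr lborel borel ((+) c)) \<phi>" using i by (simp add: lborel_distr_plus)
    then show ?thesis using integrable_distr_eq[of "(+) c" lborel borel \<phi>] i by (simp add: add.commute)
  qed
  have "(\<lambda>n. LINT x|lborel. real (Suc n) * (\<phi> (x + (1 / real (Suc n)) *\<^sub>R h) - \<phi> x)) \<longlonglongrightarrow> (LINT x|lborel. classical_gradient \<phi> x \<bullet> h)"
  proof (rule integral_dominated_convergence[where w = "\<lambda>x. B * indicator (cball 0 R) x"])
    show "integrable lborel (\<lambda>x. B * indicator (cball 0 R) x :: real)"
      by (intro integrable_mult_right integrable_real_indicator emeasure_compact_finite compact_cball) auto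
    show "(\<lambda>x. real (Suc n) * (\<phi> (x + (1 / real (Suc n)) *\<^sub>R h) - \<phi> x)) \<in> borel_measurable lborel" for n
      using it[of "(1 / real (Suc n)) *\<^sub>R h"] i by (auto intro: borel_measurable_integrable simp del: of_nat_Suc)
  qed (use Q i in auto)
  moreover have "(LINT x|lborel. real (Suc n) * (\<phi> (x + (1 / real (Suc n)) *\<^sub>R h) - \<phi> x)) = 0" for n
    using it[of "(1 / real (Suc n)) *\<^sub>R h"] i integral_lborel_translation[of \<phi>] by (simp del: of_nat_Suc)
  ultimately show ?thesis by (simp add: LIMSEQ_const_iff)
qed

text \<open>Telescoping a translation by \<open>h\<close> into \<open>n\<close> translations by \<open>h / n\<close> bounds the increment by the
  difference quotient of step \<open>h / n\<close>; the limit \<open>n \<rightarrow> \<infinity>\<close> gives the directional derivative.\<close>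

lemma translation_estimate:
  assumes \<phi>: "test_function \<Omega> \<phi>" and s: "1 \<le> s"
  shows "modular s lborel (\<lambda>x. \<phi> (x + h) - \<phi> x) \<le> norm h powr s * modular s lborel (classical_gradient \<phi>)"
proof -
  obtain B R where Q: "\<And>n x. \<bar>real (Suc n) * (\<phi> (x + (1 / real (Suc n)) *\<^sub>R h) - \<phi> x)\<bar> \<le> B * indicator (cball 0 R) x"
    "\<And>x. (\<lambda>n. real (Suc n) * (\<phi> (x + (1 / real (Suc n)) *\<^sub>R h) - \<phi> x)) \<longlonglongrightarrow> classical_gradient \<phi> x \<bullet> h" "0 \<le> B"
    using test_function_difference_quotient[OF \<phi>, of h] by blast
  note i = test_function_integrable[OF \<phi>]
  obtain K where K: "compact K" "K \<subseteq> \<Omega>" "\<And>x. x \<notin> K \<Longrightarrow> \<phi> x = 0" "\<And>x. x \<notin> K \<Longrightarrow> classical_gradient \<phi> x = 0"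
    using test_function_support[OF \<phi>] by blast
  have L: "\<phi> \<in> Lp s lborel" "classical_gradient \<phi> \<in> Lp s lborel"
    using Lp_continuous_compact_support[of _ K s] test_function_continuous[OF \<phi>] K s by auto
  have m: "(\<lambda>x. \<phi> (x + c)) \<in> borel_measurable borel" for c
    using i(2) by (rule measurable_compose_rev) auto
  have Lt: "(\<lambda>x. \<phi> (x + c)) \<in> Lp s lborel" for c
  proof -
    have "integrable (distr lborel borel ((+) c)) (\<lambda>x. norm (\<phi> x) powr s)" using LpD(2)[OF L(1)] by (simp add: lborel_distr_plus)
    then have "integrable lborel (\<lambda>x. norm (\<phi> (x + c)) powr s)"
      using integrable_distr_eq[of "(+) c" lborel borel "\<lambda>x. norm (\<phi> x) powr s"] i by (simp add: add.commute)
    then show ?thesis using m by (simp add: Lp_def)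
  qed
  have trans: "modular s lborel (\<lambda>x. \<phi> (x + c + d) - \<phi> (x + c)) = modular s lborel (\<lambda>x. \<phi> (x + d) - \<phi> x)" for c d
    unfolding modular_def
    using integral_lborel_translation[of "\<lambda>x. norm (\<phi> (x + d) - \<phi> x) powr s" c] m i by auto
  have tel: "modular s lborel (\<lambda>x. \<phi> (x + real n *\<^sub>R d) - \<phi> x) powr (1 / s)
      \<le> real n * modular s lborel (\<lambda>x. \<phi> (x + d) - \<phi> x) powr (1 / s)" for n d
  proof (induction n)
    case 0
    then show ?case by (simp add: modular_def)
  next
    case (Suc n)
    have e: "x + real n *\<^sub>R d + d = x + real (Suc n) *\<^sub>R d" for x by (simp add: algebra_simps)
    have "modular s lborel (\<lambda>x. \<phi> (x + real (Suc n) *\<^sub>R d) - \<phi> x) powr (1 / s)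
      = modular s lborel (\<lambda>x. (\<phi> (x + real n *\<^sub>R d + d) - \<phi> (x + real n *\<^sub>R d)) + (\<phi> (x + real n *\<^sub>R d) - \<phi> x)) powr (1 / s)"
      unfolding e by simp
    also have "\<dots> \<le> modular s lborel (\<lambda>x. \<phi> (x + real n *\<^sub>R d + d) - \<phi> (x + real n *\<^sub>R d)) powr (1 / s)
      + modular s lborel (\<lambda>x. \<phi> (x + real n *\<^sub>R d) - \<phi> x) powr (1 / s)"
      unfolding e using s by (intro modular_triangle Lp_diff Lt L) auto
    also have "\<dots> \<le> modular s lborel (\<lambda>x. \<phi> (x + d) - \<phi> x) powr (1 / s)
      + real n * modular s lborel (\<lambda>x. \<phi> (x + d) - \<phi> x) powr (1 / s)"
      using Suc by (simp add: trans)
    finally show ?case by (simp add: algebra_simps)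
  qed
  have step: "modular s lborel (\<lambda>x. \<phi> (x + h) - \<phi> x)
    \<le> modular s lborel (\<lambda>x. real (Suc n) * (\<phi> (x + (1 / real (Suc n)) *\<^sub>R h) - \<phi> x))" for n
  proof -
    let ?A = "modular s lborel (\<lambda>x. \<phi> (x + h) - \<phi> x)"
    let ?D = "modular s lborel (\<lambda>x. \<phi> (x + (1 / real (Suc n)) *\<^sub>R h) - \<phi> x)"
    have "?A powr (1 / s) \<le> real (Suc n) * ?D powr (1 / s)"
      using tel[of "Suc n" "(1 / real (Suc n)) *\<^sub>R h"] by simp
    then have "(?A powr (1 / s)) powr s \<le> (real (Suc n) * ?D powr (1 / s)) powr s"
      using s by (intro powr_mono2) auto
    then show ?thesis using s by (simp add: modular_mult powr_mult powr_powr del: of_nat_Suc)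
  qed
  have "(\<lambda>n. modular s lborel (\<lambda>x. real (Suc n) * (\<phi> (x + (1 / real (Suc n)) *\<^sub>R h) - \<phi> x)))
    \<longlonglongrightarrow> modular s lborel (\<lambda>x. classical_gradient \<phi> x \<bullet> h)"
    unfolding modular_def
  proof (rule integral_dominated_convergence[where w = "\<lambda>x. B powr s * indicator (cball 0 R) x"])
    show "integrable lborel (\<lambda>x. B powr s * indicator (cball 0 R) x :: real)"
      by (intro integrable_mult_right integrable_real_indicator emeasure_compact_finite compact_cball) auto
    show "(\<lambda>x. norm (real (Suc n) * (\<phi> (x + (1 / real (Suc n)) *\<^sub>R h) - \<phi> x)) powr s) \<in> borel_measurable lborel" for n
      using m i by (auto simp del: of_nat_Suc)
    show "(\<lambda>x. norm (classical_gradient \<phi> x \<bullet> h) powr s) \<in> borel_measurable lborel" using i by auto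
    show "AE x in lborel. norm (norm (real (Suc n) * (\<phi> (x + (1 / real (Suc n)) *\<^sub>R h) - \<phi> x)) powr s) \<le> B powr s * indicator (cball 0 R) x" for n
    proof (rule AE_I2)
      fix x :: 'a
      have "\<bar>real (Suc n) * (\<phi> (x + (1 / real (Suc n)) *\<^sub>R h) - \<phi> x)\<bar> powr s \<le> (B * indicator (cball 0 R) x) powr s"
        using s Q(1) by (intro powr_mono2) auto
      also have "\<dots> = B powr s * indicator (cball 0 R) x" using s by (simp add: indicator_def)
      finally show "norm (norm (real (Suc n) * (\<phi> (x + (1 / real (Suc n)) *\<^sub>R h) - \<phi> x)) powr s) \<le> B powr s * indicator (cball 0 R) x"
        by simp
    qed
    show "AE x in lborel. (\<lambda>n. norm (real (Suc n) * (\<phi> (x + (1 / real (Suc n)) *\<^sub>R h) - \<phi> x)) powr s) \<longlonglongrightarrow> norm (classical_gradient \<phi> x \<bullet> h) powr s"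
      using s by (intro AE_I2 tendsto_powr' tendsto_norm Q(2) tendsto_const) auto
  qed
  then have "modular s lborel (\<lambda>x. \<phi> (x + h) - \<phi> x) \<le> modular s lborel (\<lambda>x. classical_gradient \<phi> x \<bullet> h)"
    by (rule LIMSEQ_le_const) (use step in blast)
  also have "\<dots> \<le> modular s lborel (\<lambda>x. norm h *\<^sub>R classical_gradient \<phi> x)"
    using i s by (intro modular_mono Lp_scaleR L AE_I2) (auto simp: Cauchy_Schwarz_ineq2 mult.commute[of "norm h"])
  also have "\<dots> = norm h powr s * modular s lborel (classical_gradient \<phi>)"
    by (simp only: modular_scaleR) simp
  finally show ?thesis .
qed



section \<open>Weak gradients\<close>

text \<open>Lebesgue's differentiation theorem recovers a function from its means over small boxes.\<close>

lemma AE_zero_of_box_integrals: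
  fixes f :: "'a::euclidean_space \<Rightarrow> real"
  assumes f: "integrable lebesgue f"
    and z: "\<And>a b. (LINT x:cbox a b|lebesgue. f x) = 0"
  shows "AE x in lebesgue. f x = 0"
proof -
  have si: "set_integrable lebesgue (cbox a b) f" for a b
    unfolding set_integrable_def by (rule integrable_mult_indicator[OF _ f]) simp
  have "f integrable_on cbox a b" for a b using set_lebesgue_integral_eq_integral(1)[OF si] .
  then obtain N where N: "negligible N"
    "\<And>x e. x \<notin> N \<Longrightarrow> 0 < e \<Longrightarrow> \<exists>d>0. \<forall>h. 0 < h \<and> h < d \<longrightarrow>
        norm (integral (cbox x (x + h *\<^sub>R One)) f /\<^sub>R h ^ DIM('a) - f x) < e"
    using integrable_ccontinuous_explicit[of f] by metis
  have z': "integral (cbox a b) f = 0" for a b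
    using set_lebesgue_integral_eq_integral(2)[OF si] z by metis
  have "f x = 0" if xN: "x \<notin> N" for x
  proof (rule ccontr)
    assume "f x \<noteq> 0"
    then obtain d where "d > 0" "\<forall>h. 0 < h \<and> h < d \<longrightarrow>
        norm (integral (cbox x (x + h *\<^sub>R One)) f /\<^sub>R h ^ DIM('a) - f x) < norm (f x)"
      using N(2)[OF xN, of "norm (f x)"] by auto
    then show False using z' by (auto dest!: spec[of _ "d / 2"])
  qed
  moreover have "AE x in lebesgue. x \<notin> N" using N(1) by (simp add: negligible_iff_null_sets AE_not_in)
  ultimately show ?thesis by (auto elim: eventually_mono)
qed

lemma integral_lebesgue_on_zero_outside:
  fixes f :: "'a::euclidean_space \<Rightarrow> 'b::euclidean_space"
  assumes "open \<Omega>" "\<And>x. x \<notin> \<Omega> \<Longrightarrow> f x = 0"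
  shows "(LINT x|lebesgue_on \<Omega>. f x) = (LINT x|lebesgue. f x)"
    "integrable (lebesgue_on \<Omega>) f \<longleftrightarrow> integrable lebesgue f"
proof -
  have S: "\<Omega> \<inter> space lebesgue \<in> sets lebesgue" using assms(1) by (simp add: borel_open)
  have e: "(\<lambda>x. indicator \<Omega> x *\<^sub>R f x) = f" using assms(2) by (auto simp: indicator_def)
  show "(LINT x|lebesgue_on \<Omega>. f x) = (LINT x|lebesgue. f x)"
    using integral_restrict_space[OF S, of f] e by simp
  show "integrable (lebesgue_on \<Omega>) f \<longleftrightarrow> integrable lebesgue f"
    using integrable_restrict_space[OF S, of f] e by simp
qed

lemma lebesgue_measurable_borel: "f \<in> borel_measurable borel \<Longrightarrow> f \<in> borel_measurable lebesgue"
  by (rule measurable_completion) simp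

text \<open>The fundamental lemma of the calculus of variations: the functions \<^term>\<open>bump m a b\<close>
  increase to the indicator function of the box as \<open>m \<rightarrow> \<infinity>\<close>.\<close>

lemma fundamental_lemma:
  fixes g :: "'a::euclidean_space \<Rightarrow> real"
  assumes op: "open \<Omega>" and g: "locally_integrable \<Omega> g"
    and z: "\<And>\<phi>. test_function \<Omega> \<phi> \<Longrightarrow> (LINT x|lebesgue_on \<Omega>. g x * \<phi> x) = 0"
  shows "AE x in lebesgue_on \<Omega>. g x = 0"
proof -
  have int: "integrable lebesgue (\<lambda>x. indicator (cbox a b) x * g x)" if "cbox a b \<subseteq> \<Omega>" for a b
    using g that unfolding locally_integrable_def set_integrable_def by auto
  have box0: "(LINT x|lebesgue. indicator (cbox a b) x * g x) = 0" if ab: "cbox a b \<subseteq> \<Omega>" for a b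
  proof -
    have bz: "bump m a b x = 0" if "0 < m" "x \<notin> cbox a b" for m x
      using bump_nonzero_iff[OF that(1), of a b x] that(2) box_subset_cbox[of a b] by blast
    have be: "bump (real (Suc n)) a b x * g x = bump (real (Suc n)) a b x * (indicator (cbox a b) x * g x)" for n x
      using bz[of "real (Suc n)" x] by (cases "x \<in> cbox a b") auto
    have bm: "bump (real (Suc n)) a b \<in> borel_measurable lebesgue" for n
      by (rule lebesgue_measurable_borel[OF test_function_integrable(2)[OF test_function_bump[OF _ ab]]]) simp
    have mi: "(\<lambda>x. indicator (cbox a b) x * g x) \<in> borel_measurable lebesgue"
      by (rule borel_measurable_integrable[OF int[OF ab]])
    have lim: "(\<lambda>n. LINT x|lebesgue. bump (real (Suc n)) a b x * g x) \<longlonglongrightarrow> (LINT x|lebesgue. indicator (box a b) x * (indicator (cbox a b) x * g x))"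
      unfolding be
    proof (rule integral_dominated_convergence[where w = "\<lambda>x. norm (indicator (cbox a b) x * g x)"])
      show "(\<lambda>x. indicator (box a b) x * (indicator (cbox a b) x * g x)) \<in> borel_measurable lebesgue"
        by (intro borel_measurable_times borel_measurable_indicator mi) simp
      show "(\<lambda>x. bump (real (Suc n)) a b x * (indicator (cbox a b) x * g x)) \<in> borel_measurable lebesgue" for n
        by (intro borel_measurable_times bm mi)
      show "integrable lebesgue (\<lambda>x. norm (indicator (cbox a b) x * g x))" using int[OF ab] by (rule integrable_norm)
      show "AE x in lebesgue. (\<lambda>n. bump (real (Suc n)) a b x * (indicator (cbox a b) x * g x)) \<longlonglongrightarrow> indicator (box a b) x * (indicator (cbox a b) x * g x)"
        by (intro AE_I2 tendsto_mult bump_tendsto tendsto_const)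
      show "AE x in lebesgue. norm (bump (real (Suc n)) a b x * (indicator (cbox a b) x * g x)) \<le> norm (indicator (cbox a b) x * g x)" for n
        using bump_bounds[of "real (Suc n)" a b] by (intro AE_I2) (auto simp: abs_mult simp del: of_nat_Suc intro!: mult_left_le_one_le)
    qed
    have "(LINT x|lebesgue. bump (real (Suc n)) a b x * g x) = 0" for n
    proof -
      have "(LINT x|lebesgue_on \<Omega>. g x * bump (real (Suc n)) a b x) = (LINT x|lebesgue. g x * bump (real (Suc n)) a b x)"
        by (rule integral_lebesgue_on_zero_outside[OF op]) (use bz[of "real (Suc n)"] ab in auto)
      then show ?thesis using z[OF test_function_bump[OF _ ab], of "real (Suc n)"] by (simp add: mult.commute)
    qed
    then have "(LINT x|lebesgue. indicator (box a b) x * (indicator (cbox a b) x * g x)) = 0"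
      using lim by (simp add: LIMSEQ_const_iff)
    moreover have "AE x in lebesgue. indicator (box a b) x * (indicator (cbox a b) x * g x) = indicator (cbox a b) x * g x"
    proof -
      have "AE x in lebesgue. x \<notin> cbox a b - box a b"
        by (rule AE_not_in) (use negligible_frontier_interval negligible_iff_null_sets in blast)
      then show ?thesis by eventually_elim (auto simp: indicator_def)
    qed
    then have "(LINT x|lebesgue. indicator (box a b) x * (indicator (cbox a b) x * g x)) = (LINT x|lebesgue. indicator (cbox a b) x * g x)"
      by (intro integral_cong_AE mi borel_measurable_times borel_measurable_indicator) auto
    ultimately show ?thesis by simp
  qed
  obtain \<D> where D: "countable \<D>" "\<D> \<subseteq> Pow \<Omega>" "\<And>X. X \<in> \<D> \<Longrightarrow> \<exists>a b. X = cbox a b" "\<Union>\<D> = \<Omega>"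
    using open_countable_Union_open_cbox[OF op] by metis
  have "AE x in lebesgue. x \<in> X \<longrightarrow> g x = 0" if X: "X \<in> \<D>" for X
  proof -
    obtain c d where cd: "X = cbox c d" "cbox c d \<subseteq> \<Omega>" using D X by blast
    have "AE x in lebesgue. indicator (cbox c d) x * g x = 0"
    proof (rule AE_zero_of_box_integrals[OF int[OF cd(2)]])
      fix a b :: 'a
      obtain e f where ef: "cbox a b \<inter> cbox c d = cbox e f" using Int_interval[of a b c d] by blast
      have "(LINT x:cbox a b|lebesgue. indicator (cbox c d) x * g x) = (LINT x|lebesgue. indicator (cbox e f) x * g x)"
        unfolding set_lebesgue_integral_def ef[symmetric]
        by (intro Bochner_Integration.integral_cong) (auto simp: indicator_def)
      also have "\<dots> = 0" by (rule box0) (use ef cd(2) in blast)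
      finally show "(LINT x:cbox a b|lebesgue. indicator (cbox c d) x * g x) = 0" .
    qed
    then show ?thesis by eventually_elim (auto simp: cd(1) indicator_def)
  qed
  then have "AE x in lebesgue. \<forall>X\<in>\<D>. x \<in> X \<longrightarrow> g x = 0" by (rule AE_ball_countable'[OF _ D(1)])
  then have "AE x in lebesgue. x \<in> \<Omega> \<longrightarrow> g x = 0" by eventually_elim (use D(4) in blast)
  then show ?thesis using op by (subst AE_restrict_space_iff) (auto simp: borel_open)
qed

lemma locally_integrable_mult_integrable:
  fixes f :: "'a::euclidean_space \<Rightarrow> real"
  assumes op: "open \<Omega>" and f: "locally_integrable \<Omega> f" and c: "continuous_on UNIV \<psi>"
    and K: "compact K" "K \<subseteq> \<Omega>" "\<And>x. x \<notin> K \<Longrightarrow> \<psi> x = 0"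
  shows "integrable (lebesgue_on \<Omega>) (\<lambda>x. f x * \<psi> x)"
proof -
  obtain B where B: "\<And>x. norm (\<psi> x) \<le> B" using bounded_continuous_compact_support[OF c K(1,3)] by blast
  have i: "integrable lebesgue (\<lambda>x. indicator K x *\<^sub>R f x)"
    using f K unfolding locally_integrable_def set_integrable_def by blast
  have "integrable lebesgue (\<lambda>x. (indicator K x *\<^sub>R f x) * \<psi> x)"
  proof (rule Bochner_Integration.integrable_bound)
    show "integrable lebesgue (\<lambda>x. B * norm (indicator K x *\<^sub>R f x))" using i by (intro integrable_mult_right integrable_norm)
    show "(\<lambda>x. (indicator K x *\<^sub>R f x) * \<psi> x) \<in> borel_measurable lebesgue"
      by (intro borel_measurable_times borel_measurable_integrable[OF i] lebesgue_measurable_borel borel_measurable_continuous_onI c)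
    show "AE x in lebesgue. norm ((indicator K x *\<^sub>R f x) * \<psi> x) \<le> norm (B * norm (indicator K x *\<^sub>R f x))"
    proof (rule AE_I2)
      fix x
      have "norm ((indicator K x *\<^sub>R f x) * \<psi> x) \<le> norm (indicator K x *\<^sub>R f x) * B"
        unfolding norm_mult by (intro mult_left_mono B) auto
      then show "norm ((indicator K x *\<^sub>R f x) * \<psi> x) \<le> norm (B * norm (indicator K x *\<^sub>R f x))"
        by (simp add: mult.commute)
    qed
  qed
  moreover have "(\<lambda>x. (indicator K x *\<^sub>R f x) * \<psi> x) = (\<lambda>x. f x * \<psi> x)"
  proof
    show "(indicator K x *\<^sub>R f x) * \<psi> x = f x * \<psi> x" for x using K(3)[of x] by (cases "x \<in> K") auto
  qed
  ultimately have "integrable lebesgue (\<lambda>x. f x * \<psi> x)" by simp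
  moreover have "f x * \<psi> x = 0" if "x \<notin> \<Omega>" for x using K(3)[of x] K(2) that by auto
  ultimately show ?thesis
    using integral_lebesgue_on_zero_outside(2)[OF op, of "\<lambda>x. f x * \<psi> x"] by blast
qed

lemma locally_integrable_inner:
  "locally_integrable \<Omega> G \<Longrightarrow> locally_integrable \<Omega> (\<lambda>x. G x \<bullet> b)"
  unfolding locally_integrable_def set_integrable_def
proof (intro allI impI)
  fix K assume A: "\<forall>K. compact K \<and> K \<subseteq> \<Omega> \<longrightarrow> integrable lebesgue (\<lambda>x. indicat_real K x *\<^sub>R G x)" "compact K \<and> K \<subseteq> \<Omega>"
  then have "integrable lebesgue (\<lambda>x. (indicat_real K x *\<^sub>R G x) \<bullet> b)" by (intro integrable_inner_left) auto
  then show "integrable lebesgue (\<lambda>x. indicat_real K x *\<^sub>R (G x \<bullet> b))" by simp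
qed

lemma locally_integrable_diff:
  "locally_integrable \<Omega> f \<Longrightarrow> locally_integrable \<Omega> g \<Longrightarrow> locally_integrable \<Omega> (\<lambda>x. f x - g x)"
  unfolding locally_integrable_def by (auto intro: set_integral_diff)

text \<open>Two weak gradients have the same integrals against test functions, so that the fundamental
  lemma applies to each component of their difference.\<close>

lemma weak_gradient_unique:
  fixes G H :: "'a::euclidean_space \<Rightarrow> 'a"
  assumes op: "open \<Omega>" and G: "has_weak_gradient \<Omega> u G" and H: "has_weak_gradient \<Omega> u H"
  shows "AE x in lebesgue_on \<Omega>. G x = H x"
proof -
  have lG: "locally_integrable \<Omega> G" and lH: "locally_integrable \<Omega> H"
    using G H unfolding has_weak_gradient_def by auto
  have "AE x in lebesgue_on \<Omega>. (G x - H x) \<bullet> b = 0" if b: "b \<in> Basis" for b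
  proof (rule fundamental_lemma[OF op locally_integrable_inner[OF locally_integrable_diff[OF lG lH]]])
    fix \<phi> :: "'a \<Rightarrow> real" assume \<phi>: "test_function \<Omega> \<phi>"
    obtain K where K: "compact K" "K \<subseteq> \<Omega>" "\<And>x. x \<notin> K \<Longrightarrow> \<phi> x = 0" "\<And>x. x \<notin> K \<Longrightarrow> classical_gradient \<phi> x = 0"
      using test_function_support[OF \<phi>] by blast
    have i: "integrable (lebesgue_on \<Omega>) (\<lambda>x. (F x \<bullet> b) * \<phi> x)" if "locally_integrable \<Omega> F" for F :: "'a \<Rightarrow> 'a"
      by (rule locally_integrable_mult_integrable[OF op locally_integrable_inner[OF that] test_function_continuous(1)[OF \<phi>] K(1,2,3)])
    have "(LINT x|lebesgue_on \<Omega>. (G x \<bullet> b) * \<phi> x) = (LINT x|lebesgue_on \<Omega>. (H x \<bullet> b) * \<phi> x)"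
    proof -
      have "- (LINT x|lebesgue_on \<Omega>. (F x \<bullet> b) * \<phi> x) = (LINT x|lebesgue_on \<Omega>. u x * frechet_derivative \<phi> (at x) b)"
        if "has_weak_gradient \<Omega> u F" for F
        using that \<phi> b unfolding has_weak_gradient_def by simp
      from this[OF G] this[OF H] show ?thesis by linarith
    qed
    then show "(LINT x|lebesgue_on \<Omega>. (G x - H x) \<bullet> b * \<phi> x) = 0"
      using i[OF lG] i[OF lH] by (simp add: inner_diff_left left_diff_distrib)
  qed
  then have "AE x in lebesgue_on \<Omega>. \<forall>b\<in>Basis. (G x - H x) \<bullet> b = 0"
    by (intro AE_finite_allI) auto
  then show ?thesis
  proof eventually_elim
    case (elim x)
    have "G x - H x = 0" by (rule euclidean_eqI) (use elim in simp)
    then show ?case by simp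
  qed
qed

text \<open>An open set is a countable union of boxes, on each of which the function is integrable. This
  provides the measurability of weak gradients, which are chosen as merely locally integrable.\<close>

lemma locally_integrable_measurable:
  fixes f :: "'a::euclidean_space \<Rightarrow> 'b::euclidean_space"
  assumes op: "open \<Omega>" and f: "locally_integrable \<Omega> f"
  shows "f \<in> borel_measurable (lebesgue_on \<Omega>)"
proof -
  obtain \<D> where D: "countable \<D>" "\<D> \<subseteq> Pow \<Omega>" "\<And>X. X \<in> \<D> \<Longrightarrow> \<exists>a b. X = cbox a b" "\<Union>\<D> = \<Omega>"
    using open_countable_Union_open_cbox[OF op] by metis
  have S: "\<Omega> \<in> sets lebesgue" using op by (simp add: borel_open)
  show ?thesis
  proof (rule measurable_piecewise_restrict[OF D(1)])
    fix X assume X: "X \<in> \<D>"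
    then obtain a b where ab: "X = cbox a b" "cbox a b \<subseteq> \<Omega>" using D by blast
    have Xs: "X \<inter> space (lebesgue_on \<Omega>) \<in> sets (lebesgue_on \<Omega>)"
      using ab S by (auto simp: sets_restrict_space image_iff intro!: bexI[of _ "cbox a b"])
    then show "X \<inter> space (lebesgue_on \<Omega>) \<in> sets (lebesgue_on \<Omega>)" .
    have "(\<lambda>x. indicator X x *\<^sub>R f x) \<in> borel_measurable lebesgue"
      using f ab unfolding locally_integrable_def set_integrable_def by (intro borel_measurable_integrable) auto
    then have "(\<lambda>x. indicator X x *\<^sub>R f x) \<in> borel_measurable (lebesgue_on \<Omega>)"
      by (rule measurable_restrict_space1)
    then show "f \<in> borel_measurable (restrict_space (lebesgue_on \<Omega>) X)"
      by (subst borel_measurable_restrict_space_iff[OF Xs])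
  qed (use D(4) in auto)
qed

section \<open>First-order Sobolev spaces on a bounded open set\<close>

locale bounded_open =
  fixes \<Omega> :: "'a::euclidean_space set" and q :: real
  assumes open_domain: "open \<Omega>" and bounded_domain: "bounded \<Omega>" and q_gt_1: "1 < q"
begin

abbreviation M :: "'a measure" where "M \<equiv> lebesgue_on \<Omega>"
abbreviation grad :: "('a \<Rightarrow> real) \<Rightarrow> 'a \<Rightarrow> 'a" where "grad \<equiv> weak_gradient \<Omega>"
abbreviation W :: "('a \<Rightarrow> real) set" where "W \<equiv> W10_space q \<Omega>"

lemma L_space_eq: "L_space s \<Omega> = Lp s M"
  by (simp add: L_space_def Lp_def)

sublocale fm: finite_measure M
  by (rule finite_measure_lebesgue_on[OF lmeasurable_open[OF bounded_domain open_domain]])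

lemma domain_sets: "\<Omega> \<in> sets lebesgue"
  using open_domain by (simp add: borel_open)

lemma q_ge: "1 \<le> q" "0 \<le> q" "0 < q"
  using q_gt_1 by auto

lemma continuous_measurable: "continuous_on UNIV f \<Longrightarrow> f \<in> borel_measurable M"
  by (intro measurable_restrict_space1 lebesgue_measurable_borel borel_measurable_continuous_onI)

lemma modular_lborel:
  fixes f :: "'a \<Rightarrow> 'b::euclidean_space"
  assumes "f \<in> borel_measurable borel" "\<And>x. x \<notin> \<Omega> \<Longrightarrow> f x = 0"
  shows "modular s M f = modular s lborel f" "f \<in> Lp s M \<longleftrightarrow> f \<in> Lp s lborel"
proof -
  have m: "(\<lambda>x. norm (f x) powr s) \<in> borel_measurable lborel" using assms(1) by measurable
  have z: "norm (f x) powr s = 0" if "x \<notin> \<Omega>" for x using assms(2)[OF that] by simp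
  show "modular s M f = modular s lborel f"
    using integral_lebesgue_on_zero_outside(1)[OF open_domain, of "\<lambda>x. norm (f x) powr s"] z integral_completion[OF m]
    unfolding modular_def by simp
  have "f \<in> borel_measurable M" by (intro measurable_restrict_space1 lebesgue_measurable_borel assms(1))
  then show "f \<in> Lp s M \<longleftrightarrow> f \<in> Lp s lborel"
    using assms(1) integral_lebesgue_on_zero_outside(2)[OF open_domain, of "\<lambda>x. norm (f x) powr s"] z integrable_completion[OF m]
    by (simp add: Lp_def)
qed

lemma test_function_outside:
  assumes "test_function \<Omega> \<phi>" "x \<notin> \<Omega>"
  shows "\<phi> x = 0" "classical_gradient \<phi> x = 0"
  using test_function_zero[OF assms(1), of x] assms unfolding test_function_def by blast+

lemma test_function_Lp:
  assumes \<phi>: "test_function \<Omega> \<phi>" and s: "0 \<le> s"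
  shows "\<phi> \<in> Lp s M" "classical_gradient \<phi> \<in> Lp s M"
proof -
  obtain K where K: "compact K" "K \<subseteq> \<Omega>" "\<And>x. x \<notin> K \<Longrightarrow> \<phi> x = 0" "\<And>x. x \<notin> K \<Longrightarrow> classical_gradient \<phi> x = 0"
    using test_function_support[OF \<phi>] by blast
  have "\<phi> \<in> Lp s lborel" by (rule Lp_continuous_compact_support[OF test_function_continuous(1)[OF \<phi>] K(1,3) s])
  then show "\<phi> \<in> Lp s M"
    using modular_lborel(2)[OF test_function_integrable(2)[OF \<phi>] test_function_outside(1)[OF \<phi>]] by blast
  have "classical_gradient \<phi> \<in> Lp s lborel" by (rule Lp_continuous_compact_support[OF test_function_continuous(2)[OF \<phi>] K(1,4) s])
  then show "classical_gradient \<phi> \<in> Lp s M"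
    using modular_lborel(2)[OF test_function_integrable(4)[OF \<phi>] test_function_outside(2)[OF \<phi>]] by blast
qed

lemma Lp_locally_integrable:
  fixes f :: "'a \<Rightarrow> 'b::euclidean_space"
  assumes "f \<in> Lp q M"
  shows "locally_integrable \<Omega> f"
  unfolding locally_integrable_def set_integrable_def
proof (intro allI impI)
  fix K assume K: "compact K \<and> K \<subseteq> \<Omega>"
  have "integrable M f" using fm.Lp_integrable[OF q_ge(1) assms] .
  then have "integrable lebesgue (\<lambda>x. indicator \<Omega> x *\<^sub>R f x)"
    using integrable_restrict_space[of \<Omega> lebesgue f] domain_sets by simp
  then have "integrable lebesgue (\<lambda>x. indicator K x *\<^sub>R (indicator \<Omega> x *\<^sub>R f x))"
    by (rule integrable_mult_indicator[rotated]) (use K in \<open>auto intro: fmeasurableD lmeasurable_compact\<close>)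
  moreover have "(\<lambda>x. indicator K x *\<^sub>R (indicator \<Omega> x *\<^sub>R f x)) = (\<lambda>x. indicator K x *\<^sub>R f x)"
  proof
    show "indicator K x *\<^sub>R (indicator \<Omega> x *\<^sub>R f x) = indicator K x *\<^sub>R f x" for x
      using K by (cases "x \<in> K") auto
  qed
  ultimately show "integrable lebesgue (\<lambda>x. indicator K x *\<^sub>R f x)" by simp
qed

lemma Lp_times_continuous_integrable:
  fixes f :: "'a \<Rightarrow> real"
  assumes f: "f \<in> Lp q M" and c: "continuous_on UNIV \<psi>" and B: "\<And>x. norm (\<psi> x) \<le> B"
  shows "integrable M (\<lambda>x. f x * \<psi> x)"
proof (rule Bochner_Integration.integrable_bound)
  show "integrable M (\<lambda>x. B * norm (f x))"
    using fm.Lp_integrable[OF q_ge(1) f] by (intro integrable_mult_right integrable_norm)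
  show "(\<lambda>x. f x * \<psi> x) \<in> borel_measurable M"
    by (intro borel_measurable_times LpD(1)[OF f] continuous_measurable c)
  show "AE x in M. norm (f x * \<psi> x) \<le> norm (B * norm (f x))"
  proof (rule AE_I2)
    fix x
    have "norm (f x * \<psi> x) \<le> norm (f x) * B" unfolding norm_mult by (intro mult_left_mono B) auto
    then show "norm (f x * \<psi> x) \<le> norm (B * norm (f x))" by (simp add: mult.commute)
  qed
qed

lemma has_weak_gradientI:
  assumes "u \<in> Lp q M" "G \<in> Lp q M"
    "\<And>\<phi> b. test_function \<Omega> \<phi> \<Longrightarrow> b \<in> Basis \<Longrightarrow>
      (LINT x|M. u x * (classical_gradient \<phi> x \<bullet> b)) = - (LINT x|M. (G x \<bullet> b) * \<phi> x)"
  shows "has_weak_gradient \<Omega> u G"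
  unfolding has_weak_gradient_def
  using assms(3) Lp_locally_integrable[OF assms(1)] Lp_locally_integrable[OF assms(2)]
  by (auto simp: test_function_has_derivative(2))

lemma has_weak_gradientD:
  assumes "has_weak_gradient \<Omega> u G" "test_function \<Omega> \<phi>" "b \<in> Basis"
  shows "(LINT x|M. u x * (classical_gradient \<phi> x \<bullet> b)) = - (LINT x|M. (G x \<bullet> b) * \<phi> x)"
  using assms unfolding has_weak_gradient_def by (simp add: test_function_has_derivative(2))

lemma Lp_inner: "G \<in> Lp q M \<Longrightarrow> (\<lambda>x. G x \<bullet> b) \<in> Lp q M" for G :: "'a \<Rightarrow> 'a"
proof (rule Lp_bound[where w = "\<lambda>x. norm (norm b *\<^sub>R G x) powr q"])
  assume G: "G \<in> Lp q M"
  show "(\<lambda>x. G x \<bullet> b) \<in> borel_measurable M" using LpD(1)[OF G] by measurable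
  show "integrable M (\<lambda>x. norm (norm b *\<^sub>R G x) powr q)" by (rule LpD(2)[OF Lp_scaleR[OF G]])
  show "AE x in M. norm (G x \<bullet> b) powr q \<le> norm (norm b *\<^sub>R G x) powr q"
    using q_ge by (intro AE_I2 powr_mono2) (auto simp: Cauchy_Schwarz_ineq2 mult.commute[of "norm b"])
qed

lemma test_function_bounds:
  assumes \<phi>: "test_function \<Omega> \<phi>"
  obtains B where "0 < B" "\<And>x. norm (\<phi> x) \<le> B" "\<And>x. norm (classical_gradient \<phi> x \<bullet> b) \<le> B"
proof -
  obtain K where K: "compact K" "K \<subseteq> \<Omega>" "\<And>x. x \<notin> K \<Longrightarrow> \<phi> x = 0" "\<And>x. x \<notin> K \<Longrightarrow> classical_gradient \<phi> x = 0"
    using test_function_support[OF \<phi>] by blast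
  have z: "classical_gradient \<phi> x \<bullet> b = 0" if "x \<notin> K" for x using K(4)[OF that] by simp
  have c: "continuous_on UNIV (\<lambda>x. classical_gradient \<phi> x \<bullet> b)"
    by (intro continuous_intros test_function_continuous(2)[OF \<phi>])
  obtain B1 where B1: "0 \<le> B1" "\<And>x. norm (\<phi> x) \<le> B1"
    using bounded_continuous_compact_support[OF test_function_continuous(1)[OF \<phi>] K(1,3)] by blast
  obtain B2 where B2: "0 \<le> B2" "\<And>x. norm (classical_gradient \<phi> x \<bullet> b) \<le> B2"
    using bounded_continuous_compact_support[OF c K(1) z] by blast
  show ?thesis
  proof (rule that[of "B1 + B2 + 1"])
    show "0 < B1 + B2 + 1" using B1(1) B2(1) by simp
    show "norm (\<phi> x) \<le> B1 + B2 + 1" for x using B1(2)[of x] B2(1) by simp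
    show "norm (classical_gradient \<phi> x \<bullet> b) \<le> B1 + B2 + 1" for x using B2(2)[of x] B1(1) by simp
  qed
qed

lemma test_pairings_integrable:
  assumes \<phi>: "test_function \<Omega> \<phi>" and u: "u \<in> Lp q M" and G: "G \<in> Lp q M"
  shows "integrable M (\<lambda>x. u x * (classical_gradient \<phi> x \<bullet> b))" "integrable M (\<lambda>x. (G x \<bullet> b) * \<phi> x)"
proof -
  obtain B where "0 < B" and B: "\<And>x. norm (\<phi> x) \<le> B" "\<And>x. norm (classical_gradient \<phi> x \<bullet> b) \<le> B"
    using test_function_bounds[OF \<phi>, of b] by blast
  have c: "continuous_on UNIV (\<lambda>x. classical_gradient \<phi> x \<bullet> b)"
    by (intro continuous_intros test_function_continuous(2)[OF \<phi>])
  show "integrable M (\<lambda>x. u x * (classical_gradient \<phi> x \<bullet> b))"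
    by (rule Lp_times_continuous_integrable[OF u c B(2)])
  show "integrable M (\<lambda>x. (G x \<bullet> b) * \<phi> x)"
    by (rule Lp_times_continuous_integrable[OF Lp_inner[OF G] test_function_continuous(1)[OF \<phi>] B(1)])
qed

lemma test_function_weak_gradient:
  assumes \<phi>: "test_function \<Omega> \<phi>"
  shows "has_weak_gradient \<Omega> \<phi> (classical_gradient \<phi>)"
proof (rule has_weak_gradientI[OF test_function_Lp[OF \<phi> q_ge(2)]])
  fix \<psi> :: "'a \<Rightarrow> real" and b :: 'a assume \<psi>: "test_function \<Omega> \<psi>" and b: "b \<in> Basis"
  have "((\<lambda>x. \<phi> x * \<psi> x) has_derivative (\<lambda>v. \<phi> x * (classical_gradient \<psi> x \<bullet> v) + classical_gradient \<phi> x \<bullet> v * \<psi> x)) (at x)" for x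
    by (intro has_derivative_mult test_function_has_derivative(1)[OF \<phi>] test_function_has_derivative(1)[OF \<psi>])
  note d = fun_cong[OF frechet_derivative_eqI[OF this], of _ b]
  have e: "classical_gradient (\<lambda>x. \<phi> x * \<psi> x) x \<bullet> b = \<phi> x * (classical_gradient \<psi> x \<bullet> b) + classical_gradient \<phi> x \<bullet> b * \<psi> x" for x
    using d[of x] test_function_has_derivative(2)[OF test_function_mult[OF \<phi> \<psi>], of x b] by simp
  have zero: "(LINT x|M. classical_gradient (\<lambda>x. \<phi> x * \<psi> x) x \<bullet> b) = 0"
  proof -
    have "(LINT x|M. classical_gradient (\<lambda>x. \<phi> x * \<psi> x) x \<bullet> b) = (LINT x|lebesgue. classical_gradient (\<lambda>x. \<phi> x * \<psi> x) x \<bullet> b)"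
      by (rule integral_lebesgue_on_zero_outside[OF open_domain])
        (simp add: test_function_outside(2)[OF test_function_mult[OF \<phi> \<psi>]])
    also have "\<dots> = (LINT x|lborel. classical_gradient (\<lambda>x. \<phi> x * \<psi> x) x \<bullet> b)"
      by (intro integral_completion borel_measurable_inner borel_measurable_const)
        (simp add: test_function_integrable(4)[OF test_function_mult[OF \<phi> \<psi>]])
    also have "\<dots> = 0" by (rule integral_directional_derivative_test_function[OF test_function_mult[OF \<phi> \<psi>]])
    finally show ?thesis .
  qed
  show "(LINT x|M. \<phi> x * (classical_gradient \<psi> x \<bullet> b)) = - (LINT x|M. classical_gradient \<phi> x \<bullet> b * \<psi> x)"
    using zero test_pairings_integrable[OF \<psi> test_function_Lp[OF \<phi> q_ge(2)], of b] unfolding e by simp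
qed

lemma has_weak_gradient_lincomb:
  assumes u: "u \<in> Lp q M" "G \<in> Lp q M" "has_weak_gradient \<Omega> u G"
    and v: "v \<in> Lp q M" "H \<in> Lp q M" "has_weak_gradient \<Omega> v H"
  shows "has_weak_gradient \<Omega> (\<lambda>x. a * u x + b * v x) (\<lambda>x. a *\<^sub>R G x + b *\<^sub>R H x)"
proof (rule has_weak_gradientI)
  show "(\<lambda>x. a * u x + b * v x) \<in> Lp q M" "(\<lambda>x. a *\<^sub>R G x + b *\<^sub>R H x) \<in> Lp q M"
    using u v q_ge by (auto intro!: Lp_add Lp_mult Lp_scaleR)
  fix \<phi> :: "'a \<Rightarrow> real" and c :: 'a assume \<phi>: "test_function \<Omega> \<phi>" and c: "c \<in> Basis"
  note iu = test_pairings_integrable[OF \<phi> u(1,2), of c] and iv = test_pairings_integrable[OF \<phi> v(1,2), of c]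
  have "(LINT x|M. (a * u x + b * v x) * (classical_gradient \<phi> x \<bullet> c))
    = a * (LINT x|M. u x * (classical_gradient \<phi> x \<bullet> c)) + b * (LINT x|M. v x * (classical_gradient \<phi> x \<bullet> c))"
    using iu(1) iv(1) by (simp add: distrib_right mult.assoc)
  also have "\<dots> = - (a * (LINT x|M. (G x \<bullet> c) * \<phi> x) + b * (LINT x|M. (H x \<bullet> c) * \<phi> x))"
    using has_weak_gradientD[OF u(3) \<phi> c] has_weak_gradientD[OF v(3) \<phi> c] by simp
  also have "a * (LINT x|M. (G x \<bullet> c) * \<phi> x) + b * (LINT x|M. (H x \<bullet> c) * \<phi> x)
      = (LINT x|M. ((a *\<^sub>R G x + b *\<^sub>R H x) \<bullet> c) * \<phi> x)"
    using iu(2) iv(2) by (simp add: distrib_right mult.assoc inner_add_left)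
  finally show "(LINT x|M. (a * u x + b * v x) * (classical_gradient \<phi> x \<bullet> c)) = - (LINT x|M. ((a *\<^sub>R G x + b *\<^sub>R H x) \<bullet> c) * \<phi> x)" .
qed

lemma integral_against_bounded_tendsto:
  fixes f :: "nat \<Rightarrow> 'a \<Rightarrow> real"
  assumes f: "\<And>n. f n \<in> Lp q M" and g: "g \<in> Lp q M"
    and lim: "(\<lambda>n. modular q M (\<lambda>x. f n x - g x)) \<longlonglongrightarrow> 0"
    and c: "continuous_on UNIV \<psi>" and B: "\<And>x. norm (\<psi> x) \<le> B" "0 < B"
  shows "(\<lambda>n. LINT x|M. f n x * \<psi> x) \<longlonglongrightarrow> (LINT x|M. g x * \<psi> x)"
proof (rule LIMSEQ_I)
  fix e :: real assume e: "0 < e"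
  obtain d where d: "0 < d" "\<And>h::'a \<Rightarrow> real. h \<in> Lp q M \<Longrightarrow> modular q M h < d \<Longrightarrow> (LINT x|M. norm (h x)) < e / B"
    using fm.integral_norm_small[OF q_ge(1) divide_pos_pos[OF e B(2)]] by blast
  obtain N where N: "\<And>n. N \<le> n \<Longrightarrow> modular q M (\<lambda>x. f n x - g x) < d"
    using LIMSEQ_D[OF lim d(1)] by auto
  have "norm ((LINT x|M. f n x * \<psi> x) - (LINT x|M. g x * \<psi> x)) < e" if "N \<le> n" for n
  proof -
    have L: "(\<lambda>x. f n x - g x) \<in> Lp q M" by (intro Lp_diff q_ge f g)
    have "(LINT x|M. f n x * \<psi> x) - (LINT x|M. g x * \<psi> x) = (LINT x|M. (f n x - g x) * \<psi> x)"
      using Lp_times_continuous_integrable[OF f c B(1)] Lp_times_continuous_integrable[OF g c B(1)]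
      by (simp add: left_diff_distrib)
    also have "norm \<dots> \<le> (LINT x|M. norm ((f n x - g x) * \<psi> x))" by (rule integral_norm_bound)
    also have "\<dots> \<le> (LINT x|M. B * norm (f n x - g x))"
    proof (rule integral_mono)
      show "integrable M (\<lambda>x. norm ((f n x - g x) * \<psi> x))"
        by (intro integrable_norm Lp_times_continuous_integrable[OF L c B(1)])
      show "integrable M (\<lambda>x. B * norm (f n x - g x))"
        by (intro integrable_mult_right integrable_norm fm.Lp_integrable[OF q_ge(1) L])
      show "norm ((f n x - g x) * \<psi> x) \<le> B * norm (f n x - g x)" for x
        unfolding norm_mult mult.commute[of B] by (intro mult_left_mono B) auto
    qed
    also have "\<dots> = B * (LINT x|M. norm (f n x - g x))" by simp
    also have "\<dots> < B * (e / B)" by (intro mult_strict_left_mono d(2) L N that B)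
    finally show ?thesis using B by simp
  qed
  then show "\<exists>no. \<forall>n\<ge>no. norm ((LINT x|M. f n x * \<psi> x) - (LINT x|M. g x * \<psi> x)) < e" by blast
qed

lemma has_weak_gradient_limit:
  assumes u: "\<And>n. u n \<in> Lp q M" "\<And>n. G n \<in> Lp q M" "\<And>n. has_weak_gradient \<Omega> (u n) (G n)"
    and v: "v \<in> Lp q M" "H \<in> Lp q M"
    and lim: "(\<lambda>n. modular q M (\<lambda>x. u n x - v x)) \<longlonglongrightarrow> 0" "(\<lambda>n. modular q M (\<lambda>x. G n x - H x)) \<longlonglongrightarrow> 0"
  shows "has_weak_gradient \<Omega> v H"
proof (rule has_weak_gradientI[OF v])
  fix \<phi> :: "'a \<Rightarrow> real" and b :: 'a assume \<phi>: "test_function \<Omega> \<phi>" and b: "b \<in> Basis"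
  obtain B where B: "0 < B" "\<And>x. norm (\<phi> x) \<le> B" "\<And>x. norm (classical_gradient \<phi> x \<bullet> b) \<le> B"
    using test_function_bounds[OF \<phi>, of b] by blast
  have c: "continuous_on UNIV (\<lambda>x. classical_gradient \<phi> x \<bullet> b)"
    by (intro continuous_intros test_function_continuous(2)[OF \<phi>])
  have 1: "(\<lambda>n. LINT x|M. u n x * (classical_gradient \<phi> x \<bullet> b)) \<longlonglongrightarrow> (LINT x|M. v x * (classical_gradient \<phi> x \<bullet> b))"
    by (rule integral_against_bounded_tendsto[OF u(1) v(1) lim(1) c B(3,1)])
  have "(\<lambda>n. modular q M (\<lambda>x. G n x \<bullet> b - H x \<bullet> b)) \<longlonglongrightarrow> 0"
  proof (rule tendsto_sandwich[OF _ _ tendsto_const lim(2)])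
    show "\<forall>\<^sub>F n in sequentially. modular q M (\<lambda>x. G n x \<bullet> b - H x \<bullet> b) \<le> modular q M (\<lambda>x. G n x - H x)"
    proof (rule always_eventually, rule allI, rule modular_mono)
      fix n
      show "(\<lambda>x. G n x - H x) \<in> Lp q M" by (intro Lp_diff q_ge u v)
      show "(\<lambda>x. G n x \<bullet> b - H x \<bullet> b) \<in> borel_measurable M" using LpD(1)[OF u(2)[of n]] LpD(1)[OF v(2)] by measurable
      show "AE x in M. norm (G n x \<bullet> b - H x \<bullet> b) \<le> norm (G n x - H x)"
        using Basis_le_norm[OF b] by (auto simp flip: inner_diff_left)
    qed (rule q_ge)
  qed simp
  then have "(\<lambda>n. LINT x|M. (G n x \<bullet> b) * \<phi> x) \<longlonglongrightarrow> (LINT x|M. (H x \<bullet> b) * \<phi> x)"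
    by (rule integral_against_bounded_tendsto[OF Lp_inner[OF u(2)] Lp_inner[OF v(2)] _ test_function_continuous(1)[OF \<phi>] B(2,1)])
  then have "(\<lambda>n. - (LINT x|M. (G n x \<bullet> b) * \<phi> x)) \<longlonglongrightarrow> - (LINT x|M. (H x \<bullet> b) * \<phi> x)" by (rule tendsto_minus)
  then have "(\<lambda>n. LINT x|M. u n x * (classical_gradient \<phi> x \<bullet> b)) \<longlonglongrightarrow> - (LINT x|M. (H x \<bullet> b) * \<phi> x)"
    using has_weak_gradientD[OF u(3) \<phi> b] by simp
  then show "(LINT x|M. v x * (classical_gradient \<phi> x \<bullet> b)) = - (LINT x|M. (H x \<bullet> b) * \<phi> x)"
    using 1 LIMSEQ_unique by blast
qed

text \<open>The gradient picked by the choice operator agrees almost everywhere with a \<open>q\<close>-integrable one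
  and therefore is integrable, too.\<close>

lemma W1_spaceD:
  assumes "u \<in> W1_space q \<Omega>"
  shows "u \<in> Lp q M" "grad u \<in> Lp q M" "has_weak_gradient \<Omega> u (grad u)"
proof -
  obtain G where G: "has_weak_gradient \<Omega> u G" "G \<in> Lp q M" and u: "u \<in> Lp q M"
    using assms unfolding W1_space_def L_space_eq by blast
  show "u \<in> Lp q M" by (rule u)
  show g: "has_weak_gradient \<Omega> u (grad u)" unfolding weak_gradient_def by (rule someI[of "has_weak_gradient \<Omega> u", OF G(1)])
  have "AE x in M. grad u x = G x" by (rule weak_gradient_unique[OF open_domain g G(1)])
  then have ae: "AE x in M. norm (grad u x) powr q \<le> norm (G x) powr q" by eventually_elim simp
  show "grad u \<in> Lp q M"
  proof (rule Lp_bound[OF _ LpD(2)[OF G(2)] ae])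
    show "grad u \<in> borel_measurable M"
      by (rule locally_integrable_measurable[OF open_domain]) (use g in \<open>simp add: has_weak_gradient_def\<close>)
  qed
qed

lemma W1_spaceI:
  assumes "u \<in> Lp q M" "G \<in> Lp q M" "has_weak_gradient \<Omega> u G"
  shows "u \<in> W1_space q \<Omega>" "AE x in M. grad u x = G x"
proof -
  show u: "u \<in> W1_space q \<Omega>"
    unfolding W1_space_def L_space_eq mem_Collect_eq using assms by (intro conjI exI[of _ G])
  show "AE x in M. grad u x = G x" by (rule weak_gradient_unique[OF open_domain W1_spaceD(3)[OF u] assms(3)])
qed

lemma W1_lincomb:
  assumes u: "u \<in> W1_space q \<Omega>" and v: "v \<in> W1_space q \<Omega>"
  shows "(\<lambda>x. a * u x + b * v x) \<in> W1_space q \<Omega>"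
    "AE x in M. grad (\<lambda>x. a * u x + b * v x) x = a *\<^sub>R grad u x + b *\<^sub>R grad v x"
proof -
  have h: "has_weak_gradient \<Omega> (\<lambda>x. a * u x + b * v x) (\<lambda>x. a *\<^sub>R grad u x + b *\<^sub>R grad v x)"
    using W1_spaceD[OF u] W1_spaceD[OF v] by (intro has_weak_gradient_lincomb)
  have L: "(\<lambda>x. a * u x + b * v x) \<in> Lp q M" "(\<lambda>x. a *\<^sub>R grad u x + b *\<^sub>R grad v x) \<in> Lp q M"
    using Lp_add[OF q_ge(2) Lp_mult[OF W1_spaceD(1)[OF u], of a] Lp_mult[OF W1_spaceD(1)[OF v], of b]]
      Lp_add[OF q_ge(2) Lp_scaleR[OF W1_spaceD(2)[OF u], of a] Lp_scaleR[OF W1_spaceD(2)[OF v], of b]] by blast+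
  show "(\<lambda>x. a * u x + b * v x) \<in> W1_space q \<Omega>"
    "AE x in M. grad (\<lambda>x. a * u x + b * v x) x = a *\<^sub>R grad u x + b *\<^sub>R grad v x"
    by (rule W1_spaceI(1)[OF L h], rule W1_spaceI(2)[OF L h])
qed

lemma test_function_W1:
  assumes "test_function \<Omega> \<phi>"
  shows "\<phi> \<in> W1_space q \<Omega>" "AE x in M. grad \<phi> x = classical_gradient \<phi> x"
  by (rule W1_spaceI(1)[OF test_function_Lp[OF assms q_ge(2)] test_function_weak_gradient[OF assms]],
      rule W1_spaceI(2)[OF test_function_Lp[OF assms q_ge(2)] test_function_weak_gradient[OF assms]])

lemma W1_diff:
  assumes u: "u \<in> W1_space q \<Omega>" and v: "v \<in> W1_space q \<Omega>"
  shows "u - v \<in> W1_space q \<Omega>" "AE x in M. grad (u - v) x = grad u x - grad v x"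
proof -
  have e: "u - v = (\<lambda>x. 1 * u x + (-1) * v x)" by (auto simp: fun_diff_def)
  show "u - v \<in> W1_space q \<Omega>" "AE x in M. grad (u - v) x = grad u x - grad v x"
    unfolding e using W1_lincomb[OF u v, of 1 "-1"] by simp_all
qed

lemma modular_grad_diff:
  assumes u: "u \<in> W1_space q \<Omega>" and v: "v \<in> W1_space q \<Omega>"
  shows "modular q M (grad (u - v)) = modular q M (\<lambda>x. grad u x - grad v x)"
  by (rule modular_cong_AE[OF LpD(1)[OF W1_spaceD(2)[OF W1_diff(1)[OF u v]]]
        LpD(1)[OF Lp_diff[OF q_ge(2) W1_spaceD(2)[OF u] W1_spaceD(2)[OF v]]] W1_diff(2)[OF u v]])

lemma W1_norm_less_iff:
  assumes u: "u \<in> W1_space q \<Omega>" and v: "v \<in> W1_space q \<Omega>" and e: "0 < e"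
  shows "W1_norm q \<Omega> (u - v) < e \<longleftrightarrow>
    modular q M (\<lambda>x. u x - v x) + modular q M (\<lambda>x. grad u x - grad v x) < e powr q"
proof -
  define m where "m = modular q M (\<lambda>x. u x - v x) + modular q M (\<lambda>x. grad u x - grad v x)"
  have m0: "0 \<le> m" by (simp add: m_def)
  have d: "modular q M (u - v) = modular q M (\<lambda>x. u x - v x)" by (simp only: fun_diff_def)
  have "m = modular q M (u - v) + modular q M (grad (u - v))"
    by (simp only: m_def d modular_grad_diff[OF u v])
  then have "W1_norm q \<Omega> (u - v) = m powr (1 / q)"
    by (simp only: W1_norm_def modular_def real_norm_def)
  moreover have "m powr (1 / q) < e \<longleftrightarrow> m < e powr q"
  proof
    assume "m powr (1 / q) < e"
    then have "(m powr (1 / q)) powr q < e powr q" using q_ge by (intro powr_less_mono2) auto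
    then show "m < e powr q" using m0 q_ge by (simp add: powr_powr)
  next
    assume "m < e powr q"
    then have "m powr (1 / q) < (e powr q) powr (1 / q)" using q_ge m0 by (intro powr_less_mono2) auto
    then show "m powr (1 / q) < e" using e q_ge by (simp add: powr_powr)
  qed
  ultimately show ?thesis by (simp add: m_def)
qed

lemma W_iff:
  "u \<in> W \<longleftrightarrow> u \<in> W1_space q \<Omega> \<and> (\<forall>e>0. \<exists>\<phi>. test_function \<Omega> \<phi> \<and>
     modular q M (\<lambda>x. u x - \<phi> x) + modular q M (\<lambda>x. grad u x - grad \<phi> x) < e)"
proof -
  have "(\<forall>e>0. \<exists>\<phi>. test_function \<Omega> \<phi> \<and> W1_norm q \<Omega> (u - \<phi>) < e) \<longleftrightarrow>
    (\<forall>e>0. \<exists>\<phi>. test_function \<Omega> \<phi> \<and> modular q M (\<lambda>x. u x - \<phi> x) + modular q M (\<lambda>x. grad u x - grad \<phi> x) < e)"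
    if u: "u \<in> W1_space q \<Omega>"
  proof (intro iffI allI impI)
    fix e :: real assume A: "\<forall>e>0. \<exists>\<phi>. test_function \<Omega> \<phi> \<and> W1_norm q \<Omega> (u - \<phi>) < e" and e: "0 < e"
    obtain \<phi> where \<phi>: "test_function \<Omega> \<phi>" "W1_norm q \<Omega> (u - \<phi>) < e powr (1 / q)"
      using A[rule_format, of "e powr (1 / q)"] e by auto
    then have "modular q M (\<lambda>x. u x - \<phi> x) + modular q M (\<lambda>x. grad u x - grad \<phi> x) < (e powr (1 / q)) powr q"
      using W1_norm_less_iff[OF u test_function_W1(1)[OF \<phi>(1)], of "e powr (1 / q)"] e by simp
    then show "\<exists>\<phi>. test_function \<Omega> \<phi> \<and> modular q M (\<lambda>x. u x - \<phi> x) + modular q M (\<lambda>x. grad u x - grad \<phi> x) < e"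
      using \<phi>(1) e q_ge by (auto simp: powr_powr)
  next
    fix e :: real assume A: "\<forall>e>0. \<exists>\<phi>. test_function \<Omega> \<phi> \<and> modular q M (\<lambda>x. u x - \<phi> x) + modular q M (\<lambda>x. grad u x - grad \<phi> x) < e" and e: "0 < e"
    obtain \<phi> where \<phi>: "test_function \<Omega> \<phi>" "modular q M (\<lambda>x. u x - \<phi> x) + modular q M (\<lambda>x. grad u x - grad \<phi> x) < e powr q"
      using A[rule_format, of "e powr q"] e by auto
    then show "\<exists>\<phi>. test_function \<Omega> \<phi> \<and> W1_norm q \<Omega> (u - \<phi>) < e"
      using W1_norm_less_iff[OF u test_function_W1(1)[OF \<phi>(1)] e] by blast
  qed
  then show ?thesis unfolding W10_space_def by blast
qed

lemma WD:
  assumes "u \<in> W"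
  shows "u \<in> W1_space q \<Omega>" "u \<in> Lp q M" "grad u \<in> Lp q M"
  using assms W1_spaceD unfolding W_iff by auto

text \<open>Every property of \<open>W\<close> that passes to limits is inherited from test functions.\<close>

lemma W_closed:
  assumes v: "v \<in> W1_space q \<Omega>"
    and lim: "\<And>e. 0 < e \<Longrightarrow> \<exists>u\<in>W. modular q M (\<lambda>x. u x - v x) + modular q M (\<lambda>x. grad u x - grad v x) < e"
  shows "v \<in> W"
  unfolding W_iff
proof (intro conjI v allI impI)
  fix e :: real assume e: "0 < e"
  define e' where "e' = e / (2 * 2 powr q)"
  have e': "0 < e'" using e by (simp add: e'_def)
  obtain u where u: "u \<in> W" "modular q M (\<lambda>x. u x - v x) + modular q M (\<lambda>x. grad u x - grad v x) < e'"
    using lim[OF e'] by blast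
  obtain \<phi> where \<phi>: "test_function \<Omega> \<phi>" "modular q M (\<lambda>x. u x - \<phi> x) + modular q M (\<lambda>x. grad u x - grad \<phi> x) < e'"
    using u(1) e' unfolding W_iff by blast
  note Lu = WD[OF u(1)] and L\<phi> = W1_spaceD[OF test_function_W1(1)[OF \<phi>(1)]] and Lv = W1_spaceD[OF v]
  have tri: "modular q M (\<lambda>x. f x - h x) \<le> 2 powr q * (modular q M (\<lambda>x. g x - f x) + modular q M (\<lambda>x. g x - h x))"
    if "f \<in> Lp q M" "g \<in> Lp q M" "h \<in> Lp q M" for f g h :: "'a \<Rightarrow> 'z::euclidean_space"
    using modular_add_le[OF q_ge(2) Lp_diff[OF q_ge(2) that(1,2)] Lp_diff[OF q_ge(2) that(2,3)]]
    by (simp add: modular_minus_commute[of q M f g])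
  have "modular q M (\<lambda>x. v x - \<phi> x) + modular q M (\<lambda>x. grad v x - grad \<phi> x)
     \<le> 2 powr q * (modular q M (\<lambda>x. u x - v x) + modular q M (\<lambda>x. u x - \<phi> x))
       + 2 powr q * (modular q M (\<lambda>x. grad u x - grad v x) + modular q M (\<lambda>x. grad u x - grad \<phi> x))"
    by (intro add_mono tri Lu L\<phi> Lv)
  also have "\<dots> = 2 powr q * ((modular q M (\<lambda>x. u x - v x) + modular q M (\<lambda>x. grad u x - grad v x))
      + (modular q M (\<lambda>x. u x - \<phi> x) + modular q M (\<lambda>x. grad u x - grad \<phi> x)))"
    by (simp add: algebra_simps)
  also have "\<dots> < 2 powr q * (e' + e')" using u(2) \<phi>(2) by (intro mult_strict_left_mono add_strict_mono) auto
  also have "\<dots> = e" by (simp add: e'_def)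
  finally show "\<exists>\<phi>. test_function \<Omega> \<phi> \<and> modular q M (\<lambda>x. v x - \<phi> x) + modular q M (\<lambda>x. grad v x - grad \<phi> x) < e"
    using \<phi>(1) by blast
qed

end



section \<open>Linear structure, Poincare inequality and completeness\<close>

lemma modular_lincomb_diff_le:
  fixes f g :: "'x \<Rightarrow> 'b::euclidean_space"
  assumes s: "0 \<le> s" and L: "f \<in> Lp s M" "g \<in> Lp s M" "f' \<in> Lp s M" "g' \<in> Lp s M"
  shows "modular s M (\<lambda>x. (a *\<^sub>R f x + b *\<^sub>R g x) - (a *\<^sub>R f' x + b *\<^sub>R g' x))
    \<le> 2 powr s * (\<bar>a\<bar> powr s * modular s M (\<lambda>x. f x - f' x) + \<bar>b\<bar> powr s * modular s M (\<lambda>x. g x - g' x))"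
proof -
  have "modular s M (\<lambda>x. (a *\<^sub>R f x + b *\<^sub>R g x) - (a *\<^sub>R f' x + b *\<^sub>R g' x))
     = modular s M (\<lambda>x. a *\<^sub>R (f x - f' x) + b *\<^sub>R (g x - g' x))"
    by (simp add: algebra_simps)
  also have "\<dots> \<le> 2 powr s * (modular s M (\<lambda>x. a *\<^sub>R (f x - f' x)) + modular s M (\<lambda>x. b *\<^sub>R (g x - g' x)))"
    by (rule modular_add_le[OF s Lp_scaleR[OF Lp_diff[OF s L(1,3)]] Lp_scaleR[OF Lp_diff[OF s L(2,4)]]])
  finally show ?thesis by (simp only: modular_scaleR)
qed

lemma modular_diff_triangle:
  assumes "0 \<le> s" "f \<in> Lp s M" "g \<in> Lp s M" "h \<in> Lp s M"
  shows "modular s M (\<lambda>x. f x - h x) \<le> 2 powr s * (modular s M (\<lambda>x. f x - g x) + modular s M (\<lambda>x. g x - h x))"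
  using modular_add_le[OF assms(1) Lp_diff[OF assms(1,2,3)] Lp_diff[OF assms(1,3,4)]] by simp

lemma modular_le_diff:
  assumes "0 \<le> s" "f \<in> Lp s M" "g \<in> Lp s M"
  shows "modular s M f \<le> 2 powr s * (modular s M (\<lambda>x. f x - g x) + modular s M g)"
  using modular_add_le[OF assms(1) Lp_diff[OF assms(1,2,3)] assms(3)] by simp

context bounded_open
begin

lemma test_function_W:
  assumes "test_function \<Omega> \<phi>"
  shows "\<phi> \<in> W"
  unfolding W_iff
proof (intro conjI allI impI exI[of _ \<phi>] assms test_function_W1)
  fix e :: real assume "0 < e"
  then show "modular q M (\<lambda>x. \<phi> x - \<phi> x) + modular q M (\<lambda>x. grad \<phi> x - grad \<phi> x) < e"
    by (simp add: modular_def)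
qed

lemma modular_grad_test_function:
  assumes \<phi>: "test_function \<Omega> \<phi>"
  shows "modular q M (grad \<phi>) = modular q lborel (classical_gradient \<phi>)"
proof -
  have "modular q M (grad \<phi>) = modular q M (classical_gradient \<phi>)"
    by (rule modular_cong_AE[OF LpD(1)[OF W1_spaceD(2)[OF test_function_W1(1)[OF \<phi>]]]
          LpD(1)[OF test_function_Lp(2)[OF \<phi> q_ge(2)]] test_function_W1(2)[OF \<phi>]])
  then show ?thesis
    using modular_lborel(1)[OF test_function_integrable(4)[OF \<phi>] test_function_outside(2)[OF \<phi>], where s = q] by simp
qed

lemma modular_test_function:
  assumes \<phi>: "test_function \<Omega> \<phi>"
  shows "modular q M \<phi> = modular q lborel \<phi>"
  using modular_lborel(1)[OF test_function_integrable(2)[OF \<phi>] test_function_outside(1)[OF \<phi>], where s = q] by simp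

lemma W_approx:
  assumes "u \<in> W" "0 < e"
  obtains \<phi> where "test_function \<Omega> \<phi>" "modular q M (\<lambda>x. u x - \<phi> x) < e" "modular q M (\<lambda>x. grad u x - grad \<phi> x) < e"
proof -
  obtain \<phi> where \<phi>: "test_function \<Omega> \<phi>" "modular q M (\<lambda>x. u x - \<phi> x) + modular q M (\<lambda>x. grad u x - grad \<phi> x) < e"
    using assms unfolding W_iff by auto
  show ?thesis
  proof (rule that[OF \<phi>(1)])
    show "modular q M (\<lambda>x. u x - \<phi> x) < e"
      using \<phi>(2) modular_nonneg[of q M "\<lambda>x. grad u x - grad \<phi> x"] by linarith
    show "modular q M (\<lambda>x. grad u x - grad \<phi> x) < e"
      using \<phi>(2) modular_nonneg[of q M "\<lambda>x. u x - \<phi> x"] by linarith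
  qed
qed

lemma W_lincomb:
  assumes u: "u \<in> W" and v: "v \<in> W"
  shows "(\<lambda>x. a * u x + b * v x) \<in> W"
proof (rule W_closed)
  let ?w = "\<lambda>x. a * u x + b * v x"
  show w1: "?w \<in> W1_space q \<Omega>" by (rule W1_lincomb(1)[OF WD(1)[OF u] WD(1)[OF v]])
  fix e :: real assume e: "0 < e"
  define K where "K = 2 * (2 powr q * (\<bar>a\<bar> powr q + \<bar>b\<bar> powr q)) + 1"
  have K: "0 < K" by (simp add: K_def add_nonneg_pos)
  define d where "d = e / K"
  have d: "0 < d" using e K by (simp add: d_def)
  obtain \<phi> where \<phi>: "test_function \<Omega> \<phi>" "modular q M (\<lambda>x. u x - \<phi> x) < d" "modular q M (\<lambda>x. grad u x - grad \<phi> x) < d"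
    using W_approx[OF u d] by blast
  obtain \<psi> where \<psi>: "test_function \<Omega> \<psi>" "modular q M (\<lambda>x. v x - \<psi> x) < d" "modular q M (\<lambda>x. grad v x - grad \<psi> x) < d"
    using W_approx[OF v d] by blast
  let ?z = "\<lambda>x. a * \<phi> x + b * \<psi> x"
  have z: "?z \<in> W" by (rule test_function_W[OF test_function_lincomb[OF \<phi>(1) \<psi>(1)]])
  note L\<phi> = WD(2,3)[OF test_function_W[OF \<phi>(1)]] and L\<psi> = WD(2,3)[OF test_function_W[OF \<psi>(1)]]
  have bound: "2 powr q * (\<bar>a\<bar> powr q * x + \<bar>b\<bar> powr q * y) \<le> 2 powr q * (\<bar>a\<bar> powr q + \<bar>b\<bar> powr q) * d"
    if "x < d" "y < d" for x y
  proof -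
    have "\<bar>a\<bar> powr q * x + \<bar>b\<bar> powr q * y \<le> \<bar>a\<bar> powr q * d + \<bar>b\<bar> powr q * d"
      using that by (intro add_mono mult_left_mono) auto
    then have "2 powr q * (\<bar>a\<bar> powr q * x + \<bar>b\<bar> powr q * y) \<le> 2 powr q * (\<bar>a\<bar> powr q * d + \<bar>b\<bar> powr q * d)"
      by (intro mult_left_mono) auto
    then show ?thesis by (simp add: algebra_simps)
  qed
  have 1: "modular q M (\<lambda>x. ?z x - ?w x) \<le> 2 powr q * (\<bar>a\<bar> powr q + \<bar>b\<bar> powr q) * d"
  proof -
    have "modular q M (\<lambda>x. ?z x - ?w x) = modular q M (\<lambda>x. (a *\<^sub>R u x + b *\<^sub>R v x) - (a *\<^sub>R \<phi> x + b *\<^sub>R \<psi> x))"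
      by (subst modular_minus_commute) simp
    also have "\<dots> \<le> 2 powr q * (\<bar>a\<bar> powr q * modular q M (\<lambda>x. u x - \<phi> x) + \<bar>b\<bar> powr q * modular q M (\<lambda>x. v x - \<psi> x))"
      by (rule modular_lincomb_diff_le[OF q_ge(2) WD(2)[OF u] WD(2)[OF v] L\<phi>(1) L\<psi>(1)])
    also have "\<dots> \<le> 2 powr q * (\<bar>a\<bar> powr q + \<bar>b\<bar> powr q) * d" by (rule bound[OF \<phi>(2) \<psi>(2)])
    finally show ?thesis .
  qed
  have 2: "modular q M (\<lambda>x. grad ?z x - grad ?w x) \<le> 2 powr q * (\<bar>a\<bar> powr q + \<bar>b\<bar> powr q) * d"
  proof -
    have "modular q M (\<lambda>x. grad ?z x - grad ?w x)
      = modular q M (\<lambda>x. (a *\<^sub>R grad u x + b *\<^sub>R grad v x) - (a *\<^sub>R grad \<phi> x + b *\<^sub>R grad \<psi> x))"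
    proof (subst modular_minus_commute, rule modular_cong_AE)
      show "(\<lambda>x. grad ?w x - grad ?z x) \<in> borel_measurable M"
        by (rule LpD(1)[OF Lp_diff[OF q_ge(2) W1_spaceD(2)[OF w1] WD(3)[OF z]]])
      show "(\<lambda>x. (a *\<^sub>R grad u x + b *\<^sub>R grad v x) - (a *\<^sub>R grad \<phi> x + b *\<^sub>R grad \<psi> x)) \<in> borel_measurable M"
        by (intro borel_measurable_diff borel_measurable_add borel_measurable_scaleR borel_measurable_const
            LpD(1)[OF WD(3)[OF u]] LpD(1)[OF WD(3)[OF v]] LpD(1)[OF L\<phi>(2)] LpD(1)[OF L\<psi>(2)])
      show "AE x in M. grad ?w x - grad ?z x = (a *\<^sub>R grad u x + b *\<^sub>R grad v x) - (a *\<^sub>R grad \<phi> x + b *\<^sub>R grad \<psi> x)"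
        using W1_lincomb(2)[OF WD(1)[OF u] WD(1)[OF v], of a b]
          W1_lincomb(2)[OF test_function_W1(1)[OF \<phi>(1)] test_function_W1(1)[OF \<psi>(1)], of a b]
        by eventually_elim simp
    qed
    also have "\<dots> \<le> 2 powr q * (\<bar>a\<bar> powr q * modular q M (\<lambda>x. grad u x - grad \<phi> x) + \<bar>b\<bar> powr q * modular q M (\<lambda>x. grad v x - grad \<psi> x))"
      by (rule modular_lincomb_diff_le[OF q_ge(2) WD(3)[OF u] WD(3)[OF v] L\<phi>(2) L\<psi>(2)])
    also have "\<dots> \<le> 2 powr q * (\<bar>a\<bar> powr q + \<bar>b\<bar> powr q) * d" by (rule bound[OF \<phi>(3) \<psi>(3)])
    finally show ?thesis .
  qed
  have "2 * (2 powr q * (\<bar>a\<bar> powr q + \<bar>b\<bar> powr q) * d) < K * d" using d by (simp add: K_def algebra_simps)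
  also have "K * d = e" using K by (simp add: d_def)
  finally have "modular q M (\<lambda>x. ?z x - ?w x) + modular q M (\<lambda>x. grad ?z x - grad ?w x) < e" using 1 2 by linarith
  then show "\<exists>z\<in>W. modular q M (\<lambda>x. z x - ?w x) + modular q M (\<lambda>x. grad z x - grad ?w x) < e"
    by (rule bexI[of _ ?z, OF _ z])
qed

lemma W_zero: "(\<lambda>x. 0) \<in> W"
  by (rule test_function_W, rule test_functionI[of _ "{}"]) (auto simp: C_infinity_def)

lemma grad_zero: "AE x in M. grad (\<lambda>x. 0) x = 0"
  using W1_lincomb(2)[OF WD(1)[OF W_zero] WD(1)[OF W_zero], of 0 0] by simp

lemma W_scale: "u \<in> W \<Longrightarrow> (\<lambda>x. c * u x) \<in> W"
  using W_lincomb[of u u c 0] by simp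

lemma grad_scale: "u \<in> W \<Longrightarrow> AE x in M. grad (\<lambda>x. c * u x) x = c *\<^sub>R grad u x"
  using W1_lincomb(2)[OF WD(1) WD(1), of u u c 0] by simp

lemma W_add: "u \<in> W \<Longrightarrow> v \<in> W \<Longrightarrow> (\<lambda>x. u x + v x) \<in> W"
  using W_lincomb[of u v 1 1] by simp

lemma grad_add: "u \<in> W \<Longrightarrow> v \<in> W \<Longrightarrow> AE x in M. grad (\<lambda>x. u x + v x) x = grad u x + grad v x"
  using W1_lincomb(2)[OF WD(1) WD(1), of u v 1 1] by simp

lemma W_diff: "u \<in> W \<Longrightarrow> v \<in> W \<Longrightarrow> (\<lambda>x. u x - v x) \<in> W"
  using W_lincomb[of u v 1 "-1"] by simp

lemma W_sum:
  assumes "finite I" "\<And>i. i \<in> I \<Longrightarrow> z i \<in> W"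
  shows "(\<lambda>x. \<Sum>i\<in>I. c i * z i x) \<in> W" "AE x in M. grad (\<lambda>x. \<Sum>i\<in>I. c i * z i x) x = (\<Sum>i\<in>I. c i *\<^sub>R grad (z i) x)"
proof -
  have "(\<lambda>x. \<Sum>i\<in>I. c i * z i x) \<in> W \<and> (AE x in M. grad (\<lambda>x. \<Sum>i\<in>I. c i * z i x) x = (\<Sum>i\<in>I. c i *\<^sub>R grad (z i) x))"
    using assms
  proof (induction I)
    case empty
    then show ?case using W_zero grad_zero by simp
  next
    case (insert j J)
    have zj: "(\<lambda>x. c j * z j x) \<in> W" using insert by (intro W_scale) auto
    have IH: "(\<lambda>x. \<Sum>i\<in>J. c i * z i x) \<in> W" "AE x in M. grad (\<lambda>x. \<Sum>i\<in>J. c i * z i x) x = (\<Sum>i\<in>J. c i *\<^sub>R grad (z i) x)"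
      using insert by auto
    have e: "(\<lambda>x. \<Sum>i\<in>insert j J. c i * z i x) = (\<lambda>x. c j * z j x + (\<Sum>i\<in>J. c i * z i x))"
      using insert(1,2) by simp
    have "AE x in M. grad (\<lambda>x. c j * z j x + (\<Sum>i\<in>J. c i * z i x)) x = (\<Sum>i\<in>insert j J. c i *\<^sub>R grad (z i) x)"
      using grad_add[OF zj IH(1)] IH(2) grad_scale[of "z j" "c j", OF insert(4)[OF insertI1]]
      by eventually_elim (use insert(1,2) in simp)
    then show ?case unfolding e using W_add[OF zj IH(1)] by blast
  qed
  then show "(\<lambda>x. \<Sum>i\<in>I. c i * z i x) \<in> W" "AE x in M. grad (\<lambda>x. \<Sum>i\<in>I. c i * z i x) x = (\<Sum>i\<in>I. c i *\<^sub>R grad (z i) x)"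
    by auto
qed

lemma modular_grad_cong:
  assumes "u \<in> W" "G \<in> Lp q M" "AE x in M. grad u x = G x"
  shows "modular s M (grad u) = modular s M G"
  by (rule modular_cong_AE[OF LpD(1)[OF WD(3)[OF assms(1)]] LpD(1)[OF assms(2)] assms(3)])

text \<open>A translation by more than the diameter of \<open>\<Omega>\<close> separates a test function from its translate.\<close>

lemma Poincare_test_function:
  obtains C where "0 \<le> C" "\<And>\<phi>. test_function \<Omega> \<phi> \<Longrightarrow> modular q M \<phi> \<le> C * modular q M (grad \<phi>)"
proof -
  obtain R where R: "0 < R" "\<And>x. x \<in> \<Omega> \<Longrightarrow> norm x \<le> R" using bounded_domain unfolding bounded_pos by blast
  obtain b :: 'a where b: "b \<in> Basis" using nonempty_Basis by blast
  define h where "h = (3 * R) *\<^sub>R b"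
  have nh: "norm h = 3 * R" using R b by (simp add: h_def)
  show ?thesis
  proof (rule that[of "norm h powr q"])
    fix \<phi> assume \<phi>: "test_function \<Omega> \<phi>"
    note i = test_function_integrable[OF \<phi>]
    obtain K where K: "compact K" "K \<subseteq> \<Omega>" "\<And>x. x \<notin> K \<Longrightarrow> \<phi> x = 0" "\<And>x. x \<notin> K \<Longrightarrow> classical_gradient \<phi> x = 0"
      using test_function_support[OF \<phi>] by blast
    have c: "continuous_on UNIV \<phi>" by (rule test_function_continuous(1)[OF \<phi>])
    have ct: "continuous_on UNIV (\<lambda>x. \<phi> (x + h))"
      by (rule continuous_on_compose2[OF c]) (auto intro: continuous_intros)
    have L: "\<phi> \<in> Lp q lborel" by (rule Lp_continuous_compact_support[OF c K(1,3) q_ge(2)])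
    have cK: "compact ((\<lambda>x. x - h) ` K)" using K(1) by (intro compact_continuous_image continuous_intros)
    have "\<phi> (x + h) = 0" if "x \<notin> (\<lambda>x. x - h) ` K" for x
    proof (rule K(3))
      show "x + h \<notin> K" using that by (metis add_diff_cancel image_eqI)
    qed
    then have Lt: "(\<lambda>x. \<phi> (x + h)) \<in> Lp q lborel" by (rule Lp_continuous_compact_support[OF ct cK _ q_ge(2)])
    have "modular q M \<phi> = modular q lborel \<phi>" by (rule modular_test_function[OF \<phi>])
    also have "\<dots> \<le> modular q lborel (\<lambda>x. \<phi> (x + h) - \<phi> x)"
    proof (rule modular_mono[OF _ Lp_diff[OF q_ge(2) Lt L] q_ge(2)])
      show "\<phi> \<in> borel_measurable lborel" using i by simp
      show "AE x in lborel. norm (\<phi> x) \<le> norm (\<phi> (x + h) - \<phi> x)"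
      proof (rule AE_I2)
        fix x :: 'a
        show "norm (\<phi> x) \<le> norm (\<phi> (x + h) - \<phi> x)"
        proof (cases "x \<in> \<Omega>")
          case True
          have "x + h \<notin> \<Omega>"
          proof
            assume "x + h \<in> \<Omega>"
            then have "norm (x + h) \<le> R" "norm x \<le> R" using R True by auto
            then show False using norm_triangle_ineq4[of "x + h" x] nh R(1) by simp
          qed
          then show ?thesis using test_function_outside(1)[OF \<phi>] by simp
        qed (simp add: test_function_outside(1)[OF \<phi>])
      qed
    qed
    also have "\<dots> \<le> norm h powr q * modular q lborel (classical_gradient \<phi>)" by (rule translation_estimate[OF \<phi> q_ge(1)])
    also have "modular q lborel (classical_gradient \<phi>) = modular q M (grad \<phi>)" by (rule modular_grad_test_function[OF \<phi>, symmetric])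
    finally show "modular q M \<phi> \<le> norm h powr q * modular q M (grad \<phi>)" .
  qed simp
qed

text \<open>Test functions are dense, and both sides are continuous.\<close>

lemma Poincare:
  obtains C where "0 < C" "\<And>u. u \<in> W \<Longrightarrow> modular q M u \<le> C * modular q M (grad u)"
proof -
  obtain C where C: "0 \<le> C" "\<And>\<phi>. test_function \<Omega> \<phi> \<Longrightarrow> modular q M \<phi> \<le> C * modular q M (grad \<phi>)"
    using Poincare_test_function by blast
  let ?D = "2 powr q * (C * 2 powr q)"
  have D: "0 \<le> ?D" using C by simp
  show ?thesis
  proof (rule that[of "?D + 1"])
    show "0 < ?D + 1" using D by simp
    fix u assume u: "u \<in> W"
    have "modular q M u \<le> ?D * modular q M (grad u)"
    proof (rule field_le_epsilon)
      fix e :: real assume e: "0 < e"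
      have D2: "0 < 2 powr q + ?D" using D by (intro add_pos_nonneg) auto
      define d where "d = e / (2 powr q + ?D)"
      have d: "0 < d" using e D2 by (simp add: d_def)
      obtain \<phi> where \<phi>: "test_function \<Omega> \<phi>" "modular q M (\<lambda>x. u x - \<phi> x) < d" "modular q M (\<lambda>x. grad u x - grad \<phi> x) < d"
        using W_approx[OF u d] by blast
      note L = WD[OF u] and L\<phi> = WD[OF test_function_W[OF \<phi>(1)]]
      have "modular q M (grad \<phi>) \<le> 2 powr q * (modular q M (\<lambda>x. grad \<phi> x - grad u x) + modular q M (grad u))"
        by (rule modular_le_diff[OF q_ge(2) L\<phi>(3) L(3)])
      also have "\<dots> \<le> 2 powr q * (d + modular q M (grad u))"
        using \<phi>(3) by (intro mult_left_mono add_mono) (auto simp: modular_minus_commute[of q M "grad \<phi>"])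
      finally have g: "modular q M (grad \<phi>) \<le> 2 powr q * (d + modular q M (grad u))" .
      have "modular q M u \<le> 2 powr q * (modular q M (\<lambda>x. u x - \<phi> x) + modular q M \<phi>)"
        by (rule modular_le_diff[OF q_ge(2) L(2) L\<phi>(2)])
      also have "\<dots> \<le> 2 powr q * (d + C * modular q M (grad \<phi>))"
        using \<phi>(2) C(2)[OF \<phi>(1)] by (intro mult_left_mono add_mono) auto
      also have "\<dots> \<le> 2 powr q * (d + C * (2 powr q * (d + modular q M (grad u))))"
        using g C(1) by (intro mult_left_mono add_mono) auto
      also have "\<dots> = ?D * modular q M (grad u) + (2 powr q + ?D) * d" by (simp add: algebra_simps)
      also have "(2 powr q + ?D) * d = e" using D2 by (simp add: d_def)
      finally show "modular q M u \<le> ?D * modular q M (grad u) + e" .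
    qed
    also have "\<dots> \<le> (?D + 1) * modular q M (grad u)" by (intro mult_right_mono) auto
    finally show "modular q M u \<le> (?D + 1) * modular q M (grad u)" .
  qed
qed

lemma modular_grad_minus:
  assumes u: "u \<in> W" and v: "v \<in> W"
  shows "modular s M (grad (\<lambda>x. u x - v x)) = modular s M (\<lambda>x. grad u x - grad v x)"
proof (rule modular_grad_cong[OF W_diff[OF u v] Lp_diff[OF q_ge(2) WD(3)[OF u] WD(3)[OF v]]])
  show "AE x in M. grad (\<lambda>x. u x - v x) x = grad u x - grad v x"
    using W1_lincomb(2)[OF WD(1)[OF u] WD(1)[OF v], of 1 "-1"] by simp
qed

text \<open>The Poincare inequality reduces Cauchy sequences of gradients to Cauchy sequences in \<open>L\<^sup>q\<close>; the
  limits of functions and gradients fit together, because weak gradients pass to limits.\<close>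

lemma W_complete:
  assumes u: "\<And>n. u n \<in> W"
    and cau: "\<And>e. 0 < e \<Longrightarrow> \<exists>N. \<forall>i\<ge>N. \<forall>j\<ge>N. modular q M (\<lambda>x. grad (u i) x - grad (u j) x) < e"
  obtains v where "v \<in> W" "(\<lambda>n. modular q M (\<lambda>x. u n x - v x)) \<longlonglongrightarrow> 0"
    "(\<lambda>n. modular q M (\<lambda>x. grad (u n) x - grad v x)) \<longlonglongrightarrow> 0"
proof -
  obtain C where C: "0 < C" "\<And>u. u \<in> W \<Longrightarrow> modular q M u \<le> C * modular q M (grad u)" using Poincare by blast
  have cau': "\<exists>N. \<forall>i\<ge>N. \<forall>j\<ge>N. modular q M (\<lambda>x. u i x - u j x) < e" if e: "0 < e" for e
  proof -
    obtain N where N: "\<forall>i\<ge>N. \<forall>j\<ge>N. modular q M (\<lambda>x. grad (u i) x - grad (u j) x) < e / C"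
      using cau[of "e / C"] e C(1) by auto
    have "modular q M (\<lambda>x. u i x - u j x) < e" if "i \<ge> N" "j \<ge> N" for i j
    proof -
      have "modular q M (\<lambda>x. u i x - u j x) \<le> C * modular q M (\<lambda>x. grad (u i) x - grad (u j) x)"
        using C(2)[OF W_diff[OF u u], of i j] unfolding modular_grad_minus[OF u u] .
      also have "\<dots> < C * (e / C)" using N that C(1) by (intro mult_strict_left_mono) auto
      finally show ?thesis using C(1) by simp
    qed
    then show ?thesis by blast
  qed
  obtain v where v: "v \<in> Lp q M" "(\<lambda>n. modular q M (\<lambda>x. u n x - v x)) \<longlonglongrightarrow> 0"
    using fm.modular_complete[of q u, OF q_ge(1) WD(2)[OF u] cau'] by blast
  obtain H where H: "H \<in> Lp q M" "(\<lambda>n. modular q M (\<lambda>x. grad (u n) x - H x)) \<longlonglongrightarrow> 0"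
    using fm.modular_complete[of q "\<lambda>n. grad (u n)", OF q_ge(1) WD(3)[OF u] cau] by blast
  have w: "has_weak_gradient \<Omega> v H"
    by (rule has_weak_gradient_limit[OF WD(2)[OF u] WD(3)[OF u] W1_spaceD(3)[OF WD(1)[OF u]] v(1) H(1) v(2) H(2)])
  note v1 = W1_spaceI[OF v(1) H(1) w]
  have e: "modular q M (\<lambda>x. grad (u n) x - grad v x) = modular q M (\<lambda>x. grad (u n) x - H x)" for n
  proof (rule modular_cong_AE)
    show "(\<lambda>x. grad (u n) x - grad v x) \<in> borel_measurable M"
      by (rule LpD(1)[OF Lp_diff[OF q_ge(2) WD(3)[OF u] W1_spaceD(2)[OF v1(1)]]])
    show "(\<lambda>x. grad (u n) x - H x) \<in> borel_measurable M"
      by (rule LpD(1)[OF Lp_diff[OF q_ge(2) WD(3)[OF u] H(1)]])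
    show "AE x in M. grad (u n) x - grad v x = grad (u n) x - H x"
      using v1(2) by eventually_elim simp
  qed
  have g: "(\<lambda>n. modular q M (\<lambda>x. grad (u n) x - grad v x)) \<longlonglongrightarrow> 0" unfolding e by (rule H(2))
  have "v \<in> W"
  proof (rule W_closed[OF v1(1)])
    fix \<epsilon> :: real assume "0 < \<epsilon>"
    have "(\<lambda>n. modular q M (\<lambda>x. u n x - v x) + modular q M (\<lambda>x. grad (u n) x - grad v x)) \<longlonglongrightarrow> 0 + 0"
      by (intro tendsto_add v(2) g)
    then have "\<forall>\<^sub>F n in sequentially. modular q M (\<lambda>x. u n x - v x) + modular q M (\<lambda>x. grad (u n) x - grad v x) < \<epsilon>"
      using \<open>0 < \<epsilon>\<close> by (intro order_tendstoD(2)) auto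
    then obtain n where "modular q M (\<lambda>x. u n x - v x) + modular q M (\<lambda>x. grad (u n) x - grad v x) < \<epsilon>"
      unfolding eventually_sequentially by blast
    then show "\<exists>w\<in>W. modular q M (\<lambda>x. w x - v x) + modular q M (\<lambda>x. grad w x - grad v x) < \<epsilon>" using u by blast
  qed
  then show ?thesis using v(2) g by (rule that)
qed

end



section \<open>Compactness of the embedding\<close>

text \<open>Jensen's inequality for the mean value, obtained by testing Young's inequality with a constant.\<close>

lemma (in finite_measure) modular_mean_le:
  fixes g :: "'a \<Rightarrow> real"
  assumes s: "1 < s" and g: "g \<in> Lp s M" and a: "(LINT x|M. g x) = a * measure M (space M)"
  shows "\<bar>a\<bar> powr s * measure M (space M) \<le> modular s M g"
proof -
  have c: "(\<lambda>x. a) \<in> Lp s M" by (auto simp: Lp_def)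
  have aa: "\<bar>a\<bar> powr (s - 2) * (a * a) = \<bar>a\<bar> powr s"
    by (cases "a = 0") (simp_all add: powr_diff power2_eq_square)
  have "duality s M (\<lambda>x. a) g = (LINT x|M. (\<bar>a\<bar> powr (s - 2) * a) * g x)"
    by (simp add: duality_def mult.assoc)
  also have "\<dots> = \<bar>a\<bar> powr (s - 2) * a * (a * measure M (space M))" by (simp add: a)
  also have "\<dots> = \<bar>a\<bar> powr s * measure M (space M)" by (simp add: aa[symmetric])
  finally have d: "duality s M (\<lambda>x. a) g = \<bar>a\<bar> powr s * measure M (space M)" .
  have m: "modular s M (\<lambda>x. a) = \<bar>a\<bar> powr s * measure M (space M)" by (simp add: modular_def)
  have "s * duality s M (\<lambda>x. a) g \<le> (s - 1) * modular s M (\<lambda>x. a) + modular s M g"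
    by (rule duality_le_modular[OF s c g])
  then show ?thesis unfolding d m by (simp add: algebra_simps)
qed

text \<open>Half-open cubes of side \<open>d\<close>, which partition the space; \<open>z\<close> lists the integer coordinates of a
  corner, indexed by the basis vectors.\<close>

definition cell :: "real \<Rightarrow> ('a::euclidean_space \<Rightarrow> int) \<Rightarrow> 'a set" where
  "cell d z = {x. \<forall>i\<in>Basis. real_of_int (z i) * d \<le> x \<bullet> i \<and> x \<bullet> i < (real_of_int (z i) + 1) * d}"

text \<open>The value \<open>0\<close> away from the basis makes the index a single function for each cell.\<close>

definition cell_index :: "real \<Rightarrow> 'a::euclidean_space \<Rightarrow> 'a \<Rightarrow> int" where
  "cell_index d x = (\<lambda>i. if i \<in> Basis then \<lfloor>(x \<bullet> i) / d\<rfloor> else 0)"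

definition cell_average :: "real \<Rightarrow> ('a::euclidean_space \<Rightarrow> real) \<Rightarrow> ('a \<Rightarrow> int) \<Rightarrow> real" where
  "cell_average d f z = (LINT x|restrict_space lborel (cell d z). f x) / d ^ DIM('a)"

lemma cell_borel [measurable]: "cell d z \<in> sets borel"
proof -
  have "cell d z = (\<Inter>i\<in>Basis. {x. real_of_int (z i) * d \<le> x \<bullet> i} \<inter> {x. x \<bullet> i < (real_of_int (z i) + 1) * d})"
    by (auto simp: cell_def)
  also have "\<dots> \<in> sets borel"
    by (intro sets.finite_INT finite_Basis nonempty_Basis sets.Int borel_closed borel_open
        closed_Collect_le open_Collect_less continuous_intros)
  finally show ?thesis .
qed

lemma emeasure_cell:
  assumes d: "0 < d"
  shows "emeasure lborel (cell d (z :: 'a::euclidean_space \<Rightarrow> int)) = ennreal (d ^ DIM('a))"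
proof -
  define a :: 'a where "a = (\<Sum>i\<in>Basis. (real_of_int (z i) * d) *\<^sub>R i)"
  define b :: 'a where "b = (\<Sum>i\<in>Basis. ((real_of_int (z i) + 1) * d) *\<^sub>R i)"
  have ai: "a \<bullet> i = real_of_int (z i) * d" and bi: "b \<bullet> i = (real_of_int (z i) + 1) * d" if "i \<in> Basis" for i
    using that by (simp_all add: a_def b_def)
  have le: "a \<bullet> i \<le> b \<bullet> i" if "i \<in> Basis" for i using ai[OF that] bi[OF that] d by (simp add: algebra_simps)
  have e: "(\<Prod>i\<in>Basis. (b - a) \<bullet> i) = d ^ DIM('a)"
  proof -
    have "(\<Prod>i\<in>Basis. (b - a) \<bullet> i) = (\<Prod>i\<in>(Basis::'a set). d)"
      by (rule prod.cong) (auto simp: inner_diff_left ai bi algebra_simps)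
    then show ?thesis by simp
  qed
  have 1: "box a b \<subseteq> cell d z" by (auto simp: mem_box cell_def ai bi less_imp_le)
  have 2: "cell d z \<subseteq> cbox a b" by (auto simp: mem_box cell_def ai bi less_imp_le)
  have m1: "emeasure lborel (box a b) = ennreal (d ^ DIM('a))"
    using emeasure_lborel_box[of a b] le e by (simp add: prod_ennreal)
  have m2: "emeasure lborel (cbox a b) = ennreal (d ^ DIM('a))"
    using emeasure_lborel_cbox_eq[of a b] le e by (simp add: prod_ennreal)
  have "emeasure lborel (box a b) \<le> emeasure lborel (cell d z)"
    by (rule emeasure_mono[OF 1]) simp
  moreover have "emeasure lborel (cell d z) \<le> emeasure lborel (cbox a b)"
    by (rule emeasure_mono[OF 2]) simp
  ultimately show ?thesis using m1 m2 by (intro antisym) auto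
qed

lemma cell_index:
  assumes d: "0 < d"
  shows "x \<in> cell d (cell_index d x)" "x \<in> cell d z \<Longrightarrow> i \<in> Basis \<Longrightarrow> z i = \<lfloor>(x \<bullet> i) / d\<rfloor>"
proof -
  have f: "real_of_int \<lfloor>(x \<bullet> i) / d\<rfloor> * d \<le> x \<bullet> i" "x \<bullet> i < (real_of_int \<lfloor>(x \<bullet> i) / d\<rfloor> + 1) * d" for i
  proof -
    have f1: "real_of_int \<lfloor>(x \<bullet> i) / d\<rfloor> \<le> (x \<bullet> i) / d" and f2: "(x \<bullet> i) / d < real_of_int \<lfloor>(x \<bullet> i) / d\<rfloor> + 1"
      by linarith+
    show "real_of_int \<lfloor>(x \<bullet> i) / d\<rfloor> * d \<le> x \<bullet> i" using f1 by (simp only: pos_le_divide_eq[OF d])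
    show "x \<bullet> i < (real_of_int \<lfloor>(x \<bullet> i) / d\<rfloor> + 1) * d" using f2 by (simp only: pos_divide_less_eq[OF d])
  qed
  then show "x \<in> cell d (cell_index d x)" by (auto simp: cell_def cell_index_def)
  show "z i = \<lfloor>(x \<bullet> i) / d\<rfloor>" if "x \<in> cell d z" "i \<in> Basis"
    using that d by (intro floor_unique[symmetric]) (auto simp: cell_def pos_le_divide_eq pos_divide_less_eq)
qed

lemma finite_measure_cell:
  assumes "0 < d"
  shows "finite_measure (restrict_space lborel (cell d z))"
    "measure (restrict_space lborel (cell d (z :: 'a::euclidean_space \<Rightarrow> int))) (space (restrict_space lborel (cell d z))) = d ^ DIM('a)"
proof -
  have e: "emeasure (restrict_space lborel (cell d z)) (space (restrict_space lborel (cell d z))) = ennreal (d ^ DIM('a))"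
    using emeasure_cell[OF assms, of z] by (simp add: space_restrict_space emeasure_restrict_space)
  then show "finite_measure (restrict_space lborel (cell d z))" by (intro finite_measureI) simp
  show "measure (restrict_space lborel (cell d z)) (space (restrict_space lborel (cell d z))) = d ^ DIM('a)"
    using e assms by (simp add: measure_def)
qed

text \<open>The mean of \<open>c - f\<close> over the cell is \<open>c - cell_average d f z\<close>, so that this is Jensen's inequality.
  It is stated for the nonnegative integral because Tonelli's theorem is applied to the right-hand
  side.\<close>

lemma cell_average_le:
  fixes f :: "'a::euclidean_space \<Rightarrow> real"
  assumes s: "1 < s" and d: "0 < d" and f: "f \<in> borel_measurable borel" and B: "\<And>x. norm (f x) \<le> B"
  shows "ennreal (\<bar>c - cell_average d f z\<bar> powr s) * ennreal (d ^ DIM('a))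
    \<le> (\<integral>\<^sup>+y. ennreal (\<bar>c - f y\<bar> powr s) * indicator (cell d z) y \<partial>lborel)"
proof -
  define R where "R = restrict_space lborel (cell d z)"
  interpret R: finite_measure R unfolding R_def by (rule finite_measure_cell(1)[OF d])
  have mR: "measure R (space R) = d ^ DIM('a)" unfolding R_def by (rule finite_measure_cell(2)[OF d])
  have fR: "f \<in> borel_measurable R" unfolding R_def using f by (intro measurable_restrict_space1) simp
  have iR: "integrable R f"
    by (rule R.integrable_const_bound[of _ B]) (use fR B in auto)
  have gm: "(\<lambda>y. c - f y) \<in> borel_measurable R" using fR by measurable
  have "0 \<le> B" using B[of 0] norm_ge_zero order_trans by blast
  have gL: "(\<lambda>y. c - f y) \<in> Lp s R"
    unfolding Lp_def
  proof (intro CollectI conjI gm R.integrable_const_bound[of _ "(\<bar>c\<bar> + B) powr s"] AE_I2)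
    fix y
    have "norm (c - f y) \<le> \<bar>c\<bar> + B" using B[of y] norm_triangle_ineq4[of c "f y"] by simp
    then show "norm (norm (c - f y) powr s) \<le> (\<bar>c\<bar> + B) powr s" using s by (auto intro!: powr_mono2)
  qed (use gm in measurable)
  have "(LINT y|R. c - f y) = (c - cell_average d f z) * measure R (space R)"
    using iR d by (simp add: mR cell_average_def R_def[symmetric] left_diff_distrib)
  then have "\<bar>c - cell_average d f z\<bar> powr s * d ^ DIM('a) \<le> modular s R (\<lambda>y. c - f y)"
    using R.modular_mean_le[OF s gL] mR by simp
  then have "ennreal (\<bar>c - cell_average d f z\<bar> powr s * d ^ DIM('a)) \<le> ennreal (modular s R (\<lambda>y. c - f y))"
    by (rule ennreal_leI)
  also have "ennreal (modular s R (\<lambda>y. c - f y)) = (\<integral>\<^sup>+y. ennreal (\<bar>c - f y\<bar> powr s) \<partial>R)"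
    unfolding modular_def using LpD(2)[OF gL] by (subst nn_integral_eq_integral[symmetric]) auto
  also have "\<dots> = (\<integral>\<^sup>+y. ennreal (\<bar>c - f y\<bar> powr s) * indicator (cell d z) y \<partial>lborel)"
    unfolding R_def by (rule nn_integral_restrict_space) simp
  finally show ?thesis using d by (simp add: ennreal_mult)
qed

lemma nn_integral_lborel_translation:
  fixes f :: "'a::euclidean_space \<Rightarrow> ennreal"
  assumes "f \<in> borel_measurable borel"
  shows "(\<integral>\<^sup>+h. f (x + h) \<partial>lborel) = (\<integral>\<^sup>+y. f y \<partial>lborel)"
proof -
  have "(\<integral>\<^sup>+y. f y \<partial>lborel) = (\<integral>\<^sup>+y. f y \<partial>distr lborel borel ((+) x))" by (simp add: lborel_distr_plus)
  also have "\<dots> = (\<integral>\<^sup>+h. f (x + h) \<partial>lborel)" using assms by (intro nn_integral_distr) auto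
  finally show ?thesis by simp
qed

lemma powr_scale_small:
  fixes c e s :: real
  assumes "0 \<le> c" "0 < e" "0 < s"
  obtains d where "0 < d" "c * d powr s < e"
proof (rule that[of "(e / (c + 1)) powr (1 / s)"])
  show "0 < (e / (c + 1)) powr (1 / s)" using assms by simp
  have "((e / (c + 1)) powr (1 / s)) powr s = e / (c + 1)" using assms by (simp add: powr_powr)
  moreover have "c * (e / (c + 1)) < (c + 1) * (e / (c + 1))" using assms by (intro mult_strict_right_mono) auto
  moreover have "(c + 1) * (e / (c + 1)) = e" using assms(1) by simp
  ultimately show "c * ((e / (c + 1)) powr (1 / s)) powr s < e" by simp
qed

context bounded_open
begin

lemma test_function_bounded:
  assumes "test_function \<Omega> \<phi>"
  obtains B where "0 < B" "\<And>x. norm (\<phi> x) \<le> B"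
proof (rule test_function_bounds[OF assms, of 0])
  fix B assume "0 < B" "\<And>x. norm (\<phi> x) \<le> B"
  then show thesis by (rule that)
qed

text \<open>On a cell of side \<open>d\<close>, the distance of a function to its mean is controlled by its increments
  over vectors in the cube of half-side \<open>d\<close>. Integrated over all cells and combined with the
  translation estimate, this approximates test functions by step functions on finitely many cells,
  uniformly on bounded sets of gradients.\<close>

lemma cell_approximation:
  fixes d :: real and R :: real
  assumes d: "0 < d" and R: "\<And>x. x \<in> \<Omega> \<Longrightarrow> norm x \<le> R"
  obtains Z :: "('a \<Rightarrow> int) set" where "finite Z" "\<And>x. x \<in> \<Omega> \<Longrightarrow> cell_index d x \<in> Z"
    "\<And>\<phi>. test_function \<Omega> \<phi> \<Longrightarrow> (\<lambda>x. cell_average d \<phi> (cell_index d x)) \<in> Lp q M \<and>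
      modular q M (\<lambda>x. \<phi> x - cell_average d \<phi> (cell_index d x))
        \<le> 2 ^ DIM('a) * (real DIM('a) * d) powr q * modular q M (grad \<phi>)"
proof -
  define m where "m = \<lceil>R / d\<rceil> + 1"
  define Z where "Z = {z :: 'a \<Rightarrow> int. \<forall>i. (i \<in> Basis \<longrightarrow> z i \<in> {-m..m}) \<and> (i \<notin> Basis \<longrightarrow> z i = 0)}"
  have fZ: "finite Z" unfolding Z_def by (rule finite_set_of_finite_funs) auto
  have iZ: "cell_index d x \<in> Z" if "x \<in> \<Omega>" for x
  proof -
    have "\<lfloor>(x \<bullet> i) / d\<rfloor> \<in> {-m..m}" if i: "i \<in> Basis" for i
    proof -
      have "\<bar>x \<bullet> i\<bar> \<le> R" using Basis_le_norm[OF i, of x] R[OF \<open>x \<in> \<Omega>\<close>] by linarith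
      then have "(x \<bullet> i) / d \<le> R / d" "- (R / d) \<le> (x \<bullet> i) / d"
        using d by (auto simp: divide_right_mono minus_divide_left simp del: minus_divide_left[symmetric] intro!: divide_right_mono)
      then show ?thesis unfolding m_def by (simp add: floor_le_iff le_floor_iff) linarith
    qed
    then show ?thesis by (auto simp: Z_def cell_index_def)
  qed
  show ?thesis
  proof (rule that[OF fZ iZ])
    fix \<phi> assume \<phi>: "test_function \<Omega> \<phi>"
    note i = test_function_integrable[OF \<phi>]
    have m [measurable]: "\<phi> \<in> borel_measurable borel" by (rule i(2))
    obtain B where B: "0 < B" "\<And>x. norm (\<phi> x) \<le> B" using test_function_bounded[OF \<phi>] by blast
    define P where "P = (\<lambda>x. \<Sum>z\<in>Z. cell_average d \<phi> z * indicator (cell d z) x)"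
    have PM [measurable]: "P \<in> borel_measurable borel" unfolding P_def by measurable
    have Peq: "P x = cell_average d \<phi> (cell_index d x)" if x: "x \<in> \<Omega>" for x
    proof -
      have ind: "indicator (cell d z) x = (if z = cell_index d x then 1 else (0::real))" if z: "z \<in> Z" for z
      proof -
        have "z = cell_index d x" if xz: "x \<in> cell d z"
        proof
          show "z i = cell_index d x i" for i
            using cell_index(2)[OF d xz, of i] z by (cases "i \<in> Basis") (auto simp: Z_def cell_index_def)
        qed
        then show ?thesis using cell_index(1)[OF d, of x] by (cases "z = cell_index d x") (auto simp: indicator_def)
      qed
      have "P x = (\<Sum>z\<in>Z. if z = cell_index d x then cell_average d \<phi> z else 0)"
        unfolding P_def by (rule sum.cong[OF refl]) (simp add: ind)
      also have "\<dots> = cell_average d \<phi> (cell_index d x)" using iZ[OF x] fZ by (simp add: sum.delta')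
      finally show ?thesis .
    qed
    define H :: "'a set" where "H = cbox (- (d *\<^sub>R One)) (d *\<^sub>R One)"
    have H [measurable]: "H \<in> sets borel" by (simp add: H_def)
    have pt: "ennreal (\<bar>\<phi> x - P x\<bar> powr q) * ennreal (d ^ DIM('a)) \<le> (\<integral>\<^sup>+h. ennreal (\<bar>\<phi> (x + h) - \<phi> x\<bar> powr q) * indicator H h \<partial>lborel)"
      if x: "x \<in> \<Omega>" for x
    proof -
      let ?z = "cell_index d x"
      have "ennreal (\<bar>\<phi> x - P x\<bar> powr q) * ennreal (d ^ DIM('a)) \<le> (\<integral>\<^sup>+y. ennreal (\<bar>\<phi> x - \<phi> y\<bar> powr q) * indicator (cell d ?z) y \<partial>lborel)"
        unfolding Peq[OF x] by (rule cell_average_le[OF q_gt_1 d m B(2)])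
      also have "\<dots> = (\<integral>\<^sup>+h. ennreal (\<bar>\<phi> x - \<phi> (x + h)\<bar> powr q) * indicator (cell d ?z) (x + h) \<partial>lborel)"
        by (rule nn_integral_lborel_translation[symmetric]) measurable
      also have "\<dots> \<le> (\<integral>\<^sup>+h. ennreal (\<bar>\<phi> (x + h) - \<phi> x\<bar> powr q) * indicator H h \<partial>lborel)"
      proof (rule nn_integral_mono)
        fix h :: 'a
        have "h \<in> H" if "x + h \<in> cell d ?z"
        proof -
          have "-d \<le> h \<bullet> i \<and> h \<bullet> i \<le> d" if "i \<in> Basis" for i
            using \<open>x + h \<in> cell d ?z\<close> cell_index(1)[OF d, of x] that
            by (auto simp: cell_def inner_add_left algebra_simps dest!: bspec[of _ _ i])
          then show ?thesis by (auto simp: H_def mem_box)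
        qed
        then show "ennreal (\<bar>\<phi> x - \<phi> (x + h)\<bar> powr q) * indicator (cell d ?z) (x + h) \<le> ennreal (\<bar>\<phi> (x + h) - \<phi> x\<bar> powr q) * indicator H h"
          by (auto simp: indicator_def abs_minus_commute)
      qed
      finally show ?thesis .
    qed
    define A where "A = modular q M (grad \<phi>)"
    have A0: "0 \<le> A" by (simp add: A_def)
    have inner: "(\<integral>\<^sup>+x. ennreal (\<bar>\<phi> (x + h) - \<phi> x\<bar> powr q) * indicator H h \<partial>lborel)
      \<le> ennreal ((real DIM('a) * d) powr q * A) * indicator H h" for h
    proof (cases "h \<in> H")
      case True
      have "\<bar>h \<bullet> i\<bar> \<le> d" if "i \<in> Basis" for i using True that by (force simp: H_def mem_box abs_le_iff)
      then have "(\<Sum>i\<in>Basis. \<bar>h \<bullet> i\<bar>) \<le> (\<Sum>i\<in>(Basis::'a set). d)" by (rule sum_mono)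
      then have nh: "norm h \<le> real DIM('a) * d" using norm_le_l1[of h] by simp
      obtain K where K: "compact K" "K \<subseteq> \<Omega>" "\<And>x. x \<notin> K \<Longrightarrow> \<phi> x = 0" "\<And>x. x \<notin> K \<Longrightarrow> classical_gradient \<phi> x = 0"
        using test_function_support[OF \<phi>] by blast
      have cK: "compact (K \<union> (\<lambda>x. x - h) ` K)" using K(1) by (intro compact_Un compact_continuous_image continuous_intros)
      have c: "continuous_on UNIV (\<lambda>x. \<phi> (x + h) - \<phi> x)"
        by (intro continuous_intros continuous_on_compose2[OF test_function_continuous(1)[OF \<phi>]] test_function_continuous(1)[OF \<phi>]) auto
      have z: "\<phi> (x + h) - \<phi> x = 0" if "x \<notin> K \<union> (\<lambda>x. x - h) ` K" for x
      proof -
        have "x + h \<notin> K"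
        proof
          assume "x + h \<in> K"
          then have "(x + h) - h \<in> (\<lambda>x. x - h) ` K" by (rule imageI)
          then show False using that by simp
        qed
        then show ?thesis using K(3)[of x] K(3)[of "x + h"] that by simp
      qed
      have L: "(\<lambda>x. \<phi> (x + h) - \<phi> x) \<in> Lp q lborel" by (rule Lp_continuous_compact_support[OF c cK z q_ge(2)])
      have "(\<integral>\<^sup>+x. ennreal (\<bar>\<phi> (x + h) - \<phi> x\<bar> powr q) \<partial>lborel) = ennreal (modular q lborel (\<lambda>x. \<phi> (x + h) - \<phi> x))"
        unfolding modular_def using LpD(2)[OF L] by (subst nn_integral_eq_integral) auto
      also have "\<dots> \<le> ennreal ((real DIM('a) * d) powr q * A)"
      proof (rule ennreal_leI)
        have "modular q lborel (\<lambda>x. \<phi> (x + h) - \<phi> x) \<le> norm h powr q * modular q lborel (classical_gradient \<phi>)"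
          by (rule translation_estimate[OF \<phi> q_ge(1)])
        also have "\<dots> = norm h powr q * A" unfolding A_def modular_grad_test_function[OF \<phi>] ..
        also have "\<dots> \<le> (real DIM('a) * d) powr q * A"
          using nh q_ge A0 by (intro mult_right_mono powr_mono2) auto
        finally show "modular q lborel (\<lambda>x. \<phi> (x + h) - \<phi> x) \<le> (real DIM('a) * d) powr q * A" .
      qed
      finally show ?thesis using True by simp
    qed simp
    have eH: "emeasure lborel H = ennreal ((2 * d) ^ DIM('a))"
    proof -
      have "emeasure lborel H = ennreal (\<Prod>b\<in>(Basis::'a set). (d *\<^sub>R One - - (d *\<^sub>R One)) \<bullet> b)"
        unfolding H_def emeasure_lborel_cbox_eq using d by (simp add: prod_ennreal)
      also have "(\<Prod>b\<in>(Basis::'a set). (d *\<^sub>R One - - (d *\<^sub>R One)) \<bullet> b) = (\<Prod>b\<in>(Basis::'a set). 2 * d)"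
        by (rule prod.cong) (auto simp: inner_add_left)
      finally show ?thesis by simp
    qed
    define I where "I = (\<integral>\<^sup>+x. ennreal (\<bar>\<phi> x - P x\<bar> powr q) * indicator \<Omega> x \<partial>lborel)"
    have Ob [measurable]: "\<Omega> \<in> sets borel" using open_domain by (rule borel_open)
    have "I * ennreal (d ^ DIM('a)) = (\<integral>\<^sup>+x. ennreal (\<bar>\<phi> x - P x\<bar> powr q) * indicator \<Omega> x * ennreal (d ^ DIM('a)) \<partial>lborel)"
      unfolding I_def by (rule nn_integral_multc[symmetric]) measurable
    also have "\<dots> \<le> (\<integral>\<^sup>+x. (\<integral>\<^sup>+h. ennreal (\<bar>\<phi> (x + h) - \<phi> x\<bar> powr q) * indicator H h \<partial>lborel) \<partial>lborel)"
      by (rule nn_integral_mono) (use pt in \<open>auto simp: indicator_def\<close>)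
    also have "\<dots> = (\<integral>\<^sup>+h. (\<integral>\<^sup>+x. ennreal (\<bar>\<phi> (x + h) - \<phi> x\<bar> powr q) * indicator H h \<partial>lborel) \<partial>lborel)"
      by (rule lborel_pair.Fubini') measurable
    also have "\<dots> \<le> (\<integral>\<^sup>+h. ennreal ((real DIM('a) * d) powr q * A) * indicator H h \<partial>lborel)"
      by (rule nn_integral_mono) (rule inner)
    also have "\<dots> = ennreal ((real DIM('a) * d) powr q * A) * ennreal ((2 * d) ^ DIM('a))"
      by (subst nn_integral_cmult_indicator) (auto simp: eH)
    also have "\<dots> = ennreal (2 ^ DIM('a) * (real DIM('a) * d) powr q * A) * ennreal (d ^ DIM('a))"
      using d A0 by (simp add: power_mult_distrib mult_ac flip: ennreal_mult)
    finally have "I * ennreal (d ^ DIM('a)) \<le> ennreal (2 ^ DIM('a) * (real DIM('a) * d) powr q * A) * ennreal (d ^ DIM('a))" .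
    then have I: "I \<le> ennreal (2 ^ DIM('a) * (real DIM('a) * d) powr q * A)"
      using d by (subst (asm) ennreal_mult_le_mult_iff[of "ennreal (d ^ DIM('a))", simplified mult.commute[of "ennreal (d ^ DIM('a))"]]) auto
    have "(\<integral>\<^sup>+x. ennreal (norm (\<phi> x - P x) powr q) \<partial>M) = (\<integral>\<^sup>+x. ennreal (norm (\<phi> x - P x) powr q) * indicator \<Omega> x \<partial>lebesgue)"
      by (rule nn_integral_restrict_space) (simp add: domain_sets)
    also have "\<dots> = I"
      unfolding I_def real_norm_def by (rule nn_integral_completion)
    finally have nI: "(\<integral>\<^sup>+x. ennreal (norm (\<phi> x - P x) powr q) \<partial>M) = I" .
    have dM: "(\<lambda>x. \<phi> x - P x) \<in> borel_measurable M"
      by (intro measurable_restrict_space1 lebesgue_measurable_borel) measurable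
    have int: "integrable M (\<lambda>x. norm (\<phi> x - P x) powr q)"
      by (rule integrableI_nonneg) (use dM nI I in \<open>auto intro: le_less_trans\<close>)
    then have dL: "(\<lambda>x. \<phi> x - P x) \<in> Lp q M" using dM by (simp add: Lp_def)
    have "ennreal (modular q M (\<lambda>x. \<phi> x - P x)) = I"
      unfolding modular_def nI[symmetric] using int by (subst nn_integral_eq_integral) auto
    then have "ennreal (modular q M (\<lambda>x. \<phi> x - P x)) \<le> ennreal (2 ^ DIM('a) * (real DIM('a) * d) powr q * A)" using I by simp
    then have mod: "modular q M (\<lambda>x. \<phi> x - P x) \<le> 2 ^ DIM('a) * (real DIM('a) * d) powr q * A"
      using A0 d by (subst (asm) ennreal_le_iff) auto
    have "(\<lambda>x. \<phi> x - (\<phi> x - P x)) \<in> Lp q M" by (rule Lp_diff[OF q_ge(2) test_function_Lp(1)[OF \<phi> q_ge(2)] dL])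
    then have PL: "P \<in> Lp q M" by simp
    have PL': "(\<lambda>x. cell_average d \<phi> (cell_index d x)) \<in> Lp q M"
    proof -
      have sp: "space M = \<Omega>" by simp
      have "(\<lambda>x. cell_average d \<phi> (cell_index d x)) \<in> borel_measurable M"
        using LpD(1)[OF PL] Peq sp by (subst measurable_cong[of M _ P]) auto
      moreover have "integrable M (\<lambda>x. norm (cell_average d \<phi> (cell_index d x)) powr q)"
        using LpD(2)[OF PL] Peq sp by (subst Bochner_Integration.integrable_cong[of M M _ "\<lambda>x. norm (P x) powr q"]) auto
      ultimately show ?thesis by (simp add: Lp_def)
    qed
    have "modular q M (\<lambda>x. \<phi> x - cell_average d \<phi> (cell_index d x)) = modular q M (\<lambda>x. \<phi> x - P x)"
      unfolding modular_def by (rule Bochner_Integration.integral_cong) (auto simp: Peq)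
    then show "(\<lambda>x. cell_average d \<phi> (cell_index d x)) \<in> Lp q M \<and>
      modular q M (\<lambda>x. \<phi> x - cell_average d \<phi> (cell_index d x))
        \<le> 2 ^ DIM('a) * (real DIM('a) * d) powr q * modular q M (grad \<phi>)"
      using mod PL' unfolding A_def by simp
  qed
qed

lemma cell_average_bound:
  assumes \<phi>: "test_function \<Omega> \<phi>" and d: "0 < d"
  shows "\<bar>cell_average d \<phi> z\<bar> powr q * d ^ DIM('a) \<le> modular q M \<phi>"
proof -
  obtain B where B: "0 < B" "\<And>x. norm (\<phi> x) \<le> B" using test_function_bounded[OF \<phi>] by blast
  obtain K where K: "compact K" "K \<subseteq> \<Omega>" "\<And>x. x \<notin> K \<Longrightarrow> \<phi> x = 0" "\<And>x. x \<notin> K \<Longrightarrow> classical_gradient \<phi> x = 0"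
    using test_function_support[OF \<phi>] by blast
  have L: "\<phi> \<in> Lp q lborel"
    by (rule Lp_continuous_compact_support[OF test_function_continuous(1)[OF \<phi>] K(1,3) q_ge(2)])
  have "ennreal (\<bar>0 - cell_average d \<phi> z\<bar> powr q) * ennreal (d ^ DIM('a))
    \<le> (\<integral>\<^sup>+y. ennreal (\<bar>0 - \<phi> y\<bar> powr q) * indicator (cell d z) y \<partial>lborel)"
    by (rule cell_average_le[OF q_gt_1 d test_function_integrable(2)[OF \<phi>] B(2)])
  also have "\<dots> \<le> (\<integral>\<^sup>+y. ennreal (norm (\<phi> y) powr q) \<partial>lborel)"
    by (rule nn_integral_mono) (auto simp: indicator_def)
  also have "\<dots> = ennreal (modular q M \<phi>)"
    unfolding modular_test_function[OF \<phi>] unfolding modular_def using LpD(2)[OF L] by (intro nn_integral_eq_integral) auto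
  finally have "ennreal (\<bar>cell_average d \<phi> z\<bar> powr q * d ^ DIM('a)) \<le> ennreal (modular q M \<phi>)"
    using d by (simp add: ennreal_mult)
  then show ?thesis by (subst (asm) ennreal_le_iff) auto
qed

text \<open>Total boundedness of gradient-bounded sets in \<open>L\<^sup>q\<close>: the finitely many cell averages, rounded
  to multiples of \<open>\<eta>\<close>, determine a test function up to a small error.\<close>

lemma finite_code_test_functions:
  assumes e: "0 < e" and K: "0 \<le> K"
  obtains code :: "('a \<Rightarrow> real) \<Rightarrow> ('a \<Rightarrow> int) \<Rightarrow> int"
  where "finite (code ` {\<phi>. test_function \<Omega> \<phi> \<and> modular q M (grad \<phi>) \<le> K})"
    "\<And>\<phi> \<psi>. test_function \<Omega> \<phi> \<Longrightarrow> test_function \<Omega> \<psi> \<Longrightarrow> modular q M (grad \<phi>) \<le> K \<Longrightarrow> modular q M (grad \<psi>) \<le> K \<Longrightarrow>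
      code \<phi> = code \<psi> \<Longrightarrow> modular q M (\<lambda>x. \<phi> x - \<psi> x) < e"
proof -
  obtain R where R: "\<And>x. x \<in> \<Omega> \<Longrightarrow> norm x \<le> R" using bounded_domain unfolding bounded_iff by blast
  obtain C where C: "0 < C" "\<And>u. u \<in> W \<Longrightarrow> modular q M u \<le> C * modular q M (grad u)" using Poincare by blast
  define \<mu> where "\<mu> = measure M (space M)"
  have \<mu>: "0 \<le> \<mu>" by (simp add: \<mu>_def)
  let ?Q = "2 powr q :: real"
  define c where "c = (?Q + ?Q * ?Q) * (2 ^ DIM('a) * real DIM('a) powr q * K)"
  have c0: "0 \<le> c" using K by (simp add: c_def)
  obtain d where d: "0 < d" "c * d powr q < e / 2" using powr_scale_small[OF c0, of "e / 2" q] e q_ge by auto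
  obtain \<eta> where \<eta>: "0 < \<eta>" "(?Q * ?Q * \<mu>) * \<eta> powr q < e / 2"
    using powr_scale_small[of "?Q * ?Q * \<mu>" "e / 2" q] e q_ge \<mu> by auto
  obtain Z :: "('a \<Rightarrow> int) set" where Z: "finite Z" "\<And>x. x \<in> \<Omega> \<Longrightarrow> cell_index d x \<in> Z"
    "\<And>\<phi>. test_function \<Omega> \<phi> \<Longrightarrow> (\<lambda>x. cell_average d \<phi> (cell_index d x)) \<in> Lp q M \<and>
      modular q M (\<lambda>x. \<phi> x - cell_average d \<phi> (cell_index d x))
        \<le> 2 ^ DIM('a) * (real DIM('a) * d) powr q * modular q M (grad \<phi>)"
    using cell_approximation[OF d(1) R] by blast
  define code where "code = (\<lambda>\<phi> z. if z \<in> Z then \<lfloor>cell_average d \<phi> z / \<eta>\<rfloor> else 0)"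
  define B where "B = (C * K / d ^ DIM('a)) powr (1 / q)"
  define b where "b = \<lceil>B / \<eta>\<rceil> + 1"
  show ?thesis
  proof (rule that[of code])
    have "finite {g :: ('a \<Rightarrow> int) \<Rightarrow> int. \<forall>z. (z \<in> Z \<longrightarrow> g z \<in> {-b..b}) \<and> (z \<notin> Z \<longrightarrow> g z = 0)}"
      by (rule finite_set_of_finite_funs) (use Z(1) in auto)
    moreover have "code ` {\<phi>. test_function \<Omega> \<phi> \<and> modular q M (grad \<phi>) \<le> K}
      \<subseteq> {g. \<forall>z. (z \<in> Z \<longrightarrow> g z \<in> {-b..b}) \<and> (z \<notin> Z \<longrightarrow> g z = 0)}"
    proof (clarsimp simp: code_def)
      fix \<phi> z assume \<phi>: "test_function \<Omega> \<phi>" "modular q M (grad \<phi>) \<le> K"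
      have "\<bar>cell_average d \<phi> z\<bar> powr q * d ^ DIM('a) \<le> modular q M \<phi>" by (rule cell_average_bound[OF \<phi>(1) d(1)])
      also have "\<dots> \<le> C * modular q M (grad \<phi>)" by (rule C(2)[OF test_function_W[OF \<phi>(1)]])
      also have "\<dots> \<le> C * K" using \<phi>(2) C(1) by (intro mult_left_mono) auto
      finally have "\<bar>cell_average d \<phi> z\<bar> powr q \<le> C * K / d ^ DIM('a)" using d(1) by (simp add: pos_le_divide_eq)
      then have "(\<bar>cell_average d \<phi> z\<bar> powr q) powr (1 / q) \<le> B" unfolding B_def using q_ge by (intro powr_mono2) auto
      then have "\<bar>cell_average d \<phi> z\<bar> \<le> B" using q_ge by (simp add: powr_powr)
      then have "cell_average d \<phi> z / \<eta> \<le> B / \<eta>" "- B / \<eta> \<le> cell_average d \<phi> z / \<eta>"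
        using \<eta>(1) by (auto intro!: divide_right_mono simp del: minus_divide_left[symmetric])
      then show "- b \<le> \<lfloor>cell_average d \<phi> z / \<eta>\<rfloor> \<and> \<lfloor>cell_average d \<phi> z / \<eta>\<rfloor> \<le> b"
        unfolding b_def by (simp add: floor_le_iff le_floor_iff) linarith
    qed
    ultimately show "finite (code ` {\<phi>. test_function \<Omega> \<phi> \<and> modular q M (grad \<phi>) \<le> K})"
      by (rule finite_subset[rotated])
    fix \<phi> \<psi> assume \<phi>: "test_function \<Omega> \<phi>" "modular q M (grad \<phi>) \<le> K"
      and \<psi>: "test_function \<Omega> \<psi>" "modular q M (grad \<psi>) \<le> K" and eq: "code \<phi> = code \<psi>"
    define P where "P = (\<lambda>(\<phi> :: 'a \<Rightarrow> real) x. cell_average d \<phi> (cell_index d x))"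
    define T where "T = 2 ^ DIM('a) * (real DIM('a) * d) powr q * K"
    have PL: "P f \<in> Lp q M" and PT: "modular q M (\<lambda>x. f x - P f x) \<le> T"
      if f: "test_function \<Omega> f" "modular q M (grad f) \<le> K" for f
    proof -
      show "P f \<in> Lp q M" using Z(3)[OF f(1)] unfolding P_def by blast
      have "modular q M (\<lambda>x. f x - P f x) \<le> 2 ^ DIM('a) * (real DIM('a) * d) powr q * modular q M (grad f)"
        using Z(3)[OF f(1)] unfolding P_def by blast
      also have "\<dots> \<le> T" unfolding T_def using f(2) by (intro mult_left_mono) auto
      finally show "modular q M (\<lambda>x. f x - P f x) \<le> T" .
    qed
    have Pd: "norm (P \<phi> x - P \<psi> x) \<le> \<eta>" if x: "x \<in> \<Omega>" for x
    proof -
      let ?z = "cell_index d x"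
      have "\<lfloor>cell_average d \<phi> ?z / \<eta>\<rfloor> = \<lfloor>cell_average d \<psi> ?z / \<eta>\<rfloor>"
        using fun_cong[OF eq, of ?z] Z(2)[OF x] by (simp add: code_def)
      then have "\<bar>cell_average d \<phi> ?z / \<eta> - cell_average d \<psi> ?z / \<eta>\<bar> \<le> 1" by linarith
      then have "\<bar>(cell_average d \<phi> ?z - cell_average d \<psi> ?z) / \<eta>\<bar> \<le> 1" by (simp add: diff_divide_distrib)
      then show ?thesis using \<eta>(1) by (simp add: P_def abs_divide pos_divide_le_eq)
    qed
    have PP: "modular q M (\<lambda>x. P \<phi> x - P \<psi> x) \<le> \<mu> * \<eta> powr q"
    proof -
      have "modular q M (\<lambda>x. P \<phi> x - P \<psi> x) \<le> modular q M (\<lambda>x. \<eta>)"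
      proof (rule modular_mono[OF _ _ q_ge(2)])
        show "(\<lambda>x. P \<phi> x - P \<psi> x) \<in> borel_measurable M" by (rule LpD(1)[OF Lp_diff[OF q_ge(2) PL[OF \<phi>] PL[OF \<psi>]]])
        show "(\<lambda>x. \<eta>) \<in> Lp q M" by (auto simp: Lp_def)
        show "AE x in M. norm (P \<phi> x - P \<psi> x) \<le> norm \<eta>" using Pd \<eta>(1) by (intro AE_I2) auto
      qed
      also have "\<dots> = \<mu> * \<eta> powr q" using \<eta>(1) by (simp add: modular_def \<mu>_def mult.commute)
      finally show ?thesis .
    qed
    note L\<phi> = test_function_Lp(1)[OF \<phi>(1) q_ge(2)] and L\<psi> = test_function_Lp(1)[OF \<psi>(1) q_ge(2)]
    have "modular q M (\<lambda>x. P \<phi> x - \<psi> x) \<le> ?Q * (modular q M (\<lambda>x. P \<phi> x - P \<psi> x) + modular q M (\<lambda>x. P \<psi> x - \<psi> x))"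
      by (rule modular_diff_triangle[OF q_ge(2) PL[OF \<phi>] PL[OF \<psi>] L\<psi>])
    also have "\<dots> \<le> ?Q * (\<mu> * \<eta> powr q + T)"
      using PP PT[OF \<psi>] by (intro mult_left_mono add_mono) (auto simp: modular_minus_commute[of q M "P \<psi>"])
    finally have 1: "modular q M (\<lambda>x. P \<phi> x - \<psi> x) \<le> ?Q * (\<mu> * \<eta> powr q + T)" .
    have "modular q M (\<lambda>x. \<phi> x - \<psi> x) \<le> ?Q * (modular q M (\<lambda>x. \<phi> x - P \<phi> x) + modular q M (\<lambda>x. P \<phi> x - \<psi> x))"
      by (rule modular_diff_triangle[OF q_ge(2) L\<phi> PL[OF \<phi>] L\<psi>])
    also have "\<dots> \<le> ?Q * (T + ?Q * (\<mu> * \<eta> powr q + T))"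
      using 1 PT[OF \<phi>] by (intro mult_left_mono add_mono) auto
    also have "\<dots> = (?Q + ?Q * ?Q) * T + (?Q * ?Q * \<mu>) * \<eta> powr q" by (simp add: algebra_simps)
    also have "(?Q + ?Q * ?Q) * T = c * d powr q" using d(1) by (simp add: T_def c_def powr_mult mult_ac)
    also have "c * d powr q + (?Q * ?Q * \<mu>) * \<eta> powr q < e" using d(2) \<eta>(2) by linarith
    finally show "modular q M (\<lambda>x. \<phi> x - \<psi> x) < e" .
  qed
qed

text \<open>A function in \<open>W\<close> gets the code of a nearby test function, whose gradient may be larger by a
  fixed amount.\<close>

lemma finite_code_W:
  assumes e: "0 < e" and K: "0 \<le> K"
  obtains code :: "('a \<Rightarrow> real) \<Rightarrow> ('a \<Rightarrow> int) \<Rightarrow> int"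
  where "finite (code ` {u \<in> W. modular q M (grad u) \<le> K})"
    "\<And>u v. u \<in> W \<Longrightarrow> v \<in> W \<Longrightarrow> modular q M (grad u) \<le> K \<Longrightarrow> modular q M (grad v) \<le> K \<Longrightarrow>
      code u = code v \<Longrightarrow> modular q M (\<lambda>x. u x - v x) < e"
proof -
  let ?Q = "2 powr q :: real"
  have Q: "1 \<le> ?Q" using q_ge powr_mono[of 0 q 2] by simp
  define d where "d = min 1 (e / (?Q + ?Q * ?Q * 2))"
  have D: "0 < ?Q + ?Q * ?Q * 2" by (intro add_pos_pos mult_pos_pos) auto
  have d: "0 < d" "d \<le> 1" "(?Q + ?Q * ?Q * 2) * d \<le> e"
  proof -
    show "0 < d" "d \<le> 1" using e D by (auto simp: d_def)
    have "(?Q + ?Q * ?Q * 2) * d \<le> (?Q + ?Q * ?Q * 2) * (e / (?Q + ?Q * ?Q * 2))"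
      using D by (intro mult_left_mono) (auto simp: d_def)
    then show "(?Q + ?Q * ?Q * 2) * d \<le> e" using D by simp
  qed
  define K' where "K' = ?Q * (1 + K)"
  have K': "0 \<le> K'" using K by (simp add: K'_def)
  obtain code :: "('a \<Rightarrow> real) \<Rightarrow> ('a \<Rightarrow> int) \<Rightarrow> int"
    where code: "finite (code ` {\<phi>. test_function \<Omega> \<phi> \<and> modular q M (grad \<phi>) \<le> K'})"
    "\<And>\<phi> \<psi>. test_function \<Omega> \<phi> \<Longrightarrow> test_function \<Omega> \<psi> \<Longrightarrow> modular q M (grad \<phi>) \<le> K' \<Longrightarrow> modular q M (grad \<psi>) \<le> K' \<Longrightarrow>
      code \<phi> = code \<psi> \<Longrightarrow> modular q M (\<lambda>x. \<phi> x - \<psi> x) < d"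
    using finite_code_test_functions[OF d(1) K'] by blast
  have "\<forall>u. \<exists>\<phi>. u \<in> W \<longrightarrow> test_function \<Omega> \<phi> \<and> modular q M (\<lambda>x. u x - \<phi> x) < d \<and> modular q M (\<lambda>x. grad u x - grad \<phi> x) < d"
  proof
    show "\<exists>\<phi>. u \<in> W \<longrightarrow> test_function \<Omega> \<phi> \<and> modular q M (\<lambda>x. u x - \<phi> x) < d \<and> modular q M (\<lambda>x. grad u x - grad \<phi> x) < d" for u
    proof (cases "u \<in> W")
      case True
      show ?thesis by (rule W_approx[OF True d(1)]) (intro exI impI conjI)
    qed simp
  qed
  from choice[OF this] obtain a where
    "\<forall>u. u \<in> W \<longrightarrow> test_function \<Omega> (a u) \<and> modular q M (\<lambda>x. u x - a u x) < d \<and> modular q M (\<lambda>x. grad u x - grad (a u) x) < d" ..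
  then have a: "\<And>u. u \<in> W \<Longrightarrow> test_function \<Omega> (a u)" "\<And>u. u \<in> W \<Longrightarrow> modular q M (\<lambda>x. u x - a u x) < d"
    "\<And>u. u \<in> W \<Longrightarrow> modular q M (\<lambda>x. grad u x - grad (a u) x) < d"
    by simp_all
  have aK: "modular q M (grad (a u)) \<le> K'" if u: "u \<in> W" "modular q M (grad u) \<le> K" for u
  proof -
    have "modular q M (grad (a u)) \<le> ?Q * (modular q M (\<lambda>x. grad (a u) x - grad u x) + modular q M (grad u))"
      by (rule modular_le_diff[OF q_ge(2) WD(3)[OF test_function_W[OF a(1)[OF u(1)]]] WD(3)[OF u(1)]])
    also have "\<dots> \<le> ?Q * (1 + K)"
      using a(3)[OF u(1)] d(2) u(2) by (intro mult_left_mono add_mono) (auto simp: modular_minus_commute[of q M "grad (a u)"])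
    finally show ?thesis by (simp add: K'_def)
  qed
  show ?thesis
  proof (rule that[of "\<lambda>u. code (a u)"])
    show "finite ((\<lambda>u. code (a u)) ` {u \<in> W. modular q M (grad u) \<le> K})"
      by (rule finite_subset[OF _ code(1)]) (use a(1) aK in auto)
    fix u v assume u: "u \<in> W" "modular q M (grad u) \<le> K" and v: "v \<in> W" "modular q M (grad v) \<le> K"
      and eq: "code (a u) = code (a v)"
    note Lau = test_function_Lp(1)[OF a(1)[OF u(1)] q_ge(2)] and Lav = test_function_Lp(1)[OF a(1)[OF v(1)] q_ge(2)]
    have 1: "modular q M (\<lambda>x. a u x - a v x) < d"
      by (rule code(2)[OF a(1)[OF u(1)] a(1)[OF v(1)] aK[OF u] aK[OF v] eq])
    have "modular q M (\<lambda>x. a u x - v x) \<le> ?Q * (modular q M (\<lambda>x. a u x - a v x) + modular q M (\<lambda>x. a v x - v x))"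
      by (rule modular_diff_triangle[OF q_ge(2) Lau Lav WD(2)[OF v(1)]])
    also have "\<dots> \<le> ?Q * (d + d)"
      using 1 a(2)[OF v(1)] by (intro mult_left_mono add_mono) (auto simp: modular_minus_commute[of q M "a v"])
    finally have 2: "modular q M (\<lambda>x. a u x - v x) \<le> ?Q * (d + d)" .
    have "modular q M (\<lambda>x. u x - v x) \<le> ?Q * (modular q M (\<lambda>x. u x - a u x) + modular q M (\<lambda>x. a u x - v x))"
      by (rule modular_diff_triangle[OF q_ge(2) WD(2)[OF u(1)] Lau WD(2)[OF v(1)]])
    also have "\<dots> < ?Q * (d + ?Q * (d + d))"
      using 2 a(2)[OF u(1)] by (intro mult_strict_left_mono add_less_le_mono) auto
    also have "\<dots> = (?Q + ?Q * ?Q * 2) * d" by (simp add: algebra_simps)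
    also have "\<dots> \<le> e" by (rule d(3))
    finally show "modular q M (\<lambda>x. u x - v x) < e" .
  qed
qed

text \<open>One representative of each code.\<close>

lemma finite_net:
  assumes e: "0 < e" and K: "0 \<le> K" and S: "S \<subseteq> {u \<in> W. modular q M (grad u) \<le> K}"
  obtains I where "finite I" "I \<subseteq> S" "\<And>u. u \<in> S \<Longrightarrow> \<exists>v\<in>I. modular q M (\<lambda>x. u x - v x) < e"
proof -
  obtain code :: "('a \<Rightarrow> real) \<Rightarrow> ('a \<Rightarrow> int) \<Rightarrow> int"
    where code: "finite (code ` {u \<in> W. modular q M (grad u) \<le> K})"
    "\<And>u v. u \<in> W \<Longrightarrow> v \<in> W \<Longrightarrow> modular q M (grad u) \<le> K \<Longrightarrow> modular q M (grad v) \<le> K \<Longrightarrow>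
      code u = code v \<Longrightarrow> modular q M (\<lambda>x. u x - v x) < e"
    using finite_code_W[OF e K] by blast
  have fin: "finite (code ` S)" by (rule finite_subset[OF image_mono[OF S] code(1)])
  define r where "r = inv_into S code"
  show ?thesis
  proof (rule that[of "r ` code ` S"])
    show "finite (r ` code ` S)" using fin by simp
    show "r ` code ` S \<subseteq> S" unfolding r_def by (auto intro: inv_into_into)
    fix u assume u: "u \<in> S"
    have r: "r (code u) \<in> S" "code (r (code u)) = code u"
      unfolding r_def by (rule inv_into_into[OF imageI[OF u]], rule f_inv_into_f[OF imageI[OF u]])
    have "modular q M (\<lambda>x. u x - r (code u) x) < e" by (rule code(2)) (use u r S in auto)
    then show "\<exists>v\<in>r ` code ` S. modular q M (\<lambda>x. u x - v x) < e" using u by blast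
  qed
qed

text \<open>Rellich's theorem. For each accuracy, one of the finitely many codes occurs infinitely often; the
  diagonal sequence serves all accuracies.\<close>

lemma Cauchy_subsequence:
  fixes u :: "nat \<Rightarrow> 'a \<Rightarrow> real"
  assumes u: "\<And>n. u n \<in> W" "\<And>n. modular q M (grad (u n)) \<le> K"
  obtains r :: "nat \<Rightarrow> nat" where "strict_mono r"
    "\<And>e. 0 < e \<Longrightarrow> \<exists>N. \<forall>i\<ge>N. \<forall>j\<ge>N. modular q M (\<lambda>x. u (r i) x - u (r j) x) < e"
proof -
  have K: "0 \<le> K" by (rule order_trans[OF modular_nonneg u(2)[of 0]])
  define Q where "Q = (\<lambda>(n::nat) (s::nat \<Rightarrow> nat). \<forall>i j. modular q M (\<lambda>x. u (s i) x - u (s j) x) < 1 / real (Suc n))"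
  interpret subseqs Q
  proof
    fix n :: nat and s :: "nat \<Rightarrow> nat"
    have e: "0 < 1 / real (Suc n)" by simp
    obtain code :: "('a \<Rightarrow> real) \<Rightarrow> ('a \<Rightarrow> int) \<Rightarrow> int"
      where code: "finite (code ` {u \<in> W. modular q M (grad u) \<le> K})"
      "\<And>u v. u \<in> W \<Longrightarrow> v \<in> W \<Longrightarrow> modular q M (grad u) \<le> K \<Longrightarrow> modular q M (grad v) \<le> K \<Longrightarrow>
        code u = code v \<Longrightarrow> modular q M (\<lambda>x. u x - v x) < 1 / real (Suc n)"
      using finite_code_W[OF e K] by blast
    have "finite ((\<lambda>i. code (u (s i))) ` UNIV)"
      by (rule finite_subset[OF _ code(1)]) (use u in auto)
    then obtain y where y: "infinite ((\<lambda>i. code (u (s i))) -` {y} \<inter> UNIV)"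
      using inf_img_fin_dom'[of "\<lambda>i. code (u (s i))" UNIV] by auto
    define T where "T = {i. code (u (s i)) = y}"
    have T: "infinite T" using y by (simp add: T_def vimage_def)
    define r where "r = enumerate T"
    have r: "strict_mono r" "\<And>i. r i \<in> T"
      using T strict_mono_enumerate[OF T] enumerate_in_set[OF T] by (auto simp: r_def)
    have "Q n (s \<circ> r)"
      unfolding Q_def comp_def
    proof (intro allI)
      fix i j
      show "modular q M (\<lambda>x. u (s (r i)) x - u (s (r j)) x) < 1 / real (Suc n)"
        by (rule code(2)[OF u(1) u(1) u(2) u(2)]) (use r(2)[of i] r(2)[of j] in \<open>simp add: T_def\<close>)
    qed
    then show "\<exists>r'. strict_mono r' \<and> Q n (s \<circ> r')" using r(1) by blast
  qed
  show ?thesis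
  proof (rule that[OF subseq_diagseq])
    fix e :: real assume e: "0 < e"
    obtain k :: nat where k: "1 / real (Suc k) < e" using nat_approx_posE[OF e] by blast
    have "Q k (diagseq \<circ> ((+) (Suc k)))"
      by (rule diagseq_holds) (auto simp: Q_def)
    then have *: "modular q M (\<lambda>x. u (diagseq (Suc k + i)) x - u (diagseq (Suc k + j)) x) < e" for i j
      using k unfolding Q_def comp_def by (meson less_trans)
    have "modular q M (\<lambda>x. u (diagseq i) x - u (diagseq j) x) < e" if "i \<ge> Suc k" "j \<ge> Suc k" for i j
      using *[of "i - Suc k" "j - Suc k"] that by simp
    then show "\<exists>N. \<forall>i\<ge>N. \<forall>j\<ge>N. modular q M (\<lambda>x. u (diagseq i) x - u (diagseq j) x) < e" by blast
  qed
qed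

end



section \<open>Odd maps of spheres\<close>

definition sphere_norm :: "nat \<Rightarrow> (nat \<Rightarrow> real) \<Rightarrow> real" where
  "sphere_norm n x = sqrt (\<Sum>i\<le>n. (x i)\<^sup>2)"

definition normalise :: "nat \<Rightarrow> (nat \<Rightarrow> real) \<Rightarrow> nat \<Rightarrow> real" where
  "normalise n x = (\<lambda>i. if i \<le> n then x i / sphere_norm n x else 0)"

abbreviation odd_on :: "(nat \<Rightarrow> real) set \<Rightarrow> ((nat \<Rightarrow> real) \<Rightarrow> nat \<Rightarrow> real) \<Rightarrow> bool" where
  "odd_on S f \<equiv> (\<forall>x\<in>S. f (\<lambda>i. - x i) = (\<lambda>i. - f x i))"

lemma topspace_nsphere: "topspace (nsphere n) = {x. (\<Sum>i\<le>n. (x i)\<^sup>2) = 1 \<and> (\<forall>i>n. x i = 0)}"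
  by (auto simp: nsphere)

lemma nsphere_uminus: "x \<in> topspace (nsphere n) \<Longrightarrow> (\<lambda>i. - x i) \<in> topspace (nsphere n)"
  by (simp add: topspace_nsphere)

lemma nsphere_abs_le: "x \<in> topspace (nsphere n) \<Longrightarrow> \<bar>x i\<bar> \<le> 1"
proof (cases "i \<le> n")
  case True
  assume "x \<in> topspace (nsphere n)"
  then have "(x i)\<^sup>2 \<le> 1" using member_le_sum[of i "{..n}" "\<lambda>i. (x i)\<^sup>2"] True by (simp add: topspace_nsphere)
  then show ?thesis by (simp add: abs_square_le_1)
qed (simp add: topspace_nsphere)

lemma nsphere_large_coordinate:
  assumes "x \<in> topspace (nsphere n)"
  obtains j where "j \<le> n" "1 / real (Suc n) \<le> \<bar>x j\<bar>"
proof (rule ccontr)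
  assume "\<not> thesis"
  then have A: "\<And>j. j \<le> n \<Longrightarrow> \<not> 1 / real (Suc n) \<le> \<bar>x j\<bar>" using that by blast
  have "(x j)\<^sup>2 < 1 / real (Suc n)" if j: "j \<in> {..n}" for j
  proof -
    have l: "\<bar>x j\<bar> < 1 / real (Suc n)" using A[of j] j by simp
    have "(x j)\<^sup>2 = \<bar>x j\<bar> * \<bar>x j\<bar>" by (simp add: power2_eq_square)
    also have "\<dots> \<le> 1 * \<bar>x j\<bar>" using nsphere_abs_le[OF assms] by (intro mult_right_mono) auto
    also have "\<dots> < 1 / real (Suc n)" using l by simp
    finally show ?thesis .
  qed
  then have "(\<Sum>i\<le>n. (x i)\<^sup>2) < (\<Sum>i\<le>n. 1 / real (Suc n))" by (intro sum_strict_mono) auto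
  then show False using assms by (simp add: topspace_nsphere)
qed

lemma sphere_norm_pos: "\<exists>i\<le>n. x i \<noteq> 0 \<Longrightarrow> 0 < sphere_norm n x"
proof -
  assume "\<exists>i\<le>n. x i \<noteq> 0"
  then obtain i where "i \<le> n" "x i \<noteq> 0" by blast
  then have "0 < (\<Sum>i\<le>n. (x i)\<^sup>2)" by (intro sum_pos2[of _ i]) auto
  then show ?thesis by (simp add: sphere_norm_def)
qed

lemma normalise_nsphere:
  assumes "\<exists>i\<le>n. x i \<noteq> 0"
  shows "normalise n x \<in> topspace (nsphere n)"
proof -
  have p: "0 < sphere_norm n x" by (rule sphere_norm_pos[OF assms])
  have "(\<Sum>i\<le>n. (normalise n x i)\<^sup>2) = (\<Sum>i\<le>n. (x i)\<^sup>2) / (sphere_norm n x)\<^sup>2"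
    by (simp add: normalise_def power_divide sum_divide_distrib)
  also have "(sphere_norm n x)\<^sup>2 = (\<Sum>i\<le>n. (x i)\<^sup>2)" by (simp add: sphere_norm_def sum_nonneg)
  finally have "(\<Sum>i\<le>n. (normalise n x i)\<^sup>2) = 1" using p by (simp add: sphere_norm_def)
  then show ?thesis by (simp add: topspace_nsphere normalise_def)
qed

lemma normalise_id:
  assumes "x \<in> topspace (nsphere n)"
  shows "normalise n x = x"
  using assms by (auto simp: normalise_def sphere_norm_def topspace_nsphere)

lemma normalise_minus: "normalise n (\<lambda>i. - x i) = (\<lambda>i. - normalise n x i)"
  by (auto simp: normalise_def sphere_norm_def)

text \<open>Radial projection to the sphere. All deformations below take place in the punctured space and are
  transported to the sphere in this way.\<close>

lemma continuous_map_normalise: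
  assumes c: "\<And>i. i \<le> n \<Longrightarrow> continuous_map X euclideanreal (\<lambda>x. g x i)"
    and nz: "\<And>x. x \<in> topspace X \<Longrightarrow> \<exists>i\<le>n. g x i \<noteq> 0"
  shows "continuous_map X (nsphere n) (\<lambda>x. normalise n (g x))"
proof -
  have s: "continuous_map X euclideanreal (\<lambda>x. \<Sum>i\<le>n. (g x i)\<^sup>2)"
    using c by (intro continuous_map_sum continuous_map_real_pow) auto
  have "continuous_map euclideanreal euclideanreal sqrt"
    by (simp add: continuous_on_real_sqrt[OF continuous_on_id])
  then have "continuous_map X euclideanreal (sqrt \<circ> (\<lambda>x. \<Sum>i\<le>n. (g x i)\<^sup>2))"
    by (rule continuous_map_compose[OF s])
  then have n: "continuous_map X euclideanreal (\<lambda>x. sphere_norm n (g x))" by (simp add: sphere_norm_def comp_def)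
  have "continuous_map X euclideanreal (\<lambda>x. normalise n (g x) i)" for i
  proof (cases "i \<le> n")
    case True
    have "sphere_norm n (g x) \<noteq> 0" if "x \<in> topspace X" for x using sphere_norm_pos[OF nz[OF that]] by simp
    then show ?thesis using True c[OF True] n by (simp add: normalise_def continuous_map_real_divide)
  qed (simp add: normalise_def)
  moreover have "normalise n (g x) \<in> topspace (nsphere n)" if "x \<in> topspace X" for x by (rule normalise_nsphere[OF nz[OF that]])
  ultimately show ?thesis
    unfolding nsphere continuous_map_in_subtopology by (auto simp: continuous_map_componentwise_UNIV topspace_nsphere)
qed

lemma degree_linear_homotopy:
  assumes a: "\<And>i. i \<le> n \<Longrightarrow> continuous_map (nsphere n) euclideanreal (\<lambda>x. a x i)"
    and b: "\<And>i. i \<le> n \<Longrightarrow> continuous_map (nsphere n) euclideanreal (\<lambda>x. b x i)"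
    and nz: "\<And>x t. x \<in> topspace (nsphere n) \<Longrightarrow> 0 \<le> t \<Longrightarrow> t \<le> 1 \<Longrightarrow> \<exists>i\<le>n. (1 - t) * a x i + t * b x i \<noteq> 0"
  shows "Brouwer_degree2 n (\<lambda>x. normalise n (a x)) = Brouwer_degree2 n (\<lambda>x. normalise n (b x))"
proof (rule Brouwer_degree2_homotopic)
  define h where "h = (\<lambda>z::real \<times> (nat \<Rightarrow> real). \<lambda>i. (1 - fst z) * a (snd z) i + fst z * b (snd z) i)"
  let ?X = "prod_topology (subtopology euclideanreal {0..1}) (nsphere n)"
  have f: "continuous_map ?X euclideanreal fst"
    by (metis continuous_map_fst continuous_map_into_fulltopology)
  have s: "continuous_map ?X euclideanreal (\<lambda>z. c (snd z))" if "continuous_map (nsphere n) euclideanreal c" for c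
    using continuous_map_compose[OF continuous_map_snd that] by (simp add: comp_def)
  have "continuous_map ?X (nsphere n) (\<lambda>z. normalise n (h z))"
  proof (rule continuous_map_normalise)
    show "continuous_map ?X euclideanreal (\<lambda>z. h z i)" if "i \<le> n" for i
      unfolding h_def
      by (intro continuous_map_add continuous_map_real_mult continuous_map_diff f s[OF a[OF that]] s[OF b[OF that]]) simp
    show "\<exists>i\<le>n. h z i \<noteq> 0" if "z \<in> topspace ?X" for z
      using nz[of "snd z" "fst z"] that by (auto simp: h_def topspace_prod_topology)
  qed
  moreover have "h (0, x) = a x" "h (1, x) = b x" for x by (auto simp: h_def)
  ultimately show "homotopic_with (\<lambda>x. True) (nsphere n) (nsphere n) (\<lambda>x. normalise n (a x)) (\<lambda>x. normalise n (b x))"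
    unfolding homotopic_with_def by (intro exI[of _ "\<lambda>z. normalise n (h z)"]) auto
qed

text \<open>The metric of the function type weighs the coordinates by a summable sequence. On spheres this
  unweighted distance is equivalent and easier to estimate.\<close>

definition coordinate_distance :: "nat \<Rightarrow> (nat \<Rightarrow> real) \<Rightarrow> (nat \<Rightarrow> real) \<Rightarrow> real" where
  "coordinate_distance n x y = (\<Sum>i\<le>n. \<bar>x i - y i\<bar>)"

lemma coordinate_distance_triangle: "coordinate_distance n x z \<le> coordinate_distance n x y + coordinate_distance n y z"
  unfolding coordinate_distance_def sum.distrib[symmetric] by (rule sum_mono) auto

lemma coordinate_distance_nonneg: "0 \<le> coordinate_distance n x y"
  unfolding coordinate_distance_def by (rule sum_nonneg) auto

lemma coordinate_distance_same: "coordinate_distance n x x = 0"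
  by (simp add: coordinate_distance_def)

lemma coordinate_distance_commute: "coordinate_distance n x y = coordinate_distance n y x"
  unfolding coordinate_distance_def by (rule sum.cong) auto

lemma coordinate_distance_minus: "coordinate_distance n (\<lambda>i. - x i) (\<lambda>i. - y i) = coordinate_distance n x y"
  unfolding coordinate_distance_def by (rule sum.cong) auto

lemma compact_nsphere: "compact (topspace (nsphere n))"
proof -
  define B where "B = (\<lambda>i::nat. if i \<le> n then {-1..1::real} else {0})"
  have "compactin (product_topology (\<lambda>i. euclideanreal) UNIV) (PiE UNIV B)"
    unfolding compactin_PiE by (auto simp: B_def)
  then have cB: "compact (PiE UNIV B)" by (simp add: euclidean_product_topology)
  have c: "continuous_on UNIV (\<lambda>x::nat \<Rightarrow> real. x i)" for i by (rule continuous_on_product_coordinates)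
  have "topspace (nsphere n) = {x. (\<Sum>i\<le>n. (x i)\<^sup>2) = 1} \<inter> (\<Inter>i\<in>{n<..}. {x. x i = 0})"
    by (auto simp: topspace_nsphere)
  also have "closed \<dots>"
    by (intro closed_Int closed_INT ballI closed_Collect_eq continuous_on_sum continuous_on_power c continuous_on_const)
  finally have "closed (topspace (nsphere n))" .
  moreover have "topspace (nsphere n) \<subseteq> PiE UNIV B"
  proof
    fix x assume x: "x \<in> topspace (nsphere n)"
    show "x \<in> PiE UNIV B" using nsphere_abs_le[OF x] x by (auto simp: B_def topspace_nsphere abs_le_iff)
  qed
  ultimately show ?thesis using cB by (metis compact_Int_closed inf.absorb2)
qed

lemma continuous_map_nsphere_iff:
  "continuous_map (nsphere n) euclideanreal f \<longleftrightarrow> continuous_on (topspace (nsphere n)) f"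
  unfolding topspace_nsphere by (subst nsphere) (simp add: euclidean_product_topology)

lemma nsphere_uniformly_continuous:
  assumes f: "continuous_map (nsphere n) euclideanreal f" and e: "0 < e"
  obtains d where "0 < d"
    "\<And>x y. x \<in> topspace (nsphere n) \<Longrightarrow> y \<in> topspace (nsphere n) \<Longrightarrow> coordinate_distance n x y < d \<Longrightarrow> \<bar>f x - f y\<bar> < e"
proof -
  let ?S = "topspace (nsphere n)"
  have "continuous_on ?S f" using f by (simp only: continuous_map_nsphere_iff)
  then have "uniformly_continuous_on ?S f" using compact_nsphere by (rule compact_uniformly_continuous)
  then obtain d where d: "0 < d" "\<And>x y. x \<in> ?S \<Longrightarrow> y \<in> ?S \<Longrightarrow> dist y x < d \<Longrightarrow> dist (f y) (f x) < e"
    using e unfolding uniformly_continuous_on_def by metis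
  show ?thesis
  proof (rule that[of "d / 4"])
    show "0 < d / 4" using d by simp
    fix x y assume x: "x \<in> ?S" and y: "y \<in> ?S" and l: "coordinate_distance n x y < d / 4"
    have c: "dist (x i) (y i) \<le> coordinate_distance n x y" for i
    proof (cases "i \<le> n")
      case True
      then show ?thesis unfolding coordinate_distance_def dist_real_def
        by (intro member_le_sum[of i "{..n}" "\<lambda>i. \<bar>x i - y i\<bar>"]) auto
    next
      case False
      then show ?thesis using x y coordinate_distance_nonneg[of n x y] by (simp add: topspace_nsphere)
    qed
    obtain N where N: "(1/2::real) ^ N < d / 2" using real_arch_pow_inv[of "d / 2" "1/2"] d by auto
    have "dist x y \<le> 2 * Max {dist (x (from_nat k)) (y (from_nat k)) | k. k \<le> N} + (1/2) ^ N"
      by (rule dist_fun_le_dist_first_terms)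
    also have "Max {dist (x (from_nat k)) (y (from_nat k)) | k. k \<le> N} \<le> coordinate_distance n x y"
    proof (rule Max.boundedI)
      have "{dist (x (from_nat k)) (y (from_nat k)) | k. k \<le> N} = (\<lambda>k. dist (x (from_nat k)) (y (from_nat k))) ` {..N}" by auto
      then show "finite {dist (x (from_nat k)) (y (from_nat k)) | k. k \<le> N}" by simp
    qed (use c in auto)
    finally have "dist x y < d" using l N by linarith
    then have "dist (f x) (f y) < e" by (intro d(2) x y)
    then show "\<bar>f x - f y\<bar> < e" by (simp add: dist_real_def)
  qed
qed

text \<open>The inf-convolution of a continuous function with a multiple of the distance is a Lipschitz
  approximation.\<close>

lemma Lipschitz_approximation:
  assumes f: "continuous_map (nsphere n) euclideanreal f" and e: "0 < e"
    and f1: "\<And>x. x \<in> topspace (nsphere n) \<Longrightarrow> \<bar>f x\<bar> \<le> 1"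
  obtains g L where "0 \<le> L"
    "\<And>x y. x \<in> topspace (nsphere n) \<Longrightarrow> y \<in> topspace (nsphere n) \<Longrightarrow> \<bar>g x - g y\<bar> \<le> L * coordinate_distance n x y"
    "\<And>x. x \<in> topspace (nsphere n) \<Longrightarrow> \<bar>g x - f x\<bar> \<le> e"
proof -
  let ?S = "topspace (nsphere n)" and ?d = "coordinate_distance n"
  obtain d where d: "0 < d" "\<And>x y. x \<in> ?S \<Longrightarrow> y \<in> ?S \<Longrightarrow> ?d x y < d \<Longrightarrow> \<bar>f x - f y\<bar> < e"
    using nsphere_uniformly_continuous[OF f e] by blast
  define L where "L = 2 / d"
  define g where "g = (\<lambda>x. INF y\<in>?S. f y + L * ?d x y)"
  have L: "0 < L" using d(1) by (simp add: L_def)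
  have ne: "?S \<noteq> {}" using in_topspace_nsphere by blast
  have bdd: "bdd_below ((\<lambda>y. f y + L * ?d x y) ` ?S)" for x
  proof (rule bdd_belowI2[of _ "-1"])
    fix y assume "y \<in> ?S"
    then have "-1 \<le> f y" using f1[of y] by linarith
    then show "-1 \<le> f y + L * ?d x y" using L coordinate_distance_nonneg[of n x y] by (simp add: add_increasing2)
  qed
  have lip: "g x \<le> g y + L * ?d x y" if "x \<in> ?S" "y \<in> ?S" for x y
  proof -
    have "g x - L * ?d x y \<le> g y"
      unfolding g_def
    proof (rule cINF_greatest[OF ne])
      fix z assume z: "z \<in> ?S"
      have "(INF y\<in>?S. f y + L * ?d x y) \<le> f z + L * ?d x z" by (rule cINF_lower[OF bdd z])
      also have "\<dots> \<le> f z + L * (?d x y + ?d y z)"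
        using L coordinate_distance_triangle by (intro add_left_mono mult_left_mono) auto
      finally show "(INF y\<in>?S. f y + L * ?d x y) - L * ?d x y \<le> f z + L * ?d y z" by (simp add: algebra_simps)
    qed
    then show ?thesis by simp
  qed
  show ?thesis
  proof (rule that[of L g])
    show "0 \<le> L" using L by simp
    show "\<bar>g x - g y\<bar> \<le> L * ?d x y" if "x \<in> ?S" "y \<in> ?S" for x y
      using lip[OF that] lip[OF that(2,1)] by (simp add: coordinate_distance_commute[of n y x] abs_le_iff)
    show "\<bar>g x - f x\<bar> \<le> e" if x: "x \<in> ?S" for x
    proof -
      have 1: "g x \<le> f x"
        using cINF_lower[OF bdd x, of x] by (simp add: g_def coordinate_distance_same)
      have "f x - e \<le> g x"
        unfolding g_def
      proof (rule cINF_greatest[OF ne])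
        fix y assume y: "y \<in> ?S"
        show "f x - e \<le> f y + L * ?d x y"
        proof (cases "?d x y < d")
          case True
          have "\<bar>f x - f y\<bar> < e" by (rule d(2)[OF x y True])
          moreover have "0 \<le> L * ?d x y" using L coordinate_distance_nonneg by simp
          ultimately show ?thesis by linarith
        next
          case False
          have "L * d \<le> L * ?d x y" using False L by (intro mult_left_mono) auto
          then have "2 \<le> L * ?d x y" using d(1) by (simp add: L_def)
          then show ?thesis using f1[OF x] f1[OF y] e by linarith
        qed
      qed
      then show ?thesis using 1 e by linarith
    qed
  qed
qed

text \<open>General position. The ratios of a Lipschitz map on a sphere of dimension \<open>m - 1\<close> cannot cover
  the cube \<open>[0, 1)\<^sup>m\<close>: the sphere is covered by \<open>O(M\<^sup>m\<^sup>-\<^sup>1)\<close> pieces so small that the ratios of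
  one piece meet at most one of the \<open>M\<^sup>m\<close> points with coordinates in \<open>{0, 1/M, \<dots>}\<close>.\<close>

lemma Lipschitz_general_position:
  fixes g :: "(nat \<Rightarrow> real) \<Rightarrow> nat \<Rightarrow> real"
  assumes m: "m = Suc n" and L: "0 \<le> L" and c: "0 < c"
    and lip: "\<And>x y i. x \<in> topspace (nsphere n) \<Longrightarrow> y \<in> topspace (nsphere n) \<Longrightarrow> i \<le> m \<Longrightarrow>
      \<bar>g x i - g y i\<bar> \<le> L * coordinate_distance n x y"
    and low: "\<And>x. x \<in> topspace (nsphere n) \<Longrightarrow> \<exists>i\<le>m. c \<le> \<bar>g x i\<bar>"
  obtains v :: "nat \<Rightarrow> real" where "\<And>x. x \<in> topspace (nsphere n) \<Longrightarrow> \<exists>i<m. g x i \<noteq> v i * g x m"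
proof (rule ccontr)
  let ?S = "topspace (nsphere n)" and ?d = "coordinate_distance n"
  assume "\<not> thesis"
  then have "\<forall>v. \<exists>x. x \<in> ?S \<and> (\<forall>i<m. g x i = v i * g x m)" using that by blast
  from choice[OF this] obtain X where X: "\<And>v. X v \<in> ?S" "\<And>v i. i < m \<Longrightarrow> g (X v) i = v i * g (X v) m" by auto
  \<comment> \<open>Refining the grid by the factor \<open>Q\<close> separates ratios that differ by \<open>1 / M\<close>.\<close>
  obtain Q :: nat where Q: "8 * L * (real m)\<^sup>2 / c < real Q" using reals_Archimedean2 by blast
  have Q0: "0 < Q"
  proof -
    have "0 \<le> 8 * L * (real m)\<^sup>2 / c" using L c by simp
    then show ?thesis using Q by linarith
  qed
  \<comment> \<open>Large enough for \<open>M ^ m\<close> to exceed the number of codes, at most \<open>2 * m * (3 * Q * M) ^ n\<close>.\<close>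
  define M where "M = 2 * m * (3 * Q) ^ n + 1"
  have M0: "0 < M" by (simp add: M_def)
  define K where "K = Q * M"
  have K0: "0 < K" using Q0 M0 by (simp add: K_def)
  define V where "V = (\<lambda>k::nat \<Rightarrow> nat. \<lambda>i. real (k i) / real M)"
  define I where "I = PiE {..<m} (\<lambda>i. {..<M})"
  have "\<exists>j. j < m \<and> 1 / real m \<le> \<bar>x j\<bar>" if "x \<in> ?S" for x
    using nsphere_large_coordinate[OF that] unfolding m by (metis less_Suc_eq_le)
  then have "\<forall>x. \<exists>j. x \<in> ?S \<longrightarrow> j < m \<and> 1 / real m \<le> \<bar>x j\<bar>" by blast
  from choice[OF this] obtain J where J: "\<And>x. x \<in> ?S \<Longrightarrow> J x < m" "\<And>x. x \<in> ?S \<Longrightarrow> 1 / real m \<le> \<bar>x (J x)\<bar>" by auto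
  \<comment> \<open>A large coordinate is determined by the others up to its sign, so only the others are recorded.\<close>
  define code where "code = (\<lambda>x::nat \<Rightarrow> real. (J x, 0 < x (J x), restrict (\<lambda>i. \<lfloor>real K * x i\<rfloor>) ({..<m} - {J x})))"
  define codes where "codes = (SIGMA j:{..<m}. (UNIV :: bool set) \<times> PiE ({..<m} - {j}) (\<lambda>i. {- int K..int K}))"
  have "code (X (V k)) \<in> codes" for k
  proof -
    have "\<lfloor>real K * X (V k) i\<rfloor> \<in> {- int K..int K}" for i
    proof -
      have "\<bar>real K * X (V k) i\<bar> \<le> real K * 1" unfolding abs_mult using nsphere_abs_le[OF X(1)] by (intro mult_mono) auto
      then have "- real K \<le> real K * X (V k) i" "real K * X (V k) i \<le> real K" by (simp_all add: abs_le_iff)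
      then show ?thesis by (simp add: le_floor_iff floor_le_iff)
    qed
    then show ?thesis using J(1)[OF X(1)] by (auto simp: code_def codes_def)
  qed
  then have sub: "(\<lambda>k. code (X (V k))) ` I \<subseteq> codes" by blast
  have fin: "finite codes" unfolding codes_def by (intro finite_SigmaI finite_cartesian_product finite_PiE) auto
  have "card codes = (\<Sum>j<m. 2 * (2 * K + 1) ^ n)"
    unfolding codes_def
  proof (subst card_SigmaI)
    show "(\<Sum>a<m. card ((UNIV::bool set) \<times> PiE ({..<m} - {a}) (\<lambda>i. {- int K..int K}))) = (\<Sum>j<m. 2 * (2 * K + 1) ^ n)"
    proof (rule sum.cong[OF refl])
      fix a assume a: "a \<in> {..<m}"
      have "card (PiE ({..<m} - {a}) (\<lambda>i. {- int K..int K})) = (2 * K + 1) ^ card ({..<m} - {a})"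
        by (subst card_PiE) (auto simp: nat_add_distrib nat_mult_distrib)
      also have "card ({..<m} - {a}) = n" using a m by simp
      finally show "card ((UNIV::bool set) \<times> PiE ({..<m} - {a}) (\<lambda>i. {- int K..int K})) = 2 * (2 * K + 1) ^ n"
        by (simp add: card_cartesian_product)
    qed
  qed (auto intro!: finite_cartesian_product finite_PiE)
  then have "card codes = 2 * m * (2 * K + 1) ^ n" by simp
  also have "\<dots> \<le> 2 * m * (3 * K) ^ n" using K0 by (intro mult_left_mono power_mono) auto
  also have "\<dots> = 2 * m * (3 * Q) ^ n * M ^ n" by (simp add: K_def power_mult_distrib)
  also have "\<dots> < M * M ^ n" using M0 by (intro mult_strict_right_mono) (auto simp: M_def)
  also have "\<dots> = card I" unfolding I_def m by (subst card_PiE) auto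
  finally have lt: "card codes < card I" .
  have "\<not> inj_on (\<lambda>k. code (X (V k))) I"
  proof
    assume "inj_on (\<lambda>k. code (X (V k))) I"
    then have "card I \<le> card codes" using card_inj_on_le sub fin by blast
    then show False using lt by simp
  qed
  then obtain k l where kl: "k \<in> I" "l \<in> I" "k \<noteq> l" "code (X (V k)) = code (X (V l))" unfolding inj_on_def by blast
  define x where "x = X (V k)"
  define y where "y = X (V l)"
  have xS: "x \<in> ?S" and yS: "y \<in> ?S" by (simp_all add: x_def y_def X)
  define j where "j = J x"
  have jy: "J y = j" and sg: "0 < x j \<longleftrightarrow> 0 < y j"
    and fl: "\<And>i. i < m \<Longrightarrow> i \<noteq> j \<Longrightarrow> \<lfloor>real K * x i\<rfloor> = \<lfloor>real K * y i\<rfloor>"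
  proof -
    have e: "code x = code y" using kl(4) by (simp add: x_def y_def)
    then show J': "J y = j" by (simp add: code_def j_def)
    show "0 < x j \<longleftrightarrow> 0 < y j" using e J' by (simp add: code_def j_def)
    fix i assume i: "i < m" "i \<noteq> j"
    have "restrict (\<lambda>i. \<lfloor>real K * x i\<rfloor>) ({..<m} - {j}) = restrict (\<lambda>i. \<lfloor>real K * y i\<rfloor>) ({..<m} - {j})"
      using e J' by (simp add: code_def j_def)
    from fun_cong[OF this, of i] show "\<lfloor>real K * x i\<rfloor> = \<lfloor>real K * y i\<rfloor>" using i by simp
  qed
  have jm: "j < m" using J(1)[OF xS] by (simp add: j_def)
  have xj: "1 / real m \<le> \<bar>x j\<bar>" "1 / real m \<le> \<bar>y j\<bar>" using J(2)[OF xS] J(2)[OF yS] jy by (simp_all add: j_def)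
  have di: "\<bar>x i - y i\<bar> \<le> 1 / real K" if "i < m" "i \<noteq> j" for i
  proof -
    have "\<bar>real K * x i - real K * y i\<bar> \<le> 1" using fl[OF that] by linarith
    then have "real K * \<bar>x i - y i\<bar> \<le> 1" by (simp add: abs_mult flip: right_diff_distrib)
    then show ?thesis using K0 by (simp add: pos_le_divide_eq mult.commute)
  qed
  have split: "(\<Sum>i\<le>n. h i) = h j + (\<Sum>i\<in>{..n} - {j}. h i)" for h :: "nat \<Rightarrow> real"
    using jm m by (intro sum.remove) auto
  have dj: "\<bar>x j - y j\<bar> \<le> (real m)\<^sup>2 / real K"
  proof -
    have "(x j)\<^sup>2 - (y j)\<^sup>2 = (\<Sum>i\<in>{..n} - {j}. (y i)\<^sup>2 - (x i)\<^sup>2)"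
      using xS yS split[of "\<lambda>i. (x i)\<^sup>2"] split[of "\<lambda>i. (y i)\<^sup>2"] by (simp add: topspace_nsphere sum_subtractf)
    also have "\<bar>\<dots>\<bar> \<le> (\<Sum>i\<in>{..n} - {j}. \<bar>(y i)\<^sup>2 - (x i)\<^sup>2\<bar>)" by (rule sum_abs)
    also have "\<dots> \<le> (\<Sum>i\<in>{..n} - {j}. 2 / real K)"
    proof (rule sum_mono)
      fix i assume i: "i \<in> {..n} - {j}"
      have "\<bar>(y i)\<^sup>2 - (x i)\<^sup>2\<bar> = \<bar>y i + x i\<bar> * \<bar>x i - y i\<bar>"
        by (simp add: power2_eq_square abs_mult[symmetric] algebra_simps abs_minus_commute)
      also have "\<dots> \<le> 2 * (1 / real K)"
        using nsphere_abs_le[OF xS, of i] nsphere_abs_le[OF yS, of i] di[of i] i m by (intro mult_mono) auto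
      finally show "\<bar>(y i)\<^sup>2 - (x i)\<^sup>2\<bar> \<le> 2 / real K" by simp
    qed
    also have "\<dots> \<le> real m * (2 / real K)"
    proof -
      have "card ({..n} - {j}) \<le> m" using card_mono[of "{..n}" "{..n} - {j}"] m by simp
      then show ?thesis by (simp add: mult_right_mono divide_right_mono)
    qed
    finally have "\<bar>(x j)\<^sup>2 - (y j)\<^sup>2\<bar> \<le> real m * (2 / real K)" .
    moreover have "\<bar>(x j)\<^sup>2 - (y j)\<^sup>2\<bar> = \<bar>x j - y j\<bar> * \<bar>x j + y j\<bar>"
      by (simp add: power2_eq_square abs_mult[symmetric] algebra_simps)
    moreover have "2 / real m \<le> \<bar>x j + y j\<bar>" using xj sg by (cases "0 < x j") auto
    moreover from this have "\<bar>x j - y j\<bar> * (2 / real m) \<le> \<bar>x j - y j\<bar> * \<bar>x j + y j\<bar>"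
      by (intro mult_left_mono) auto
    ultimately have l: "\<bar>x j - y j\<bar> * (2 / real m) \<le> real m * (2 / real K)" by linarith
    have "\<bar>x j - y j\<bar> = (real m / 2) * (\<bar>x j - y j\<bar> * (2 / real m))" using m by simp
    also have "\<dots> \<le> (real m / 2) * (real m * (2 / real K))" using l by (intro mult_left_mono) auto
    also have "\<dots> = (real m)\<^sup>2 / real K" by (simp add: power2_eq_square)
    finally show ?thesis .
  qed
  have "?d x y = \<bar>x j - y j\<bar> + (\<Sum>i\<in>{..n} - {j}. \<bar>x i - y i\<bar>)"
    unfolding coordinate_distance_def by (rule split)
  also have "\<dots> \<le> (real m)\<^sup>2 / real K + (\<Sum>i\<in>{..n} - {j}. 1 / real K)"
    using dj di m by (intro add_mono sum_mono) auto
  also have "(\<Sum>i\<in>{..n} - {j}. 1 / real K) \<le> real m / real K"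
  proof -
    have "card ({..n} - {j}) \<le> m" using card_mono[of "{..n}" "{..n} - {j}"] m by simp
    then show ?thesis by (simp add: divide_right_mono)
  qed
  also have "(real m)\<^sup>2 / real K + real m / real K \<le> 2 * (real m)\<^sup>2 / real K"
  proof -
    have "real m \<le> (real m)\<^sup>2" using m self_le_power[of "real m" 2] by simp
    then have "real m / real K \<le> (real m)\<^sup>2 / real K" by (rule divide_right_mono) simp
    then show ?thesis by simp
  qed
  finally have dxy: "?d x y \<le> 2 * (real m)\<^sup>2 / real K" by simp
  have Vb: "0 \<le> V r i" "V r i \<le> 1" if "r \<in> I" "i < m" for r i
  proof -
    have "r i \<in> {..<M}" using that unfolding I_def by (intro PiE_mem[of r "{..<m}" "\<lambda>i. {..<M}" i]) auto
    then show "0 \<le> V r i" "V r i \<le> 1" using M0 by (auto simp: V_def divide_le_eq)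
  qed
  have big: "c \<le> \<bar>g (X (V r)) m\<bar>" if r: "r \<in> I" for r
  proof -
    obtain i where i: "i \<le> m" "c \<le> \<bar>g (X (V r)) i\<bar>" using low[OF X(1)] by blast
    show ?thesis
    proof (cases "i = m")
      case False
      then have im: "i < m" using i by simp
      have "\<bar>V r i * g (X (V r)) m\<bar> \<le> 1 * \<bar>g (X (V r)) m\<bar>"
        unfolding abs_mult using Vb[OF r im] by (intro mult_right_mono) auto
      then show ?thesis using i(2) X(2)[OF im, of "V r"] by simp
    qed (use i in simp)
  qed
  have "\<exists>i<m. k i \<noteq> l i"
  proof (rule ccontr)
    assume "\<not> (\<exists>i<m. k i \<noteq> l i)"
    then have "k = l" using kl(1,2) unfolding I_def by (intro PiE_ext[of k "{..<m}" "\<lambda>i. {..<M}" l]) auto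
    then show False using kl(3) by simp
  qed
  then obtain i where i: "i < m" "k i \<noteq> l i" by blast
  have gx: "g x i = V k i * g x m" and gy: "g y i = V l i * g y m" using X(2)[OF i(1)] by (simp_all add: x_def y_def)
  have "c \<le> \<bar>g x m\<bar>" using big[OF kl(1)] by (simp add: x_def)
  have l1: "\<bar>V l i\<bar> \<le> 1" using Vb[OF kl(2) i(1)] by simp
  have "\<bar>V k i - V l i\<bar> * c \<le> \<bar>V k i - V l i\<bar> * \<bar>g x m\<bar>" using \<open>c \<le> \<bar>g x m\<bar>\<close> by (intro mult_left_mono) auto
  also have "\<dots> = \<bar>(g x i - g y i) - V l i * (g x m - g y m)\<bar>"
    unfolding abs_mult[symmetric] by (simp add: gx gy algebra_simps)
  also have "\<dots> \<le> \<bar>g x i - g y i\<bar> + \<bar>V l i\<bar> * \<bar>g x m - g y m\<bar>"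
    unfolding abs_mult[symmetric] by (rule abs_triangle_ineq4)
  also have "\<dots> \<le> L * ?d x y + 1 * (L * ?d x y)"
    using lip[OF xS yS, of i] lip[OF xS yS, of m] i(1) l1 by (intro add_mono mult_mono) auto
  also have "\<dots> = 2 * L * ?d x y" by simp
  also have "\<dots> \<le> 2 * L * (2 * (real m)\<^sup>2 / real K)" using dxy L by (intro mult_left_mono) auto
  also have "\<dots> \<le> 8 * L * (real m)\<^sup>2 / real K" using L by (simp add: divide_right_mono)
  finally have "\<bar>V k i - V l i\<bar> * c \<le> 8 * L * (real m)\<^sup>2 / real K" .
  moreover have "1 / real M \<le> \<bar>V k i - V l i\<bar>"
  proof -
    have "1 \<le> \<bar>real (k i) - real (l i)\<bar>" using i(2) by linarith
    then have "1 / real M \<le> \<bar>real (k i) - real (l i)\<bar> / real M" by (rule divide_right_mono) simp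
    also have "\<dots> = \<bar>V k i - V l i\<bar>" using M0 by (simp add: V_def diff_divide_distrib[symmetric] abs_divide)
    finally show ?thesis .
  qed
  ultimately have "1 / real M * c \<le> 8 * L * (real m)\<^sup>2 / real K"
    using c by (meson less_imp_le mult_right_mono order_trans)
  then have "real Q \<le> 8 * L * (real m)\<^sup>2 / c"
    using c M0 Q0 by (simp add: K_def field_simps)
  then show False using Q by simp
qed

text \<open>An odd self-map of a sphere has odd degree. The map is deformed through odd nonvanishing maps:
  to a Lipschitz map, then by a shear that moves the image of the equator away from the poles, and
  finally by shrinking the last coordinate by the factor \<open>|x\<^sub>m|\<close>, after which the equator is mapped to
  itself and the degrees of the map and of its restriction have the same parity.\<close>

theorem odd_map_odd_degree:
  "continuous_map (nsphere n) (nsphere n) f \<Longrightarrow> odd_on (topspace (nsphere n)) f \<Longrightarrow> odd (Brouwer_degree2 n f)"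
proof (induction n arbitrary: f)
  case 0
  let ?e = "\<lambda>i::nat. if i = 0 then 1 else (0::real)"
  have S0: "x = ?e \<or> x = (\<lambda>i. - ?e i)" if "x \<in> topspace (nsphere 0)" for x
  proof -
    have "(x 0)\<^sup>2 = 1" "\<forall>i>0. x i = 0" using that by (auto simp: topspace_nsphere)
    then have "x 0 = 1 \<or> x 0 = -1" "\<forall>i>0. x i = 0" by (auto simp: power2_eq_1_iff)
    then show ?thesis by (auto simp: fun_eq_iff)
  qed
  have e: "?e \<in> topspace (nsphere 0)" by (simp add: topspace_nsphere)
  have fe: "f ?e \<in> topspace (nsphere 0)" using 0(1) e by (auto simp: continuous_map_def)
  have odd: "f (\<lambda>i. - ?e i) = (\<lambda>i. - f ?e i)" using 0(2)[rule_format, OF e] .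
  from S0[OF fe] show ?case
  proof
    assume a: "f ?e = ?e"
    have "f x = id x" if "x \<in> topspace (nsphere 0)" for x using S0[OF that] a odd by auto
    then have "Brouwer_degree2 0 f = Brouwer_degree2 0 id" by (rule Brouwer_degree2_eq)
    then show ?thesis by simp
  next
    assume a: "f ?e = (\<lambda>i. - ?e i)"
    have "f x = (\<lambda>i. if i = 0 then - x i else x i)" if "x \<in> topspace (nsphere 0)" for x using S0[OF that] a odd by auto
    then have "Brouwer_degree2 0 f = Brouwer_degree2 0 (\<lambda>x i. if i = 0 then - x i else x i)" by (rule Brouwer_degree2_eq)
    then show ?thesis by (simp add: Brouwer_degree2_reflection)
  qed
next
  case (Suc n)
  define m where "m = Suc n"
  let ?S = "topspace (nsphere m)"
  have f: "continuous_map (nsphere m) (nsphere m) f" and fo: "odd_on ?S f" using Suc.prems by (simp_all add: m_def)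
  have fS: "f x \<in> ?S" if "x \<in> ?S" for x using f that by (auto simp: continuous_map_def)
  have fc: "continuous_map (nsphere m) euclideanreal (\<lambda>x. f x i)" for i
    using continuous_map_compose[OF f continuous_map_nsphere_projection[of m i]] by (simp add: comp_def)
  \<comment> \<open>Half the size that some coordinate of every point of the sphere is known to have.\<close>
  define c where "c = 1 / (2 * real (Suc m))"
  have c: "0 < c" by (simp add: c_def)
  have "\<exists>h L. 0 \<le> L \<and> (\<forall>x\<in>?S. \<forall>y\<in>?S. \<bar>h x - h y\<bar> \<le> L * coordinate_distance m x y) \<and> (\<forall>x\<in>?S. \<bar>h x - f x i\<bar> \<le> c)" for i
  proof (rule Lipschitz_approximation[OF fc[of i] c])
    show "\<bar>f x i\<bar> \<le> 1" if "x \<in> ?S" for x by (rule nsphere_abs_le[OF fS[OF that]])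
    fix h L assume "0 \<le> L" "\<And>x y. x \<in> ?S \<Longrightarrow> y \<in> ?S \<Longrightarrow> \<bar>h x - h y\<bar> \<le> L * coordinate_distance m x y"
      "\<And>x. x \<in> ?S \<Longrightarrow> \<bar>h x - f x i\<bar> \<le> c"
    then show ?thesis by (intro exI[of _ h] exI[of _ L] conjI ballI)
  qed
  then have "\<forall>i. \<exists>h L. 0 \<le> L \<and> (\<forall>x\<in>?S. \<forall>y\<in>?S. \<bar>h x - h y\<bar> \<le> L * coordinate_distance m x y) \<and> (\<forall>x\<in>?S. \<bar>h x - f x i\<bar> \<le> c)" by blast
  from choice[OF this] obtain h where "\<forall>i. \<exists>L. 0 \<le> L \<and> (\<forall>x\<in>?S. \<forall>y\<in>?S. \<bar>h i x - h i y\<bar> \<le> L * coordinate_distance m x y) \<and> (\<forall>x\<in>?S. \<bar>h i x - f x i\<bar> \<le> c)" ..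
  from choice[OF this] obtain L where h: "\<And>i. 0 \<le> L i" "\<And>i x y. x \<in> ?S \<Longrightarrow> y \<in> ?S \<Longrightarrow> \<bar>h i x - h i y\<bar> \<le> L i * coordinate_distance m x y"
    "\<And>i x. x \<in> ?S \<Longrightarrow> \<bar>h i x - f x i\<bar> \<le> c" by blast
  define LL where "LL = (\<Sum>i\<le>m. L i)"
  have LL: "0 \<le> LL" unfolding LL_def by (intro sum_nonneg h)
  have LLi: "L i \<le> LL" if "i \<le> m" for i unfolding LL_def using h(1) that by (intro member_le_sum) auto
  \<comment> \<open>Antisymmetrising keeps the Lipschitz constant and the distance to the odd map \<open>f\<close>.\<close>
  define g where "g = (\<lambda>x i. (h i x - h i (\<lambda>j. - x j)) / 2)"
  have go: "g (\<lambda>j. - x j) = (\<lambda>i. - g x i)" for x by (auto simp: g_def field_simps)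
  have gl: "\<bar>g x i - g y i\<bar> \<le> LL * coordinate_distance m x y" if "x \<in> ?S" "y \<in> ?S" "i \<le> m" for x y i
  proof -
    have "\<bar>h i x - h i y\<bar> \<le> LL * coordinate_distance m x y" if "x \<in> ?S" "y \<in> ?S" for x y
      using h(2)[OF that, of i] mult_right_mono[OF LLi[OF \<open>i \<le> m\<close>] coordinate_distance_nonneg[of m x y]] by linarith
    note bounds = this[OF that(1,2)] this[OF nsphere_uminus[OF that(1)] nsphere_uminus[OF that(2)], unfolded coordinate_distance_minus]
    have "\<bar>(a - b) / 2 - (a' - b') / 2\<bar> \<le> B" if "\<bar>a - a'\<bar> \<le> B" "\<bar>b - b'\<bar> \<le> B" for a b a' b' B :: real
    proof -
      have "(a - b) / 2 - (a' - b') / 2 = ((a - a') - (b - b')) / 2" by (simp add: field_simps)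
      then have "\<bar>(a - b) / 2 - (a' - b') / 2\<bar> = \<bar>((a - a') - (b - b')) / 2\<bar>" by (rule arg_cong)
      also have "\<dots> = \<bar>(a - a') - (b - b')\<bar> / 2" by (simp only: abs_divide abs_numeral)
      finally have e: "\<bar>(a - b) / 2 - (a' - b') / 2\<bar> = \<bar>(a - a') - (b - b')\<bar> / 2" .
      have "\<bar>(a - a') - (b - b')\<bar> \<le> B + B"
        by (rule order_trans[OF abs_triangle_ineq4 add_mono[OF that]])
      then show ?thesis unfolding e by simp
    qed
    from this[OF bounds] show ?thesis unfolding g_def .
  qed
  have gf: "\<bar>g x i - f x i\<bar> \<le> c" if x: "x \<in> ?S" for x i
  proof -
    have "f (\<lambda>j. - x j) i = - f x i" using fo x by simp
    then have 1: "\<bar>h i (\<lambda>j. - x j) + f x i\<bar> \<le> c" using h(3)[OF nsphere_uminus[OF x], of i] by simp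
    have e: "g x i - f x i = ((h i x - f x i) - (h i (\<lambda>j. - x j) + f x i)) / 2" by (simp add: g_def field_simps)
    show ?thesis unfolding e using 1 h(3)[OF x, of i] by (simp add: abs_le_iff)
  qed
  have gc: "continuous_map (nsphere m) euclideanreal (\<lambda>x. g x i)" if i: "i \<le> m" for i
  proof -
    have "continuous_on ?S (\<lambda>x. g x i)"
      unfolding continuous_on_def
    proof
      fix x assume x: "x \<in> ?S"
      have t: "((\<lambda>y. LL * coordinate_distance m y x) \<longlongrightarrow> LL * coordinate_distance m x x) (at x within ?S)"
        unfolding coordinate_distance_def
        by (intro tendsto_intros tendsto_rabs_zero_iff[THEN iffD1] continuous_on_product_coordinates[unfolded continuous_on_def, rule_format]
            continuous_on_subset[OF continuous_on_product_coordinates, of ?S, unfolded continuous_on_def, rule_format] x) auto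
      show "((\<lambda>y. g y i) \<longlongrightarrow> g x i) (at x within ?S)"
      proof (rule LIM_zero_cancel, rule Lim_null_comparison)
        show "\<forall>\<^sub>F y in at x within ?S. norm (g y i - g x i) \<le> LL * coordinate_distance m y x"
          using gl[OF _ x i] by (auto simp: eventually_at_filter)
        show "((\<lambda>y. LL * coordinate_distance m y x) \<longlongrightarrow> 0) (at x within ?S)"
          using t by (simp add: coordinate_distance_same)
      qed
    qed
    then show ?thesis by (simp only: continuous_map_nsphere_iff)
  qed
  have c2: "2 * c = 1 / real (Suc m)" by (simp add: c_def del: of_nat_Suc)
  have large: "\<exists>i\<le>m. 2 * c \<le> \<bar>f x i\<bar>" if "x \<in> ?S" for x
  proof (rule nsphere_large_coordinate[OF fS[OF that]])
    fix j assume "j \<le> m" "1 / real (Suc m) \<le> \<bar>f x j\<bar>"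
    then show ?thesis unfolding c2 by blast
  qed
  have glow: "\<exists>i\<le>m. c \<le> \<bar>g x i\<bar>" if x: "x \<in> ?S" for x
  proof -
    obtain i where "i \<le> m" "2 * c \<le> \<bar>f x i\<bar>" using large[OF x] by blast
    then show ?thesis using gf[OF x, of i] by (intro exI[of _ i]) linarith
  qed
  have eq: "x \<in> ?S" if "x \<in> topspace (nsphere n)" for x using that by (auto simp: topspace_nsphere m_def)
  have eqd: "coordinate_distance m x y = coordinate_distance n x y"
    if "x \<in> topspace (nsphere n)" "y \<in> topspace (nsphere n)" for x y
    using that by (simp add: coordinate_distance_def m_def topspace_nsphere)
  have "\<exists>v::nat \<Rightarrow> real. \<forall>x\<in>topspace (nsphere n). \<exists>i<m. g x i \<noteq> v i * g x m"
  proof (rule Lipschitz_general_position[OF m_def LL c])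
    show "\<bar>g x i - g y i\<bar> \<le> LL * coordinate_distance n x y" if "x \<in> topspace (nsphere n)" "y \<in> topspace (nsphere n)" "i \<le> m" for x y i
      using gl[OF eq[OF that(1)] eq[OF that(2)] that(3)] eqd[OF that(1,2)] by simp
    show "\<exists>i\<le>m. c \<le> \<bar>g x i\<bar>" if "x \<in> topspace (nsphere n)" for x by (rule glow[OF eq[OF that]])
    fix v :: "nat \<Rightarrow> real" assume "\<And>x. x \<in> topspace (nsphere n) \<Longrightarrow> \<exists>i<m. g x i \<noteq> v i * g x m"
    then show ?thesis by (intro exI[of _ v] ballI)
  qed
  then obtain v :: "nat \<Rightarrow> real" where v: "\<And>x. x \<in> topspace (nsphere n) \<Longrightarrow> \<exists>i<m. g x i \<noteq> v i * g x m" by blast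
  define G where "G = (\<lambda>x i. if i < m then g x i - v i * g x m else g x m)"
  define F where "F = (\<lambda>x i. if i < m then g x i - v i * g x m else \<bar>x m\<bar> * g x m)"
  have cG: "continuous_map (nsphere m) euclideanreal (\<lambda>x. G x i)" if "i \<le> m" for i
    using gc[OF that] gc[of m] by (cases "i < m") (auto simp: G_def intro!: continuous_map_diff continuous_map_real_mult_left)
  have cF: "continuous_map (nsphere m) euclideanreal (\<lambda>x. F x i)" if "i \<le> m" for i
    using gc[OF that] gc[of m] continuous_map_nsphere_projection[of m m]
    by (cases "i < m") (auto simp: F_def intro!: continuous_map_diff continuous_map_real_mult_left continuous_map_real_mult continuous_map_real_abs)
  have "Brouwer_degree2 m f = Brouwer_degree2 m (\<lambda>x. normalise m (f x))"
    by (rule Brouwer_degree2_eq) (simp add: normalise_id fS)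
  also have "\<dots> = Brouwer_degree2 m (\<lambda>x. normalise m (g x))"
  proof (rule degree_linear_homotopy[OF fc gc])
    fix x t assume x: "x \<in> ?S" and t: "0 \<le> t" "t \<le> (1::real)"
    obtain i where i: "i \<le> m" "2 * c \<le> \<bar>f x i\<bar>" using large[OF x] by blast
    have "(1 - t) * f x i + t * g x i \<noteq> 0"
    proof
      assume "(1 - t) * f x i + t * g x i = 0"
      then have "f x i = t * (f x i - g x i)" by (simp add: algebra_simps)
      then have "\<bar>f x i\<bar> = t * \<bar>f x i - g x i\<bar>" using t by (metis abs_mult abs_of_nonneg)
      also have "\<dots> \<le> 1 * c" using gf[OF x, of i] t by (intro mult_mono) (auto simp: abs_minus_commute)
      finally show False using i c by simp
    qed
    then show "\<exists>i\<le>m. (1 - t) * f x i + t * g x i \<noteq> 0" using i by blast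
  qed
  also have "\<dots> = Brouwer_degree2 m (\<lambda>x. normalise m (G x))"
  proof (rule degree_linear_homotopy[OF gc cG])
    fix x t assume x: "x \<in> ?S" and t: "0 \<le> t" "t \<le> (1::real)"
    obtain i where i: "i \<le> m" "g x i \<noteq> 0" using glow[OF x] c by force
    show "\<exists>i\<le>m. (1 - t) * g x i + t * G x i \<noteq> 0"
    proof (cases "g x m = 0")
      case True
      then have "(1 - t) * g x i + t * G x i = g x i" using i by (auto simp: G_def algebra_simps)
      then show ?thesis using i by metis
    next
      case False
      have "(1 - t) * g x m + t * G x m = g x m" by (simp add: G_def algebra_simps)
      then show ?thesis using False by (metis order_refl)
    qed
  qed
  also have "\<dots> = Brouwer_degree2 m (\<lambda>x. normalise m (F x))"
  proof (rule degree_linear_homotopy[OF cG cF])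
    fix x t assume x: "x \<in> ?S" and t: "0 \<le> t" "t \<le> (1::real)"
    show "\<exists>i\<le>m. (1 - t) * G x i + t * F x i \<noteq> 0"
    proof (cases "\<exists>i<m. G x i \<noteq> 0")
      case True
      then obtain i where i: "i < m" "G x i \<noteq> 0" by blast
      then have "(1 - t) * G x i + t * F x i = G x i" by (simp add: G_def F_def algebra_simps)
      then show ?thesis using i by (metis less_imp_le)
    next
      case False
      obtain i where i: "i \<le> m" "g x i \<noteq> 0" using glow[OF x] c by force
      have gm: "g x m \<noteq> 0"
      proof
        assume "g x m = 0"
        then show False using False i by (cases "i = m") (auto simp: G_def)
      qed
      have "x m \<noteq> 0"
      proof
        assume "x m = 0"
        then have "x \<in> topspace (nsphere n)" using x topspace_nsphere_minus1[of x m] by (simp add: m_def)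
        then show False using v[of x] False by (auto simp: G_def)
      qed
      have "(1 - t) * G x m + t * F x m = ((1 - t) + t * \<bar>x m\<bar>) * g x m" by (simp add: G_def F_def algebra_simps)
      moreover have "0 < (1 - t) + t * \<bar>x m\<bar>"
        using t \<open>x m \<noteq> 0\<close> by (cases "t = 1") (auto intro: add_pos_nonneg)
      ultimately show ?thesis using gm by (intro exI[of _ m]) auto
    qed
  qed
  finally have deg: "Brouwer_degree2 m f = Brouwer_degree2 m (\<lambda>x. normalise m (F x))" .
  define H where "H = (\<lambda>x. normalise m (F x))"
  have nzF: "\<exists>i\<le>m. F x i \<noteq> 0" if x: "x \<in> ?S" for x
  proof (cases "\<exists>i<m. G x i \<noteq> 0")
    case True
    then obtain i where i: "i < m" "G x i \<noteq> 0" by blast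
    then have "F x i \<noteq> 0" by (simp add: F_def G_def)
    then show ?thesis using i(1) by (intro exI[of _ i]) simp
  next
    case False
    obtain i where i: "i \<le> m" "g x i \<noteq> 0" using glow[OF x] c by force
    have gm: "g x m \<noteq> 0"
    proof
      assume "g x m = 0"
      then show False using False i by (cases "i = m") (auto simp: G_def)
    qed
    have "x m \<noteq> 0"
    proof
      assume "x m = 0"
      then have "x \<in> topspace (nsphere n)" using x topspace_nsphere_minus1[of x m] by (simp add: m_def)
      then show False using v[of x] False by (auto simp: G_def)
    qed
    then show ?thesis using gm by (intro exI[of _ m]) (simp add: F_def)
  qed
  have cH: "continuous_map (nsphere m) (nsphere m) H"
    unfolding H_def by (rule continuous_map_normalise[OF cF nzF])
  have Fo: "F (\<lambda>i. - x i) = (\<lambda>i. - F x i)" for x by (auto simp: F_def go)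
  have Ho: "H (\<lambda>i. - x i) = (\<lambda>i. - H x i)" for x unfolding H_def Fo by (rule normalise_minus)
  have Heq: "H x \<in> topspace (nsphere n)" if x: "x \<in> topspace (nsphere n)" for x
  proof -
    have "H x \<in> ?S" using cH eq[OF x] by (auto simp: continuous_map_def)
    moreover have "H x m = 0" using x by (simp add: H_def normalise_def F_def m_def topspace_nsphere)
    ultimately show ?thesis using topspace_nsphere_minus1[of "H x" m] by (simp add: m_def)
  qed
  have "even (Brouwer_degree2 m H - Brouwer_degree2 (m - Suc 0) H)"
  proof (rule Borsuk_odd_mapping_degree_step[OF cH])
    show "(H \<circ> (\<lambda>x i. - x i)) u = ((\<lambda>x i. - x i) \<circ> H) u" for u by (simp add: Ho)
    show "H \<in> topspace (nsphere (m - Suc 0)) \<rightarrow> topspace (nsphere (m - Suc 0))" using Heq by (simp add: m_def)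
  qed
  moreover have "odd (Brouwer_degree2 n H)"
  proof (rule Suc.IH)
    have "continuous_map (subtopology (nsphere m) {x. x m = 0}) (nsphere m) H" by (rule continuous_map_from_subtopology[OF cH])
    then have "continuous_map (nsphere n) (nsphere m) H" unfolding m_def subtopology_nsphere_equator .
    then have "continuous_map (nsphere n) (subtopology (nsphere m) {x. x m = 0}) H"
      unfolding continuous_map_in_subtopology using Heq by (auto simp: topspace_nsphere m_def)
    then show "continuous_map (nsphere n) (nsphere n) H" unfolding m_def subtopology_nsphere_equator .
    show "odd_on (topspace (nsphere n)) H" using Ho by blast
  qed
  ultimately have "odd (Brouwer_degree2 m H)" by (simp add: m_def)
  then show ?case using deg by (simp add: m_def H_def)
qed

text \<open>Otherwise the target embeds into a proper subspace and the normalised map is an odd self-map of the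
  sphere that misses a pole. A map that is not surjective has degree \<open>0\<close>, which is even.\<close>

theorem Borsuk_Ulam:
  assumes h: "continuous_map (nsphere n) (subtopology (Euclidean_space m) (- {\<lambda>i. 0})) h"
    and o: "odd_on (topspace (nsphere n)) h"
  shows "n < m"
proof (rule ccontr)
  assume "\<not> n < m"
  then have mn: "m \<le> n" by simp
  have hE: "continuous_map (nsphere n) (Euclidean_space m) h" and hz: "\<And>x. x \<in> topspace (nsphere n) \<Longrightarrow> h x \<noteq> (\<lambda>i. 0)"
    using h by (auto simp: continuous_map_in_subtopology)
  have hm: "h x i = 0" if "x \<in> topspace (nsphere n)" "m \<le> i" for x i
    using hE that by (auto simp: continuous_map_def topspace_Euclidean_space)
  have c: "continuous_map (nsphere n) euclideanreal (\<lambda>x. h x i)" for i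
    using hE unfolding Euclidean_space_def continuous_map_in_subtopology by (auto simp: continuous_map_componentwise_UNIV)
  have nz: "\<exists>i\<le>n. h x i \<noteq> 0" if x: "x \<in> topspace (nsphere n)" for x
  proof -
    obtain i where "h x i \<noteq> 0" using hz[OF x] by auto
    moreover from this have "i \<le> n" using hm[OF x, of i] mn by (cases "m \<le> i") auto
    ultimately show ?thesis by blast
  qed
  define f where "f = (\<lambda>x. normalise n (h x))"
  have f: "continuous_map (nsphere n) (nsphere n) f" unfolding f_def by (rule continuous_map_normalise[OF c nz])
  have "odd_on (topspace (nsphere n)) f" using o by (simp add: f_def normalise_minus)
  then have "odd (Brouwer_degree2 n f)" by (rule odd_map_odd_degree[OF f])
  moreover have "f ` topspace (nsphere n) \<noteq> topspace (nsphere n)"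
  proof
    assume s: "f ` topspace (nsphere n) = topspace (nsphere n)"
    have "(\<lambda>i. if i = n then 1 else 0) \<in> topspace (nsphere n)"
      by (simp add: topspace_nsphere if_distrib[of "\<lambda>t. t\<^sup>2"] cong: if_cong)
    then obtain x where x: "x \<in> topspace (nsphere n)" "(\<lambda>i. if i = n then 1 else 0) = f x" using s by blast
    have "f x n = 0" using hm[OF x(1) mn] by (simp add: f_def normalise_def)
    then show False using fun_cong[OF x(2), of n] by simp
  qed
  ultimately show False using Brouwer_degree2_nonsurjective[OF f] by simp
qed



section \<open>Genus and the norm topology\<close>

text \<open>Odd maps into punctured Euclidean spaces can be composed with \<open>F\<close>.\<close>

lemma genus_le_of_odd_map:
  assumes F: "continuous_map (subtopology T A) (subtopology T B) F"
    and o: "\<And>u. u \<in> A \<Longrightarrow> F (- u) = - F u" and AT: "A \<subseteq> topspace T"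
  shows "genus T A \<le> genus T B"
  unfolding genus_def
proof (rule Inf_superset_mono, clarify)
  fix m \<phi>
  assume \<phi>: "continuous_map (subtopology T B) (subtopology (Euclidean_space m) (- {\<lambda>i. 0})) \<phi>"
    and po: "\<forall>u\<in>B. \<phi> (- u) = - \<phi> u"
  have FB: "F u \<in> B" if "u \<in> A" for u
    using F that AT by (auto simp: continuous_map_in_subtopology Pi_iff)
  show "\<exists>m'. enat m = enat m' \<and> (\<exists>\<phi>. continuous_map (subtopology T A) (subtopology (Euclidean_space m') (- {\<lambda>i. 0})) \<phi> \<and>
      (\<forall>u\<in>A. \<phi> (- u) = - \<phi> u))"
  proof (intro exI[of _ m] exI[of _ "\<phi> \<circ> F"] conjI refl ballI)
    show "continuous_map (subtopology T A) (subtopology (Euclidean_space m) (- {\<lambda>i. 0})) (\<phi> \<circ> F)"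
      by (rule continuous_map_compose[OF F \<phi>])
    show "(\<phi> \<circ> F) (- u) = - (\<phi> \<circ> F) u" if "u \<in> A" for u using o[OF that] po FB[OF that] by simp
  qed
qed

lemma genus_mono:
  assumes "A \<subseteq> B" "B \<subseteq> topspace T"
  shows "genus T A \<le> genus T B"
proof (rule genus_le_of_odd_map[of T A B "\<lambda>u. u"])
  show "continuous_map (subtopology T A) (subtopology T B) (\<lambda>u. u)"
    using assms by (auto simp: continuous_map_in_subtopology intro: continuous_map_from_subtopology)
qed (use assms in auto)

lemma genus_empty: "genus T {} = 0"
proof -
  have "genus T {} \<le> enat 0"
    unfolding genus_def
  proof (rule Inf_lower, intro CollectI exI conjI)
    show "continuous_map (subtopology T {}) (subtopology (Euclidean_space 0) (- {\<lambda>i. 0})) (\<lambda>u i. 0)"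
      by (simp add: continuous_map_def)
  qed simp_all
  then show ?thesis by (simp add: zero_enat_def[symmetric])
qed

text \<open>Composition with \<open>F\<close> reduces the claim to the Borsuk--Ulam theorem.\<close>

lemma genus_ge_of_odd_sphere_map:
  assumes F: "continuous_map (nsphere n) (subtopology T B) F"
    and o: "\<And>x. x \<in> topspace (nsphere n) \<Longrightarrow> F (\<lambda>i. - x i) = - F x"
  shows "enat (Suc n) \<le> genus T B"
  unfolding genus_def
proof (rule Inf_greatest, clarify)
  fix m \<phi>
  assume \<phi>: "continuous_map (subtopology T B) (subtopology (Euclidean_space m) (- {\<lambda>i. 0})) \<phi>"
    and po: "\<forall>u\<in>B. \<phi> (- u) = - \<phi> u"
  have "n < m"
  proof (rule Borsuk_Ulam)
    show "continuous_map (nsphere n) (subtopology (Euclidean_space m) (- {\<lambda>i. 0})) (\<phi> \<circ> F)"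
      by (rule continuous_map_compose[OF F \<phi>])
    show "odd_on (topspace (nsphere n)) (\<phi> \<circ> F)"
    proof
      fix x assume x: "x \<in> topspace (nsphere n)"
      have "F x \<in> B" using F x by (auto simp: continuous_map_in_subtopology Pi_iff)
      then show "(\<phi> \<circ> F) (\<lambda>i. - x i) = (\<lambda>i. - (\<phi> \<circ> F) x i)" using o[OF x] po by (simp add: fun_Compl_def)
    qed
  qed
  then show "enat (Suc n) \<le> enat m" by simp
qed

context bounded_open
begin

abbreviation T :: "('a \<Rightarrow> real) topology" where "T \<equiv> W10_topology q \<Omega>"

definition lnorm :: "('a \<Rightarrow> 'b::euclidean_space) \<Rightarrow> real" where
  "lnorm f = modular q M f powr (1 / q)"

lemma lnorm_nonneg [simp]: "0 \<le> lnorm f"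
  by (simp add: lnorm_def)

lemma lnorm_powr: "lnorm f powr q = modular q M f"
  using q_ge by (simp add: lnorm_def powr_powr)

lemma lnorm_less_iff: "0 < e \<Longrightarrow> lnorm f < e \<longleftrightarrow> modular q M f < e powr q"
proof
  assume e: "0 < e" and "lnorm f < e"
  then have "lnorm f powr q < e powr q" using q_ge by (intro powr_less_mono2) auto
  then show "modular q M f < e powr q" by (simp add: lnorm_powr)
next
  assume e: "0 < e" and "modular q M f < e powr q"
  then have "lnorm f < (e powr q) powr (1 / q)" unfolding lnorm_def using q_ge by (intro powr_less_mono2) auto
  then show "lnorm f < e" using e q_ge by (simp add: powr_powr)
qed

lemma lnorm_triangle:
  assumes "f \<in> Lp q M" "g \<in> Lp q M"
  shows "\<bar>lnorm f - lnorm g\<bar> \<le> lnorm (\<lambda>x. f x - g x)"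
proof -
  have 1: "lnorm f \<le> lnorm (\<lambda>x. f x - g x) + lnorm g" if "f \<in> Lp q M" "g \<in> Lp q M" for f g :: "'a \<Rightarrow> 'b"
    using modular_triangle[OF q_ge(1) Lp_diff[OF q_ge(2) that] that(2)] by (simp add: lnorm_def)
  have "lnorm (\<lambda>x. g x - f x) = lnorm (\<lambda>x. f x - g x)" by (simp add: lnorm_def modular_minus_commute[of q M g])
  then show ?thesis using 1[OF assms] 1[OF assms(2,1)] by linarith
qed

lemma W10_norm_diff:
  assumes "u \<in> W" "v \<in> W"
  shows "W10_norm q \<Omega> (u - v) = lnorm (\<lambda>x. grad u x - grad v x)"
  using modular_grad_diff[OF WD(1)[OF assms(1)] WD(1)[OF assms(2)]]
  by (simp add: W10_norm_def lnorm_def) (simp add: modular_def)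

text \<open>Continuity into \<open>W\<close> amounts to smallness of the gradient of the difference, since this defines the
  pseudometric.\<close>

lemma continuous_map_into_W:
  assumes FW: "\<And>x. x \<in> topspace X \<Longrightarrow> F x \<in> W"
    and loc: "\<And>x e. x \<in> topspace X \<Longrightarrow> 0 < e \<Longrightarrow>
      \<exists>U. openin X U \<and> x \<in> U \<and> (\<forall>y\<in>U. modular q M (\<lambda>z. grad (F x) z - grad (F y) z) < e)"
  shows "continuous_map X T F"
  unfolding continuous_map_def
proof (intro conjI allI impI)
  show "F \<in> topspace X \<rightarrow> topspace T" using FW by auto
  fix V assume V: "openin T V"
  show "openin X {x \<in> topspace X. F x \<in> V}"
  proof (subst openin_subopen, intro ballI)
    fix x assume x: "x \<in> {x \<in> topspace X. F x \<in> V}"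
    then have xX: "x \<in> topspace X" and xV: "F x \<in> V" by auto
    obtain r where r: "0 < r" "\<And>v. v \<in> W \<Longrightarrow> W10_norm q \<Omega> (F x - v) < r \<Longrightarrow> v \<in> V"
      using V xV unfolding openin_W10_topology by blast
    obtain U where U: "openin X U" "x \<in> U" "\<forall>y\<in>U. modular q M (\<lambda>z. grad (F x) z - grad (F y) z) < r powr q"
      using loc[OF xX, of "r powr q"] r(1) by auto
    have "F y \<in> V" if y: "y \<in> U" for y
    proof -
      have yX: "y \<in> topspace X" using U(1) y openin_subset by blast
      have "lnorm (\<lambda>z. grad (F x) z - grad (F y) z) < r" using U(3) y lnorm_less_iff[OF r(1)] by blast
      then show ?thesis using r(2)[OF FW[OF yX]] W10_norm_diff[OF FW[OF xX] FW[OF yX]] by simp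
    qed
    then show "\<exists>U. openin X U \<and> x \<in> U \<and> U \<subseteq> {x \<in> topspace X. F x \<in> V}"
      using U(1,2) openin_subset[OF U(1)] by (intro exI[of _ U]) auto
  qed
qed

text \<open>Lipschitz functions for the pseudometric. All functions on \<open>W\<close> whose continuity is needed are
  obtained from norms, which are of this kind.\<close>

lemma continuous_map_from_W:
  fixes f :: "('a \<Rightarrow> real) \<Rightarrow> real"
  assumes K: "0 \<le> K" and lip: "\<And>u v. u \<in> W \<Longrightarrow> v \<in> W \<Longrightarrow> \<bar>f u - f v\<bar> \<le> K * lnorm (\<lambda>x. grad u x - grad v x)"
  shows "continuous_map T euclideanreal f"
  unfolding continuous_map_def
proof (intro conjI allI impI)
  show "f \<in> topspace T \<rightarrow> topspace euclideanreal" by simp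
  fix V :: "real set" assume V: "openin euclideanreal V"
  show "openin T {x \<in> topspace T. f x \<in> V}"
    unfolding openin_W10_topology
  proof (intro conjI ballI)
    show "{x \<in> topspace T. f x \<in> V} \<subseteq> W" by auto
    fix u assume "u \<in> {x \<in> topspace T. f x \<in> V}"
    then have u: "u \<in> W" "f u \<in> V" by auto
    obtain e where e: "0 < e" "\<And>t. dist t (f u) < e \<Longrightarrow> t \<in> V" using V u(2) unfolding open_openin[symmetric] open_dist by blast
    show "\<exists>r>0. \<forall>v\<in>W. W10_norm q \<Omega> (u - v) < r \<longrightarrow> v \<in> {x \<in> topspace T. f x \<in> V}"
    proof (intro exI[of _ "e / (K + 1)"] conjI ballI impI)
      show "0 < e / (K + 1)" using e K by simp
      fix v assume v: "v \<in> W" and "W10_norm q \<Omega> (u - v) < e / (K + 1)"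
      then have l: "lnorm (\<lambda>x. grad u x - grad v x) < e / (K + 1)" using W10_norm_diff[OF u(1) v] by simp
      have "\<bar>f u - f v\<bar> \<le> K * lnorm (\<lambda>x. grad u x - grad v x)" by (rule lip[OF u(1) v])
      also have "\<dots> \<le> (K + 1) * lnorm (\<lambda>x. grad u x - grad v x)" by (intro mult_right_mono) auto
      also have "\<dots> < (K + 1) * (e / (K + 1))" using l K by (intro mult_strict_left_mono) auto
      also have "\<dots> = e" using K by simp
      finally have "f v \<in> V" by (intro e(2)) (simp add: dist_real_def abs_minus_commute)
      then show "v \<in> {x \<in> topspace T. f x \<in> V}" using v by simp
    qed
  qed
qed

lemma Poincare_lnorm:
  obtains K where "0 \<le> K" "\<And>u v. u \<in> W \<Longrightarrow> v \<in> W \<Longrightarrow> lnorm (\<lambda>x. u x - v x) \<le> K * lnorm (\<lambda>x. grad u x - grad v x)"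
proof -
  obtain C where C: "0 < C" "\<And>u. u \<in> W \<Longrightarrow> modular q M u \<le> C * modular q M (grad u)" using Poincare by blast
  show ?thesis
  proof (rule that[of "C powr (1 / q)"])
    fix u v assume u: "u \<in> W" and v: "v \<in> W"
    have "modular q M (\<lambda>x. u x - v x) \<le> C * modular q M (\<lambda>x. grad u x - grad v x)"
      using C(2)[OF W_diff[OF u v]] unfolding modular_grad_minus[OF u v] .
    then have "lnorm (\<lambda>x. u x - v x) \<le> (C * modular q M (\<lambda>x. grad u x - grad v x)) powr (1 / q)"
      unfolding lnorm_def using q_ge by (intro powr_mono2) auto
    also have "\<dots> = C powr (1 / q) * lnorm (\<lambda>x. grad u x - grad v x)"
      using C(1) by (simp add: powr_mult lnorm_def)
    finally show "lnorm (\<lambda>x. u x - v x) \<le> C powr (1 / q) * lnorm (\<lambda>x. grad u x - grad v x)" .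
  qed simp
qed

lemma continuous_map_powr_q:
  assumes "continuous_map X euclideanreal f"
  shows "continuous_map X euclideanreal (\<lambda>x. \<bar>f x\<bar> powr q)"
proof -
  have "continuous_on UNIV (\<lambda>t::real. \<bar>t\<bar> powr q)"
    using q_ge by (auto intro!: continuous_intros continuous_on_powr')
  then have "continuous_map euclideanreal euclideanreal (\<lambda>t::real. \<bar>t\<bar> powr q)" by simp
  from continuous_map_compose[OF assms this] show ?thesis by (simp add: comp_def)
qed

lemma continuous_map_lnorm_diff:
  assumes w: "w \<in> W"
  shows "continuous_map T euclideanreal (\<lambda>u. lnorm (\<lambda>x. u x - w x))"
proof -
  obtain K where K: "0 \<le> K" "\<And>u v. u \<in> W \<Longrightarrow> v \<in> W \<Longrightarrow> lnorm (\<lambda>x. u x - v x) \<le> K * lnorm (\<lambda>x. grad u x - grad v x)"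
    using Poincare_lnorm by blast
  show ?thesis
  proof (rule continuous_map_from_W[OF K(1)])
    fix u v assume u: "u \<in> W" and v: "v \<in> W"
    have "\<bar>lnorm (\<lambda>x. u x - w x) - lnorm (\<lambda>x. v x - w x)\<bar> \<le> lnorm (\<lambda>x. (u x - w x) - (v x - w x))"
      by (intro lnorm_triangle Lp_diff q_ge WD(2) u v w)
    also have "\<dots> = lnorm (\<lambda>x. u x - v x)" by simp
    also have "\<dots> \<le> K * lnorm (\<lambda>x. grad u x - grad v x)" by (rule K(2)[OF u v])
    finally show "\<bar>lnorm (\<lambda>x. u x - w x) - lnorm (\<lambda>x. v x - w x)\<bar> \<le> K * lnorm (\<lambda>x. grad u x - grad v x)" .
  qed
qed

lemma continuous_map_modular_diff:
  assumes w: "w \<in> W"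
  shows "continuous_map T euclideanreal (\<lambda>u. modular q M (\<lambda>x. u x - w x))"
  using continuous_map_powr_q[OF continuous_map_lnorm_diff[OF w]] by (simp add: lnorm_powr)

lemma continuous_map_modular: "continuous_map T euclideanreal (modular q M)"
  using continuous_map_modular_diff[OF W_zero] by simp

lemma continuous_map_lnorm: "continuous_map T euclideanreal (\<lambda>u. lnorm u)"
  using continuous_map_lnorm_diff[OF W_zero] by simp

lemma continuous_map_modular_grad: "continuous_map T euclideanreal (\<lambda>u. modular q M (grad u))"
proof -
  have "continuous_map T euclideanreal (\<lambda>u. lnorm (grad u))"
    by (rule continuous_map_from_W[of 1]) (auto intro!: lnorm_triangle WD(3))
  then show ?thesis using continuous_map_powr_q[of T "\<lambda>u. lnorm (grad u)"] by (simp add: lnorm_powr)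
qed

lemma D1_eq: "D1 q \<Omega> = {u \<in> W. modular q M u = 1}"
  by (simp add: D1_def modular_def)

lemma D1_W: "u \<in> D1 q \<Omega> \<Longrightarrow> u \<in> W"
  by (simp add: D1_eq)

lemma uminus_W: "u \<in> W \<Longrightarrow> - u \<in> W"
  using W_scale[of u "-1"] by (simp add: fun_Compl_def)

lemma modular_uminus: "modular s M (- u) = modular s M u" for u :: "'a \<Rightarrow> real"
  by (simp add: modular_def)

lemma modular_grad_uminus: "u \<in> W \<Longrightarrow> modular s M (grad (- u)) = modular s M (grad u)"
proof -
  assume u: "u \<in> W"
  have "modular s M (grad (- u)) = modular s M (\<lambda>x. (-1) *\<^sub>R grad u x)"
  proof (rule modular_grad_cong[OF uminus_W[OF u] Lp_scaleR[OF WD(3)[OF u]]])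
    show "AE x in M. grad (- u) x = (-1) *\<^sub>R grad u x" using grad_scale[OF u, of "-1"] by (simp add: fun_Compl_def)
  qed
  then show ?thesis by (simp only: modular_scaleR) simp
qed

lemma continuous_map_lincomb:
  assumes I: "finite I" and z: "\<And>i. i \<in> I \<Longrightarrow> z i \<in> W"
    and c: "\<And>i. i \<in> I \<Longrightarrow> continuous_map X euclideanreal (c i)"
  shows "continuous_map X T (\<lambda>x y. \<Sum>i\<in>I. c i x * z i y)"
proof (rule continuous_map_into_W)
  show "(\<lambda>y. \<Sum>i\<in>I. c i x * z i y) \<in> W" for x using W_sum(1)[of I z "\<lambda>i. c i x", OF I z] by simp
  fix x and e :: real assume x: "x \<in> topspace X" and e: "0 < e"
  define s where "s = (\<lambda>y. \<Sum>i\<in>I. \<bar>c i x - c i y\<bar>)"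
  define m where "m = (\<Sum>i\<in>I. modular q M (grad (z i)))"
  have m: "0 \<le> m" unfolding m_def by (rule sum_nonneg) simp
  define d where "d = min 1 (e / (m + 1))"
  have d: "0 < d" "d \<le> 1" "d * m < e"
  proof -
    show "0 < d" "d \<le> 1" using e m by (auto simp: d_def)
    have "d * m \<le> e / (m + 1) * m" using m by (intro mult_right_mono) (auto simp: d_def)
    also have "\<dots> < e" using e m by (simp add: field_simps)
    finally show "d * m < e" .
  qed
  have sc: "continuous_map X euclideanreal s"
    unfolding s_def using c by (intro continuous_map_sum I continuous_map_real_abs continuous_map_diff) auto
  show "\<exists>U. openin X U \<and> x \<in> U \<and> (\<forall>y\<in>U. modular q M (\<lambda>a. grad (\<lambda>y. \<Sum>i\<in>I. c i x * z i y) a - grad (\<lambda>b. \<Sum>i\<in>I. c i y * z i b) a) < e)"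
  proof (intro exI[of _ "{y \<in> topspace X. s y \<in> {..<d}}"] conjI ballI)
    show "openin X {y \<in> topspace X. s y \<in> {..<d}}"
      by (rule openin_continuous_map_preimage[OF sc]) simp
    show "x \<in> {y \<in> topspace X. s y \<in> {..<d}}" using x d by (simp add: s_def)
    fix y assume y: "y \<in> {y \<in> topspace X. s y \<in> {..<d}}"
    let ?t = "\<lambda>i. c i x - c i y"
    have tL: "(\<lambda>a. \<Sum>i\<in>I. ?t i *\<^sub>R grad (z i) a) \<in> Lp q M"
      by (rule Lp_sum[OF q_ge(2) I]) (use WD(3)[OF z] in auto)
    have gL: "grad (\<lambda>b. \<Sum>i\<in>I. f i * z i b) \<in> Lp q M" for f by (rule WD(3)[OF W_sum(1)[OF I z]])
    have ae: "AE a in M. grad (\<lambda>b. \<Sum>i\<in>I. f i * z i b) a = (\<Sum>i\<in>I. f i *\<^sub>R grad (z i) a)" for f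
      by (rule W_sum(2)[OF I z])
    have "modular q M (\<lambda>a. grad (\<lambda>y. \<Sum>i\<in>I. c i x * z i y) a - grad (\<lambda>b. \<Sum>i\<in>I. c i y * z i b) a)
      = modular q M (\<lambda>a. \<Sum>i\<in>I. ?t i *\<^sub>R grad (z i) a)"
    proof (rule modular_cong_AE[OF LpD(1)[OF Lp_diff[OF q_ge(2) gL gL]] LpD(1)[OF tL]])
      show "AE a in M. grad (\<lambda>y. \<Sum>i\<in>I. c i x * z i y) a - grad (\<lambda>b. \<Sum>i\<in>I. c i y * z i b) a = (\<Sum>i\<in>I. ?t i *\<^sub>R grad (z i) a)"
        using ae[of "\<lambda>i. c i x"] ae[of "\<lambda>i. c i y"]
        by eventually_elim (simp add: sum_subtractf scaleR_left_diff_distrib)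
    qed
    also have "\<dots> \<le> (\<Sum>i\<in>I. \<bar>?t i\<bar> * modular q M (grad (z i)))"
    proof (rule modular_convex_combination[OF q_ge(1) I])
      show "grad (z i) \<in> Lp q M" if "i \<in> I" for i by (rule WD(3)[OF z[OF that]])
      show "(\<Sum>i\<in>I. \<bar>?t i\<bar>) \<le> 1" using y d(2) by (simp add: s_def)
    qed
    also have "\<dots> \<le> (\<Sum>i\<in>I. s y * modular q M (grad (z i)))"
    proof (rule sum_mono)
      fix i assume i: "i \<in> I"
      have "\<bar>?t i\<bar> \<le> s y" unfolding s_def using I i by (intro member_le_sum[of i I "\<lambda>i. \<bar>c i x - c i y\<bar>"]) auto
      then show "\<bar>?t i\<bar> * modular q M (grad (z i)) \<le> s y * modular q M (grad (z i))" by (intro mult_right_mono) auto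
    qed
    also have "\<dots> = s y * m" by (simp add: m_def sum_distrib_left)
    also have "\<dots> \<le> d * m" using y m by (intro mult_right_mono) auto
    also have "\<dots> < e" by (rule d(3))
    finally show "modular q M (\<lambda>a. grad (\<lambda>y. \<Sum>i\<in>I. c i x * z i y) a - grad (\<lambda>b. \<Sum>i\<in>I. c i y * z i b) a) < e" .
  qed
qed

text \<open>Normalised linear combinations with continuous coefficients. Both kinds of odd maps into sublevel
  sets that are needed below, from spheres and from other sublevel sets, have this form.\<close>

lemma normalised_lincomb:
  fixes c :: "'i \<Rightarrow> 'x \<Rightarrow> real"
  assumes I: "finite I" and z: "\<And>i. i \<in> I \<Longrightarrow> z i \<in> W"
    and c: "\<And>i. i \<in> I \<Longrightarrow> continuous_map X euclideanreal (c i)"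
    and pos: "\<And>x. x \<in> topspace X \<Longrightarrow> 0 < modular q M (\<lambda>y. \<Sum>i\<in>I. c i x * z i y)"
  defines "G \<equiv> \<lambda>x y. inverse (lnorm (\<lambda>y. \<Sum>i\<in>I. c i x * z i y)) * (\<Sum>i\<in>I. c i x * z i y)"
  shows "continuous_map X T G" "\<And>x. x \<in> topspace X \<Longrightarrow> G x \<in> D1 q \<Omega>"
proof -
  define N where "N = (\<lambda>x. lnorm (\<lambda>y. \<Sum>i\<in>I. c i x * z i y))"
  have Fc: "continuous_map X T (\<lambda>x y. \<Sum>i\<in>I. c i x * z i y)" by (rule continuous_map_lincomb[OF I z c])
  have Nc: "continuous_map X euclideanreal N"
    using continuous_map_compose[OF Fc continuous_map_lnorm] by (simp add: N_def comp_def)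
  have Np: "0 < N x" if "x \<in> topspace X" for x using pos[OF that] by (simp add: N_def lnorm_def)
  have ce: "continuous_map X euclideanreal (\<lambda>x. inverse (N x) * c i x)" if "i \<in> I" for i
    by (intro continuous_map_real_mult continuous_map_real_inverse Nc c[OF that]) (use Np in force)
  have Ge: "G = (\<lambda>x y. \<Sum>i\<in>I. (inverse (N x) * c i x) * z i y)"
    unfolding G_def N_def by (simp add: sum_distrib_left mult.assoc)
  show "continuous_map X T G"
    unfolding Ge by (rule continuous_map_lincomb[OF I z ce])
  show "G x \<in> D1 q \<Omega>" if x: "x \<in> topspace X" for x
  proof -
    have W: "(\<lambda>y. \<Sum>i\<in>I. c i x * z i y) \<in> W" by (rule W_sum(1)[OF I z])
    have "modular q M (G x) = \<bar>inverse (N x)\<bar> powr q * modular q M (\<lambda>y. \<Sum>i\<in>I. c i x * z i y)"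
      unfolding G_def N_def by (rule modular_mult)
    also have "\<dots> = \<bar>inverse (N x)\<bar> powr q * N x powr q" by (simp add: N_def lnorm_powr)
    also have "\<dots> = (\<bar>inverse (N x)\<bar> * N x) powr q" using Np[OF x] by (subst powr_mult) auto
    also have "\<dots> = 1" using Np[OF x] by simp
    finally have "modular q M (G x) = 1" .
    moreover have "G x \<in> W" unfolding G_def by (rule W_scale[OF W])
    ultimately show ?thesis by (simp add: D1_eq)
  qed
qed

end



section \<open>Minimax levels and critical points\<close>

locale two_exponents = bounded_open +
  fixes p :: real
  assumes p_gt_1: "1 < p" and p_less_q: "p < q"
begin

lemma p_ge: "1 \<le> p" "0 \<le> p" "0 < p" "p \<le> q"
  using p_gt_1 p_less_q by auto

text \<open>The weights are such that \<open>1 / q\<close> times the derivative of the energy is the operator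
  \<open>-e\<Delta>\<^sub>p - \<Delta>\<^sub>q\<close>.\<close>

definition energy :: "real \<Rightarrow> ('a \<Rightarrow> real) \<Rightarrow> real" where
  "energy e u = e * (q / p) * modular p M (grad u) + modular q M (grad u)"

definition sublevel :: "real \<Rightarrow> real \<Rightarrow> ('a \<Rightarrow> real) set" where
  "sublevel e a = {u \<in> D1 q \<Omega>. energy e u \<le> a}"

lemma sublevel_W: "sublevel e a \<subseteq> W"
  by (auto simp: sublevel_def D1_eq)

lemma grad_Lp_p: "u \<in> W \<Longrightarrow> grad u \<in> Lp p M"
  by (rule fm.Lp_subset(1)[OF p_ge(2,4) WD(3)])

lemma modular_p_le: "u \<in> W \<Longrightarrow> modular p M (grad u) \<le> measure M (space M) + modular q M (grad u)"
  by (rule fm.Lp_subset(2)[OF p_ge(2,4) WD(3)])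

lemma energy_ge:
  assumes "0 \<le> e"
  shows "modular q M (grad u) \<le> energy e u" "0 \<le> energy e u"
proof -
  have "0 \<le> e * (q / p) * modular p M (grad u)" using assms q_ge p_ge by simp
  then show "modular q M (grad u) \<le> energy e u" "0 \<le> energy e u" by (auto simp: energy_def intro: add_nonneg_nonneg)
qed

lemma energy_cong:
  assumes u: "u \<in> W" and G: "G \<in> Lp q M" and ae: "AE x in M. grad u x = G x"
  shows "energy e u = e * (q / p) * modular p M G + modular q M G"
  unfolding energy_def modular_grad_cong[OF u G ae] ..

lemma energy_scale:
  assumes "u \<in> W"
  shows "energy e (\<lambda>x. c * u x) = e * (q / p) * (\<bar>c\<bar> powr p * modular p M (grad u)) + \<bar>c\<bar> powr q * modular q M (grad u)"
  using energy_cong[OF W_scale[OF assms] Lp_scaleR[OF WD(3)[OF assms]] grad_scale[OF assms]] by (simp only: modular_scaleR)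

text \<open>Factors above \<open>1\<close> enlarge the \<open>q\<close>-part most.\<close>

lemma energy_scale_le:
  assumes u: "u \<in> W" and e: "0 \<le> e" and c: "\<bar>c\<bar> \<le> k" "1 \<le> k"
  shows "energy e (\<lambda>x. c * u x) \<le> k powr q * energy e u"
proof -
  have 1: "\<bar>c\<bar> powr p \<le> k powr q"
  proof -
    have "\<bar>c\<bar> powr p \<le> k powr p" using c p_ge by (intro powr_mono2) auto
    also have "\<dots> \<le> k powr q" using c p_ge by (intro powr_mono) auto
    finally show ?thesis .
  qed
  have 2: "\<bar>c\<bar> powr q \<le> k powr q" using c q_ge by (intro powr_mono2) auto
  have "energy e (\<lambda>x. c * u x) \<le> e * (q / p) * (k powr q * modular p M (grad u)) + k powr q * modular q M (grad u)"
    unfolding energy_scale[OF u] using 1 2 e q_ge p_ge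
    by (intro add_mono mult_left_mono mult_right_mono) auto
  also have "\<dots> = k powr q * energy e u" by (simp add: energy_def algebra_simps)
  finally show ?thesis .
qed

lemma energy_convex:
  assumes e: "0 \<le> e" and I: "finite I" and z: "\<And>i. i \<in> I \<Longrightarrow> z i \<in> W" and c: "(\<Sum>i\<in>I. \<bar>c i\<bar>) \<le> 1"
  shows "energy e (\<lambda>x. \<Sum>i\<in>I. c i * z i x) \<le> (\<Sum>i\<in>I. \<bar>c i\<bar> * energy e (z i))"
proof -
  let ?G = "\<lambda>x. \<Sum>i\<in>I. c i *\<^sub>R grad (z i) x"
  have GL: "?G \<in> Lp q M" by (rule Lp_sum[OF q_ge(2) I]) (rule WD(3)[OF z])
  have "energy e (\<lambda>x. \<Sum>i\<in>I. c i * z i x) = e * (q / p) * modular p M ?G + modular q M ?G"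
    by (rule energy_cong[OF W_sum(1)[OF I z] GL W_sum(2)[OF I z]])
  also have "\<dots> \<le> e * (q / p) * (\<Sum>i\<in>I. \<bar>c i\<bar> * modular p M (grad (z i))) + (\<Sum>i\<in>I. \<bar>c i\<bar> * modular q M (grad (z i)))"
    using e q_ge p_ge
    by (intro add_mono mult_left_mono modular_convex_combination I c grad_Lp_p z WD(3)) auto
  also have "\<dots> = (\<Sum>i\<in>I. \<bar>c i\<bar> * energy e (z i))"
    by (simp add: energy_def sum_distrib_left sum.distrib algebra_simps)
  finally show ?thesis .
qed

lemma energy_uminus: "u \<in> W \<Longrightarrow> energy e (- u) = energy e u"
  by (simp add: energy_def modular_grad_uminus)

lemma duality_continuous:
  assumes R: "0 \<le> R" and th: "0 < \<theta>"
  obtains \<delta> where "0 < \<delta>"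
    "\<And>u v y. u \<in> D1 q \<Omega> \<Longrightarrow> v \<in> D1 q \<Omega> \<Longrightarrow> y \<in> W \<Longrightarrow> modular q M y \<le> R \<Longrightarrow>
      modular q M (\<lambda>x. u x - v x) < \<delta> \<Longrightarrow> \<bar>duality q M u y - duality q M v y\<bar> \<le> \<theta>"
proof -
  define t where "t = \<theta> / (2 * (2 + R))"
  have t: "0 < t" using th R by (simp add: t_def)
  obtain C where C: "0 \<le> C"
    "\<And>f g y :: 'a \<Rightarrow> real. f \<in> Lp q M \<Longrightarrow> g \<in> Lp q M \<Longrightarrow> y \<in> Lp q M \<Longrightarrow>
      \<bar>duality q M f y - duality q M g y\<bar> \<le> t * (modular q M f + modular q M g + modular q M y) + C * modular q M (\<lambda>x. f x - g x)"
    using duality_uniform_continuity[OF q_gt_1 t, where M = M] by blast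
  show ?thesis
  proof (rule that[of "\<theta> / (2 * (C + 1))"])
    show "0 < \<theta> / (2 * (C + 1))" using th C(1) by simp
    fix u v y assume u: "u \<in> D1 q \<Omega>" and v: "v \<in> D1 q \<Omega>" and y: "y \<in> W" "modular q M y \<le> R"
      and d: "modular q M (\<lambda>x. u x - v x) < \<theta> / (2 * (C + 1))"
    have "\<bar>duality q M u y - duality q M v y\<bar> \<le> t * (modular q M u + modular q M v + modular q M y) + C * modular q M (\<lambda>x. u x - v x)"
      using u v y by (intro C(2) WD(2)) (auto simp: D1_eq)
    also have "\<dots> \<le> t * (2 + R) + (C + 1) * (\<theta> / (2 * (C + 1)))"
      using u v y d t C(1) by (intro add_mono mult_left_mono mult_mono) (auto simp: D1_eq)
    also have "t * (2 + R) = \<theta> / 2" unfolding t_def using R by (subst times_divide_eq_left) (simp add: field_simps)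
    also have "(C + 1) * (\<theta> / (2 * (C + 1))) = \<theta> / 2" using C(1) by (simp add: field_simps)
    finally show "\<bar>duality q M u y - duality q M v y\<bar> \<le> \<theta>" by simp
  qed
qed

text \<open>The deformation step. Replacing \<open>w\<close> by a point \<open>y\<close> of smaller energy on the hyperplane
  \<open>\<integral>|w|\<^sup>q\<^sup>-\<^sup>2wy = 1\<close> does not decrease the \<open>L\<^sup>q\<close> norm, so that normalising \<open>y\<close> does not increase the energy.
  The choice of \<open>y\<close> is made continuous and odd in \<open>w\<close> by a partition of unity over a finite net for the
  \<open>L\<^sup>q\<close> distance; convexity of the energy and linearity of the constraint make this harmless.\<close>

lemma genus_sublevel_descent:
  assumes e: "0 \<le> e" and bb: "b < b'"
    and desc: "\<And>w. w \<in> sublevel e a \<Longrightarrow> \<exists>y\<in>W. duality q M w y = 1 \<and> energy e y \<le> b"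
  shows "genus T (sublevel e a) \<le> genus T (sublevel e b')"
proof (cases "sublevel e a = {}")
  case True
  then show ?thesis by (simp add: genus_empty)
next
  case False
  let ?S = "sublevel e a"
  have b0: "0 \<le> b"
  proof -
    obtain w where "w \<in> ?S" using False by blast
    then obtain y where "energy e y \<le> b" using desc by blast
    then show ?thesis using energy_ge(2)[OF e, of y] by linarith
  qed
  have b'0: "0 < b'" using b0 bb by simp
  have SD: "w \<in> D1 q \<Omega>" "w \<in> W" if "w \<in> ?S" for w using that by (auto simp: sublevel_def D1_eq)
  \<comment> \<open>Normalising a function of modular at least \<open>\<rho>\<close> multiplies the energy by at most \<open>1 / \<rho>\<close>.\<close>
  define \<rho> where "\<rho> = max (1 / 2) (b / b')"
  have \<rho>: "0 < \<rho>" "\<rho> < 1" "b / \<rho> \<le> b'"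
  proof -
    show "0 < \<rho>" by (simp add: \<rho>_def)
    show "\<rho> < 1" using bb b'0 by (simp add: \<rho>_def)
    have "b = b / b' * b'" using b'0 by simp
    also have "\<dots> \<le> \<rho> * b'" using b'0 by (intro mult_right_mono) (auto simp: \<rho>_def)
    finally show "b / \<rho> \<le> b'" using \<open>0 < \<rho>\<close> by (simp add: pos_divide_le_eq mult.commute)
  qed
  \<comment> \<open>The tolerated defect of the constraint: it turns into the defect \<open>q * \<theta>\<close> of the modular.\<close>
  define \<theta> where "\<theta> = (1 - \<rho>) / q"
  have th: "0 < \<theta>" "q * \<theta> = 1 - \<rho>" using \<rho> q_ge by (auto simp: \<theta>_def)
  obtain C where C: "0 < C" "\<And>u. u \<in> W \<Longrightarrow> modular q M u \<le> C * modular q M (grad u)" using Poincare by blast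
  have R: "0 \<le> C * b" using C(1) b0 by simp
  obtain \<delta> where \<delta>: "0 < \<delta>"
    "\<And>u v y. u \<in> D1 q \<Omega> \<Longrightarrow> v \<in> D1 q \<Omega> \<Longrightarrow> y \<in> W \<Longrightarrow> modular q M y \<le> C * b \<Longrightarrow>
      modular q M (\<lambda>x. u x - v x) < \<delta> \<Longrightarrow> \<bar>duality q M u y - duality q M v y\<bar> \<le> \<theta>"
    using duality_continuous[OF R th(1)] by blast
  have Sb: "?S \<subseteq> {u \<in> W. modular q M (grad u) \<le> max 0 a}"
  proof
    fix w assume w: "w \<in> ?S"
    then have "energy e w \<le> a" by (simp add: sublevel_def)
    then show "w \<in> {u \<in> W. modular q M (grad u) \<le> max 0 a}" using SD(2)[OF w] energy_ge(1)[OF e, of w] by auto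
  qed
  obtain I where I: "finite I" "I \<subseteq> ?S" "\<And>u. u \<in> ?S \<Longrightarrow> \<exists>v\<in>I. modular q M (\<lambda>x. u x - v x) < \<delta>"
    using finite_net[OF \<delta>(1) _ Sb] by auto
  have "\<forall>w. \<exists>y. w \<in> ?S \<longrightarrow> y \<in> W \<and> duality q M w y = 1 \<and> energy e y \<le> b" using desc by blast
  from choice[OF this] obtain y where y: "\<And>w. w \<in> ?S \<Longrightarrow> y w \<in> W" "\<And>w. w \<in> ?S \<Longrightarrow> duality q M w (y w) = 1"
    "\<And>w. w \<in> ?S \<Longrightarrow> energy e (y w) \<le> b" by auto
  have IS: "i \<in> ?S" if "i \<in> I" for i using I(2) that by blast
  have yW: "y i \<in> W" if "i \<in> I" for i by (rule y(1)[OF IS[OF that]])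
  have yR: "modular q M (y i) \<le> C * b" if i: "i \<in> I" for i
  proof -
    have "modular q M (y i) \<le> C * modular q M (grad (y i))" by (rule C(2)[OF yW[OF i]])
    also have "\<dots> \<le> C * b"
      using energy_ge(1)[OF e, of "y i"] y(3)[OF IS[OF i]] C(1) by (intro mult_left_mono) auto
    finally show ?thesis .
  qed
  define \<beta> :: "('a \<Rightarrow> real) \<Rightarrow> ('a \<Rightarrow> real) \<Rightarrow> real" where "\<beta> = (\<lambda>i w. max 0 (\<delta> - modular q M (\<lambda>x. w x - i x)))"
  define \<beta>' :: "('a \<Rightarrow> real) \<Rightarrow> ('a \<Rightarrow> real) \<Rightarrow> real" where "\<beta>' = (\<lambda>i w. max 0 (\<delta> - modular q M (\<lambda>x. w x + i x)))"
  define D where "D = (\<lambda>w. \<Sum>i\<in>I. \<beta> i w + \<beta>' i w)"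
  \<comment> \<open>The net together with its mirror image; the mirrored point \<open>- i\<close> contributes \<open>- y i\<close>, which makes \<open>c\<close> odd.\<close>
  define c where "c = (\<lambda>i w. (\<beta> i w - \<beta>' i w) / D w)"
  have bn: "0 \<le> \<beta> i w" "0 \<le> \<beta>' i w" for i w by (auto simp: \<beta>_def \<beta>'_def)
  have neg: "\<beta> i (- w) = \<beta>' i w" "\<beta>' i (- w) = \<beta> i w" for i w
  proof -
    have "modular q M (\<lambda>x. (- w) x - i x) = modular q M (\<lambda>x. - (w x + i x))" by (simp add: fun_Compl_def)
    also have "\<dots> = modular q M (\<lambda>x. w x + i x)" by (simp only: modular_def norm_minus_cancel)
    finally show "\<beta> i (- w) = \<beta>' i w" by (simp add: \<beta>_def \<beta>'_def)
    have "modular q M (\<lambda>x. (- w) x + i x) = modular q M (\<lambda>x. - (w x - i x))" by (simp add: fun_Compl_def)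
    also have "\<dots> = modular q M (\<lambda>x. w x - i x)" by (simp only: modular_def norm_minus_cancel)
    finally show "\<beta>' i (- w) = \<beta> i w" by (simp add: \<beta>_def \<beta>'_def)
  qed
  have Dneg: "D (- w) = D w" for w unfolding D_def neg by (rule sum.cong) auto
  have cneg: "c i (- w) = - c i w" for i w unfolding c_def Dneg neg minus_divide_left by simp
  have Dp: "0 < D w" if w: "w \<in> ?S" for w
  proof -
    obtain i where i: "i \<in> I" "modular q M (\<lambda>x. w x - i x) < \<delta>" using I(3)[OF w] by auto
    have "0 < \<beta> i w + \<beta>' i w" using i(2) bn(2)[of i w] by (simp add: \<beta>_def add_pos_nonneg)
    then show ?thesis unfolding D_def by (rule sum_pos2[OF I(1) i(1)]) (simp add: bn)
  qed
  let ?X = "subtopology T ?S"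
  have tX: "topspace ?X = ?S" using Int_absorb1[OF sublevel_W[of e a]] by simp
  have bc: "continuous_map ?X euclideanreal (\<beta> i)" "continuous_map ?X euclideanreal (\<beta>' i)" if i: "i \<in> I" for i
  proof -
    have iW: "i \<in> W" by (rule SD(2)[OF IS[OF i]])
    have 1: "continuous_map ?X euclideanreal (\<lambda>w. modular q M (\<lambda>x. w x - i x))"
      by (rule continuous_map_from_subtopology[OF continuous_map_modular_diff[OF iW]])
    have "continuous_map ?X euclideanreal (\<lambda>w. modular q M (\<lambda>x. w x - (- i) x))"
      by (rule continuous_map_from_subtopology[OF continuous_map_modular_diff[OF uminus_W[OF iW]]])
    then have 2: "continuous_map ?X euclideanreal (\<lambda>w. modular q M (\<lambda>x. w x + i x))" by (simp add: fun_Compl_def)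
    show "continuous_map ?X euclideanreal (\<beta> i)" "continuous_map ?X euclideanreal (\<beta>' i)"
      unfolding \<beta>_def \<beta>'_def by (intro continuous_map_real_max continuous_map_diff 1 2 continuous_map_const[THEN iffD2]; simp)+
  qed
  have cc: "continuous_map ?X euclideanreal (c i)" if i: "i \<in> I" for i
  proof -
    have "continuous_map ?X euclideanreal D"
      unfolding D_def by (intro continuous_map_sum I(1) continuous_map_add bc)
    moreover have "D w \<noteq> 0" if "w \<in> topspace ?X" for w using Dp[of w] that unfolding tX by simp
    ultimately show ?thesis unfolding c_def by (intro continuous_map_real_divide continuous_map_diff bc[OF i]) auto
  qed
  have cs: "(\<Sum>i\<in>I. \<bar>c i w\<bar>) \<le> 1" if w: "w \<in> ?S" for w
  proof -
    have "(\<Sum>i\<in>I. \<bar>c i w\<bar>) \<le> (\<Sum>i\<in>I. (\<beta> i w + \<beta>' i w) / D w)"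
    proof (rule sum_mono)
      fix i
      have "\<bar>\<beta> i w - \<beta>' i w\<bar> \<le> \<beta> i w + \<beta>' i w" using bn[of i w] by linarith
      then show "\<bar>c i w\<bar> \<le> (\<beta> i w + \<beta>' i w) / D w" using Dp[OF w] by (simp add: c_def abs_divide divide_right_mono)
    qed
    also have "\<dots> = D w / D w" by (simp add: D_def flip: sum_divide_distrib)
    also have "\<dots> = 1" using Dp[OF w] by simp
    finally show ?thesis .
  qed
  define \<eta> where "\<eta> = (\<lambda>w x. \<Sum>i\<in>I. c i w * y i x)"
  have \<eta>W: "\<eta> w \<in> W" for w unfolding \<eta>_def by (rule W_sum(1)[OF I(1) yW])
  have \<eta>E: "energy e (\<eta> w) \<le> b" if w: "w \<in> ?S" for w
  proof -
    have "energy e (\<eta> w) \<le> (\<Sum>i\<in>I. \<bar>c i w\<bar> * energy e (y i))"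
      unfolding \<eta>_def by (rule energy_convex[OF e I(1) yW cs[OF w]])
    also have "\<dots> \<le> (\<Sum>i\<in>I. \<bar>c i w\<bar> * b)" using y(3) IS by (intro sum_mono mult_left_mono) auto
    also have "\<dots> = (\<Sum>i\<in>I. \<bar>c i w\<bar>) * b" by (simp add: sum_distrib_right)
    also have "\<dots> \<le> 1 * b" using cs[OF w] b0 by (intro mult_right_mono) auto
    finally show ?thesis by simp
  qed
  have \<eta>N: "\<rho> \<le> modular q M (\<eta> w)" if w: "w \<in> ?S" for w
  proof -
    have wL: "w \<in> Lp q M" by (rule WD(2)[OF SD(2)[OF w]])
    have "duality q M w (\<eta> w) = (\<Sum>i\<in>I. c i w * duality q M w (y i))"
      unfolding \<eta>_def using duality_sum[OF q_gt_1 wL I(1) WD(2)[OF yW], where c = "\<lambda>i. c i w"] by simp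
    also have "\<dots> = (\<Sum>i\<in>I. (\<beta> i w - \<beta>' i w) * duality q M w (y i)) / D w"
      by (simp add: c_def sum_divide_distrib)
    finally have d: "duality q M w (\<eta> w) = (\<Sum>i\<in>I. (\<beta> i w - \<beta>' i w) * duality q M w (y i)) / D w" .
    have "(1 - \<theta>) * D w \<le> (\<Sum>i\<in>I. (\<beta> i w - \<beta>' i w) * duality q M w (y i))"
      unfolding D_def sum_distrib_left
    proof (rule sum_mono)
      fix i assume i: "i \<in> I"
      have 1: "\<beta> i w * (1 - \<theta>) \<le> \<beta> i w * duality q M w (y i)"
      proof (cases "\<beta> i w = 0")
        case False
        then have "modular q M (\<lambda>x. w x - i x) < \<delta>" by (auto simp: \<beta>_def max_def split: if_splits)
        then have "\<bar>duality q M w (y i) - duality q M i (y i)\<bar> \<le> \<theta>"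
          by (rule \<delta>(2)[OF SD(1)[OF w] SD(1)[OF IS[OF i]] yW[OF i] yR[OF i]])
        then have "1 - \<theta> \<le> duality q M w (y i)" using y(2)[OF IS[OF i]] by linarith
        then show ?thesis by (intro mult_left_mono bn)
      qed simp
      have 2: "\<beta>' i w * (1 - \<theta>) \<le> \<beta>' i w * (- duality q M w (y i))"
      proof (cases "\<beta>' i w = 0")
        case False
        then have "modular q M (\<lambda>x. w x + i x) < \<delta>" by (auto simp: \<beta>'_def max_def split: if_splits)
        moreover have "modular q M (\<lambda>x. (- w) x - i x) = modular q M (\<lambda>x. - (w x + i x))" by (simp add: fun_Compl_def)
        ultimately have m: "modular q M (\<lambda>x. (- w) x - i x) < \<delta>" by (simp only: modular_def norm_minus_cancel)
        have "- w \<in> D1 q \<Omega>" using SD[OF w] by (simp add: D1_eq uminus_W modular_uminus)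
        from \<delta>(2)[OF this SD(1)[OF IS[OF i]] yW[OF i] yR[OF i] m]
        have "\<bar>duality q M (- w) (y i) - duality q M i (y i)\<bar> \<le> \<theta>" .
        moreover have "duality q M (- w) (y i) = - duality q M w (y i)"
          using duality_uminus_left[of q M w "y i"] by (simp add: fun_Compl_def)
        ultimately have "1 - \<theta> \<le> - duality q M w (y i)" using y(2)[OF IS[OF i]] by linarith
        then show ?thesis by (intro mult_left_mono bn)
      qed simp
      show "(1 - \<theta>) * (\<beta> i w + \<beta>' i w) \<le> (\<beta> i w - \<beta>' i w) * duality q M w (y i)"
        using 1 2 by (simp add: algebra_simps)
    qed
    then have "1 - \<theta> \<le> duality q M w (\<eta> w)" unfolding d using Dp[OF w] by (simp add: pos_le_divide_eq)
    then have "q * (1 - \<theta>) \<le> q * duality q M w (\<eta> w)" using q_ge by (intro mult_left_mono) auto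
    also have "\<dots> \<le> (q - 1) * modular q M w + modular q M (\<eta> w)"
      by (rule duality_le_modular[OF q_gt_1 wL WD(2)[OF \<eta>W]])
    also have "modular q M w = 1" using SD(1)[OF w] by (simp add: D1_eq)
    finally have "q - q * \<theta> \<le> q - 1 + modular q M (\<eta> w)" by (simp add: algebra_simps)
    then show ?thesis using th(2) by simp
  qed
  define G where "G = (\<lambda>w x. inverse (lnorm (\<eta> w)) * \<eta> w x)"
  have pos: "0 < modular q M (\<lambda>x. \<Sum>i\<in>I. c i w * y i x)" if "w \<in> topspace ?X" for w
    using \<eta>N[of w] \<rho>(1) that unfolding tX \<eta>_def by linarith
  note nl = normalised_lincomb[OF I(1) yW cc pos]
  have Gc: "continuous_map ?X T G" unfolding G_def \<eta>_def by (rule nl(1))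
  have GD: "G w \<in> D1 q \<Omega>" if w: "w \<in> ?S" for w unfolding G_def \<eta>_def by (rule nl(2)) (use w tX in auto)
  have GE: "energy e (G w) \<le> b'" if w: "w \<in> ?S" for w
  proof -
    define k where "k = \<rho> powr (- (1 / q))"
    have k1: "1 \<le> k"
    proof -
      have "\<rho> powr (1 / q) \<le> 1" using \<rho> q_ge by (intro powr_le1) auto
      then show ?thesis using \<rho>(1) by (simp add: k_def powr_minus one_le_inverse)
    qed
    have kq: "k powr q = 1 / \<rho>" unfolding k_def powr_powr using \<rho>(1) q_ge by (simp add: powr_minus_divide)
    have "\<rho> powr (1 / q) \<le> lnorm (\<eta> w)" unfolding lnorm_def using \<eta>N[OF w] \<rho>(1) q_ge by (intro powr_mono2) auto
    then have "inverse (lnorm (\<eta> w)) \<le> inverse (\<rho> powr (1 / q))" using \<rho>(1) by (intro le_imp_inverse_le) auto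
    then have ck: "\<bar>inverse (lnorm (\<eta> w))\<bar> \<le> k" unfolding k_def powr_minus by simp
    have "energy e (G w) \<le> k powr q * energy e (\<eta> w)" unfolding G_def by (rule energy_scale_le[OF \<eta>W e ck k1])
    also have "\<dots> \<le> 1 / \<rho> * b" unfolding kq using \<eta>E[OF w] \<rho>(1) by (intro mult_left_mono) auto
    also have "\<dots> \<le> b'" using \<rho>(3) by simp
    finally show ?thesis .
  qed
  show ?thesis
  proof (rule genus_le_of_odd_map[of T ?S "sublevel e b'" G])
    show "continuous_map ?X (subtopology T (sublevel e b')) G"
      unfolding continuous_map_in_subtopology tX
    proof (intro conjI Gc funcsetI)
      show "G w \<in> sublevel e b'" if "w \<in> ?S" for w
        unfolding sublevel_def mem_Collect_eq by (rule conjI[OF GD[OF that] GE[OF that]])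
    qed
    show "?S \<subseteq> topspace T" unfolding topspace_W10_topology by (rule sublevel_W)
    fix w assume "w \<in> ?S"
    have "\<eta> (- w) = (\<lambda>x. - \<eta> w x)" by (simp add: \<eta>_def cneg sum_negf)
    moreover have "lnorm (\<lambda>x. - \<eta> w x) = lnorm (\<eta> w)" by (simp add: lnorm_def modular_def)
    ultimately show "G (- w) = - G w" by (simp add: G_def fun_Compl_def)
  qed
qed

text \<open>Scaling by \<open>1 / r\<close> restores the constraint \<open>\<integral>|w|\<^sup>q\<^sup>-\<^sup>2wy = 1\<close>. The minimum with \<open>1\<close> accounts for the
  fact that the two parts of the energy scale with different powers.\<close>

lemma D1_scale_feasible:
  assumes c: "\<And>y. y \<in> W \<Longrightarrow> duality q M w y = 1 \<Longrightarrow> c0 \<le> energy e y" and e: "0 \<le> e"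
    and y: "y \<in> W" and r: "duality q M w y = r" "0 < r" and c0: "0 \<le> c0"
  shows "c0 * min 1 r powr q \<le> energy e y"
proof -
  have "duality q M w (\<lambda>x. (1 / r) * y x) = (1 / r) * r"
    using duality_scaleR[of q M w "1 / r" y] r by simp
  then have "c0 \<le> energy e (\<lambda>x. (1 / r) * y x)" using r by (intro c W_scale y) auto
  also have "\<dots> \<le> (1 / min 1 r) powr q * energy e y"
    by (rule energy_scale_le[OF y e]) (use r in \<open>auto simp: min_def field_simps\<close>)
  finally have "c0 \<le> energy e y / min 1 r powr q" using r by (simp add: powr_divide)
  then show ?thesis using r by (simp add: pos_le_divide_eq)
qed

text \<open>The Palais--Smale property for the sequences produced by the descent step: the midpoint of two
  members is almost feasible for one of them, so it has energy at least about \<open>c\<close>, and uniform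
  convexity forces the gradients together.\<close>

lemma minimax_sequence_converges:
  assumes e: "0 \<le> e" and c0: "0 \<le> c"
    and w: "\<And>n. w n \<in> D1 q \<Omega>" "\<And>n. energy e (w n) \<le> c + 1 / real (Suc n)"
    and low: "\<And>n y. y \<in> W \<Longrightarrow> duality q M (w n) y = 1 \<Longrightarrow> c - 1 / real (Suc n) \<le> energy e y"
  obtains r v where "strict_mono r" "v \<in> W" "(\<lambda>n. modular q M (\<lambda>x. w (r n) x - v x)) \<longlonglongrightarrow> 0"
    "(\<lambda>n. modular q M (\<lambda>x. grad (w (r n)) x - grad v x)) \<longlonglongrightarrow> 0"
proof -
  have wW: "w n \<in> W" and wN: "modular q M (w n) = 1" for n using w(1)[of n] by (auto simp: D1_eq)
  have wA: "modular q M (grad (w n)) \<le> c + 1" for n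
  proof -
    have "1 / real (Suc n) \<le> 1" by simp
    then show ?thesis using w(2)[of n] energy_ge(1)[OF e, of "w n"] by linarith
  qed
  have "\<exists>r::nat \<Rightarrow> nat. strict_mono r \<and>
    (\<forall>d>0. \<exists>N. \<forall>i\<ge>N. \<forall>j\<ge>N. modular q M (\<lambda>x. w (r i) x - w (r j) x) < d)"
  proof (rule Cauchy_subsequence[where u = w and K = "c + 1", OF wW wA])
    fix r :: "nat \<Rightarrow> nat"
    assume "strict_mono r" "\<And>d. 0 < d \<Longrightarrow> \<exists>N. \<forall>i\<ge>N. \<forall>j\<ge>N. modular q M (\<lambda>x. w (r i) x - w (r j) x) < d"
    then show ?thesis by (intro exI[of _ r] conjI allI impI)
  qed
  then obtain r :: "nat \<Rightarrow> nat" where r0: "strict_mono r \<and>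
    (\<forall>d>0. \<exists>N. \<forall>i\<ge>N. \<forall>j\<ge>N. modular q M (\<lambda>x. w (r i) x - w (r j) x) < d)" ..
  note r = conjunct1[OF r0] conjunct2[OF r0, rule_format]
  have "\<exists>N. \<forall>i\<ge>N. \<forall>j\<ge>N. modular q M (\<lambda>x. grad (w (r i)) x - grad (w (r j)) x) < \<epsilon>" if \<epsilon>: "0 < \<epsilon>" for \<epsilon>
  proof -
    \<comment> \<open>Both gradients have modular at most \<open>c + 1\<close>, so that the first error term is at most \<open>\<epsilon> / 2\<close>.\<close>
    define t where "t = \<epsilon> / (4 * (c + 1))"
    have t: "0 < t" using \<epsilon> c0 by (simp add: t_def)
    obtain C where C: "0 \<le> C" "\<And>f g :: 'a \<Rightarrow> 'a. f \<in> Lp q M \<Longrightarrow> g \<in> Lp q M \<Longrightarrow>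
      modular q M (\<lambda>x. f x - g x) \<le> t * (modular q M f + modular q M g)
       + C * ((modular q M f + modular q M g) / 2 - modular q M (\<lambda>x. (1/2) *\<^sub>R (f x + g x)))"
      using modular_uniform_convexity[OF q_gt_1 t, where M = M] by blast
    have lim: "((\<lambda>s. C * (2 * s + (c - c * (1 - s / 2) powr q))) \<longlongrightarrow> C * (2 * 0 + (c - c * (1 - 0 / 2) powr q))) (at_right 0)"
      by (intro tendsto_intros) auto
    then have "((\<lambda>s. C * (2 * s + (c - c * (1 - s / 2) powr q))) \<longlongrightarrow> 0) (at_right 0)" by simp
    then have "\<forall>\<^sub>F s in at_right 0. C * (2 * s + (c - c * (1 - s / 2) powr q)) < \<epsilon> / 2"
      using \<epsilon> by (intro order_tendstoD(2)) auto
    moreover have "\<forall>\<^sub>F s in at_right (0::real). s < 1" by (rule eventually_at_rightI[of 0 1]) auto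
    moreover have "\<forall>\<^sub>F s in at_right (0::real). 0 < s" by (rule eventually_at_right_less)
    ultimately have "\<forall>\<^sub>F s in at_right 0. 0 < s \<and> s < 1 \<and> C * (2 * s + (c - c * (1 - s / 2) powr q)) < \<epsilon> / 2"
      by eventually_elim auto
    then obtain s where s: "0 < s" "s < 1" "C * (2 * s + (c - c * (1 - s / 2) powr q)) < \<epsilon> / 2"
      using eventually_happens[of _ "at_right (0::real)"] trivial_limit_at_right_real by blast
    obtain \<delta> where \<delta>: "0 < \<delta>"
      "\<And>u v y. u \<in> D1 q \<Omega> \<Longrightarrow> v \<in> D1 q \<Omega> \<Longrightarrow> y \<in> W \<Longrightarrow> modular q M y \<le> 1 \<Longrightarrow>
        modular q M (\<lambda>x. u x - v x) < \<delta> \<Longrightarrow> \<bar>duality q M u y - duality q M v y\<bar> \<le> s"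
      using duality_continuous[OF zero_le_one s(1)] by blast
    obtain N1 where N1: "\<And>i j. N1 \<le> i \<Longrightarrow> N1 \<le> j \<Longrightarrow> modular q M (\<lambda>x. w (r i) x - w (r j) x) < \<delta>"
      using r(2)[OF \<delta>(1)] by blast
    obtain N2 where N2: "1 / real (Suc N2) < s" using nat_approx_posE[OF s(1)] by blast
    have "modular q M (\<lambda>x. grad (w (r i)) x - grad (w (r j)) x) < \<epsilon>" if i: "max N1 N2 \<le> i" and j: "max N1 N2 \<le> j" for i j
    proof -
      let ?u = "w (r i)" and ?v = "w (r j)"
      have small: "1 / real (Suc (r k)) < s" if "max N1 N2 \<le> k" for k
      proof -
        have "N2 \<le> r k" using that seq_suble[OF r(1), of k] by simp
        then have "1 / real (Suc (r k)) \<le> 1 / real (Suc N2)" by (intro divide_left_mono) auto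
        then show ?thesis using N2 by linarith
      qed
      define z where "z = (\<lambda>x. (1/2) * ?u x + (1/2) * ?v x)"
      have zW: "z \<in> W" unfolding z_def by (rule W_lincomb[OF wW wW])
      define d where "d = duality q M ?u ?v"
      have "\<bar>duality q M ?u ?v - duality q M ?v ?v\<bar> \<le> s"
        by (rule \<delta>(2)[OF w(1) w(1) wW]) (use N1 i j wN in auto)
      then have d: "1 - s \<le> d" unfolding d_def duality_self[OF q_gt_1] wN by linarith
      have "duality q M ?u z = duality q M ?u (\<lambda>x. (1/2) * ?u x) + duality q M ?u (\<lambda>x. (1/2) * ?v x)"
        unfolding z_def by (rule duality_add[OF q_gt_1 WD(2)[OF wW] WD(2)[OF W_scale[OF wW]] WD(2)[OF W_scale[OF wW]]])
      also have "\<dots> = (1 + d) / 2"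
        using duality_scaleR[of q M ?u "1/2" ?u] duality_scaleR[of q M ?u "1/2" ?v]
        by (simp add: duality_self[OF q_gt_1] wN d_def)
      finally have dz: "duality q M ?u z = (1 + d) / 2" .
      have zE: "c * (1 - s / 2) powr q - s \<le> energy e z"
      proof (cases "c - 1 / real (Suc (r i)) < 0")
        case True
        have "c * (1 - s / 2) powr q \<le> c * 1" using s c0 q_ge by (intro mult_left_mono powr_le1) auto
        then show ?thesis using True small[OF i] energy_ge(2)[OF e, of z] by linarith
      next
        case False
        have "(c - 1 / real (Suc (r i))) * min 1 ((1 + d) / 2) powr q \<le> energy e z"
          by (rule D1_scale_feasible[OF low e zW dz]) (use d s False in auto)
        moreover have "(1 - s / 2) powr q \<le> min 1 ((1 + d) / 2) powr q" using d s q_ge by (intro powr_mono2) auto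
        then have "(c - 1 / real (Suc (r i))) * (1 - s / 2) powr q \<le> (c - 1 / real (Suc (r i))) * min 1 ((1 + d) / 2) powr q"
          using False by (intro mult_left_mono) auto
        moreover have "1 / real (Suc (r i)) * (1 - s / 2) powr q \<le> s * 1"
          using small[OF i] s q_ge by (intro mult_mono powr_le1) auto
        ultimately show ?thesis by (simp add: left_diff_distrib)
      qed
      note Lu = WD(3)[OF wW[of "r i"]] and Lv = WD(3)[OF wW[of "r j"]]
      have gz: "AE x in M. grad z x = (1/2) *\<^sub>R (grad ?u x + grad ?v x)"
        using W1_lincomb(2)[OF WD(1)[OF wW[of "r i"]] WD(1)[OF wW[of "r j"]], of "1/2" "1/2"]
        unfolding z_def by eventually_elim (simp add: scaleR_add_right)
      have zL: "(\<lambda>x. (1/2) *\<^sub>R (grad ?u x + grad ?v x)) \<in> Lp q M" by (rule Lp_scaleR[OF Lp_add[OF q_ge(2) Lu Lv]])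
      have q_mid: "modular q M (\<lambda>x. (1/2) *\<^sub>R (grad ?u x + grad ?v x)) = modular q M (grad z)"
        by (rule modular_grad_cong[OF zW zL gz, symmetric])
      have p_mid: "modular p M (grad z) \<le> (modular p M (grad ?u) + modular p M (grad ?v)) / 2"
      proof -
        have "modular p M (grad z) = modular p M (\<lambda>x. \<Sum>k\<in>(UNIV::bool set). (1/2) *\<^sub>R (if k then grad ?u x else grad ?v x))"
          unfolding modular_grad_cong[OF zW zL gz] by (simp add: UNIV_bool scaleR_add_right add.commute)
        also have "\<dots> \<le> (\<Sum>k\<in>(UNIV::bool set). \<bar>1/2\<bar> * modular p M (\<lambda>x. if k then grad ?u x else grad ?v x))"
        proof (rule modular_convex_combination[OF p_ge(1)])
          show "(\<lambda>x. if k then grad ?u x else grad ?v x) \<in> Lp p M" for k using grad_Lp_p[OF wW] by (cases k) auto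
        qed (auto simp: UNIV_bool)
        finally show ?thesis by (simp add: UNIV_bool)
      qed
      have "(modular q M (grad ?u) + modular q M (grad ?v)) / 2 - modular q M (grad z) \<le> (energy e ?u + energy e ?v) / 2 - energy e z"
      proof -
        have "e * (q / p) * modular p M (grad z) \<le> e * (q / p) * ((modular p M (grad ?u) + modular p M (grad ?v)) / 2)"
          using e q_ge p_ge by (intro mult_left_mono p_mid) auto
        moreover have "(a' + b') / 2 - c' \<le> (K * a + a' + (K * b + b')) / 2 - (K * c + c')"
          if "K * c \<le> K * ((a + b) / 2)" for K a b c a' b' c' :: real using that by (simp add: field_simps)
        ultimately show ?thesis unfolding energy_def by blast
      qed
      also have "\<dots> \<le> 2 * s + (c - c * (1 - s / 2) powr q)"
      proof -
        have E: "energy e (w (r k)) \<le> c + s" if "max N1 N2 \<le> k" for k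
          by (rule order_trans[OF w(2)]) (use small[OF that] in \<open>simp only: add_le_cancel_left less_imp_le\<close>)
        have "(a + b) / 2 - z' \<le> 2 * s + (c - m)" if "a \<le> c + s" "b \<le> c + s" "m - s \<le> z'" for a b z' m
          using that by (simp add: field_simps)
        from this[OF E[OF i] E[OF j] zE] show ?thesis .
      qed
      finally have def: "(modular q M (grad ?u) + modular q M (grad ?v)) / 2 - modular q M (grad z) \<le> 2 * s + (c - c * (1 - s / 2) powr q)" .
      have "modular q M (\<lambda>x. grad ?u x - grad ?v x) \<le> t * (modular q M (grad ?u) + modular q M (grad ?v))
         + C * ((modular q M (grad ?u) + modular q M (grad ?v)) / 2 - modular q M (grad z))"
        using C(2)[OF Lu Lv] unfolding q_mid .
      also have "\<dots> \<le> t * ((c + 1) + (c + 1)) + C * (2 * s + (c - c * (1 - s / 2) powr q))"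
        using wA[of "r i"] wA[of "r j"] def t C(1) by (intro add_mono mult_left_mono) auto
      also have "t * ((c + 1) + (c + 1)) = \<epsilon> / 2" using c0 by (simp add: t_def field_simps)
      also have "\<epsilon> / 2 + C * (2 * s + (c - c * (1 - s / 2) powr q)) < \<epsilon>" using s(3) by linarith
      finally show ?thesis .
    qed
    then show ?thesis by blast
  qed
  then obtain v where "v \<in> W" "(\<lambda>n. modular q M (\<lambda>x. w (r n) x - v x)) \<longlonglongrightarrow> 0"
    "(\<lambda>n. modular q M (\<lambda>x. grad (w (r n)) x - grad v x)) \<longlonglongrightarrow> 0"
    using W_complete[of "\<lambda>n. w (r n)", OF wW] by blast
  then show ?thesis by (rule that[OF r(1)])
qed

end



context two_exponents
begin

text \<open>The levels that are reached by sets of genus at least \<open>k\<close>. Sublevel sets suffice, since they are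
  the largest sets on which the energy is bounded by a given level.\<close>

definition admissible :: "real \<Rightarrow> nat \<Rightarrow> real set" where
  "admissible e k = {a. enat k \<le> genus T (sublevel e a)}"

definition minimax :: "real \<Rightarrow> nat \<Rightarrow> real" where
  "minimax e k = Inf (admissible e k)"

lemma admissible_sublevel:
  assumes "0 < k" "a \<in> admissible e k"
  obtains u where "u \<in> sublevel e a"
proof -
  have "sublevel e a \<noteq> {}"
  proof
    assume "sublevel e a = {}"
    then have "enat k \<le> 0" using assms(2) by (simp add: admissible_def genus_empty)
    then show False using assms(1) by (simp add: zero_enat_def)
  qed
  then obtain u where "u \<in> sublevel e a" by auto
  then show thesis by (rule that)
qed

lemma admissible_ge_0:
  assumes "0 \<le> e" "0 < k" "a \<in> admissible e k"
  shows "0 \<le> a"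
proof -
  obtain u where "u \<in> sublevel e a" by (rule admissible_sublevel[OF assms(2,3)])
  then show ?thesis using energy_ge(2)[OF assms(1), of u] by (simp add: sublevel_def)
qed

lemma minimax_le:
  assumes "0 \<le> e" "0 < k" "a \<in> admissible e k"
  shows "minimax e k \<le> a"
  unfolding minimax_def
  by (rule cInf_lower[OF assms(3) bdd_belowI[of _ 0]]) (rule admissible_ge_0[OF assms(1,2)])

lemma minimax_ge_0:
  assumes "0 \<le> e" "0 < k" "admissible e k \<noteq> {}"
  shows "0 \<le> minimax e k"
  unfolding minimax_def by (rule cInf_greatest[OF assms(3)]) (rule admissible_ge_0[OF assms(1,2)])

text \<open>Otherwise the descent step carries a sublevel set of genus \<open>k\<close> below the infimum of the admissible
  levels.\<close>

lemma minimax_almost_critical: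
  assumes e: "0 \<le> e" and k: "0 < k" and ne: "admissible e k \<noteq> {}" and d: "0 < d"
  shows "\<exists>w. w \<in> D1 q \<Omega> \<and> energy e w \<le> minimax e k + d \<and>
    (\<forall>y\<in>W. duality q M w y = 1 \<longrightarrow> minimax e k - d \<le> energy e y)"
proof (rule ccontr)
  assume no: "\<nexists>w. w \<in> D1 q \<Omega> \<and> energy e w \<le> minimax e k + d \<and>
    (\<forall>y\<in>W. duality q M w y = 1 \<longrightarrow> minimax e k - d \<le> energy e y)"
  have "Inf (admissible e k) < minimax e k + d" using d by (simp add: minimax_def)
  then obtain a where a: "a \<in> admissible e k" "a < minimax e k + d" using cInf_lessD[OF ne] by blast
  have "genus T (sublevel e a) \<le> genus T (sublevel e (minimax e k - d / 2))"
  proof (rule genus_sublevel_descent[OF e])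
    show "minimax e k - d < minimax e k - d / 2" using d by simp
    fix w assume "w \<in> sublevel e a"
    then have "w \<in> D1 q \<Omega>" "energy e w \<le> minimax e k + d" using a(2) by (auto simp: sublevel_def)
    then obtain y where "y \<in> W" "duality q M w y = 1" "\<not> minimax e k - d \<le> energy e y" using no by blast
    then show "\<exists>y\<in>W. duality q M w y = 1 \<and> energy e y \<le> minimax e k - d" by (intro bexI[of _ y]) auto
  qed
  moreover have "enat k \<le> genus T (sublevel e a)" using a(1) by (simp add: admissible_def)
  ultimately have "minimax e k - d / 2 \<in> admissible e k" unfolding admissible_def mem_Collect_eq by (rule order_trans[rotated])
  then have "minimax e k \<le> minimax e k - d / 2" by (rule minimax_le[OF e k])
  then show False using d by simp
qed

lemma energy_tendsto:
  assumes w: "\<And>n. w n \<in> W" and v: "v \<in> W" and lim: "(\<lambda>n. modular q M (\<lambda>x. grad (w n) x - grad v x)) \<longlonglongrightarrow> 0"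
  shows "(\<lambda>n. energy e (w n)) \<longlonglongrightarrow> energy e v"
proof -
  have "(\<lambda>n. modular p M (\<lambda>x. grad (w n) x - grad v x)) \<longlonglongrightarrow> 0"
    by (rule fm.modular_tendsto_0_lower_exponent[OF p_ge(3,4) Lp_diff[OF q_ge(2) WD(3)[OF w] WD(3)[OF v]] lim])
  from modular_tendsto[OF p_ge(1) grad_Lp_p[OF w] grad_Lp_p[OF v] this]
    modular_tendsto[OF q_ge(1) WD(3)[OF w] WD(3)[OF v] lim]
  show ?thesis unfolding energy_def by (intro tendsto_intros)
qed

lemma duality_tendsto:
  assumes w: "\<And>n. w n \<in> D1 q \<Omega>" and v: "v \<in> D1 q \<Omega>" and y: "y \<in> W"
    and lim: "(\<lambda>n. modular q M (\<lambda>x. w n x - v x)) \<longlonglongrightarrow> 0"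
  shows "(\<lambda>n. duality q M (w n) y) \<longlonglongrightarrow> duality q M v y"
proof (rule tendstoI)
  fix \<epsilon> :: real assume \<epsilon>: "0 < \<epsilon>"
  then have \<epsilon>2: "0 < \<epsilon> / 2" by simp
  show "\<forall>\<^sub>F n in sequentially. dist (duality q M (w n) y) (duality q M v y) < \<epsilon>"
  proof (rule duality_continuous[OF modular_nonneg[of q M y] \<epsilon>2])
    fix \<delta> assume \<delta>: "0 < \<delta>" "\<And>u v z. u \<in> D1 q \<Omega> \<Longrightarrow> v \<in> D1 q \<Omega> \<Longrightarrow> z \<in> W \<Longrightarrow> modular q M z \<le> modular q M y \<Longrightarrow>
      modular q M (\<lambda>x. u x - v x) < \<delta> \<Longrightarrow> \<bar>duality q M u z - duality q M v z\<bar> \<le> \<epsilon> / 2"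
    have "\<forall>\<^sub>F n in sequentially. modular q M (\<lambda>x. w n x - v x) < \<delta>" by (rule order_tendstoD(2)[OF lim \<delta>(1)])
    then show ?thesis
    proof (rule eventually_mono)
      fix n assume "modular q M (\<lambda>x. w n x - v x) < \<delta>"
      from \<delta>(2)[OF w v y order_refl this] have "\<bar>duality q M (w n) y - duality q M v y\<bar> \<le> \<epsilon> / 2" .
      then show "dist (duality q M (w n) y) (duality q M v y) < \<epsilon>" using \<epsilon> by (simp add: dist_real_def)
    qed
  qed
qed

text \<open>Almost critical points at accuracies \<open>1 / (n + 1)\<close> converge along a subsequence, and the minimality
  on the hyperplanes survives in the limit, because the constraints converge.\<close>

lemma critical_point:
  assumes e: "0 \<le> e" and k: "0 < k" and ne: "admissible e k \<noteq> {}"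
  obtains w where "w \<in> D1 q \<Omega>" "energy e w = minimax e k"
    "\<And>y. y \<in> W \<Longrightarrow> duality q M w y = 1 \<Longrightarrow> minimax e k \<le> energy e y"
proof -
  define c where "c = minimax e k"
  have c0: "0 \<le> c" unfolding c_def by (rule minimax_ge_0[OF e k ne])
  have "\<forall>n. \<exists>w. w \<in> D1 q \<Omega> \<and> energy e w \<le> c + 1 / real (Suc n) \<and>
    (\<forall>y\<in>W. duality q M w y = 1 \<longrightarrow> c - 1 / real (Suc n) \<le> energy e y)"
    unfolding c_def by (intro allI minimax_almost_critical[OF e k ne]) simp
  from choice[OF this] obtain w where w0: "\<forall>n. w n \<in> D1 q \<Omega> \<and> energy e (w n) \<le> c + 1 / real (Suc n) \<and>
    (\<forall>y\<in>W. duality q M (w n) y = 1 \<longrightarrow> c - 1 / real (Suc n) \<le> energy e y)" ..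
  have w: "w n \<in> D1 q \<Omega>" "energy e (w n) \<le> c + 1 / real (Suc n)" for n using w0[rule_format, of n] by (simp_all del: of_nat_Suc)
  have low: "c - 1 / real (Suc n) \<le> energy e y" if "y \<in> W" "duality q M (w n) y = 1" for n y using w0[rule_format, of n] that by blast
  show thesis
  proof (rule minimax_sequence_converges[OF e c0 w low])
    fix r :: "nat \<Rightarrow> nat" and v
    assume r: "strict_mono r" and v: "v \<in> W" and l1: "(\<lambda>n. modular q M (\<lambda>x. w (r n) x - v x)) \<longlonglongrightarrow> 0"
      and l2: "(\<lambda>n. modular q M (\<lambda>x. grad (w (r n)) x - grad v x)) \<longlonglongrightarrow> 0"
    have wW: "w n \<in> W" for n by (rule D1_W[OF w(1)])
    have "(\<lambda>n. modular q M (w (r n))) \<longlonglongrightarrow> modular q M v"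
      by (rule modular_tendsto[OF q_ge(1) WD(2)[OF wW] WD(2)[OF v] l1])
    moreover have "(\<lambda>n. modular q M (w (r n))) = (\<lambda>n. 1)" using w(1) by (auto simp: D1_eq)
    ultimately have "modular q M v = 1" by (simp add: LIMSEQ_const_iff)
    then have vD: "v \<in> D1 q \<Omega>" using v by (simp add: D1_eq)
    have inv: "(\<lambda>n. 1 / real (Suc (r n))) \<longlonglongrightarrow> 0"
      using LIMSEQ_subseq_LIMSEQ[OF LIMSEQ_inverse_real_of_nat r] by (simp add: comp_def inverse_eq_divide)
    have up: "(\<lambda>n. c + 1 / real (Suc (r n))) \<longlonglongrightarrow> c + 0" "(\<lambda>n. max 0 (c - 1 / real (Suc (r n)))) \<longlonglongrightarrow> max 0 (c - 0)"
      by (intro tendsto_intros inv)+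
    have "energy e v \<le> c + 0"
      by (rule LIMSEQ_le[OF energy_tendsto[OF wW v l2] up(1)]) (use w(2) in blast)
    moreover have low_v: "c \<le> energy e y" if y: "y \<in> W" "duality q M v y = 1" for y
    proof -
      have d: "(\<lambda>n. duality q M (w (r n)) y) \<longlonglongrightarrow> 1"
        using duality_tendsto[OF w(1) vD y(1) l1] unfolding y(2) .
      have "(\<lambda>n. max 0 (c - 1 / real (Suc (r n))) * min 1 (duality q M (w (r n)) y) powr q) \<longlonglongrightarrow> max 0 (c - 0) * min 1 1 powr q"
        by (intro tendsto_mult up(2) tendsto_powr tendsto_min tendsto_const d) simp
      then have "(\<lambda>n. max 0 (c - 1 / real (Suc (r n))) * min 1 (duality q M (w (r n)) y) powr q) \<longlonglongrightarrow> c"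
        using c0 by simp
      moreover have "\<forall>\<^sub>F n in sequentially. 0 < duality q M (w (r n)) y" by (rule order_tendstoD(1)[OF d zero_less_one])
      then have "\<forall>\<^sub>F n in sequentially. max 0 (c - 1 / real (Suc (r n))) * min 1 (duality q M (w (r n)) y) powr q \<le> energy e y"
      proof (rule eventually_mono)
        fix n assume pos: "0 < duality q M (w (r n)) y"
        show "max 0 (c - 1 / real (Suc (r n))) * min 1 (duality q M (w (r n)) y) powr q \<le> energy e y"
        proof (rule D1_scale_feasible[OF _ e y(1) refl pos max.cobounded1])
          show "max 0 (c - 1 / real (Suc (r n))) \<le> energy e z" if "z \<in> W" "duality q M (w (r n)) z = 1" for z
            using low[OF that] energy_ge(2)[OF e, of z] by simp
        qed
      qed
      ultimately show ?thesis by (rule tendsto_upperbound) simp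
    qed
    ultimately have "energy e v = c"
      using low_v[OF v] vD by (simp add: duality_self[OF q_gt_1] D1_eq)
    then show thesis using that[OF vD] low_v unfolding c_def by blast
  qed
qed

text \<open>Euler--Lagrange: a minimiser on the hyperplane \<open>\<integral>|w|\<^sup>q\<^sup>-\<^sup>2wy = 1\<close> through \<open>w\<close> is critical, because
  this hyperplane is tangent to the \<open>L\<^sup>q\<close> sphere at \<open>w\<close>.\<close>

lemma Euler_Lagrange:
  assumes w: "w \<in> D1 q \<Omega>" and mn: "\<And>y. y \<in> W \<Longrightarrow> duality q M w y = 1 \<Longrightarrow> energy e w \<le> energy e y" and v: "v \<in> W"
  shows "e * duality p M (grad w) (grad v) + duality q M (grad w) (grad v)
    = (e * modular p M (grad w) + modular q M (grad w)) * duality q M w v"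
proof -
  have wW: "w \<in> W" by (rule D1_W[OF w])
  have w1: "duality q M w w = 1" using w by (simp add: duality_self[OF q_gt_1] D1_eq)
  define l where "l = duality q M w v"
  define H where "H = (\<lambda>x. grad v x + (- l) *\<^sub>R grad w x)"
  have HL: "H \<in> Lp q M" unfolding H_def by (intro Lp_add Lp_scaleR WD(3) wW v q_ge)
  have HLp: "H \<in> Lp p M" by (rule fm.Lp_subset(1)[OF p_ge(2,4) HL])
  define f where "f = (\<lambda>t. e * (q / p) * modular p M (\<lambda>x. grad w x + t *\<^sub>R H x) + modular q M (\<lambda>x. grad w x + t *\<^sub>R H x))"
  have f_min: "f 0 \<le> f t" for t
  proof -
    let ?y = "\<lambda>x. (1 - t * l) * w x + t * v x"
    have yW: "?y \<in> W" by (rule W_lincomb[OF wW v])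
    have "duality q M w ?y = duality q M w (\<lambda>x. (1 - t * l) * w x) + duality q M w (\<lambda>x. t * v x)"
      by (rule duality_add[OF q_gt_1 WD(2)[OF wW] WD(2)[OF W_scale[OF wW]] WD(2)[OF W_scale[OF v]]])
    also have "\<dots> = (1 - t * l) * duality q M w w + t * duality q M w v"
      using duality_scaleR[of q M w "1 - t * l" w] duality_scaleR[of q M w t v] by simp
    finally have dy: "duality q M w ?y = 1" unfolding w1 by (simp add: l_def)
    have ae: "AE x in M. grad ?y x = grad w x + t *\<^sub>R H x"
      using W1_lincomb(2)[OF WD(1)[OF wW] WD(1)[OF v], of "1 - t * l" t]
      by eventually_elim (simp add: H_def algebra_simps)
    have "f t = energy e ?y"
      unfolding f_def by (rule energy_cong[OF yW Lp_add[OF q_ge(2) WD(3)[OF wW] Lp_scaleR[OF HL]] ae, symmetric])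
    moreover have "f 0 = energy e w" by (simp add: f_def energy_def)
    ultimately show ?thesis using mn[OF yW dy] by simp
  qed
  have "(f has_real_derivative e * (q / p) * (p * duality p M (grad w) H) + q * duality q M (grad w) H) (at 0)"
    unfolding f_def
    by (intro DERIV_add DERIV_cmult modular_has_derivative_line p_gt_1 q_gt_1 grad_Lp_p WD(3) wW HL HLp)
  from DERIV_local_min[OF this zero_less_one] f_min
  have "e * (q / p) * (p * duality p M (grad w) H) + q * duality q M (grad w) H = 0" by blast
  then have "q * (e * duality p M (grad w) H + duality q M (grad w) H) = 0" using p_ge by (simp add: algebra_simps)
  then have z: "e * duality p M (grad w) H + duality q M (grad w) H = 0" using q_ge by simp
  have D: "duality s M (grad w) H = duality s M (grad w) (grad v) - l * modular s M (grad w)"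
    if s: "1 < s" and L: "grad w \<in> Lp s M" "grad v \<in> Lp s M" for s
    unfolding H_def duality_add[OF s L Lp_scaleR[OF L(1)]] duality_scaleR duality_self[OF s] by simp
  show ?thesis
    using z unfolding D[OF p_gt_1 grad_Lp_p[OF wW] grad_Lp_p[OF v]] D[OF q_gt_1 WD(3)[OF wW] WD(3)[OF v]] l_def
    by (simp add: algebra_simps)
qed

end



section \<open>Finite-dimensional spheres of test functions\<close>

lemma AE_lebesgue_on_not_in_open:
  fixes S \<Omega> :: "'a::euclidean_space set"
  assumes "open \<Omega>" "open S" "S \<subseteq> \<Omega>" "S \<noteq> {}"
  shows "\<not> (AE x in lebesgue_on \<Omega>. x \<notin> S)"
proof
  assume ae: "AE x in lebesgue_on \<Omega>. x \<notin> S"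
  have O: "\<Omega> \<inter> space lebesgue \<in> sets lebesgue" using assms(1) by (simp add: borel_open)
  have "AE x in lebesgue. x \<in> \<Omega> \<longrightarrow> x \<notin> S" using ae unfolding AE_restrict_space_iff[OF O] .
  then have "AE x in lebesgue. x \<notin> S" by (rule eventually_mono) (use assms(3) in blast)
  moreover have "S \<in> sets lebesgue" using assms(2) by (simp add: borel_open)
  ultimately have "S \<in> null_sets lebesgue" by (simp add: AE_iff_null_sets)
  then have "negligible S" by (simp add: negligible_iff_null_sets)
  then show False using open_not_negligible[OF assms(2,4)] by contradiction
qed

lemma disjoint_boxes:
  fixes \<Omega> :: "'a::euclidean_space set"
  assumes "open \<Omega>" "\<Omega> \<noteq> {}"
  shows "\<exists>a b :: nat \<Rightarrow> 'a. (\<forall>i\<le>n. cbox (a i) (b i) \<subseteq> \<Omega>) \<and> (\<forall>i. box (a i) (b i) \<noteq> {}) \<and>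
    (\<forall>i j x. i \<noteq> j \<longrightarrow> x \<in> box (a i) (b i) \<longrightarrow> x \<notin> box (a j) (b j))"
proof -
  obtain x0 where "x0 \<in> \<Omega>" using assms(2) by blast
  then obtain r where r: "0 < r" "cball x0 r \<subseteq> \<Omega>" using assms(1) open_contains_cball by blast
  obtain b0 :: 'a where b0: "b0 \<in> Basis" using nonempty_Basis by blast
  define h where "h = r / (real n + real DIM('a))"
  have dp: "0 < real n + real DIM('a)" by (simp add: add_nonneg_pos)
  have h: "0 < h" "real n * h + h * real DIM('a) = r"
  proof -
    show "0 < h" using r(1) dp by (simp add: h_def)
    have "h * (real n + real DIM('a)) = r" using dp by (simp add: h_def)
    then show "real n * h + h * real DIM('a) = r" by (simp add: algebra_simps)
  qed
  define c where "c = (\<lambda>i::nat. x0 + (real i * h) *\<^sub>R b0)"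
  have cc: "c i \<bullet> b0 = x0 \<bullet> b0 + real i * h" for i using b0 by (simp add: c_def inner_add_left)
  have One: "One \<bullet> b = (1::real)" if "b \<in> Basis" for b :: 'a using that by simp
  show ?thesis
  proof (rule exI[of _ "\<lambda>i. c i - (h / 2) *\<^sub>R One"], rule exI[of _ "\<lambda>i. c i + (h / 2) *\<^sub>R One"], intro conjI allI impI)
    \<comment> \<open>Translates of one cube along a coordinate direction, all within distance \<open>r\<close> of \<open>x0\<close>.\<close>
    show "cbox (c i - (h / 2) *\<^sub>R One) (c i + (h / 2) *\<^sub>R One) \<subseteq> \<Omega>" if i: "i \<le> n" for i
    proof
      fix x assume x: "x \<in> cbox (c i - (h / 2) *\<^sub>R One) (c i + (h / 2) *\<^sub>R One)"
      have "\<bar>(x - c i) \<bullet> b\<bar> \<le> h" if b: "b \<in> Basis" for b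
      proof -
        have "c i \<bullet> b - h / 2 \<le> x \<bullet> b" "x \<bullet> b \<le> c i \<bullet> b + h / 2"
          using x b unfolding mem_box by (auto simp: inner_diff_left inner_add_left)
        then show ?thesis using h(1) by (simp add: inner_diff_left abs_le_iff)
      qed
      then have "(\<Sum>b\<in>Basis. \<bar>(x - c i) \<bullet> b\<bar>) \<le> real DIM('a) * h" by (intro sum_bounded_above[THEN order_trans]) auto
      then have 1: "norm (x - c i) \<le> h * real DIM('a)" using norm_le_l1[of "x - c i"] by (simp add: mult.commute)
      have "norm (c i - x0) = real i * h" using h(1) b0 by (simp add: c_def)
      also have "\<dots> \<le> real n * h" using i h(1) by (intro mult_right_mono) auto
      finally have "norm (x - x0) \<le> r" using 1 h(2) norm_triangle_ineq[of "x - c i" "c i - x0"] by simp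
      then show "x \<in> \<Omega>" using r(2) by (auto simp: dist_norm norm_minus_commute)
    qed
    show "box (c i - (h / 2) *\<^sub>R One) (c i + (h / 2) *\<^sub>R One) \<noteq> {}" for i
      using h(1) by (simp add: box_ne_empty inner_diff_left inner_add_left)
    fix i j x assume ij: "i \<noteq> j" and x: "x \<in> box (c i - (h / 2) *\<^sub>R One) (c i + (h / 2) *\<^sub>R One)"
    show "x \<notin> box (c j - (h / 2) *\<^sub>R One) (c j + (h / 2) *\<^sub>R One)"
    proof
      assume y: "x \<in> box (c j - (h / 2) *\<^sub>R One) (c j + (h / 2) *\<^sub>R One)"
      have "\<bar>x \<bullet> b0 - c i \<bullet> b0\<bar> < h / 2" "\<bar>x \<bullet> b0 - c j \<bullet> b0\<bar> < h / 2"
        using bspec[OF x[unfolded mem_box] b0] bspec[OF y[unfolded mem_box] b0] b0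
        unfolding inner_diff_left inner_add_left by (simp_all only: inner_scaleR_left One abs_less_iff) linarith+
      then have "\<bar>c i \<bullet> b0 - c j \<bullet> b0\<bar> < h" by linarith
      then have "\<bar>(real i - real j) * h\<bar> < h" unfolding cc by (simp add: algebra_simps)
      then have "\<bar>real i - real j\<bar> < 1" using h(1) by (simp add: abs_mult)
      moreover have "1 \<le> \<bar>real i - real j\<bar>" using ij by linarith
      ultimately show False by simp
    qed
  qed
qed

context two_exponents
begin

lemma energy_0: "energy 0 u = modular q M (grad u)"
  by (simp add: energy_def)

text \<open>Bump functions of disjoint boxes span a sphere on which Borsuk--Ulam bounds the genus from
  below. This makes the minimax levels finite.\<close>

lemma admissible_0_nonempty:
  assumes ne: "\<Omega> \<noteq> {}"
  shows "admissible 0 (Suc n) \<noteq> {}"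
proof -
  obtain a b :: "nat \<Rightarrow> 'a" where "(\<forall>i\<le>n. cbox (a i) (b i) \<subseteq> \<Omega>) \<and> (\<forall>i. box (a i) (b i) \<noteq> {}) \<and>
    (\<forall>i j x. i \<noteq> j \<longrightarrow> x \<in> box (a i) (b i) \<longrightarrow> x \<notin> box (a j) (b j))"
    using disjoint_boxes[OF open_domain ne, of n] by (elim exE)
  then have ab: "i \<le> n \<Longrightarrow> cbox (a i) (b i) \<subseteq> \<Omega>" "box (a i) (b i) \<noteq> {}"
    "i \<noteq> j \<Longrightarrow> x \<in> box (a i) (b i) \<Longrightarrow> x \<notin> box (a j) (b j)" for i j x by simp_all
  define z where "z = (\<lambda>i. bump 1 (a i) (b i))"
  have zW: "z i \<in> W" if "i \<in> {..n}" for i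
    unfolding z_def by (rule test_function_W[OF test_function_bump]) (use ab(1)[of i] that in auto)
  have z0: "z i x \<noteq> 0 \<longleftrightarrow> x \<in> box (a i) (b i)" for i x unfolding z_def by (rule bump_nonzero_iff) simp
  have pos: "0 < modular q M (\<lambda>y. \<Sum>i\<in>{..n}. x i * z i y)" if x: "x \<in> topspace (nsphere n)" for x
  proof -
    have "(\<Sum>i\<le>n. (x i)\<^sup>2) = 1" using x by (simp add: topspace_nsphere)
    moreover have "(\<Sum>i\<le>n. (x i)\<^sup>2) = 0" if "\<forall>j\<le>n. x j = 0" using that by (intro sum.neutral) auto
    ultimately have "\<not> (\<forall>j\<le>n. x j = 0)" using zero_neq_one by metis
    then obtain j where j: "j \<le> n" "x j \<noteq> 0" by auto
    have "modular q M (\<lambda>y. \<Sum>i\<in>{..n}. x i * z i y) \<noteq> 0"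
    proof
      assume "modular q M (\<lambda>y. \<Sum>i\<in>{..n}. x i * z i y) = 0"
      then have "AE y in M. (\<Sum>i\<in>{..n}. x i * z i y) = 0"
        by (simp only: modular_eq_0_iff[OF WD(2)[OF W_sum(1)[OF finite_atMost zW]]])
      then have "AE y in M. y \<notin> box (a j) (b j)"
      proof (rule eventually_mono)
        fix y assume s: "(\<Sum>i\<in>{..n}. x i * z i y) = 0"
        show "y \<notin> box (a j) (b j)"
        proof
          assume y: "y \<in> box (a j) (b j)"
          have "x i * z i y = 0" if "i \<in> {..n} - {j}" for i using ab(3)[of j i y] y z0[of i y] that by auto
          then have "(\<Sum>i\<in>{..n} - {j}. x i * z i y) = 0" by (intro sum.neutral) blast
          then have "x j * z j y = 0" using s j(1) by (simp add: sum.remove[of "{..n}" j])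
          then show False using j(2) z0[of j y] y by simp
        qed
      qed
      moreover have "box (a j) (b j) \<subseteq> \<Omega>" using ab(1)[OF j(1)] box_subset_cbox by blast
      ultimately show False using AE_lebesgue_on_not_in_open[OF open_domain open_box _ ab(2)] by blast
    qed
    then show ?thesis using modular_nonneg[of q M "\<lambda>y. \<Sum>i\<in>{..n}. x i * z i y"] by linarith
  qed
  define G where "G = (\<lambda>x y. inverse (lnorm (\<lambda>y. \<Sum>i\<in>{..n}. x i * z i y)) * (\<Sum>i\<in>{..n}. x i * z i y))"
  note nl = normalised_lincomb[where X = "nsphere n" and c = "\<lambda>i x. x i", OF finite_atMost[of n] zW continuous_map_nsphere_projection pos]
  have Gc: "continuous_map (nsphere n) T G" unfolding G_def by (rule nl(1))
  have GD: "G x \<in> D1 q \<Omega>" if "x \<in> topspace (nsphere n)" for x unfolding G_def by (rule nl(2)) (use that in simp_all)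
  have "continuous_map (nsphere n) euclideanreal (\<lambda>x. modular q M (grad (G x)))"
    using continuous_map_compose[OF Gc continuous_map_modular_grad] by (simp add: comp_def)
  then have "continuous_on (topspace (nsphere n)) (\<lambda>x. modular q M (grad (G x)))"
    by (simp only: continuous_map_nsphere_iff)
  then have "compact ((\<lambda>x. modular q M (grad (G x))) ` topspace (nsphere n))"
    by (rule compact_continuous_image[OF _ compact_nsphere])
  then have "bounded ((\<lambda>x. modular q M (grad (G x))) ` topspace (nsphere n))" by (rule compact_imp_bounded)
  then obtain B where B: "\<And>x. x \<in> topspace (nsphere n) \<Longrightarrow> \<bar>modular q M (grad (G x))\<bar> \<le> B"
    unfolding bounded_iff by auto
  have "enat (Suc n) \<le> genus T (sublevel 0 B)"
  proof (rule genus_ge_of_odd_sphere_map)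
    show "continuous_map (nsphere n) (subtopology T (sublevel 0 B)) G"
      unfolding continuous_map_in_subtopology
    proof (intro conjI Gc funcsetI)
      show "G x \<in> sublevel 0 B" if "x \<in> topspace (nsphere n)" for x
        using GD[OF that] B[OF that] by (simp add: sublevel_def energy_0)
    qed
    fix x :: "nat \<Rightarrow> real"
    have "(\<lambda>y. \<Sum>i\<in>{..n}. - x i * z i y) = (\<lambda>y. - (\<Sum>i\<in>{..n}. x i * z i y))" by (simp add: sum_negf)
    moreover have "lnorm (\<lambda>y. - (\<Sum>i\<in>{..n}. x i * z i y)) = lnorm (\<lambda>y. \<Sum>i\<in>{..n}. x i * z i y)"
      by (simp add: lnorm_def modular_def)
    ultimately show "G (\<lambda>i. - x i) = - G x" unfolding G_def by (simp add: fun_Compl_def sum_negf)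
  qed
  then have "B \<in> admissible 0 (Suc n)" by (simp add: admissible_def)
  then show ?thesis by blast
qed

section \<open>Variational eigenvalues as limits of minimax levels\<close>

lemma sublevel_Sigma:
  assumes "a \<in> admissible 0 k"
  shows "sublevel 0 a \<in> Sigma_family q \<Omega> k"
proof -
  have e: "sublevel 0 a = {u \<in> topspace T. modular q M u \<in> {1}} \<inter> {u \<in> topspace T. modular q M (grad u) \<in> {..a}}"
    by (auto simp: sublevel_def D1_eq energy_0)
  have "closedin T {u \<in> topspace T. modular q M u \<in> {1}}"
    by (rule closedin_continuous_map_preimage[OF continuous_map_modular]) simp
  moreover have "closedin T {u \<in> topspace T. modular q M (grad u) \<in> {..a}}"
    by (rule closedin_continuous_map_preimage[OF continuous_map_modular_grad]) simp
  ultimately have c: "closedin T (sublevel 0 a)" unfolding e by (rule closedin_Int)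
  have m: "- u \<in> sublevel 0 a" if "u \<in> sublevel 0 a" for u
    using that by (simp add: sublevel_def D1_eq uminus_W modular_uminus energy_uminus)
  have "uminus ` sublevel 0 a = sublevel 0 a"
  proof
    show "uminus ` sublevel 0 a \<subseteq> sublevel 0 a" using m by blast
    show "sublevel 0 a \<subseteq> uminus ` sublevel 0 a"
    proof
      fix u assume "u \<in> sublevel 0 a"
      then show "u \<in> uminus ` sublevel 0 a" using m by (intro image_eqI[of _ _ "- u"]) (simp_all add: fun_eq_iff)
    qed
  qed
  moreover have "sublevel 0 a \<subseteq> D1 q \<Omega>" by (auto simp: sublevel_def)
  ultimately show ?thesis using c assms unfolding Sigma_family_def admissible_def by blast
qed

lemma modular_grad_LINT: "modular q M (grad u) = (LINT x|M. norm (grad u x) powr q)"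
  by (simp add: modular_def)

text \<open>A competitor with supremum \<open>a\<close> is contained in the sublevel set at \<open>a\<close>, which is itself a
  competitor with supremum at most \<open>a\<close>.\<close>

lemma dirichlet_eigenvalue_eq_minimax:
  assumes k: "0 < k" and ne: "admissible 0 k \<noteq> {}"
  shows "dirichlet_eigenvalue q \<Omega> k = ereal (minimax 0 k)"
  unfolding dirichlet_eigenvalue_def modular_grad_LINT[symmetric]
proof (rule antisym)
  show "(INF A\<in>Sigma_family q \<Omega> k. SUP u\<in>A. ereal (modular q M (grad u))) \<le> ereal (minimax 0 k)"
  proof (rule ereal_le_epsilon2)
    fix d :: real assume d: "0 < d"
    have "Inf (admissible 0 k) < minimax 0 k + d" using d by (simp add: minimax_def)
    then obtain a where a: "a \<in> admissible 0 k" "a < minimax 0 k + d" using cInf_lessD[OF ne] by blast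
    have "(INF A\<in>Sigma_family q \<Omega> k. SUP u\<in>A. ereal (modular q M (grad u))) \<le> (SUP u\<in>sublevel 0 a. ereal (modular q M (grad u)))"
      by (rule INF_lower[OF sublevel_Sigma[OF a(1)]])
    also have "\<dots> \<le> ereal a" by (rule SUP_least) (simp add: sublevel_def energy_0)
    also have "\<dots> \<le> ereal (minimax 0 k) + ereal d" using a(2) by simp
    finally show "(INF A\<in>Sigma_family q \<Omega> k. SUP u\<in>A. ereal (modular q M (grad u))) \<le> ereal (minimax 0 k) + ereal d" .
  qed
  show "ereal (minimax 0 k) \<le> (INF A\<in>Sigma_family q \<Omega> k. SUP u\<in>A. ereal (modular q M (grad u)))"
  proof (rule INF_greatest)
    fix A assume A: "A \<in> Sigma_family q \<Omega> k"
    then have AD: "A \<subseteq> D1 q \<Omega>" and g: "enat k \<le> genus T A" by (auto simp: Sigma_family_def)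
    have "A \<noteq> {}"
    proof
      assume "A = {}"
      then have "enat k \<le> 0" using g by (simp add: genus_empty)
      then show False using k by (simp add: zero_enat_def)
    qed
    then obtain u0 where u0: "u0 \<in> A" by blast
    define s where "s = (SUP u\<in>A. ereal (modular q M (grad u)))"
    have up: "ereal (modular q M (grad u)) \<le> s" if "u \<in> A" for u unfolding s_def by (rule SUP_upper[OF that])
    have "ereal (minimax 0 k) \<le> s"
    proof (cases s)
      case (real a)
      have "A \<subseteq> sublevel 0 a"
      proof
        fix u assume u: "u \<in> A"
        show "u \<in> sublevel 0 a" using up[OF u] AD u unfolding real by (auto simp: sublevel_def energy_0)
      qed
      then have "genus T A \<le> genus T (sublevel 0 a)" by (rule genus_mono) (simp add: sublevel_W)
      then have "a \<in> admissible 0 k" using order_trans[OF g] by (simp add: admissible_def)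
      then show ?thesis unfolding real using minimax_le[OF order_refl k] by simp
    next
      case MInf
      then show ?thesis using up[OF u0] by simp
    qed simp
    then show "ereal (minimax 0 k) \<le> (SUP u\<in>A. ereal (modular q M (grad u)))" by (simp only: s_def)
  qed
qed

text \<open>On a bounded domain the \<open>p\<close>-part of the energy is controlled by the \<open>q\<close>-part, so that a small
  coefficient \<open>e\<close> changes the levels only slightly.\<close>

lemma admissible_transfer:
  assumes e: "0 \<le> e" and a: "a \<in> admissible 0 k"
  shows "a + e * (q / p) * (measure M (space M) + a) \<in> admissible e k"
proof -
  let ?a' = "a + e * (q / p) * (measure M (space M) + a)"
  have "sublevel 0 a \<subseteq> sublevel e ?a'"
  proof
    fix u assume u: "u \<in> sublevel 0 a"
    then have uD: "u \<in> D1 q \<Omega>" "modular q M (grad u) \<le> a" by (auto simp: sublevel_def energy_0)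
    have "modular p M (grad u) \<le> measure M (space M) + a" using modular_p_le[OF D1_W[OF uD(1)]] uD(2) by linarith
    then have "e * (q / p) * modular p M (grad u) \<le> e * (q / p) * (measure M (space M) + a)"
      using e q_ge p_ge by (intro mult_left_mono) auto
    then show "u \<in> sublevel e ?a'" using uD by (simp add: sublevel_def energy_def)
  qed
  then have "genus T (sublevel 0 a) \<le> genus T (sublevel e ?a')" by (rule genus_mono) (simp add: sublevel_W)
  then show ?thesis using a unfolding admissible_def mem_Collect_eq by (rule order_trans[rotated])
qed

lemma minimax_bounds:
  assumes e: "0 \<le> e" and k: "0 < k" and ne: "admissible 0 k \<noteq> {}"
  shows "admissible e k \<noteq> {}" "minimax 0 k \<le> minimax e k"
    "minimax e k \<le> minimax 0 k + e * (q / p) * (measure M (space M) + minimax 0 k)"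
proof -
  show ne': "admissible e k \<noteq> {}" using ne admissible_transfer[OF e] by blast
  have "admissible e k \<subseteq> admissible 0 k"
  proof
    fix a assume a: "a \<in> admissible e k"
    have "sublevel e a \<subseteq> sublevel 0 a"
    proof
      fix u assume "u \<in> sublevel e a"
      then show "u \<in> sublevel 0 a" using energy_ge(1)[OF e, of u] by (simp add: sublevel_def energy_0)
    qed
    then have "genus T (sublevel e a) \<le> genus T (sublevel 0 a)" by (rule genus_mono) (simp add: sublevel_W)
    then show "a \<in> admissible 0 k" using a unfolding admissible_def mem_Collect_eq by (rule order_trans[rotated])
  qed
  then show "minimax 0 k \<le> minimax e k"
    unfolding minimax_def[of e] using minimax_le[OF order_refl k] by (intro cInf_greatest[OF ne']) blast
  define K where "K = e * (q / p)"
  define m where "m = measure M (space M)"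
  have K: "0 \<le> K" "0 < 1 + K" using e q_ge p_ge by (auto simp: K_def intro: add_pos_nonneg)
  have "(minimax e k - K * m) / (1 + K) \<le> minimax 0 k"
    unfolding minimax_def[of 0]
  proof (rule cInf_greatest[OF ne])
    fix a assume "a \<in> admissible 0 k"
    from minimax_le[OF e k admissible_transfer[OF e this]]
    have "minimax e k \<le> a + K * (m + a)" by (simp add: K_def m_def)
    then show "(minimax e k - K * m) / (1 + K) \<le> a" using K by (simp add: pos_divide_le_eq algebra_simps)
  qed
  then have "minimax e k \<le> minimax 0 k + K * (m + minimax 0 k)" using K by (simp add: pos_divide_le_eq algebra_simps)
  then show "minimax e k \<le> minimax 0 k + e * (q / p) * (measure M (space M) + minimax 0 k)" by (simp add: K_def m_def)
qed

text \<open>The multiplier of a normalised critical point differs from its energy by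
  \<open>e (q / p - 1) \<integral>|\<nabla>w|\<^sup>p\<close>, and both this and the change of the level are of order \<open>e\<close>.\<close>

lemma perturbed_eigenfunctions:
  assumes k: "0 < k" and ne: "admissible 0 k \<noteq> {}"
  obtains L where "\<And>e. 0 < e \<Longrightarrow> e \<le> 1 \<Longrightarrow> \<exists>w \<mu>. w \<in> D1 q \<Omega> \<and> \<bar>\<mu> - minimax 0 k\<bar> \<le> L * e \<and>
    (\<forall>v\<in>W. e * duality p M (grad w) (grad v) + duality q M (grad w) (grad v) = \<mu> * duality q M w v)"
proof -
  define l where "l = minimax 0 k"
  define m where "m = measure M (space M)"
  define C where "C = l + (q / p) * (m + l)"
  have l: "0 \<le> l" unfolding l_def by (rule minimax_ge_0[OF order_refl k ne])
  have m: "0 \<le> m" by (simp add: m_def)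
  have qp: "1 \<le> q / p" using p_ge by simp
  show thesis
  proof (rule that[of "(q / p) * (m + l) + (q / p) * (m + C)"])
    fix e :: real assume e: "0 < e" "e \<le> 1"
    then have e0: "0 \<le> e" by simp
    note mb = minimax_bounds[OF e0 k ne]
    obtain w where w: "w \<in> D1 q \<Omega>" "energy e w = minimax e k"
      "\<And>y. y \<in> W \<Longrightarrow> duality q M w y = 1 \<Longrightarrow> minimax e k \<le> energy e y"
      using critical_point[OF e0 k mb(1)] by blast
    define \<mu> where "\<mu> = e * modular p M (grad w) + modular q M (grad w)"
    define P where "P = modular p M (grad w)"
    have wmin: "energy e w \<le> energy e y" if "y \<in> W" "duality q M w y = 1" for y
      unfolding w(2) by (rule w(3)[OF that])
    have c: "l \<le> minimax e k" "minimax e k \<le> l + e * (q / p) * (m + l)"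
      using mb(2,3) by (simp_all add: l_def m_def)
    have "e * ((q / p) * (m + l)) \<le> 1 * ((q / p) * (m + l))"
      using m l qp by (intro mult_right_mono[OF e(2)] mult_nonneg_nonneg add_nonneg_nonneg) linarith+
    then have cC: "minimax e k \<le> C" using c(2) by (simp add: C_def mult.assoc)
    have "modular q M (grad w) \<le> minimax e k" using energy_ge(1)[OF e0, of w] w(2) by simp
    then have P: "0 \<le> P" "P \<le> m + C" using modular_p_le[OF D1_W[OF w(1)]] cC by (auto simp: P_def m_def)
    have mu: "\<mu> = minimax e k - e * ((q / p - 1) * P)"
      unfolding w(2)[symmetric] energy_def \<mu>_def P_def by (simp add: algebra_simps)
    have "(q / p - 1) * P \<le> (q / p) * (m + C)" using qp P by (intro mult_mono) auto
    then have "e * ((q / p - 1) * P) \<le> e * ((q / p) * (m + C))" by (rule mult_left_mono[OF _ e0])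
    moreover have "0 \<le> e * ((q / p - 1) * P)" using e0 qp P by simp
    moreover have "0 \<le> e * ((q / p) * (m + C))" using calculation by linarith
    moreover have "0 \<le> e * ((q / p) * (m + l))"
      using qp m l by (intro mult_nonneg_nonneg[OF e0] mult_nonneg_nonneg add_nonneg_nonneg) linarith+
    ultimately have "\<bar>\<mu> - l\<bar> \<le> e * ((q / p) * (m + l)) + e * ((q / p) * (m + C))"
      using c unfolding mu mult.assoc by linarith
    then have "\<bar>\<mu> - l\<bar> \<le> ((q / p) * (m + l) + (q / p) * (m + C)) * e" by (simp only: distrib_left distrib_right mult.commute[of e])
    moreover have "\<forall>v\<in>W. e * duality p M (grad w) (grad v) + duality q M (grad w) (grad v) = \<mu> * duality q M w v"
      unfolding \<mu>_def by (intro ballI Euler_Lagrange w(1) wmin)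
    ultimately show "\<exists>w \<mu>. w \<in> D1 q \<Omega> \<and> \<bar>\<mu> - minimax 0 k\<bar> \<le> ((q / p) * (m + l) + (q / p) * (m + C)) * e \<and>
      (\<forall>v\<in>W. e * duality p M (grad w) (grad v) + duality q M (grad w) (grad v) = \<mu> * duality q M w v)"
      using w(1) unfolding l_def by blast
  qed
qed

section \<open>Scaling to solutions of large norm\<close>

lemma duality_grad_scale:
  assumes s: "1 < s" "s \<le> q" and t: "0 < t" and w: "w \<in> W" and v: "v \<in> W"
  shows "duality s M (grad (\<lambda>x. t * w x)) (grad v) = t powr (s - 1) * duality s M (grad w) (grad v)"
proof -
  have L: "grad u \<in> Lp s M" if "u \<in> W" for u by (rule fm.Lp_subset(1)[OF _ s(2) WD(3)[OF that]]) (use s in simp)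
  have "duality s M (grad (\<lambda>x. t * w x)) (grad v) = duality s M (\<lambda>x. t *\<^sub>R grad w x) (grad v)"
    unfolding duality_def
  proof (rule integral_cong_AE)
    show "(\<lambda>x. norm (grad (\<lambda>x. t * w x) x) powr (s - 2) * (grad (\<lambda>x. t * w x) x \<bullet> grad v x)) \<in> borel_measurable M"
      by (rule borel_measurable_integrable[OF duality_integrable[OF s(1) L[OF W_scale[OF w]] L[OF v]]])
    show "(\<lambda>x. norm (t *\<^sub>R grad w x) powr (s - 2) * (t *\<^sub>R grad w x \<bullet> grad v x)) \<in> borel_measurable M"
      by (rule borel_measurable_integrable[OF duality_integrable[OF s(1) Lp_scaleR[OF L[OF w]] L[OF v]]])
    show "AE x in M. norm (grad (\<lambda>x. t * w x) x) powr (s - 2) * (grad (\<lambda>x. t * w x) x \<bullet> grad v x)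
      = norm (t *\<^sub>R grad w x) powr (s - 2) * (t *\<^sub>R grad w x \<bullet> grad v x)"
      using grad_scale[OF w, of t] by (rule eventually_mono) (simp only:)
  qed
  then show ?thesis by (simp only: duality_scaleR_left[OF t])
qed

lemma weak_solution_iff:
  "weak_solution p q \<Omega> \<mu> u \<longleftrightarrow> u \<in> W \<and> (\<forall>v\<in>W. duality p M (grad u) (grad v) + duality q M (grad u) (grad v) = \<mu> * duality q M u v)"
  unfolding weak_solution_def duality_def by (simp add: mult.assoc)

text \<open>The two principal parts have different homogeneity, so that scaling turns the small coefficient
  \<open>e\<close> into \<open>1\<close> at the cost of a large norm.\<close>

lemma weak_solution_scale:
  assumes w: "w \<in> W" and t: "0 < t"
    and EL: "\<And>v. v \<in> W \<Longrightarrow> t powr (p - q) * duality p M (grad w) (grad v) + duality q M (grad w) (grad v) = \<mu> * duality q M w v"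
  shows "weak_solution p q \<Omega> \<mu> (\<lambda>x. t * w x)"
  unfolding weak_solution_iff
proof (intro conjI ballI)
  show "(\<lambda>x. t * w x) \<in> W" by (rule W_scale[OF w])
  fix v assume v: "v \<in> W"
  have tp: "t powr (p - 1) = t powr (q - 1) * t powr (p - q)" by (simp flip: powr_add)
  have "duality p M (grad (\<lambda>x. t * w x)) (grad v) + duality q M (grad (\<lambda>x. t * w x)) (grad v)
     = t powr (p - 1) * duality p M (grad w) (grad v) + t powr (q - 1) * duality q M (grad w) (grad v)"
    unfolding duality_grad_scale[OF p_gt_1 p_ge(4) t w v] duality_grad_scale[OF q_gt_1 order_refl t w v] ..
  also have "\<dots> = t powr (q - 1) * (t powr (p - q) * duality p M (grad w) (grad v) + duality q M (grad w) (grad v))"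
    unfolding tp by (simp add: algebra_simps)
  also have "\<dots> = \<mu> * (t powr (q - 1) * duality q M w v)" unfolding EL[OF v] by simp
  also have "t powr (q - 1) * duality q M w v = duality q M (\<lambda>x. t * w x) v"
    using duality_scaleR_left[OF t, of q M w v] by simp
  finally show "duality p M (grad (\<lambda>x. t * w x)) (grad v) + duality q M (grad (\<lambda>x. t * w x)) (grad v) = \<mu> * duality q M (\<lambda>x. t * w x) v" .
qed

lemma W10_norm_scale:
  assumes "u \<in> W" "0 \<le> t"
  shows "W10_norm q \<Omega> (\<lambda>x. t * u x) = t * lnorm (grad u)"
proof -
  have "W10_norm q \<Omega> (\<lambda>x. t * u x) = modular q M (grad (\<lambda>x. t * u x)) powr (1 / q)" by (simp add: W10_norm_def modular_def)
  also have "\<dots> = (t powr q * modular q M (grad u)) powr (1 / q)"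
    unfolding modular_grad_cong[OF W_scale[OF assms(1)] Lp_scaleR[OF WD(3)[OF assms(1)]] grad_scale[OF assms(1)]]
      modular_scaleR using assms(2) by simp
  also have "\<dots> = t * lnorm (grad u)" using assms(2) q_ge by (simp add: powr_mult powr_powr lnorm_def)
  finally show ?thesis .
qed

text \<open>With \<open>e = 1 / (n + 1)\<close>, the scaling factor \<open>t\<close> is determined by \<open>t\<^sup>p\<^sup>-\<^sup>q = e\<close> and tends to infinity. The
  Poincare inequality bounds the gradients of normalised functions from below, so that the norms of
  the rescaled solutions tend to infinity as well.\<close>

lemma bifurcation_from_infinity:
  assumes k: "0 < k" and ne: "admissible 0 k \<noteq> {}"
  shows "bifurcation_point_at_infinity p q \<Omega> (minimax 0 k)"
proof -
  obtain L where L: "\<And>e. 0 < e \<Longrightarrow> e \<le> 1 \<Longrightarrow> \<exists>w \<mu>. w \<in> D1 q \<Omega> \<and> \<bar>\<mu> - minimax 0 k\<bar> \<le> L * e \<and>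
    (\<forall>v\<in>W. e * duality p M (grad w) (grad v) + duality q M (grad w) (grad v) = \<mu> * duality q M w v)"
    using perturbed_eigenfunctions[OF k ne] by blast
  define e where "e = (\<lambda>n. inverse (real (Suc n)))"
  define t where "t = (\<lambda>n. real (Suc n) powr (1 / (q - p)))"
  have t: "0 < t n" "t n powr (p - q) = e n" for n
  proof -
    show "0 < t n" by (simp add: t_def)
    have "1 / (q - p) * (p - q) = -1" using p_less_q by (simp add: field_simps)
    then show "t n powr (p - q) = e n" unfolding t_def e_def powr_powr by (simp add: powr_minus)
  qed
  have "\<forall>n. \<exists>z. fst z \<in> D1 q \<Omega> \<and> \<bar>snd z - minimax 0 k\<bar> \<le> L * e n \<and>
    (\<forall>v\<in>W. e n * duality p M (grad (fst z)) (grad v) + duality q M (grad (fst z)) (grad v) = snd z * duality q M (fst z) v)"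
  proof
    fix n
    have "0 < e n" "e n \<le> 1" by (simp_all add: e_def inverse_le_1_iff)
    from L[OF this] obtain w \<mu> where "w \<in> D1 q \<Omega> \<and> \<bar>\<mu> - minimax 0 k\<bar> \<le> L * e n \<and>
      (\<forall>v\<in>W. e n * duality p M (grad w) (grad v) + duality q M (grad w) (grad v) = \<mu> * duality q M w v)" by blast
    then show "\<exists>z. fst z \<in> D1 q \<Omega> \<and> \<bar>snd z - minimax 0 k\<bar> \<le> L * e n \<and>
      (\<forall>v\<in>W. e n * duality p M (grad (fst z)) (grad v) + duality q M (grad (fst z)) (grad v) = snd z * duality q M (fst z) v)"
      by (intro exI[of _ "(w, \<mu>)"]) simp
  qed
  from choice[OF this] obtain z where z: "\<forall>n. fst (z n) \<in> D1 q \<Omega> \<and> \<bar>snd (z n) - minimax 0 k\<bar> \<le> L * e n \<and>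
    (\<forall>v\<in>W. e n * duality p M (grad (fst (z n))) (grad v) + duality q M (grad (fst (z n))) (grad v) = snd (z n) * duality q M (fst (z n)) v)" ..
  define w where "w = (\<lambda>n. fst (z n))"
  define \<mu> where "\<mu> = (\<lambda>n. snd (z n))"
  have wD: "w n \<in> D1 q \<Omega>" and \<mu>: "\<bar>\<mu> n - minimax 0 k\<bar> \<le> L * e n"
    and EL: "\<And>v. v \<in> W \<Longrightarrow> e n * duality p M (grad (w n)) (grad v) + duality q M (grad (w n)) (grad v) = \<mu> n * duality q M (w n) v" for n
    using z[rule_format, of n] unfolding w_def \<mu>_def by blast+
  have wW: "w n \<in> W" for n by (rule D1_W[OF wD])
  define u where "u = (\<lambda>n x. t n * w n x)"
  have uW: "u n \<in> W" for n unfolding u_def by (rule W_scale[OF wW])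
  have nz: "\<not> (AE x in M. u n x = 0)" for n
  proof -
    have "modular q M (u n) = \<bar>t n\<bar> powr q * modular q M (w n)" unfolding u_def by (rule modular_mult)
    also have "\<dots> \<noteq> 0" using wD[of n] t(1)[of n] by (simp add: D1_eq)
    finally show ?thesis unfolding modular_eq_0_iff[OF WD(2)[OF uW]] .
  qed
  have sol: "weak_solution p q \<Omega> (\<mu> n) (u n)" for n
    unfolding u_def by (rule weak_solution_scale[OF wW t(1)]) (unfold t(2), rule EL)
  have lim: "\<mu> \<longlonglongrightarrow> minimax 0 k"
  proof -
    have "(\<lambda>n. L * e n) \<longlonglongrightarrow> L * 0" unfolding e_def by (intro tendsto_intros LIMSEQ_inverse_real_of_nat)
    then have "(\<lambda>n. L * e n) \<longlonglongrightarrow> 0" by simp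
    then have "(\<lambda>n. \<mu> n - minimax 0 k) \<longlonglongrightarrow> 0" by (rule Lim_null_comparison[rotated]) (simp add: \<mu>)
    then show ?thesis by (rule LIM_zero_cancel)
  qed
  obtain C where C: "0 < C" "\<And>u. u \<in> W \<Longrightarrow> modular q M u \<le> C * modular q M (grad u)" using Poincare by blast
  define c where "c = (1 / C) powr (1 / q)"
  have c: "0 < c" using C(1) by (simp add: c_def)
  have low: "c * t n \<le> W10_norm q \<Omega> (u n)" for n
  proof -
    have "1 \<le> C * modular q M (grad (w n))" using C(2)[OF wW[of n]] wD[of n] by (simp add: D1_eq)
    then have "1 / C \<le> modular q M (grad (w n))" using C(1) by (simp add: pos_divide_le_eq mult.commute)
    then have "c \<le> lnorm (grad (w n))" unfolding c_def lnorm_def using C(1) q_ge by (intro powr_mono2) auto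
    then have "c * t n \<le> lnorm (grad (w n)) * t n" using t(1)[of n] by (intro mult_right_mono) auto
    then show ?thesis unfolding u_def W10_norm_scale[OF wW less_imp_le[OF t(1)]] by (simp add: mult.commute)
  qed
  have "filterlim t at_top sequentially"
  proof -
    have "filterlim (\<lambda>n. ln (real (Suc n))) at_top sequentially"
      by (rule filterlim_compose[OF ln_at_top filterlim_compose[OF filterlim_real_sequentially filterlim_Suc]])
    then have "filterlim (\<lambda>n. exp (1 / (q - p) * ln (real (Suc n)))) at_top sequentially"
      using p_less_q by (intro filterlim_compose[OF exp_at_top] filterlim_tendsto_pos_mult_at_top[OF tendsto_const]) auto
    then show ?thesis unfolding t_def by (simp add: powr_def del: of_nat_Suc)
  qed
  then have "filterlim (\<lambda>n. c * t n) at_top sequentially" by (rule filterlim_tendsto_pos_mult_at_top[OF tendsto_const c])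
  then have "filterlim (\<lambda>n. W10_norm q \<Omega> (u n)) at_top sequentially"
    by (rule filterlim_at_top_mono) (simp add: low)
  then show ?thesis unfolding bifurcation_point_at_infinity_def using uW nz sol lim by blast
qed

end

theorem theorem5p7:
  fixes \<Omega> :: "'a::euclidean_space set" and p q :: real and k :: nat
  assumes "DIM('a) \<ge> 2"
    and "open \<Omega>" and "bounded \<Omega>" and "connected \<Omega>" and "\<Omega> \<noteq> {}"
    and "smooth_boundary \<Omega>"
    and "1 < p" and "p < q"
    and "k > 0"
  shows "\<exists>l :: real. dirichlet_eigenvalue q \<Omega> k = ereal l \<and>
           bifurcation_point_at_infinity p q \<Omega> l"
proof -
  interpret two_exponents \<Omega> q p
    by unfold_locales (use assms in auto)
  obtain n where "k = Suc n" using assms(9) gr0_implies_Suc by blast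
  then have "admissible 0 k \<noteq> {}" using admissible_0_nonempty[OF assms(5)] by simp
  then show ?thesis
    using dirichlet_eigenvalue_eq_minimax[OF assms(9)] bifurcation_from_infinity[OF assms(9)] by blast
qed

end
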